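(* Let $f$ satisfy the convexity and Lipschitz/bounded $(1+\kappa)$-th moment assumptions stated in the context. Let $\varepsilon>0$ be a fixed accuracy, and let $f$ satisfy the $r$-growth condition (context) with $r\ge\frac{1+\kappa}{\kappa}$. Let $\Psi_p$ be a prox-function which is $\left(1,\frac{1+\kappa}{\kappa}\right)$-uniformly convex w.r.t. the $\ell_p$-norm. Set $R_0=\sup_{x,y\in\mathcal X}\left(\frac{1+\kappa}{\kappa}D_{\Psi_p}(x,y)\right)^{\frac{\kappa}{1+\kappa}}$ and $R_k=R_0/2^k$. Set the number of restarts $N=\widetilde O\left(\frac1r\log_2\left(\frac{\mu_rR_0^r}{2\varepsilon}\right)\right)$ and, for $1\le k\le N$, $$T_k=\widetilde O\left(\left[\frac{\sigma_q2^{1+r}}{\mu_rR_k^{r-1}}\right]^{\frac{1+\kappa}{\kappa}}\right),\qquad\tau_k=\frac{\sigma_qR_k}{M_2T_k^{\frac{\kappa}{1+\kappa}}},\qquad\nu_k=\frac{R_k^{1/\kappa}}{\sigma_q}T_k^{-\frac1{1+\kappa}}.$$ Finally, let the bounded adversarial noise assumption hold, on the $k$-th restart, with level $$\Delta_k=\widetilde O\left(\frac{\mu_r^2R_0^{2r-1}}{M_2\sqrt d}\cdot\frac1{2^{k(2r-1)}}\right),\qquad1\le k\le N.$$ If $x_{\rm final}$ is the final output of the algorithm ZO-Restarts (context) with ZO-RSMD as the inner algorithm and with prox-function $\Psi_p$, number of restarts $N$, numbers of steps $\{T_k\}_{k=1}^N$, smoothing constants $\{\tau_k\}_{k=1}^N$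 and stepsizes $\{\nu_k\}_{k=1}^N$, then $$\mathbb E[f(x_{\rm final})]-f(x^* )\le\varepsilon,$$ the total number of steps is $$T=\widetilde O\left(\left[\frac{a_qM_2\sqrt d}{\mu_r^{1/r}}\cdot\frac1{\varepsilon^{\frac{r-1}{r}}}\right]^{\frac{1+\kappa}{\kappa}}\right),\qquad a_q=d^{\frac1q-\frac12}\min\{\sqrt{32\ln d-8},\sqrt{2q-1}\},$$ and on the last restart the maximum noise threshold is $$\Delta_N=\widetilde O\left(\frac{\mu_r^{1/r}}{M_2\sqrt d}\,\varepsilon^{2-1/r}\right).$$
   Context: Problem: minimize $f(x)=\mathbb E_{\xi\sim\mathcal D}[f(x,\xi)]$ over a compact convex set $\mathcal X\subset\mathbb R^d$, $d\ge2$; $x^*\in\arg\min_{x\in\mathcal X}f(x)$. For $\tau>0$, $\mathcal X_\tau=\mathcal X+\tau B_2^d$ with $B_2^d$ the closed Euclidean unit ball. Throughout $p\in[1,2]$ and $\frac1p+\frac1q=1$ ($1/q=0$ and $a_q$ uses the first term of the minimum if $q=\infty$). Assumptions (on $\mathcal X_\tau$ for the smoothing constants used): - Convexity: for every $\xi$, $x\mapsto f(x,\xi)$ is convex on $\mathcal X_\tau$. - Lipschitz/moment: $|f(x_1,\xi)-f(x_2,\xi)|\le M_2(\xi)\|x_1-x_2\|_2$ for all $x_1,x_2\in\mathcal X_\tau$, and for some $\kappa\in(0,1]$ and $M_2>0$, $\mathbb E_\xi[M_2(\xi)^{1+\kappa}]\le M_2^{1+\kappa}$. - Bounded adversarial noise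 with level $\Delta>0$: the deterministic noise $\delta(\cdot)$ satisfies $|\delta(x)|\le\Delta$ for all $x\in\mathcal X_\tau$. - $r$-growth: there are $r\ge1$ and $\mu_r>0$ with $\frac{\mu_r}2\|x-x^*\|_p^r\le f(x)-f(x^* )$ for all $x\in\mathcal X$. Oracle: one observes $\phi(x,\xi)=f(x,\xi)+\delta(x)$, at two points with the same $\xi$. Definition: $\sigma_q^{1+\kappa}=2^\kappa\left(\frac{\sqrt d}{2^{1/4}}a_qM_2\right)^{1+\kappa}+2^\kappa\left(\frac{d\,a_q\Delta}{\tau}\right)^{1+\kappa}$, evaluated on restart $k$ with $\tau=\tau_k$, $\Delta=\Delta_k$. A differentiable convex $\psi:\mathbb R^d\to\mathbb R$ is $(K,s)$-uniformly convex w.r.t. $\|\cdot\|_p$ ($K>0,s\ge2$) if $\psi(y)-\psi(x)-\langle\nabla\psi(x),y-x\rangle\ge\frac Ks\|x-y\|_p^s$ for all $x,y$. Bregman divergence: $D_\Psi(y,x)=\Psi(y)-\Psi(x)-\langle\nabla\Psi(x),y-x\rangle$. Fenchel conjugate: $\Psi^*(y)=\sup_x\{\langle x,y\rangle-\Psi(x)\}$. ZO-RSMD (inputs: number of iterations $T$, stepsize $\nu$, $\Psi_p$, $\tau$, starting point $x_0$): for $k=0,\dots,T-1$, sample $\mathbf e_k$ uniformly on the Euclidean unit sphere and $\xi_k\sim\mathcal D$, all independently; set $g_{k+1}=\frac{d}{2\tau}(\phi(x_k+\tau\mathbf e_k,\xi_k)-\phi(x_k-\tau\mathbf e_k,\xi_k))\mathbf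 e_k$; $y_{k+1}=\nabla(\Psi_p^* )(\nabla\Psi_p(x_k)-\nu g_{k+1})$; $x_{k+1}=\arg\min_{x\in\mathcal X}D_{\Psi_p}(x,y_{k+1})$. Output $\overline x_T=\frac1T\sum_{k=0}^{T-1}x_k$. ZO-Restarts: start with $x_0=\arg\min_{x\in\mathcal X}\Psi_p(x)$ or a random $x_0$. For $k=1,\dots,N$: run $T_k$ iterations of the inner algorithm with parameters $\nu_k,\Psi_p,\tau_k$ from starting point $x_0$, obtain $x_{\rm final}$, and set $x_0\leftarrow x_{\rm final}$. Return $x_{\rm final}$. The total number of steps is $T=\sum_{k=1}^NT_k$. Notation: $\widetilde O(\cdot)$ hides factors polynomial in $\log d$ and constants (which may depend on $r,\kappa$); the parameters $N,T_k,\Delta_k$ are chosen of the indicated orders with suitable hidden factors.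
   Formalization: The hidden factors in T_k, Δ_k and T may also depend on how far (sD_Ψ(x*,x))^{1/s}, s=(1+κ)/κ, exceeds ‖x−x*‖_p (resolved to 2^{-N} of the diameter) and on R_0/diameter; without this the claim fails, e.g. for Ψ=λ‖x‖²/2 with large λ. *)

theory Defs
  imports "HOL-Probability.Probability"
begin

definition lp_norm :: "real \<Rightarrow> real ^ 'n \<Rightarrow> real" where
  "lp_norm p x = (\<Sum>i\<in>UNIV. \<bar>x $ i\<bar> powr p) powr (1 / p)"

definition lp_diameter :: "real \<Rightarrow> (real ^ 'n) set \<Rightarrow> real" where
  "lp_diameter p X = (SUP (x, y) \<in> X \<times> X. lp_norm p (x - y))"

definition gradient :: "(real ^ 'n \<Rightarrow> real) \<Rightarrow> real ^ 'n \<Rightarrow> real ^ 'n" where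
  "gradient \<psi> x = (THE g. GDERIV \<psi> x :> g)"

definition bregman :: "(real ^ 'n \<Rightarrow> real) \<Rightarrow> real ^ 'n \<Rightarrow> real ^ 'n \<Rightarrow> real" where
  "bregman \<psi> y x = \<psi> y - \<psi> x - gradient \<psi> x \<bullet> (y - x)"

text \<open>For a uniformly convex \<open>\<psi>\<close> the supremum is finite at every \<open>y\<close>, so a real-valued
  conjugate loses nothing.\<close>

definition fenchel_conjugate :: "(real ^ 'n \<Rightarrow> real) \<Rightarrow> real ^ 'n \<Rightarrow> real" where
  "fenchel_conjugate \<psi> y = (SUP x. x \<bullet> y - \<psi> x)"

definition uniformly_convex_lp ::
    "real \<Rightarrow> real \<Rightarrow> real \<Rightarrow> (real ^ 'n \<Rightarrow> real) \<Rightarrow> bool" where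
  "uniformly_convex_lp p K s \<psi> \<longleftrightarrow>
     K > 0 \<and> s \<ge> 2 \<and> (\<forall>x. \<psi> differentiable (at x)) \<and> convex_on UNIV \<psi> \<and>
     (\<forall>x y. \<psi> y - \<psi> x - gradient \<psi> x \<bullet> (y - x) \<ge> K / s * lp_norm p (x - y) powr s)"

definition thicken :: "(real ^ 'n) set \<Rightarrow> real \<Rightarrow> (real ^ 'n) set" where
  "thicken X \<tau> = {x + \<tau> *\<^sub>R u | x u. x \<in> X \<and> u \<in> cball 0 1}"

text \<open>Radial projection of the uniform distribution on the ball.  It is restricted to the sphere so
  that a random variable with this target takes its values on the sphere everywhere, not only
  almost everywhere: the objective is unconstrained outside the thickened feasible set.\<close>

definition uniform_sphere :: "(real ^ 'n) measure" where
  "uniform_sphere =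
     restrict_space (distr (uniform_measure lborel (cball 0 1)) borel sgn) (sphere 0 1)"

definition noisy_oracle ::
    "(real ^ 'n \<Rightarrow> 's \<Rightarrow> real) \<Rightarrow> (real ^ 'n \<Rightarrow> real) \<Rightarrow> real ^ 'n \<Rightarrow> 's \<Rightarrow> real" where
  "noisy_oracle f \<delta> x \<xi> = f x \<xi> + \<delta> x"

definition zo_gradient ::
    "(real ^ 'n \<Rightarrow> 's \<Rightarrow> real) \<Rightarrow> (real ^ 'n \<Rightarrow> real) \<Rightarrow> real \<Rightarrow> real ^ 'n \<Rightarrow> (real ^ 'n) \<times> 's
      \<Rightarrow> real ^ 'n" where
  "zo_gradient f \<delta> \<tau> x = (\<lambda>(e, \<xi>).
     (real CARD('n) / (2 * \<tau>) *
       (noisy_oracle f \<delta> (x + \<tau> *\<^sub>R e) \<xi> - noisy_oracle f \<delta> (x - \<tau> *\<^sub>R e) \<xi>)) *\<^sub>R e)"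

text \<open>In the algorithms \<open>z t\<close> is the pair (direction, data sample) drawn at iteration \<open>t\<close>.\<close>

primrec rsmd_iterate ::
    "(real ^ 'n) set \<Rightarrow> (real ^ 'n \<Rightarrow> real) \<Rightarrow> (real ^ 'n \<Rightarrow> 's \<Rightarrow> real) \<Rightarrow> (real ^ 'n \<Rightarrow> real)
      \<Rightarrow> real \<Rightarrow> real \<Rightarrow> (nat \<Rightarrow> (real ^ 'n) \<times> 's) \<Rightarrow> real ^ 'n \<Rightarrow> nat \<Rightarrow> real ^ 'n" where
  "rsmd_iterate X \<psi> f \<delta> \<nu> \<tau> z x0 0 = x0"
| "rsmd_iterate X \<psi> f \<delta> \<nu> \<tau> z x0 (Suc t) =
     (let x = rsmd_iterate X \<psi> f \<delta> \<nu> \<tau> z x0 t;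
          g = zo_gradient f \<delta> \<tau> x (z t);
          y = gradient (fenchel_conjugate \<psi>) (gradient \<psi> x - \<nu> *\<^sub>R g)
      in arg_min_on (\<lambda>x'. bregman \<psi> x' y) X)"

definition zo_rsmd ::
    "(real ^ 'n) set \<Rightarrow> (real ^ 'n \<Rightarrow> real) \<Rightarrow> (real ^ 'n \<Rightarrow> 's \<Rightarrow> real) \<Rightarrow> (real ^ 'n \<Rightarrow> real)
      \<Rightarrow> nat \<Rightarrow> real \<Rightarrow> real \<Rightarrow> (nat \<Rightarrow> (real ^ 'n) \<times> 's) \<Rightarrow> real ^ 'n \<Rightarrow> real ^ 'n" where
  "zo_rsmd X \<psi> f \<delta> T \<nu> \<tau> z x0 =
     (1 / real T) *\<^sub>R (\<Sum>t<T. rsmd_iterate X \<psi> f \<delta> \<nu> \<tau> z x0 t)"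

text \<open>Point reached after \<open>k\<close> restarts; restarts are numbered from 1.\<close>

primrec zo_restarts ::
    "(real ^ 'n) set \<Rightarrow> (real ^ 'n \<Rightarrow> real) \<Rightarrow> (real ^ 'n \<Rightarrow> 's \<Rightarrow> real)
      \<Rightarrow> (nat \<Rightarrow> real ^ 'n \<Rightarrow> real) \<Rightarrow> (nat \<Rightarrow> nat) \<Rightarrow> (nat \<Rightarrow> real) \<Rightarrow> (nat \<Rightarrow> real)
      \<Rightarrow> (nat \<Rightarrow> nat \<Rightarrow> (real ^ 'n) \<times> 's) \<Rightarrow> real ^ 'n \<Rightarrow> nat \<Rightarrow> real ^ 'n" where
  "zo_restarts X \<psi> f \<delta> T \<nu> \<tau> z x0 0 = x0"
| "zo_restarts X \<psi> f \<delta> T \<nu> \<tau> z x0 (Suc k) =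
     zo_rsmd X \<psi> f (\<delta> (Suc k)) (T (Suc k)) (\<nu> (Suc k)) (\<tau> (Suc k)) (z (Suc k))
       (zo_restarts X \<psi> f \<delta> T \<nu> \<tau> z x0 k)"

definition a_const :: "real \<Rightarrow> ennreal \<Rightarrow> real" where
  "a_const d q = d powr (enn2real (1 / q) - 1 / 2) *
     (if q = top then sqrt (32 * ln d - 8)
      else min (sqrt (32 * ln d - 8)) (sqrt (2 * enn2real q - 1)))"

definition sigma_const :: "real \<Rightarrow> real \<Rightarrow> ennreal \<Rightarrow> real \<Rightarrow> real \<Rightarrow> real \<Rightarrow> real" where
  "sigma_const \<kappa> d q M2 \<Delta> \<tau> =
     (2 powr \<kappa> * (sqrt d / 2 powr (1 / 4) * a_const d q * M2) powr (1 + \<kappa>)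
      + 2 powr \<kappa> * (d * a_const d q * \<Delta> / \<tau>) powr (1 + \<kappa>)) powr (1 / (1 + \<kappa>))"

definition prox_radius :: "real \<Rightarrow> (real ^ 'n \<Rightarrow> real) \<Rightarrow> (real ^ 'n) set \<Rightarrow> real" where
  "prox_radius \<kappa> \<psi> X =
     (SUP (x, y) \<in> X \<times> X. ((1 + \<kappa>) / \<kappa> * bregman \<psi> x y) powr (\<kappa> / (1 + \<kappa>)))"

text \<open>Uniform convexity bounds \<open>(s * bregman \<psi> xs x) powr (1 / s)\<close> from below by the \<open>p\<close>-norm
  distance, where \<open>s = (1 + \<kappa>) / \<kappa>\<close>.  A restart argument also needs the converse comparison,
  up to a constant.  The smallest such constant is the quantity below, in which distances smaller
  than \<open>2 ^ -N\<close> times the diameter are not resolved (\<open>N\<close> is the number of restarts).  It is finite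
  and at least 1 for every prox-function on a compact set of positive diameter, and is one of the
  constants on which the hidden factors may depend.\<close>

definition prox_distortion ::
    "real \<Rightarrow> real \<Rightarrow> (real ^ 'n \<Rightarrow> real) \<Rightarrow> (real ^ 'n) set \<Rightarrow> real ^ 'n \<Rightarrow> nat \<Rightarrow> real" where
  "prox_distortion \<kappa> p \<psi> X xs N =
     max (prox_radius \<kappa> \<psi> X / lp_diameter p X)
         (SUP x\<in>X. ((1 + \<kappa>) / \<kappa> * bregman \<psi> xs x) powr (\<kappa> / (1 + \<kappa>))
                    / max (lp_norm p (x - xs)) (lp_diameter p X / 2 ^ N))"

text \<open>Statements ``\<open>u\<close> is of order \<open>v\<close>'' are rendered as \<open>c * v \<le> u \<le> C * v\<close>.  The dimension is a
  type, so a constant that is merely asserted to exist could depend on it; hence the admissible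
  factors are given in closed form, free of the dimension: \<open>min_steps_factor\<close> is the smallest
  admissible factor for the numbers of steps, and \<open>max_noise_factor\<close> the largest admissible
  factor for the noise levels when \<open>H\<close> bounds the factors of the numbers of steps.  The numerical
  values are not optimized.\<close>

definition min_steps_factor :: "real \<Rightarrow> real \<Rightarrow> real" where
  "min_steps_factor \<kappa> \<Lambda> =
     (let s = (1 + \<kappa>) / \<kappa> in (10 ^ 8 * s * (2 * \<Lambda>) powr s) powr s)"

definition max_noise_factor :: "real \<Rightarrow> real \<Rightarrow> real \<Rightarrow> real \<Rightarrow> real" where
  "max_noise_factor \<kappa> r \<Lambda> H =
     1 / (10 ^ 3 * ((1 + \<kappa>) / \<kappa>) * 8 powr r * H * \<Lambda> powr r)"

definition of_order :: "real \<Rightarrow> real \<Rightarrow> real \<Rightarrow> real \<Rightarrow> bool" where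
  "of_order c C u v \<longleftrightarrow> c * v \<le> u \<and> u \<le> C * v"

end

theory Submission
  imports Defs
begin

text \<open>The two-point estimator has mean equal to the gradient of the ball average of the objective, up
  to the noise. Its moment of order \<open>1 + \<kappa>\<close> in the dual norm reduces to the deviation of a Lipschitz
  function on the sphere from its mean; the required concentration is proved for Gaussian vectors by
  rotating two independent copies into each other (Maurey and Pisier), with residuals of proximal points in place
  of gradients, and passes to the sphere by homogeneity and the independence of norm and direction.

  Uniform convexity of the prox-function turns a mirror step into a recursion for the Bregman divergence
  to \<open>xs\<close>. Summed over one restart, and with the chosen parameters, it bounds the optimality gap by
  \<open>\<mu> / 2 * (R k / 2) powr r\<close>. The growth condition converts this into a bound on the distance to \<open>xs\<close>, and
  the prox distortion converts the distance back into a Bregman divergence, so that the next restart begins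
  within half the radius.\<close>

section \<open>The uniform measure on the sphere and Gaussian vectors\<close>

text \<open>All constants have to be explicit and free of the dimension, so the randomness of the
  directions is controlled through fourth moments with numerical bounds. Fourth moments enter
  because the estimator is a product of a deviation and a dual norm: as \<open>1 + \<kappa>\<close>
  is at most 2, the arithmetic-geometric mean inequality and Jensen reduce its moment to one fourth
  moment of each factor. The parameters of a restart are circular: \<open>\<sigma> k\<close>
  contains \<open>\<tau> k\<close> and \<open>\<Delta> k\<close>, while \<open>\<tau> k\<close> and
  \<open>T k\<close> contain \<open>\<sigma> k\<close>. Nothing is solved for. Each equation is
  applied as it stands, and the size of \<open>\<sigma> k\<close> is recovered afterwards from the
  noise level, by way of a comparison of the growth constant with the Lipschitz constant. The
  numbers have two sources: 150 for the deviation on the sphere and 8 for the dual norm combine to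
  720 for the moment of the estimator, and 518400 is the square of 720. The \<open>10 ^ 8\<close> in
  \<open>min_steps_factor\<close> leaves ample room above them.\<close>

lemma space_uniform_sphere [simp]: "space (uniform_sphere :: (real ^ 'n) measure) = sphere 0 1"
  by (simp add: uniform_sphere_def space_restrict_space)

lemma sets_uniform_sphere [measurable_cong]:
  "sets (uniform_sphere :: (real ^ 'n) measure) = sets (restrict_space borel (sphere 0 1))"
  by (simp add: uniform_sphere_def sets_restrict_space)

lemma borel_measurable_uniform_sphere:
  "K \<in> borel_measurable borel \<Longrightarrow> K \<in> borel_measurable (uniform_sphere :: (real ^ 'n) measure)"
  by (simp add: measurable_restrict_space1 cong: measurable_cong_sets[OF sets_uniform_sphere refl])

lemma sets_sphere_cball_borel [measurable]:
  "sphere (a :: 'a::euclidean_space) r \<in> sets borel" "cball a r \<in> sets borel"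
  by (simp_all add: borel_closed)

lemma emeasure_unit_cball:
  "emeasure lborel (cball (0 :: 'a::euclidean_space) 1) \<noteq> 0"
  "emeasure lborel (cball (0 :: 'a::euclidean_space) 1) \<noteq> \<infinity>"
  using emeasure_cball[of 1 "0::'a"] unit_ball_vol_pos[of "real DIM('a)"] by (auto simp del: unit_ball_vol_pos)

lemma nn_integral_uniform_sphere:
  fixes K :: "real ^ 'n \<Rightarrow> ennreal"
  assumes [measurable]: "K \<in> borel_measurable borel"
  shows "(\<integral>\<^sup>+e. K e \<partial>uniform_sphere) =
    (\<integral>\<^sup>+x. K (sgn x) * indicator (cball 0 1) x \<partial>lborel) / emeasure lborel (cball (0 :: real ^ 'n) 1)"
proof -
  have sgn_m [measurable]: "(sgn :: real ^ 'n \<Rightarrow> real ^ 'n) \<in> borel_measurable borel"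
    unfolding sgn_div_norm by measurable
  have "(\<integral>\<^sup>+e. K e \<partial>uniform_sphere) =
      (\<integral>\<^sup>+e. K e * indicator (sphere 0 1) e \<partial>distr (uniform_measure lborel (cball 0 1)) borel sgn)"
    unfolding uniform_sphere_def by (subst nn_integral_restrict_space) auto
  also have "\<dots> = (\<integral>\<^sup>+x. K (sgn x) * indicator (sphere 0 1) (sgn x)
        \<partial>uniform_measure lborel (cball (0 :: real ^ 'n) 1))"
    by (subst nn_integral_distr) auto
  also have "\<dots> = (\<integral>\<^sup>+x. (K (sgn x) * indicator (sphere 0 1) (sgn x)) * indicator (cball 0 1) x \<partial>lborel) /
      emeasure lborel (cball (0 :: real ^ 'n) 1)"
    by (subst nn_integral_uniform_measure) auto
  also have "(\<integral>\<^sup>+x. (K (sgn x) * indicator (sphere 0 1) (sgn x)) * indicator (cball 0 1) x \<partial>lborel) =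
      (\<integral>\<^sup>+x. K (sgn x) * indicator (cball 0 1) x \<partial>lborel)"
  proof (rule nn_integral_cong_AE)
    \<comment> \<open>\<open>sgn 0 = 0\<close> lies off the sphere, so the restriction to the sphere
      discards only the null set \<open>{0}\<close>.\<close>
    have "AE x in lborel. x \<noteq> (0 :: real ^ 'n)"
      by (rule AE_lborel_singleton)
    then show "AE x in lborel. K (sgn x) * indicator (sphere 0 1) (sgn x) * indicator (cball 0 1) x =
        K (sgn x) * indicator (cball (0 :: real ^ 'n) 1) x"
      by eventually_elim (auto simp: norm_sgn indicator_def)
  qed
  finally show ?thesis .
qed

lemma prob_space_uniform_sphere: "prob_space (uniform_sphere :: (real ^ 'n) measure)"
proof
  have "emeasure (uniform_sphere :: (real ^ 'n) measure) (space uniform_sphere) = (\<integral>\<^sup>+e. 1 \<partial>(uniform_sphere :: (real ^ 'n) measure))"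
    by simp
  also have "\<dots> = 1"
    using emeasure_unit_cball[where ?'a="real ^ 'n"]
    by (subst nn_integral_uniform_sphere) (auto simp: ennreal_divide_self top.not_eq_extremum)
  finally show "emeasure uniform_sphere (space (uniform_sphere :: (real ^ 'n) measure)) = 1" by simp
qed

lemma nn_integral_lborel_translate:
  fixes f :: "'a::euclidean_space \<Rightarrow> ennreal"
  assumes [measurable]: "f \<in> borel_measurable borel"
  shows "(\<integral>\<^sup>+x. f x \<partial>lborel) = (\<integral>\<^sup>+x. f (a + x) \<partial>lborel)"
  by (subst lborel_affine[of 1 a]) (simp_all add: nn_integral_density nn_integral_distr)

lemma nn_integral_lborel_scale:
  fixes f :: "'a::euclidean_space \<Rightarrow> ennreal"
  assumes [measurable]: "f \<in> borel_measurable borel" and c: "c > 0"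
  shows "(\<integral>\<^sup>+x. f x \<partial>lborel) = ennreal (c ^ DIM('a)) * (\<integral>\<^sup>+x. f (c *\<^sub>R x) \<partial>lborel)"
  using c by (subst lborel_affine[of c 0])
    (simp_all add: nn_integral_density nn_integral_distr nn_integral_cmult)

text \<open>\<open>sgn\<close> is invariant under positive scaling, so a dilation of the unit ball
  changes the integral only by the volume factor.\<close>

lemma nn_integral_sgn_cball:
  fixes K :: "real ^ 'n \<Rightarrow> ennreal"
  assumes [measurable]: "K \<in> borel_measurable borel" and r: "r > 0"
  shows "(\<integral>\<^sup>+x. K (sgn x) * indicator (cball 0 r) x \<partial>lborel) =
    (\<integral>\<^sup>+e. K e \<partial>uniform_sphere) * emeasure lborel (cball (0 :: real ^ 'n) r)"
proof -
  have sgn_scale: "sgn (r *\<^sub>R x) = sgn x" for x :: "real ^ 'n"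
    using r by (simp add: sgn_div_norm)
  have cb: "indicator (cball 0 r) (r *\<^sub>R x) = (indicator (cball 0 1) x :: ennreal)" for x :: "real ^ 'n"
    using r by (auto simp: indicator_def)
  let ?V = "emeasure lborel (cball (0 :: real ^ 'n) 1)"
  have "(\<integral>\<^sup>+x. K (sgn x) * indicator (cball 0 r) x \<partial>lborel) =
      ennreal (r ^ CARD('n)) * (\<integral>\<^sup>+x. K (sgn x) * indicator (cball 0 1) x \<partial>lborel)"
    using r by (subst nn_integral_lborel_scale[of _ r]) (auto simp: sgn_scale cb)
  also have "(\<integral>\<^sup>+x. K (sgn x) * indicator (cball 0 1) x \<partial>lborel) = (\<integral>\<^sup>+e. K e \<partial>uniform_sphere) * ?V"
    using emeasure_unit_cball[where ?'a="real ^ 'n"]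
    by (subst nn_integral_uniform_sphere, simp)
       (simp add: ennreal_divide_times ennreal_times_divide[symmetric] ennreal_divide_self top.not_eq_extremum
          ennreal_mult_divide_eq divide_mult_eq)
  also have "ennreal (r ^ CARD('n)) * ((\<integral>\<^sup>+e. K e \<partial>uniform_sphere) * ?V) =
     (\<integral>\<^sup>+e. K e \<partial>uniform_sphere) * emeasure lborel (cball (0 :: real ^ 'n) r)"
    using r by (simp add: emeasure_cball ennreal_mult' ennreal_mult'' mult_ac)
  finally show ?thesis .
qed

text \<open>Under Lebesgue measure the direction is independent of the norm. Both sides are
  integrals of \<phi> against measures on the radii; by \<open>nn_integral_sgn_cball\<close> these
  agree on all half lines \<open>{..a}\<close>, which generate the Borel sets. Finiteness of the
  spherical integral gives the exhausting half lines finite measure.\<close>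

lemma nn_integral_polar:
  fixes K :: "real ^ 'n \<Rightarrow> ennreal" and \<phi> :: "real \<Rightarrow> ennreal"
  assumes [measurable]: "K \<in> borel_measurable borel" "\<phi> \<in> borel_measurable borel"
    and fin: "(\<integral>\<^sup>+e. K e \<partial>uniform_sphere) < \<infinity>"
  shows "(\<integral>\<^sup>+x. K (sgn x) * \<phi> (norm x) \<partial>lborel) =
    (\<integral>\<^sup>+e. K e \<partial>uniform_sphere) * (\<integral>\<^sup>+x. \<phi> (norm (x :: real ^ 'n)) \<partial>lborel)"
proof -
  let ?E = "\<integral>\<^sup>+e. K e \<partial>uniform_sphere"
  let ?M1 = "distr (density lborel (\<lambda>x. K (sgn x))) borel norm"
  let ?M2 = "density (distr lborel borel (norm :: real ^ 'n \<Rightarrow> real)) (\<lambda>_. ?E)"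
  have em1: "emeasure ?M1 {..a} = (\<integral>\<^sup>+x. K (sgn x) * indicator (cball 0 a) x \<partial>lborel)" for a
  proof -
    have "emeasure ?M1 {..a} = emeasure (density lborel (\<lambda>x. K (sgn x))) (cball (0 :: real ^ 'n) a)"
      by (subst emeasure_distr) (auto intro!: arg_cong2[where f=emeasure])
    then show ?thesis by (simp add: emeasure_density)
  qed
  have em2: "emeasure ?M2 {..a} = ?E * emeasure lborel (cball (0 :: real ^ 'n) a)" for a
  proof -
    have "emeasure ?M2 {..a} = ?E * emeasure (distr lborel borel (norm :: real ^ 'n \<Rightarrow> real)) {..a}"
      by (subst emeasure_density_const) auto
    also have "emeasure (distr lborel borel (norm :: real ^ 'n \<Rightarrow> real)) {..a} = emeasure lborel (cball (0 :: real ^ 'n) a)"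
      by (subst emeasure_distr) (auto intro!: arg_cong[where f="emeasure lborel"])
    finally show ?thesis .
  qed
  have eq: "emeasure ?M1 {..a} = emeasure ?M2 {..a}" for a
  proof (cases "a > 0")
    case True
    then show ?thesis by (simp only: em1 em2) (rule nn_integral_sgn_cball, auto)
  next
    case False
    then have cb: "cball (0 :: real ^ 'n) a \<subseteq> {0}"
      by (auto simp: not_less) (metis norm_le_zero_iff order_trans)
    then have "emeasure lborel (cball (0 :: real ^ 'n) a) \<le> emeasure lborel {0 :: real ^ 'n}"
      by (intro emeasure_mono) auto
    then have z: "emeasure lborel (cball (0 :: real ^ 'n) a) = 0" by simp
    have "(\<integral>\<^sup>+x. K (sgn x) * indicator (cball (0 :: real ^ 'n) a) x \<partial>lborel) = 0"
      by (rule nn_integral_null_set) (use z in auto)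
    then show ?thesis using z by (simp add: em1 em2)
  qed
  have "?M1 = ?M2"
  proof (rule measure_eqI_generator_eq[where E="range (\<lambda>a :: real. {..a})" and \<Omega>=UNIV and A="\<lambda>i. {..real i}"])
    show "Int_stable (range (\<lambda>a :: real. {..a}))"
      by (auto simp: Int_stable_def intro!: image_eqI[of _ _ "min _ _"])
    show "emeasure ?M1 {..real i} \<noteq> \<infinity>" for i
      using fin emeasure_lborel_cball_finite[of "0 :: real ^ 'n" "real i"]
      by (simp add: eq em2 ennreal_mult_eq_top_iff less_top)
    show "(\<Union>i. {..real i}) = UNIV" using real_arch_simple by auto
  qed (use eq in \<open>auto simp: borel_eq_atMost\<close>)
  then have "(\<integral>\<^sup>+y. \<phi> y \<partial>?M1) = (\<integral>\<^sup>+y. \<phi> y \<partial>?M2)" by simp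
  then show ?thesis
    by (simp add: nn_integral_distr nn_integral_density nn_integral_cmult)
qed

section \<open>The standard Gaussian measure and its moments\<close>

definition gauss :: "'a::euclidean_space measure" where
  "gauss = density lborel (\<lambda>x. ennreal ((1 / sqrt (2 * pi)) ^ DIM('a) * exp (- (norm x)\<^sup>2 / 2)))"

lemma sets_gauss [measurable_cong, simp]: "sets gauss = sets borel"
  by (simp add: gauss_def)

lemma space_gauss [simp]: "space gauss = UNIV"
  by (simp add: gauss_def)

lemma nn_integral_gauss:
  fixes f :: "'a::euclidean_space \<Rightarrow> ennreal"
  assumes [measurable]: "f \<in> borel_measurable borel"
  shows "(\<integral>\<^sup>+x. f x \<partial>gauss) =
    ennreal ((1 / sqrt (2 * pi)) ^ DIM('a)) * (\<integral>\<^sup>+x. f x * ennreal (exp (- (norm x)\<^sup>2 / 2)) \<partial>lborel)"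
  unfolding gauss_def
  by (simp add: nn_integral_density nn_integral_cmult[symmetric] ennreal_mult' mult_ac)

lemma nn_integral_gauss_1: "(\<integral>\<^sup>+x. 1 \<partial>(gauss :: 'a::euclidean_space measure)) = 1"
proof -
  have 1: "(\<integral>\<^sup>+x. ennreal (std_normal_density x) \<partial>lborel) = 1"
    by (subst nn_integral_eq_integral) (auto simp: integrable_normal_moment[where k=0, simplified] integrable_normal_density)
  have n: "(norm x)\<^sup>2 = (\<Sum>b\<in>Basis. (x \<bullet> b)\<^sup>2)" for x :: 'a
    by (simp add: norm_eq_sqrt_inner euclidean_inner[of x x] power2_eq_square sum_nonneg)
  have "(\<integral>\<^sup>+x. 1 \<partial>(gauss :: 'a measure)) = (\<integral>\<^sup>+x. (\<Prod>b\<in>Basis. ennreal (std_normal_density (x \<bullet> b))) \<partial>(lborel :: 'a measure))"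
    unfolding gauss_def
    by (subst nn_integral_density)
       (auto simp: n prod_ennreal normal_density_def prod_dividef exp_sum[symmetric] sum_negf sum_divide_distrib power_divide
         intro!: nn_integral_cong)
  also have "\<dots> = 1"
    using nn_integral_lborel_prod[of "\<lambda>_::'a. std_normal_density"] 1 by (simp add: prod_ennreal)
  finally show ?thesis .
qed

lemma gauss_normalization:
  "ennreal ((1 / sqrt (2 * pi)) ^ DIM('a)) *
    (\<integral>\<^sup>+x. ennreal (exp (- (norm (x :: 'a::euclidean_space))\<^sup>2 / 2)) \<partial>lborel) = 1"
  using nn_integral_gauss_1[where ?'a='a] by (subst (asm) nn_integral_gauss) simp_all

lemma prob_space_gauss: "prob_space (gauss :: 'a::euclidean_space measure)"
  by standard (use nn_integral_gauss_1[where ?'a='a] in \<open>simp\<close>)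

interpretation gauss: prob_space "gauss :: 'a::euclidean_space measure"
  by (rule prob_space_gauss)

lemma measure_gauss_UNIV [simp]: "measure gauss (UNIV :: 'a::euclidean_space set) = 1"
  using gauss.prob_space[where ?'a='a] by simp

interpretation uniform_sphere: prob_space "uniform_sphere :: (real ^ 'n) measure"
  by (rule prob_space_uniform_sphere)

text \<open>Completing the square: translation by \<open>a\<close> turns the weighted density into a
  multiple of the density itself.\<close>

lemma nn_integral_gauss_mgf:
  fixes a :: "'a::euclidean_space"
  shows "(\<integral>\<^sup>+x. ennreal (exp (a \<bullet> x)) \<partial>gauss) = ennreal (exp ((norm a)\<^sup>2 / 2))"
proof -
  have "(\<integral>\<^sup>+x. ennreal (exp (a \<bullet> x)) * ennreal (exp (- (norm x)\<^sup>2 / 2)) \<partial>lborel) =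
      (\<integral>\<^sup>+x. ennreal (exp (a \<bullet> (a + x))) * ennreal (exp (- (norm (a + x))\<^sup>2 / 2)) \<partial>lborel)"
    by (rule nn_integral_lborel_translate) measurable
  also have "\<dots> = (\<integral>\<^sup>+x. ennreal (exp ((norm a)\<^sup>2 / 2)) * ennreal (exp (- (norm (x :: 'a))\<^sup>2 / 2)) \<partial>lborel)"
    by (intro nn_integral_cong)
       (simp add: ennreal_mult'[symmetric] exp_add[symmetric] power2_norm_eq_inner inner_add_left inner_add_right
          inner_commute algebra_simps add_divide_distrib diff_divide_distrib)
  also have "\<dots> = ennreal (exp ((norm a)\<^sup>2 / 2)) * (\<integral>\<^sup>+x. ennreal (exp (- (norm (x :: 'a))\<^sup>2 / 2)) \<partial>lborel)"
    by (rule nn_integral_cmult) measurable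
  finally have eq: "(\<integral>\<^sup>+x. ennreal (exp (a \<bullet> x)) * ennreal (exp (- (norm x)\<^sup>2 / 2)) \<partial>lborel) =
      ennreal (exp ((norm a)\<^sup>2 / 2)) * (\<integral>\<^sup>+x. ennreal (exp (- (norm (x :: 'a))\<^sup>2 / 2)) \<partial>lborel)" .
  show ?thesis
    by (subst nn_integral_gauss, simp, subst eq, subst mult.left_commute, subst gauss_normalization, simp)
qed

text \<open>Rescaling by \<open>c\<close> absorbs the extra quadratic exponent into the Gaussian
  one; the bound on \<open>l\<close> keeps the total exponent negative.\<close>

lemma nn_integral_gauss_exp_norm:
  fixes l :: real
  assumes l: "l > - 1 / 2"
  shows "(\<integral>\<^sup>+x. ennreal (exp (- l * (norm (x :: 'a::euclidean_space))\<^sup>2)) \<partial>gauss) =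
    ennreal ((1 / sqrt (1 + 2 * l)) ^ DIM('a))"
proof -
  define c where "c = 1 / sqrt (1 + 2 * l)"
  have c: "c > 0" "c\<^sup>2 * (1 + 2 * l) = 1" using l by (auto simp: c_def field_simps)
  have "(\<integral>\<^sup>+x. ennreal (exp (- l * (norm (x :: 'a))\<^sup>2)) * ennreal (exp (- (norm x)\<^sup>2 / 2)) \<partial>lborel) =
     ennreal (c ^ DIM('a)) * (\<integral>\<^sup>+x. ennreal (exp (- l * (norm (c *\<^sub>R x :: 'a))\<^sup>2)) * ennreal (exp (- (norm (c *\<^sub>R x))\<^sup>2 / 2)) \<partial>lborel)"
    by (rule nn_integral_lborel_scale) (use c in auto)
  also have "(\<integral>\<^sup>+x. ennreal (exp (- l * (norm (c *\<^sub>R x :: 'a))\<^sup>2)) * ennreal (exp (- (norm (c *\<^sub>R x))\<^sup>2 / 2)) \<partial>lborel)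
     = (\<integral>\<^sup>+x. ennreal (exp (- (norm (x :: 'a))\<^sup>2 / 2)) \<partial>lborel)"
  proof (intro nn_integral_cong)
    fix x :: 'a
    have "- l * (norm (c *\<^sub>R x))\<^sup>2 + - (norm (c *\<^sub>R x))\<^sup>2 / 2 = - (c\<^sup>2 * (1 + 2 * l)) * (norm x)\<^sup>2 / 2"
      by (simp add: power_mult_distrib algebra_simps)
    then show "ennreal (exp (- l * (norm (c *\<^sub>R x))\<^sup>2)) * ennreal (exp (- (norm (c *\<^sub>R x))\<^sup>2 / 2)) =
        ennreal (exp (- (norm x)\<^sup>2 / 2))"
      unfolding c by (simp add: ennreal_mult'[symmetric] exp_add[symmetric])
  qed
  finally have eq: "(\<integral>\<^sup>+x. ennreal (exp (- l * (norm (x :: 'a))\<^sup>2)) * ennreal (exp (- (norm x)\<^sup>2 / 2)) \<partial>lborel) =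
     ennreal (c ^ DIM('a)) * (\<integral>\<^sup>+x. ennreal (exp (- (norm (x :: 'a))\<^sup>2 / 2)) \<partial>lborel)" .
  show ?thesis
    by (subst nn_integral_gauss, simp, subst eq, subst mult.left_commute, subst gauss_normalization, simp add: c_def)
qed

lemma power_le_fact_exp:
  fixes t :: real
  assumes "t \<ge> 0" shows "t ^ n \<le> fact n * exp t"
proof -
  have "t ^ n /\<^sub>R fact n \<le> (\<Sum>k. t ^ k /\<^sub>R fact k)"
    using sum_le_suminf[OF summable_exp_generic[of t], of "{n}"] assms by simp
  then have "t ^ n /\<^sub>R fact n \<le> exp t" by (simp only: exp_def)
  then show ?thesis by (simp add: field_simps)
qed

lemma even_power_le_exp:
  fixes t :: real
  shows "t ^ (2 * m) \<le> fact (2 * m) * (exp t + exp (- t))"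
proof -
  have "t ^ (2 * m) = \<bar>t\<bar> ^ (2 * m)" by (simp add: power_even_abs)
  also have "\<dots> \<le> fact (2 * m) * exp \<bar>t\<bar>" by (rule power_le_fact_exp) simp
  also have "\<dots> \<le> fact (2 * m) * (exp t + exp (- t))"
    by (intro mult_left_mono) (auto simp: abs_real_def)
  finally show ?thesis .
qed

lemma integrable_gauss_exp_inner: "integrable gauss (\<lambda>x. exp (a \<bullet> (x :: 'a::euclidean_space)))"
  by (rule integrableI_nonneg) (auto simp: nn_integral_gauss_mgf)

lemma integral_gauss_exp_inner: "(\<integral>x. exp (a \<bullet> (x :: 'a::euclidean_space)) \<partial>gauss) = exp ((norm a)\<^sup>2 / 2)"
  by (subst integral_eq_nn_integral) (auto simp: nn_integral_gauss_mgf)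

text \<open>A power is bounded by a pair of exponentials, whose Gaussian means are explicit. What
  matters later is the growth in \<open>m\<close>: the root of order \<open>2 * m\<close> grows like
  \<open>sqrt m\<close>, which is the growth present in \<open>a_const\<close>.\<close>

lemma gauss_inner_moment:
  fixes a :: "'a::euclidean_space"
  assumes m: "m \<ge> 1"
  shows "integrable gauss (\<lambda>x. (a \<bullet> x) ^ (2 * m))"
    and "(\<integral>x. (a \<bullet> x) ^ (2 * m) \<partial>gauss) \<le> (11 * real m * (norm a)\<^sup>2) ^ m"
proof -
  have le: "(a \<bullet> x) ^ (2 * m) \<le> fact (2 * m) / l ^ (2 * m) * (exp ((l *\<^sub>R a) \<bullet> x) + exp ((- l *\<^sub>R a) \<bullet> x))"
    if "l > 0" for l x
    using even_power_le_exp[of "l * (a \<bullet> x)" m] that by (simp add: power_mult_distrib field_simps)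
  have int: "integrable gauss (\<lambda>x. C * (exp ((l *\<^sub>R a) \<bullet> x) + exp ((- l *\<^sub>R a) \<bullet> x)))" for C l
    by (intro integrable_mult_right Bochner_Integration.integrable_add integrable_gauss_exp_inner)
  show I: "integrable gauss (\<lambda>x. (a \<bullet> x) ^ (2 * m))"
    by (rule Bochner_Integration.integrable_bound[OF int[of "fact (2 * m) / 1 ^ (2 * m)" 1]])
       (use le[of 1] in auto)
  show "(\<integral>x. (a \<bullet> x) ^ (2 * m) \<partial>gauss) \<le> (11 * real m * (norm a)\<^sup>2) ^ m"
  proof (cases "a = 0")
    case True then show ?thesis using m by (simp add: power_0_left)
  next
    case False
    \<comment> \<open>With this scale both exponential means equal \<open>exp m\<close>, which is
      balanced against the factor \<open>1 / l ^ (2 * m)\<close>.\<close>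
    define l where "l = sqrt (2 * real m) / norm a"
    have l: "l > 0" and l2: "l\<^sup>2 * (norm a)\<^sup>2 = 2 * real m" using False m by (auto simp: l_def power_divide)
    have nl: "(norm (l *\<^sub>R a))\<^sup>2 / 2 = real m" "(norm (- l *\<^sub>R a))\<^sup>2 / 2 = real m"
      using l2 by (auto simp: power_mult_distrib)
    have "(\<integral>x. (a \<bullet> x) ^ (2 * m) \<partial>gauss) \<le>
        (\<integral>x. fact (2 * m) / l ^ (2 * m) * (exp ((l *\<^sub>R a) \<bullet> x) + exp ((- l *\<^sub>R a) \<bullet> x)) \<partial>gauss)"
      by (intro integral_mono I int le l)
    also have "\<dots> = fact (2 * m) / l ^ (2 * m) * (2 * exp (real m))"
      by (simp only: Bochner_Integration.integral_mult_right_zero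
          Bochner_Integration.integral_add[OF integrable_gauss_exp_inner integrable_gauss_exp_inner]
          integral_gauss_exp_inner nl) simp
    also have "\<dots> \<le> (2 * real m) ^ (2 * m) / l ^ (2 * m) * (2 ^ m * exp 1 ^ m)"
    proof (intro mult_mono divide_right_mono)
      show "(fact (2 * m) :: real) \<le> (2 * real m) ^ (2 * m)"
        using fact_le_power[of "2 * m", where ?'a=real] by simp
      show "(2 :: real) \<le> 2 ^ m" using m by (cases m) auto
    qed (use l in \<open>auto simp: exp_of_nat_mult[symmetric]\<close>)
    also have "\<dots> = ((2 * real m)\<^sup>2 / l\<^sup>2 * (2 * exp 1)) ^ m"
      by (simp only: power_mult power_mult_distrib power_divide)
    also have "(2 * real m)\<^sup>2 / l\<^sup>2 = 2 * real m * (norm a)\<^sup>2"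
      using l l2 by (simp add: field_simps power2_eq_square)
    also have "(2 * real m * (norm a)\<^sup>2 * (2 * exp 1)) ^ m \<le> (11 * real m * (norm a)\<^sup>2) ^ m"
    proof (rule power_mono)
      have e: "4 * exp 1 \<le> (11 :: real)" using e_less_272 by simp
      have "(4 * exp 1) * (real m * (norm a)\<^sup>2) \<le> 11 * (real m * (norm a)\<^sup>2)"
        by (rule mult_right_mono[OF e]) simp
      then show "2 * real m * (norm a)\<^sup>2 * (2 * exp 1) \<le> 11 * real m * (norm a)\<^sup>2" by (simp add: mult_ac)
    qed simp
    finally show ?thesis .
  qed
qed

lemma integrable_gauss_exp_norm:
  assumes "l > - 1 / 2"
  shows "integrable gauss (\<lambda>x. exp (- l * (norm (x :: 'a::euclidean_space))\<^sup>2))"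
  by (rule integrableI_nonneg) (auto simp: nn_integral_gauss_exp_norm[OF assms, simplified])

lemma integral_gauss_exp_norm:
  assumes "l > - 1 / 2"
  shows "(\<integral>x. exp (- l * (norm (x :: 'a::euclidean_space))\<^sup>2) \<partial>gauss) = (1 / sqrt (1 + 2 * l)) ^ DIM('a)"
  using assms by (subst integral_eq_nn_integral) (auto simp: nn_integral_gauss_exp_norm[OF assms, simplified])

lemma integrable_gauss_norm_power: "integrable gauss (\<lambda>x. (norm (x :: 'a::euclidean_space)) ^ (2 * m))"
proof (rule Bochner_Integration.integrable_bound)
  show "integrable gauss (\<lambda>x. fact m * 4 ^ m * exp (- (- 1 / 4) * (norm (x :: 'a))\<^sup>2))"
    by (intro integrable_mult_right integrable_gauss_exp_norm) simp
  have "(norm x) ^ (2 * m) \<le> fact m * 4 ^ m * exp (- (- 1 / 4) * (norm x)\<^sup>2)" for x :: 'a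
  proof -
    define u where "u = (norm x)\<^sup>2"
    have "u ^ m \<le> fact m * 4 ^ m * exp (u / 4)"
      using power_le_fact_exp[of "u / 4" m] by (simp add: power_divide field_simps u_def)
    then show ?thesis by (simp add: power_mult u_def)
  qed
  then show "AE x in gauss. norm (norm (x :: 'a) ^ (2 * m)) \<le> norm (fact m * 4 ^ m * exp (- (- 1 / 4) * (norm x)\<^sup>2))"
    by simp
qed measurable

text \<open>The exact mean is the dimension, but half of it suffices and follows from the Laplace
  transform at 1/2, whose value is \<open>exp (- y0 / 2)\<close>. The tangent of the exponential at
  \<open>y0\<close> converts that value into a lower bound on the mean.\<close>

lemma gauss_norm_square_ge: "(\<integral>x. (norm (x :: 'a::euclidean_space))\<^sup>2 \<partial>gauss) \<ge> real DIM('a) / 2"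
proof -
  define y0 where "y0 = real DIM('a) * ln 2"
  have int: "integrable gauss (\<lambda>x :: 'a. (norm x)\<^sup>2)" using integrable_gauss_norm_power[of 1] by simp
  have "exp (- y0 / 2) * (1 - ((norm x)\<^sup>2 - y0) / 2) \<le> exp (- (1 / 2) * (norm x)\<^sup>2)" for x :: 'a
  proof -
    have "1 - u / 2 \<le> exp (- u / 2)" for u :: real
      using exp_ge_add_one_self[of "- u / 2"] by simp
    then have "1 - ((norm x)\<^sup>2 - y0) / 2 \<le> exp (- ((norm x)\<^sup>2 - y0) / 2)" .
    then have "exp (- y0 / 2) * (1 - ((norm x)\<^sup>2 - y0) / 2) \<le> exp (- y0 / 2) * exp (- ((norm x)\<^sup>2 - y0) / 2)"
      by (rule mult_left_mono) simp
    then show ?thesis by (simp add: exp_add[symmetric] field_simps)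
  qed
  then have "(\<integral>x. exp (- y0 / 2) * (1 - ((norm x)\<^sup>2 - y0) / 2) \<partial>(gauss :: 'a measure)) \<le>
      (\<integral>x. exp (- (1 / 2) * (norm x)\<^sup>2) \<partial>(gauss :: 'a measure))"
    using int by (intro integral_mono integrable_gauss_exp_norm) auto
  also have "\<dots> = (1 / sqrt 2) ^ DIM('a)" by (subst integral_gauss_exp_norm) auto
  also have "(1 / sqrt 2) ^ DIM('a) = exp (- y0 / 2)"
  proof -
    have "(1 / sqrt 2) = exp (- ln 2 / 2 :: real)" by (simp add: exp_minus ln_sqrt[symmetric] inverse_eq_divide)
    then have "(1 / sqrt 2) ^ DIM('a) = exp (real DIM('a) * (- ln 2 / 2))" by (simp only: exp_of_nat_mult)
    then show ?thesis by (simp add: y0_def)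
  qed
  finally have "1 - ((\<integral>x. (norm x)\<^sup>2 \<partial>(gauss :: 'a measure)) - y0) / 2 \<le> 1"
    using int by (simp add: gauss.prob_space field_simps)
  moreover have "y0 \<ge> real DIM('a) / 2"
    using ln_le_minus_one[of "1 / 2"] by (simp add: y0_def field_simps ln_div)
  ultimately show ?thesis by simp
qed

text \<open>Jensen's inequality through the tangent of the power at half the dimension. The slope is
  nonnegative, so a lower bound on the second moment is enough.\<close>

lemma gauss_norm_moment_ge: "(\<integral>x. (norm (x :: 'a::euclidean_space)) ^ (2 * m) \<partial>gauss) \<ge> (real DIM('a) / 2) ^ m"
proof -
  define c where "c = real DIM('a) / 2"
  have c: "c \<ge> 0" by (simp add: c_def)
  have int: "integrable gauss (\<lambda>x :: 'a. (norm x)\<^sup>2)" using integrable_gauss_norm_power[of 1] by simp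
  have tangent: "c ^ m + real m * c ^ (m - 1) * (y - c) \<le> y ^ m" if y: "y \<ge> 0" for y
  proof (induction m)
    case (Suc m)
    have "(y - c) * (y ^ m - c ^ m) \<ge> 0"
    proof (cases "y \<ge> c")
      case True then show ?thesis using c by (simp add: power_mono)
    next
      case False
      then have "y ^ m \<le> c ^ m" using y by (intro power_mono) auto
      then show ?thesis using False by (intro mult_nonpos_nonpos) auto
    qed
    moreover have "c * c ^ m + real m * c ^ m * (y - c) \<le> c * y ^ m"
    proof -
      have "c * (c ^ m + real m * c ^ (m - 1) * (y - c)) \<le> c * y ^ m"
        using Suc c by (rule mult_left_mono)
      moreover have "c * (c ^ m + real m * c ^ (m - 1) * (y - c)) = c * c ^ m + real m * c ^ m * (y - c)"
        by (cases m) (auto simp: algebra_simps)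
      ultimately show ?thesis by simp
    qed
    ultimately show ?case by (simp add: algebra_simps)
  qed simp
  have "c ^ m \<le> c ^ m + real m * c ^ (m - 1) * ((\<integral>x. (norm x)\<^sup>2 \<partial>(gauss :: 'a measure)) - c)"
    using c gauss_norm_square_ge[where ?'a='a] by (simp add: c_def)
  also have "\<dots> = (\<integral>x. c ^ m + real m * c ^ (m - 1) * ((norm x)\<^sup>2 - c) \<partial>(gauss :: 'a measure))"
    using int by (simp add: gauss.prob_space)
  also have "\<dots> \<le> (\<integral>x. (norm x) ^ (2 * m) \<partial>(gauss :: 'a measure))"
    using int integrable_gauss_norm_power[of m] tangent by (intro integral_mono) (auto simp: power_mult)
  finally show ?thesis by (simp add: c_def)
qed

text \<open>The squared norm fluctuates by the square root of the dimension. Exponential moments at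
  the inverse scale \<open>l\<close> show this without an expansion of the fourth power.\<close>

lemma gauss_norm_square_deviation:
  shows "integrable gauss (\<lambda>x :: 'a::euclidean_space. ((norm x)\<^sup>2 - real DIM('a)) ^ 4)"
    and "(\<integral>x. ((norm (x :: 'a))\<^sup>2 - real DIM('a)) ^ 4 \<partial>gauss) \<le> 20000 * (real DIM('a))\<^sup>2"
proof -
  define d where "d = real DIM('a)"
  have d: "d \<ge> 1" by (simp add: d_def DIM_positive Suc_leI)
  define l where "l = 1 / (4 * sqrt d)"
  have l: "0 < l" "l \<le> 1 / 4" using d by (auto simp: l_def field_simps)
  have l2: "l\<^sup>2 * d = 1 / 16" using d by (simp add: l_def power_divide power_mult_distrib field_simps)
  define E where "E k x = exp (k * d) * exp (- k * (norm x)\<^sup>2)" for k and x :: 'a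
  have E_int: "integrable gauss (E k)" if "k > - 1 / 2" for k
    unfolding E_def using that by (intro integrable_mult_right integrable_gauss_exp_norm)
  have le: "((norm x)\<^sup>2 - d) ^ 4 \<le> 24 / l ^ 4 * (E (- l) x + E l x)" for x :: 'a
  proof -
    have "(l * ((norm x)\<^sup>2 - d)) ^ 4 \<le> 24 * (exp (l * ((norm x)\<^sup>2 - d)) + exp (- (l * ((norm x)\<^sup>2 - d))))"
      using even_power_le_exp[of "l * ((norm x)\<^sup>2 - d)" 2] by (simp add: fact_numeral)
    also have "exp (l * ((norm x)\<^sup>2 - d)) + exp (- (l * ((norm x)\<^sup>2 - d))) = E (- l) x + E l x"
      unfolding E_def by (simp add: exp_add[symmetric] algebra_simps)
    finally have "l ^ 4 * ((norm x)\<^sup>2 - d) ^ 4 \<le> 24 * (E (- l) x + E l x)" by (simp only: power_mult_distrib)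
    moreover have "X \<le> 24 / l ^ 4 * S" if "l ^ 4 * X \<le> 24 * S" for X S
      using that l by (simp add: field_simps)
    ultimately show ?thesis by blast
  qed
  have int: "integrable gauss (\<lambda>x. 24 / l ^ 4 * (E (- l) x + E l x))"
    using l by (intro integrable_mult_right Bochner_Integration.integrable_add E_int) auto
  show I: "integrable gauss (\<lambda>x :: 'a. ((norm x)\<^sup>2 - real DIM('a)) ^ 4)"
  proof (rule Bochner_Integration.integrable_bound[OF int], measurable, rule AE_I2)
    fix x :: 'a
    show "norm (((norm x)\<^sup>2 - real DIM('a)) ^ 4) \<le> norm (24 / l ^ 4 * (E (- l) x + E l x))"
      using order_trans[OF le[of x] abs_ge_self] by (simp only: d_def[symmetric] real_norm_def power_even_abs abs_power2 even_numeral power_abs)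
  qed
  have E_le: "(\<integral>x. E k x \<partial>gauss) \<le> exp (1 / 4)" if k: "\<bar>k\<bar> = l" for k
  proof -
    have k': "k > - 1 / 2" "1 + 2 * k > 0" using k l by auto
    \<comment> \<open>Second-order bound for the logarithm. Its linear term cancels against the
      centring factor in \<open>E\<close>, and the quadratic one leaves \<open>4 * l^2 * d\<close>,
      a constant.\<close>
    have "- ln (1 + 2 * k) / 2 \<le> - k + 4 * k\<^sup>2"
    proof (cases "k \<ge> 0")
      case True
      then have "2 * k - (2 * k)\<^sup>2 \<le> ln (1 + 2 * k)"
        using k l by (intro ln_one_plus_pos_lower_bound) auto
      moreover have "(2 * k)\<^sup>2 = 4 * k\<^sup>2" by (simp add: power_mult_distrib)
      ultimately show ?thesis using zero_le_power2[of k] by linarith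
    next
      case False
      have "ln (1 - (- 2 * k)) \<ge> - (- 2 * k) - 2 * (- 2 * k)\<^sup>2"
        using False k l by (intro ln_one_minus_pos_lower_bound) auto
      then show ?thesis by (simp add: power_mult_distrib)
    qed
    then have "exp (- ln (1 + 2 * k) / 2) \<le> exp (- k + 4 * k\<^sup>2)" by simp
    moreover have "1 / sqrt (1 + 2 * k) = exp (- ln (1 + 2 * k) / 2)"
      using k' by (simp add: exp_minus inverse_eq_divide ln_sqrt[symmetric])
    ultimately have "(1 / sqrt (1 + 2 * k)) ^ DIM('a) \<le> exp (- k + 4 * k\<^sup>2) ^ DIM('a)"
      using k' by (intro power_mono) auto
    also have "\<dots> = exp (d * (- k + 4 * k\<^sup>2))" by (simp add: exp_of_nat_mult d_def)
    finally have *: "(1 / sqrt (1 + 2 * k)) ^ DIM('a) \<le> exp (d * (- k + 4 * k\<^sup>2))" .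
    have "(\<integral>x. E k x \<partial>gauss) = exp (k * d) * (1 / sqrt (1 + 2 * k)) ^ DIM('a)"
      unfolding E_def using integral_gauss_exp_norm[OF k'(1), where ?'a='a] by simp
    also have "\<dots> \<le> exp (k * d) * exp (d * (- k + 4 * k\<^sup>2))" by (intro mult_left_mono *) simp
    also have "\<dots> = exp (4 * (l\<^sup>2 * d))"
    proof -
      have "k\<^sup>2 = l\<^sup>2" using k by (metis power2_abs)
      then show ?thesis by (simp add: exp_add[symmetric] algebra_simps)
    qed
    finally show ?thesis by (simp add: l2)
  qed
  have "(\<integral>x. ((norm x)\<^sup>2 - d) ^ 4 \<partial>(gauss :: 'a measure)) \<le> (\<integral>x. 24 / l ^ 4 * (E (- l) x + E l x) \<partial>gauss)"
    by (intro integral_mono int le) (use I in \<open>simp add: d_def\<close>)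
  also have "\<dots> = 24 / l ^ 4 * ((\<integral>x. E (- l) x \<partial>gauss) + (\<integral>x. E l x \<partial>gauss))"
    using E_int l by simp
  also have "\<dots> \<le> 24 / l ^ 4 * (exp (1 / 4) + exp (1 / 4))"
    using l by (intro mult_left_mono add_mono E_le) auto
  also have "24 / l ^ 4 = 24 * 256 * d\<^sup>2"
  proof -
    have "l ^ 4 * d\<^sup>2 = (l\<^sup>2 * d)\<^sup>2" by (simp add: power_mult_distrib flip: power_mult)
    then have "l ^ 4 * d\<^sup>2 = 1 / 256" by (simp add: l2 power_divide)
    then show ?thesis using l by (simp add: field_simps)
  qed
  also have "24 * 256 * d\<^sup>2 * (exp (1 / 4) + exp (1 / 4)) \<le> 24 * 256 * d\<^sup>2 * (1.5 + 1.5)"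
  proof (intro mult_left_mono add_mono)
    have "exp (1 / 4 :: real) \<le> 1 + 1 / 4 + (1 / 4)\<^sup>2" by (rule exp_bound) auto
    then show "exp (1 / 4 :: real) \<le> 1.5" "exp (1 / 4 :: real) \<le> 1.5" by (simp_all add: power2_eq_square)
  qed auto
  also have "\<dots> \<le> 20000 * d\<^sup>2" by simp
  finally show "(\<integral>x. ((norm (x :: 'a))\<^sup>2 - real DIM('a)) ^ 4 \<partial>gauss) \<le> 20000 * (real DIM('a))\<^sup>2"
    by (simp add: d_def)
qed

section \<open>Transfer from Gaussian vectors to the sphere\<close>

lemma nn_integral_gauss_polar:
  fixes K :: "real ^ 'n \<Rightarrow> ennreal" and \<phi> :: "real \<Rightarrow> ennreal"
  assumes [measurable]: "K \<in> borel_measurable borel" "\<phi> \<in> borel_measurable borel"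
    and fin: "(\<integral>\<^sup>+e. K e \<partial>uniform_sphere) < \<infinity>"
  shows "(\<integral>\<^sup>+x. K (sgn x) * \<phi> (norm x) \<partial>gauss) =
    (\<integral>\<^sup>+e. K e \<partial>uniform_sphere) * (\<integral>\<^sup>+x. \<phi> (norm (x :: real ^ 'n)) \<partial>gauss)"
proof -
  let ?\<phi> = "\<lambda>r. \<phi> r * ennreal (exp (- r\<^sup>2 / 2))"
  have "(\<integral>\<^sup>+x. K (sgn x) * ?\<phi> (norm x) \<partial>lborel) =
      (\<integral>\<^sup>+e. K e \<partial>uniform_sphere) * (\<integral>\<^sup>+x. ?\<phi> (norm (x :: real ^ 'n)) \<partial>lborel)"
    by (rule nn_integral_polar) (use fin in auto)
  then show ?thesis
    by (simp add: nn_integral_gauss mult_ac)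
qed

lemma nn_integral_uniform_sphere_gauss:
  fixes K :: "real ^ 'n \<Rightarrow> ennreal"
  assumes "K \<in> borel_measurable borel" "(\<integral>\<^sup>+e. K e \<partial>uniform_sphere) < \<infinity>"
  shows "(\<integral>\<^sup>+e. K e \<partial>uniform_sphere) = (\<integral>\<^sup>+x. K (sgn x) \<partial>gauss)"
  using nn_integral_gauss_polar[OF assms(1) _ assms(2), of "\<lambda>_. 1"] nn_integral_gauss_1[where ?'a="real ^ 'n"]
  by (simp del: nn_integral_const)

lemma integrable_uniform_sphere_continuous:
  fixes K :: "real ^ 'n \<Rightarrow> real"
  assumes "continuous_on UNIV K"
  shows "integrable uniform_sphere K"
proof -
  have "compact (K ` sphere 0 1)"
    by (intro compact_continuous_image continuous_on_subset[OF assms]) auto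
  then obtain B where B: "\<And>x. x \<in> sphere 0 1 \<Longrightarrow> norm (K x) \<le> B"
    using compact_imp_bounded bounded_iff by (metis image_eqI)
  show ?thesis
    by (rule uniform_sphere.integrable_const_bound[of _ B])
       (use B in \<open>auto intro!: borel_measurable_uniform_sphere borel_measurable_continuous_onI assms AE_I2\<close>)
qed

text \<open>A Gaussian inner product factors into its value on the direction and the norm. By
  independence the Gaussian moment is the spherical moment times the moment of the norm, and
  division by the latter produces the gain of the dimension.\<close>

lemma uniform_sphere_inner_moment:
  fixes a :: "real ^ 'n"
  assumes m: "m \<ge> 1"
  shows "(\<integral>e. (a \<bullet> e) ^ (2 * m) \<partial>uniform_sphere) \<le> (22 * real m * (norm a)\<^sup>2 / real CARD('n)) ^ m"
proof -
  let ?K = "\<lambda>e. (a \<bullet> e) ^ (2 * m)"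
  let ?J = "\<integral>e. ?K e \<partial>uniform_sphere" and ?R = "\<integral>x. norm (x :: real ^ 'n) ^ (2 * m) \<partial>gauss"
  have int: "integrable uniform_sphere ?K"
    by (rule integrable_uniform_sphere_continuous) (intro continuous_intros)
  have nn: "(\<integral>\<^sup>+e. ennreal (?K e) \<partial>uniform_sphere) = ennreal ?J"
    using int by (rule nn_integral_eq_integral) simp
  have "ennreal (\<integral>x. ?K x \<partial>gauss) = (\<integral>\<^sup>+x. ennreal (?K x) \<partial>gauss)"
    using gauss_inner_moment(1)[OF m] by (rule nn_integral_eq_integral[symmetric]) simp
  also have "\<dots> = (\<integral>\<^sup>+x. ennreal (?K (sgn x)) * ennreal (norm x ^ (2 * m)) \<partial>gauss)"
  proof (intro nn_integral_cong)
    fix x :: "real ^ 'n"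
    have "a \<bullet> x = (a \<bullet> sgn x) * norm x" by (cases "x = 0") (auto simp: sgn_div_norm)
    then show "ennreal (?K x) = ennreal (?K (sgn x)) * ennreal (norm x ^ (2 * m))"
      by (simp add: ennreal_mult'[symmetric] power_mult_distrib)
  qed
  also have "\<dots> = ennreal ?J * (\<integral>\<^sup>+x. ennreal (norm (x :: real ^ 'n) ^ (2 * m)) \<partial>gauss)"
    by (subst nn_integral_gauss_polar) (auto simp: nn)
  also have "(\<integral>\<^sup>+x. ennreal (norm (x :: real ^ 'n) ^ (2 * m)) \<partial>gauss) = ennreal ?R"
    using integrable_gauss_norm_power by (rule nn_integral_eq_integral) simp
  finally have eq: "(\<integral>x. ?K x \<partial>gauss) = ?J * ?R"
    by (simp add: ennreal_mult'[symmetric] integral_nonneg)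
  have "?J * (real CARD('n) / 2) ^ m \<le> ?J * ?R"
    using gauss_norm_moment_ge[of m, where ?'a="real ^ 'n"] by (intro mult_left_mono integral_nonneg) auto
  also have "\<dots> \<le> (11 * real m * (norm a)\<^sup>2) ^ m"
    using gauss_inner_moment(2)[OF m, of a] eq by simp
  finally have "?J \<le> (11 * real m * (norm a)\<^sup>2) ^ m / (real CARD('n) / 2) ^ m"
    by (simp add: pos_le_divide_eq)
  also have "\<dots> = (22 * real m * (norm a)\<^sup>2 / real CARD('n)) ^ m"
    unfolding power_divide[symmetric] by (simp add: mult_ac)
  finally show ?thesis .
qed

section \<open>Jensen-type inequalities for real powers\<close>

lemma powr_ge_tangent:
  fixes y t :: real
  assumes "y \<ge> 0" "t \<ge> 1"
  shows "1 + t * (y - 1) \<le> y powr t"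
proof (cases "y = 0")
  case False
  have "(y powr t) powr (1 / t) * 1 powr (1 - 1 / t) \<le> (1 / t) * y powr t + (1 - 1 / t) * 1"
    using assms False by (intro Youngs_inequality_0) auto
  then have "y \<le> (1 / t) * y powr t + (1 - 1 / t)" using assms False by (simp add: powr_powr)
  then have "t * y \<le> t * ((1 / t) * y powr t + (1 - 1 / t))" using assms by (intro mult_left_mono) auto
  also have "\<dots> = y powr t + t - 1" using assms by (simp add: algebra_simps)
  finally show ?thesis by (simp add: algebra_simps)
qed (use assms in auto)

text \<open>Two tangent inequalities at the midpoint, whose linear terms cancel in the sum.\<close>

lemma powr_add_le:
  fixes a b p :: real
  assumes "a \<ge> 0" "b \<ge> 0" "p \<ge> 1"
  shows "(a + b) powr p \<le> 2 powr (p - 1) * (a powr p + b powr p)"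
proof (cases "a + b = 0")
  case False
  define c where "c = a + b"
  have c: "c > 0" using assms False by (simp add: c_def)
  have "2 = (1 + p * (2 * a / c - 1)) + (1 + p * (2 * b / c - 1))"
  proof -
    define u where "u = 2 * a / c"
    have v: "2 * b / c = 2 - u" using c by (simp add: field_simps c_def u_def)
    show ?thesis unfolding v u_def[symmetric] by (simp add: algebra_simps)
  qed
  also have "\<dots> \<le> (2 * a / c) powr p + (2 * b / c) powr p"
    using assms c by (intro add_mono powr_ge_tangent) auto
  also have "\<dots> = 2 powr p * (a powr p + b powr p) / c powr p"
    using assms c by (simp add: powr_divide powr_mult field_simps)
  finally have "2 * c powr p \<le> 2 powr p * (a powr p + b powr p)"
    using c by (simp add: field_simps)
  then show ?thesis by (simp add: c_def powr_diff)
qed (use assms in auto)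

text \<open>Jensen for a concave power. Young's inequality with the constant \<open>A\<close> is the
  tangent at \<open>A\<close>: \<open>A = 1\<close> gives integrability, the mean as
  \<open>A\<close> gives the bound. A zero mean is treated apart, since the power has no tangent
  there.\<close>

lemma (in prob_space) expectation_powr_le:
  fixes Y :: "'a \<Rightarrow> real"
  assumes Y: "integrable M Y" "\<And>\<omega>. \<omega> \<in> space M \<Longrightarrow> Y \<omega> \<ge> 0" and \<alpha>: "0 < \<alpha>" "\<alpha> \<le> 1"
  shows "integrable M (\<lambda>\<omega>. Y \<omega> powr \<alpha>)" "expectation (\<lambda>\<omega>. Y \<omega> powr \<alpha>) \<le> expectation Y powr \<alpha>"
proof -
  have [measurable]: "Y \<in> borel_measurable M" using Y by auto
  have le: "Y \<omega> powr \<alpha> * A powr (1 - \<alpha>) \<le> \<alpha> * Y \<omega> + (1 - \<alpha>) * A" if "\<omega> \<in> space M" "A > 0" for \<omega> A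
  proof (cases "Y \<omega> = 0")
    case False
    then show ?thesis using Y(2)[OF that(1)] that \<alpha> by (intro Youngs_inequality_0) auto
  qed (use that \<alpha> in auto)
  show int: "integrable M (\<lambda>\<omega>. Y \<omega> powr \<alpha>)"
    by (rule Bochner_Integration.integrable_bound[of _ "\<lambda>\<omega>. \<alpha> * Y \<omega> + (1 - \<alpha>) * 1"])
       (use Y \<alpha> le[of _ 1] in \<open>auto intro!: AE_I2 abs_le_D1 simp: abs_of_nonneg\<close>)
  have EY: "expectation Y \<ge> 0" by (rule Bochner_Integration.integral_nonneg) (use Y in auto)
  show "expectation (\<lambda>\<omega>. Y \<omega> powr \<alpha>) \<le> expectation Y powr \<alpha>"
  proof (cases "expectation Y = 0")
    case True
    have "AE \<omega> in M. Y \<omega> = 0"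
      using True Y by (subst (asm) integral_nonneg_eq_0_iff_AE) auto
    then have "expectation (\<lambda>\<omega>. Y \<omega> powr \<alpha>) = expectation (\<lambda>\<omega>. 0)"
      by (intro integral_cong_AE) (auto elim!: eventually_mono)
    then show ?thesis by simp
  next
    case False
    define A where "A = expectation Y"
    have A: "A > 0" using False EY by (simp add: A_def)
    have "expectation (\<lambda>\<omega>. Y \<omega> powr \<alpha>) * A powr (1 - \<alpha>) = expectation (\<lambda>\<omega>. Y \<omega> powr \<alpha> * A powr (1 - \<alpha>))"
      by simp
    also have "\<dots> \<le> expectation (\<lambda>\<omega>. \<alpha> * Y \<omega> + (1 - \<alpha>) * A)"
      using int Y A le by (intro integral_mono) auto
    also have "\<dots> = \<alpha> * A + (1 - \<alpha>) * A" using Y by (simp add: A_def prob_space)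
    also have "\<dots> = A powr \<alpha> * A powr (1 - \<alpha>)" using A by (simp add: powr_add[symmetric] algebra_simps)
    finally show ?thesis using A by (simp add: A_def)
  qed
qed

section \<open>The p-norms and the dual norm of a random direction\<close>

lemma lp_norm_nonneg [simp]: "lp_norm p x \<ge> 0"
  by (simp add: lp_norm_def)

lemma lp_norm_powr:
  assumes "p > 0" shows "lp_norm p x powr p = (\<Sum>i\<in>UNIV. \<bar>x $ i\<bar> powr p)"
  using assms by (simp add: lp_norm_def powr_powr sum_nonneg)

lemma component_le_lp_norm:
  assumes "p > 0" shows "\<bar>x $ i\<bar> \<le> lp_norm p x"
proof -
  have "\<bar>x $ i\<bar> powr p \<le> lp_norm p x powr p"
    unfolding lp_norm_powr[OF assms] by (rule member_le_sum) auto
  then show ?thesis using assms powr_less_mono2[of p "lp_norm p x" "\<bar>x $ i\<bar>"] by fastforce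
qed

lemma lp_norm_le_iff:
  assumes "p > 0" "c \<ge> 0" shows "lp_norm p x \<le> c \<longleftrightarrow> (\<Sum>i\<in>UNIV. \<bar>x $ i\<bar> powr p) \<le> c powr p"
proof
  assume "lp_norm p x \<le> c"
  then show "(\<Sum>i\<in>UNIV. \<bar>x $ i\<bar> powr p) \<le> c powr p"
    using assms by (simp flip: lp_norm_powr add: powr_mono2)
next
  assume "(\<Sum>i\<in>UNIV. \<bar>x $ i\<bar> powr p) \<le> c powr p"
  then have "lp_norm p x powr p \<le> c powr p" using assms by (simp add: lp_norm_powr)
  then show "lp_norm p x \<le> c" using assms powr_less_mono2[of p c "lp_norm p x"] by fastforce
qed

lemma lp_norm_eq_0_iff: "p > 0 \<Longrightarrow> lp_norm p x = 0 \<longleftrightarrow> x = 0"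
  using component_le_lp_norm[of p x]
  by (auto simp: vec_eq_iff lp_norm_def)

lemma lp_norm_antimono:
  assumes "0 < p" "p \<le> p'" shows "lp_norm p' x \<le> lp_norm p x"
proof (cases "x = 0")
  case True then show ?thesis by (simp add: lp_norm_def)
next
  case False
  define c where "c = lp_norm p x"
  have c: "c > 0" using assms False lp_norm_nonneg[of p x] by (simp add: c_def lp_norm_eq_0_iff order.strict_iff_order)
  have "(\<Sum>i\<in>UNIV. \<bar>x $ i\<bar> powr p') \<le> (\<Sum>i\<in>UNIV. \<bar>x $ i\<bar> powr p * c powr (p' - p))"
  proof (rule sum_mono)
    fix i
    have "\<bar>x $ i\<bar> powr p' = \<bar>x $ i\<bar> powr p * \<bar>x $ i\<bar> powr (p' - p)"
      by (simp add: powr_add[symmetric])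
    also have "\<dots> \<le> \<bar>x $ i\<bar> powr p * c powr (p' - p)"
      using assms component_le_lp_norm[of p x i] by (intro mult_left_mono powr_mono2) (auto simp: c_def)
    finally show "\<bar>x $ i\<bar> powr p' \<le> \<bar>x $ i\<bar> powr p * c powr (p' - p)" .
  qed
  also have "\<dots> = c powr p * c powr (p' - p)"
    using assms by (simp add: sum_distrib_right[symmetric] c_def lp_norm_powr)
  also have "\<dots> = c powr p'" by (simp add: powr_add[symmetric])
  finally show ?thesis using assms c by (simp add: lp_norm_le_iff c_def[symmetric])
qed

text \<open>Comparison of power means: the tangent inequality is applied to every coordinate at the
  average \<open>A\<close> of the powers, where the linear terms sum to zero.\<close>

lemma lp_norm_power_mean:
  fixes x :: "real ^ 'n"
  assumes "1 \<le> p'" "p' \<le> p"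
  shows "lp_norm p' x \<le> real CARD('n) powr (1 / p' - 1 / p) * lp_norm p x"
proof (cases "x = 0")
  case True then show ?thesis by (simp add: lp_norm_def)
next
  case False
  define d where "d = real CARD('n)"
  define c where "c = lp_norm p' x"
  define A where "A = c powr p' / d"
  have d: "d > 0" by (simp add: d_def)
  have c: "c > 0" using assms False lp_norm_nonneg[of p' x] by (simp add: c_def lp_norm_eq_0_iff order.strict_iff_order)
  have A: "A > 0" using c d by (simp add: A_def)
  have sA: "(\<Sum>i\<in>UNIV. \<bar>x $ i\<bar> powr p') = d * A"
    using assms d by (simp add: A_def c_def lp_norm_powr)
  have "d = (\<Sum>i\<in>(UNIV :: 'n set). 1 + p / p' * (\<bar>x $ i\<bar> powr p' / A - 1))"
    using A by (simp add: sum.distrib sum_subtractf sum_distrib_left[symmetric] sum_divide_distrib[symmetric] sA)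
       (simp add: d_def)
  also have "\<dots> \<le> (\<Sum>i\<in>UNIV. (\<bar>x $ i\<bar> powr p' / A) powr (p / p'))"
    using assms A by (intro sum_mono powr_ge_tangent) auto
  also have "\<dots> = (\<Sum>i\<in>UNIV. \<bar>x $ i\<bar> powr p) / A powr (p / p')"
    using assms A by (simp add: powr_divide powr_powr sum_divide_distrib)
  finally have "d * A powr (p / p') \<le> lp_norm p x powr p"
    using assms A by (simp add: field_simps lp_norm_powr)
  moreover have "d * A powr (p / p') = (d powr (1 / p - 1 / p') * c) powr p"
    using assms A c d by (simp add: A_def powr_divide powr_mult powr_powr powr_diff field_simps flip: powr_add)
  ultimately have "(d powr (1 / p - 1 / p') * c) powr p \<le> lp_norm p x powr p" by simp
  then have "d powr (1 / p - 1 / p') * c \<le> lp_norm p x"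
    using assms powr_less_mono2[of p "lp_norm p x" "d powr (1 / p - 1 / p') * c"] by fastforce
  then have "d powr (1 / p' - 1 / p) * (d powr (1 / p - 1 / p') * c) \<le> d powr (1 / p' - 1 / p) * lp_norm p x"
    by (rule mult_left_mono) simp
  then show ?thesis using d by (simp add: c_def d_def powr_add[symmetric] mult.assoc[symmetric])
qed

lemma lp_norm_Holder:
  fixes x y :: "real ^ 'n"
  assumes "P > 1" "Q > 1" "1 / P + 1 / Q = 1"
  shows "\<bar>x \<bullet> y\<bar> \<le> lp_norm P x * lp_norm Q y"
proof (cases "x = 0 \<or> y = 0")
  case False
  define a b where "a = lp_norm P x" and "b = lp_norm Q y"
  have pos: "a > 0" "b > 0" using assms False lp_norm_nonneg[of P x] lp_norm_nonneg[of Q y]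
    by (auto simp: a_def b_def lp_norm_eq_0_iff order.strict_iff_order)
  have "\<bar>x \<bullet> y\<bar> / (a * b) \<le> (\<Sum>i\<in>UNIV. \<bar>x $ i * y $ i\<bar>) / (a * b)"
    using pos by (intro divide_right_mono) (simp_all add: inner_vec_def sum_abs)
  also have "\<dots> = (\<Sum>i\<in>UNIV. (\<bar>x $ i\<bar> / a) * (\<bar>y $ i\<bar> / b))"
    by (simp add: sum_divide_distrib abs_mult)
  also have "\<dots> \<le> (\<Sum>i\<in>UNIV. (\<bar>x $ i\<bar> / a) powr P / P + (\<bar>y $ i\<bar> / b) powr Q / Q)"
    using assms pos by (intro sum_mono Youngs_inequality) auto
  also have "\<dots> = (\<Sum>i\<in>UNIV. \<bar>x $ i\<bar> powr P) / a powr P / P + (\<Sum>i\<in>UNIV. \<bar>y $ i\<bar> powr Q) / b powr Q / Q"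
    using pos by (simp add: sum.distrib powr_divide sum_divide_distrib)
  also have "(\<Sum>i\<in>UNIV. \<bar>x $ i\<bar> powr P) = a powr P" using assms by (simp add: a_def lp_norm_powr)
  also have "(\<Sum>i\<in>UNIV. \<bar>y $ i\<bar> powr Q) = b powr Q" using assms by (simp add: b_def lp_norm_powr)
  also have "a powr P / a powr P / P + b powr Q / b powr Q / Q = 1 / P + 1 / Q" using pos by simp
  finally show ?thesis using assms pos by (simp add: a_def b_def)
qed auto

lemma norm_eq_lp_norm: "norm x = lp_norm 2 x"
  by (simp add: lp_norm_def norm_vec_def L2_set_def powr_half_sqrt sum_nonneg)

lemma norm_le_lp_norm: "0 < p \<Longrightarrow> p \<le> 2 \<Longrightarrow> norm x \<le> lp_norm p x"
  by (simp add: norm_eq_lp_norm lp_norm_antimono)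

lemma lp_norm_minus_commute: "lp_norm p (x - y) = lp_norm p (y - x)"
  by (simp add: lp_norm_def abs_minus_commute)

text \<open>A weak triangle inequality, strong enough to find a point at half the diameter from a
  given one.\<close>

lemma lp_norm_add_le_max:
  assumes p: "1 \<le> p"
  shows "lp_norm p (x + y) \<le> 2 * max (lp_norm p x) (lp_norm p y)"
proof -
  define c where "c = max (lp_norm p x) (lp_norm p y)"
  have "(\<Sum>i\<in>UNIV. \<bar>(x + y) $ i\<bar> powr p) \<le> (\<Sum>i\<in>UNIV. 2 powr (p - 1) * (\<bar>x $ i\<bar> powr p + \<bar>y $ i\<bar> powr p))"
    using p by (intro sum_mono order_trans[OF powr_mono2 powr_add_le]) auto
  also have "\<dots> = 2 powr (p - 1) * (lp_norm p x powr p + lp_norm p y powr p)"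
    using p by (simp add: lp_norm_powr sum.distrib flip: sum_distrib_left)
  also have "\<dots> \<le> 2 powr (p - 1) * (c powr p + c powr p)"
    using p by (intro mult_left_mono add_mono powr_mono2) (auto simp: c_def)
  also have "\<dots> = (2 * c) powr p"
    by (simp add: powr_mult powr_diff c_def)
  finally show ?thesis using p by (simp add: lp_norm_le_iff c_def max_def)
qed

lemma borel_measurable_lp_norm [measurable]: "lp_norm p \<in> borel_measurable borel"
  unfolding lp_norm_def by measurable

text \<open>For an even integer order the power of the norm is a sum of coordinate moments. The
  fourth power of the norm is the power \<open>2 / m\<close> of that sum, which is concave for
  \<open>2 \<le> m\<close>, so Jensen applies.\<close>

lemma uniform_sphere_lp_norm_moment:
  assumes m: "2 \<le> m"
  shows "(\<integral>e. lp_norm (2 * real m) (e :: real ^ 'n) ^ 4 \<partial>uniform_sphere) \<le>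
    real CARD('n) powr (2 / real m - 2) * (22 * real m)\<^sup>2"
proof -
  define d where "d = real CARD('n)"
  define Y where "Y e = (\<Sum>i\<in>UNIV. (e $ i) ^ (2 * m))" for e :: "real ^ 'n"
  have d: "d \<ge> 1" by (simp add: d_def Suc_leI)
  have Y0: "Y e \<ge> 0" for e by (simp add: Y_def sum_nonneg)
  have comp_int: "integrable uniform_sphere (\<lambda>e :: real ^ 'n. (e $ i) ^ (2 * m))" for i
    by (rule integrable_uniform_sphere_continuous) (intro continuous_intros)
  then have Y_int: "integrable uniform_sphere Y" unfolding Y_def by auto
  have "(\<integral>e. Y e \<partial>uniform_sphere) = (\<Sum>i\<in>UNIV. \<integral>e. (e $ i) ^ (2 * m) \<partial>(uniform_sphere :: (real ^ 'n) measure))"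
    unfolding Y_def by (rule Bochner_Integration.integral_sum) (rule comp_int)
  also have "\<dots> \<le> (\<Sum>i\<in>(UNIV :: 'n set). (22 * real m / d) ^ m)"
  proof (rule sum_mono)
    fix i :: 'n
    show "(\<integral>e. (e $ i) ^ (2 * m) \<partial>(uniform_sphere :: (real ^ 'n) measure)) \<le> (22 * real m / d) ^ m"
      using uniform_sphere_inner_moment[of m "axis i 1 :: real ^ 'n"] m
      by (simp add: inner_axis' d_def norm_axis_1)
  qed
  also have "\<dots> = d * (22 * real m / d) ^ m" by (simp add: d_def)
  finally have EY: "(\<integral>e. Y e \<partial>uniform_sphere) \<le> d * (22 * real m / d) ^ m" .
  have eq: "lp_norm (2 * real m) e ^ 4 = Y e powr (2 / real m)" for e :: "real ^ 'n"
  proof -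
    have "(\<Sum>i\<in>UNIV. \<bar>e $ i\<bar> powr (2 * real m)) = Y e"
      unfolding Y_def
    proof (rule sum.cong)
      fix i
      have "\<bar>e $ i\<bar> powr (2 * real m) = \<bar>e $ i\<bar> ^ (2 * m)"
        using m by (cases "e $ i = 0") (auto simp: powr_realpow[symmetric])
      then show "\<bar>e $ i\<bar> powr (2 * real m) = (e $ i) ^ (2 * m)" by (simp add: power_even_abs)
    qed simp
    then have "lp_norm (2 * real m) e = Y e powr (1 / (2 * real m))" by (simp add: lp_norm_def)
    moreover have "(Y e powr (1 / (2 * real m))) ^ 4 = (Y e powr (1 / (2 * real m))) powr 4"
      by (rule powr_numeral[symmetric]) simp
    ultimately show ?thesis by (simp add: powr_powr)
  qed
  have "(\<integral>e. lp_norm (2 * real m) e ^ 4 \<partial>(uniform_sphere :: (real ^ 'n) measure)) \<le> (\<integral>e. Y e \<partial>uniform_sphere) powr (2 / real m)"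
    unfolding eq using m by (intro uniform_sphere.expectation_powr_le Y_int Y0) auto
  also have "\<dots> \<le> (d * (22 * real m / d) ^ m) powr (2 / real m)"
    by (intro powr_mono2 EY Bochner_Integration.integral_nonneg Y0) simp
  also have "\<dots> = d powr (2 / real m) * (22 * real m / d) powr 2"
  proof -
    define X where "X = 22 * real m / d"
    have X: "X > 0" using m d by (simp add: X_def)
    have "(X ^ m) powr (2 / real m) = X powr 2"
      unfolding powr_realpow[OF X, symmetric] powr_powr using m by simp
    then show ?thesis using d X by (simp add: powr_mult X_def[symmetric] del: powr_numeral)
  qed
  also have "\<dots> = d powr (2 / real m - 2) * (22 * real m)\<^sup>2"
    using m d by (simp add: powr_diff power_divide)
  finally show ?thesis by (simp add: d_def)
qed

text \<open>The exact dual norm of a direction is its q-norm. It is replaced by a multiple of a norm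
  of even integer order \<open>2 * m\<close>, whose moments on the sphere are known, at the price of
  a comparison constant \<open>c\<close>. The order follows q while q is at most of order
  \<open>ln d\<close> and stops there, which matches the two terms of the minimum in
  \<open>a_const\<close>; the case \<open>q = top\<close> belongs to the regime where the order has
  stopped.\<close>

lemma uniform_sphere_dual_norm:
  fixes p :: real and q :: ennreal
  assumes d: "CARD('n) \<ge> 2" and p: "1 \<le> p" "p \<le> 2" "1 / ennreal p + 1 / q = 1"
  obtains Nn :: "real ^ 'n \<Rightarrow> real" where
    "continuous_on UNIV Nn" "\<And>e. Nn e \<ge> 0" "\<And>e x. \<bar>e \<bullet> x\<bar> \<le> Nn e * lp_norm p x"
    "(\<integral>e. Nn e ^ 4 \<partial>uniform_sphere) \<le> (8 * a_const (real CARD('n)) q) ^ 4"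
    "a_const (real CARD('n)) q > 0"
proof -
  note obtain_dual = that
  define d where "d = real CARD('n)"
  define \<rho> where "\<rho> = enn2real (1 / q)"
  have d2: "d \<ge> 2" using assms by (simp add: d_def)
  have "ennreal (1 / p) + 1 / q = 1"
    using p by (simp add: ennreal_1[symmetric] divide_ennreal del: ennreal_1)
  then have "1 / q = 1 - ennreal (1 / p)"
    by (metis ennreal_add_diff_cancel_left ennreal_neq_top)
  also have "\<dots> = ennreal (1 - 1 / p)" using p by (simp add: ennreal_minus flip: ennreal_1)
  finally have q1: "1 / q = ennreal (1 - 1 / p)" .
  then have \<rho>: "\<rho> = 1 - 1 / p" using p by (simp add: \<rho>_def)
  have \<rho>0: "0 \<le> \<rho>" "\<rho> \<le> 1 / 2" using p by (simp_all add: \<rho> field_simps)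
  have q_top: "q = top \<longleftrightarrow> \<rho> = 0"
    by (metis \<rho> q1 ennreal_divide_eq_0_iff divide_ennreal_def ennreal_0 ennreal_inverse_top ennreal_top_neq_one
        enn2real_0 \<rho>_def \<rho>0(1) ennreal_eq_0_iff order_refl mult_zero_right zero_neq_one)
  have qr: "enn2real q = 1 / \<rho>" if "\<rho> \<noteq> 0"
  proof -
    have nt: "q \<noteq> top" using that q_top by blast
    then obtain x where x: "q = ennreal x" "x \<ge> 0" by (cases q) auto
    have "x \<noteq> 0"
    proof
      assume "x = 0"
      then have "1 / q = top" using x by (simp add: ennreal_divide_zero)
      then show False using q1 by simp
    qed
    then have "ennreal (1 / x) = ennreal (1 - 1 / p)"
      using q1 x by (simp add: divide_ennreal flip: ennreal_1)
    then have "1 / x = \<rho>" using x \<rho>0 by (simp add: \<rho>)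
    then show ?thesis using x by (auto simp: enn2real_ennreal)
  qed
  have ln2: "ln d \<ge> 1 / 2"
  proof -
    have "ln d \<ge> ln 2" using d2 by simp
    then show ?thesis using ln_le_minus_one[of "1 / 2"] by (simp add: ln_div)
  qed
  \<comment> \<open>Beyond this order nothing is gained, as \<open>d powr (1 / (2 * m0))\<close> is
    already at most \<open>exp (1 / 2)\<close>. Dimension at least two gives
    \<open>ln d \<ge> 1 / 2\<close>, which keeps \<open>m0\<close> below
    \<open>32 * ln d - 8\<close>.\<close>
  define m0 where "m0 = nat \<lceil>ln d\<rceil> + 1"
  have m0: "m0 \<ge> 2" "real m0 \<ge> ln d" "real m0 \<le> ln d + 2"
    using ln2 by (simp_all add: m0_def of_nat_nat) linarith+
  have a_ge: "a_const d q \<ge> d powr (\<rho> - 1 / 2) * sqrt (real m)"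
    if "real m \<le> 32 * ln d - 8" "\<rho> \<noteq> 0 \<Longrightarrow> real m \<le> 2 / \<rho> - 1" for m
    using that q_top qr by (auto simp: a_const_def \<rho>_def[symmetric] intro!: mult_left_mono)
  have m0_le: "real m0 \<le> 32 * ln d - 8" using m0 ln2 by simp
  \<comment> \<open>Common part of the two regimes, for an order \<open>m\<close> with comparison
    constant \<open>c\<close>. The exponent \<open>2 * m / (2 * m - 1)\<close> is dual to
    \<open>2 * m\<close>, and the constant 8 comes from
    \<open>(22 * exp 1)^2 \<le> 64^2 = 8^4\<close>.\<close>
  have main: thesis
    if m: "2 \<le> m" "real m \<le> 32 * ln d - 8" "\<rho> \<noteq> 0 \<Longrightarrow> real m \<le> 2 / \<rho> - 1"
      and c: "c \<ge> 0" "\<And>x :: real ^ 'n. lp_norm (2 * real m / (2 * real m - 1)) x \<le> c * lp_norm p x"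
      and c4: "c * d powr (1 / (2 * real m)) \<le> exp 1 powr (1 / 2) * d powr \<rho>" for m c
  proof -
    let ?N = "\<lambda>e :: real ^ 'n. c * lp_norm (2 * real m) e"
    show thesis
    proof (rule obtain_dual)
      show "continuous_on UNIV ?N"
        unfolding lp_norm_def using m
        by (intro continuous_intros continuous_on_powr') (auto simp: sum_nonneg)
      show "?N e \<ge> 0" for e using c by simp
      show "\<bar>e \<bullet> x\<bar> \<le> ?N e * lp_norm p x" for e x
      proof -
        have "\<bar>e \<bullet> x\<bar> \<le> lp_norm (2 * real m) e * lp_norm (2 * real m / (2 * real m - 1)) x"
          using m by (intro lp_norm_Holder) (auto simp: field_simps)
        also have "\<dots> \<le> lp_norm (2 * real m) e * (c * lp_norm p x)"
          by (intro mult_left_mono c) simp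
        finally show ?thesis by (simp add: mult_ac)
      qed
      define t where "t = d powr (1 / (2 * real m))"
      have t: "t > 0" using d2 by (simp add: t_def)
      have a0: "a_const d q \<ge> d powr (\<rho> - 1 / 2) * sqrt (real m)" using m by (intro a_ge) auto
      moreover have apos: "d powr (\<rho> - 1 / 2) * sqrt (real m) > 0" using d2 m by simp
      ultimately show "a_const (real CARD('n)) q > 0" unfolding d_def by linarith
      have "(\<integral>e. ?N e ^ 4 \<partial>uniform_sphere) = c ^ 4 * (\<integral>e. lp_norm (2 * real m) (e :: real ^ 'n) ^ 4 \<partial>uniform_sphere)"
        by (simp add: power_mult_distrib)
      also have "\<dots> \<le> c ^ 4 * (d powr (2 / real m - 2) * (22 * real m)\<^sup>2)"
        using uniform_sphere_lp_norm_moment[OF m(1), where ?'n='n] by (intro mult_left_mono) (auto simp: d_def)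
      also have "\<dots> = (c * t) ^ 4 * d powr (- 2) * (22 * real m)\<^sup>2"
      proof -
        have "t ^ 4 = t powr 4" using t by simp
        also have "\<dots> = d powr (2 / real m)" by (simp add: t_def powr_powr)
        finally have "t ^ 4 * d powr (- 2) = d powr (2 / real m - 2)" by (simp add: powr_add[symmetric])
        then show ?thesis by (simp add: power_mult_distrib mult_ac)
      qed
      also have "\<dots> \<le> (exp 1 powr (1 / 2) * d powr \<rho>) ^ 4 * d powr (- 2) * (22 * real m)\<^sup>2"
        using c4 c t by (intro mult_right_mono power_mono) (auto simp: t_def)
      also have "\<dots> = (exp 1 * 22)\<^sup>2 * (d powr (\<rho> - 1 / 2) * sqrt (real m)) ^ 4"
      proof -
        have 1: "(d powr \<rho>) ^ 4 * d powr (- 2) = (d powr (\<rho> - 1 / 2)) ^ 4"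
        proof -
          have p4: "(d powr b) ^ 4 = d powr (4 * b)" for b
            using powr_numeral[of "d powr b" "num.Bit0 (num.Bit0 num.One)"] by (simp add: powr_powr mult.commute)
          show ?thesis unfolding p4 by (simp add: powr_add[symmetric] algebra_simps)
        qed
        have 2: "(exp (1 :: real) powr (1 / 2)) ^ 4 = (exp 1)\<^sup>2"
          by (simp add: exp_powr_real exp_of_nat_mult[symmetric] flip: exp_of_nat_mult)
        have 3: "(sqrt (real m)) ^ 4 = (real m)\<^sup>2"
          using power_mult[of "sqrt (real m)" 2 2] by simp
        show ?thesis by (simp only: power_mult_distrib 2 3 1[symmetric]) (simp add: mult_ac)
      qed
      also have "\<dots> \<le> 8 ^ 4 * a_const d q ^ 4"
      proof (intro mult_mono power_mono a0)
        have "(exp 1 * 22)\<^sup>2 \<le> (64 :: real)\<^sup>2" using e_less_272 by (intro power_mono) auto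
        then show "(exp 1 * 22)\<^sup>2 \<le> (8 ^ 4 :: real)" by simp
      qed (use apos in auto)
      finally show "(\<integral>e. ?N e ^ 4 \<partial>uniform_sphere) \<le> (8 * a_const (real CARD('n)) q) ^ 4"
        by (simp add: d_def power_mult_distrib)
    qed
  qed
  have conj: "1 / (2 * real m / (2 * real m - 1)) = 1 - 1 / (2 * real m)" if "m \<ge> 2" for m
    using that by (simp add: field_simps)
  have e1: "1 \<le> exp (1 :: real) powr (1 / 2)" by (simp add: exp_powr_real)
  \<comment> \<open>Recall that \<rho> is \<open>1 / q\<close>. In the first case q exceeds
    \<open>2 * m0\<close>, the order stays at \<open>m0\<close>, and monotonicity of the norms gives
    \<open>c = 1\<close>. In the second case \<open>m\<close> is q/2 rounded up, but at least 2, and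
    the power-mean comparison costs a dimension factor that completes the moment's
    \<open>d powr (1 / (2 * m))\<close> to \<open>d powr \<rho>\<close>.\<close>
  show thesis
  proof (cases "2 * real m0 * \<rho> < 1")
    case True
    show thesis
    proof (rule main[of m0 1])
      show "real m0 \<le> 2 / \<rho> - 1" if "\<rho> \<noteq> 0"
      proof -
        have r: "\<rho> > 0" "\<rho> \<le> 1 / 2" using \<rho>0 that by auto
        then have "2 * real m0 < 1 / \<rho>" using True by (simp add: field_simps)
        moreover have "1 / \<rho> \<ge> 2" using r by (simp add: field_simps)
        ultimately show ?thesis by simp
      qed
      show "lp_norm (2 * real m0 / (2 * real m0 - 1)) x \<le> 1 * lp_norm p x" for x :: "real ^ 'n"
      proof -
        have "1 / p \<ge> 1 / (2 * real m0 / (2 * real m0 - 1))"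
          using True m0 unfolding conj[OF m0(1)] by (simp add: \<rho> field_simps)
        then have "p \<le> 2 * real m0 / (2 * real m0 - 1)" using p m0 by (simp add: field_simps)
        then show ?thesis using p by (simp add: lp_norm_antimono)
      qed
      have "d powr (1 / (2 * real m0)) = exp (ln d / (2 * real m0))" using d2 by (simp add: powr_def)
      also have "\<dots> \<le> exp (1 / 2)" using m0 by (simp add: field_simps)
      also have "\<dots> \<le> exp 1 powr (1 / 2) * d powr \<rho>"
        using d2 \<rho>0 by (simp add: exp_powr_real ge_one_powr_ge_zero)
      finally show "1 * d powr (1 / (2 * real m0)) \<le> exp 1 powr (1 / 2) * d powr \<rho>" by simp
    qed (use m0 m0_le in auto)
  next
    case False
    then have r: "\<rho> > 0" "\<rho> \<le> 1 / 2" using \<rho>0 m0 by (cases "\<rho> = 0"; simp)+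
    define m where "m = max 2 (nat \<lceil>1 / (2 * \<rho>)\<rceil>)"
    have ge1: "1 / (2 * \<rho>) \<ge> 1" using r by (simp add: field_simps)
    have m1: "real m \<ge> 1 / (2 * \<rho>)" by (simp add: m_def) linarith
    have "real (nat \<lceil>1 / (2 * \<rho>)\<rceil>) \<le> 1 / (2 * \<rho>) + 1" using ge1 by linarith
    then have m2: "real m \<le> 1 / (2 * \<rho>) + 1" using ge1 by (simp add: m_def max_def)
    have "\<lceil>1 / (2 * \<rho>)\<rceil> \<le> int m0" using False r by (simp add: ceiling_le_iff field_simps)
    then have m3: "m \<le> m0" using m0(1) unfolding m_def by (intro max.boundedI) (simp_all only: nat_le_iff)
    have m4: "m \<ge> 2" by (simp add: m_def)
    show thesis
    proof (rule main[of m "d powr (\<rho> - 1 / (2 * real m))"])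
      show "real m \<le> 2 / \<rho> - 1" using m2 ge1 by (simp add: field_simps)
      show "real m \<le> 32 * ln d - 8" using m3 m0_le by simp
      show "lp_norm (2 * real m / (2 * real m - 1)) x \<le> d powr (\<rho> - 1 / (2 * real m)) * lp_norm p x" for x :: "real ^ 'n"
      proof -
        have "1 / p \<le> 1 / (2 * real m / (2 * real m - 1))"
          using m1 m4 r unfolding conj[OF m4] by (simp add: \<rho> field_simps)
        then have "2 * real m / (2 * real m - 1) \<le> p" using p m4 by (simp add: field_simps)
        then have "lp_norm (2 * real m / (2 * real m - 1)) x \<le> d powr (1 / (2 * real m / (2 * real m - 1)) - 1 / p) * lp_norm p x"
          unfolding d_def using m4 by (intro lp_norm_power_mean) (auto simp: field_simps)
        then show ?thesis unfolding conj[OF m4] \<rho> by (simp add: algebra_simps)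
      qed
      show "d powr (\<rho> - 1 / (2 * real m)) * d powr (1 / (2 * real m)) \<le> exp 1 powr (1 / 2) * d powr \<rho>"
        using mult_right_mono[OF e1, of "d powr \<rho>"] by (simp add: powr_add[symmetric])
    qed (use m4 in auto)
  qed
qed

section \<open>Concentration of convex Lipschitz functions\<close>

lemma lipschitz_imp_continuous:
  fixes h :: "'a::real_normed_vector \<Rightarrow> 'b::real_normed_vector"
  assumes "\<And>x y. x \<in> C \<Longrightarrow> y \<in> C \<Longrightarrow> norm (h x - h y) \<le> L * norm (x - y)"
  shows "continuous_on C h"
proof -
  have "(max L 0)-lipschitz_on C h"
    using assms by (intro lipschitz_onI)
      (auto simp: dist_norm intro!: order_trans[OF assms] mult_right_mono)
  then show ?thesis by (rule lipschitz_on_continuous_on)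
qed

lemma convex_on_affine_compose:
  fixes h :: "'a::real_vector \<Rightarrow> real"
  assumes "convex_on UNIV h"
  shows "convex_on UNIV (\<lambda>x. h (a + b *\<^sub>R x))"
proof (rule convex_onI)
  fix t x y assume t: "0 < t" "t < (1::real)"
  have "a + b *\<^sub>R ((1 - t) *\<^sub>R x + t *\<^sub>R y) = (1 - t) *\<^sub>R (a + b *\<^sub>R x) + t *\<^sub>R (a + b *\<^sub>R y)"
    by (simp add: algebra_simps)
  then show "h (a + b *\<^sub>R ((1 - t) *\<^sub>R x + t *\<^sub>R y)) \<le> (1 - t) * h (a + b *\<^sub>R x) + t * h (a + b *\<^sub>R y)"
    using convex_onD[OF assms, of t] t by simp
qed simp

text \<open>The objective is convex only on a thickened set, whereas Gaussian vectors leave every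
  compact set. Infimal convolution with \<open>L\<close> times the norm extends it with the same
  Lipschitz constant. Convexity survives because the minimised expression is jointly convex in
  \<open>y\<close> and in the point ranging over the convex set \<open>C\<close>.\<close>

lemma lipschitz_convex_extension:
  fixes C :: "'a::euclidean_space set" and h :: "'a \<Rightarrow> real"
  assumes C: "compact C" "C \<noteq> {}" and conv: "convex_on C h" and L: "L \<ge> 0"
    and lip: "\<And>x y. x \<in> C \<Longrightarrow> y \<in> C \<Longrightarrow> \<bar>h x - h y\<bar> \<le> L * norm (x - y)"
  obtains h' where "convex_on UNIV h'" "\<And>x y. \<bar>h' x - h' y\<bar> \<le> L * norm (x - y)" "\<And>x. x \<in> C \<Longrightarrow> h' x = h x"
proof -
  have cont: "continuous_on C h" using lip by (intro lipschitz_imp_continuous[of C h L]) auto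
  have "\<exists>z\<in>C. \<forall>z'\<in>C. h z + L * norm (y - z) \<le> h z' + L * norm (y - z')" for y
    by (intro continuous_attains_inf C continuous_intros cont)
  then obtain Z where Z: "\<And>y. Z y \<in> C" "\<And>y z'. z' \<in> C \<Longrightarrow> h (Z y) + L * norm (y - Z y) \<le> h z' + L * norm (y - z')"
    by metis
  define h' where "h' y = h (Z y) + L * norm (y - Z y)" for y
  have h'_le: "h' y \<le> h z + L * norm (y - z)" if "z \<in> C" for y z using Z(2)[OF that] by (simp add: h'_def)
  show thesis
  proof
    show "convex_on UNIV h'"
    proof (rule convex_onI)
      fix t x y assume t: "0 < t" "t < (1::real)"
      have "(1 - t) *\<^sub>R Z x + t *\<^sub>R Z y \<in> C"
        using Z(1) t convex_on_imp_convex[OF conv] by (intro convexD_alt) auto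
      then have "h' ((1 - t) *\<^sub>R x + t *\<^sub>R y) \<le> h ((1 - t) *\<^sub>R Z x + t *\<^sub>R Z y) +
          L * norm ((1 - t) *\<^sub>R x + t *\<^sub>R y - ((1 - t) *\<^sub>R Z x + t *\<^sub>R Z y))"
        by (rule h'_le)
      also have "\<dots> \<le> ((1 - t) * h (Z x) + t * h (Z y)) + L * ((1 - t) * norm (x - Z x) + t * norm (y - Z y))"
      proof (intro add_mono mult_left_mono L)
        show "h ((1 - t) *\<^sub>R Z x + t *\<^sub>R Z y) \<le> (1 - t) * h (Z x) + t * h (Z y)"
          using Z(1) t by (intro convex_onD[OF conv]) auto
        have "(1 - t) *\<^sub>R x + t *\<^sub>R y - ((1 - t) *\<^sub>R Z x + t *\<^sub>R Z y) = (1 - t) *\<^sub>R (x - Z x) + t *\<^sub>R (y - Z y)"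
          by (simp add: algebra_simps)
        then show "norm ((1 - t) *\<^sub>R x + t *\<^sub>R y - ((1 - t) *\<^sub>R Z x + t *\<^sub>R Z y)) \<le> (1 - t) * norm (x - Z x) + t * norm (y - Z y)"
          using norm_triangle_ineq[of "(1 - t) *\<^sub>R (x - Z x)" "t *\<^sub>R (y - Z y)"] t by simp
      qed
      finally show "h' ((1 - t) *\<^sub>R x + t *\<^sub>R y) \<le> (1 - t) * h' x + t * h' y"
        by (simp add: h'_def algebra_simps)
    qed simp
    have one: "h' x - h' y \<le> L * norm (x - y)" for x y
    proof -
      have "h' x \<le> h (Z y) + L * norm (x - Z y)" by (rule h'_le[OF Z(1)])
      also have "\<dots> \<le> h (Z y) + L * (norm (x - y) + norm (y - Z y))"
        using norm_triangle_ineq[of "x - y" "y - Z y"] by (intro add_left_mono mult_left_mono L) simp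
      finally show ?thesis by (simp add: h'_def algebra_simps)
    qed
    show "\<bar>h' x - h' y\<bar> \<le> L * norm (x - y)" for x y
      using one[of x y] one[of y x] by (simp add: norm_minus_commute abs_le_iff)
    show "h' x = h x" if "x \<in> C" for x
    proof (rule antisym)
      show "h' x \<le> h x" using h'_le[OF that, of x] by simp
      show "h x \<le> h' x" using lip[OF that Z(1)[of x]] by (simp add: h'_def)
    qed
  qed
qed

text \<open>Serves first-order conditions: after division by \<open>t\<close> the second-order
  remainder disappears in the limit.\<close>

lemma nonneg_of_vanishing_slope:
  fixes A K :: real
  assumes "\<And>t. 0 < t \<Longrightarrow> t \<le> 1 \<Longrightarrow> 0 \<le> A + t * K"
  shows "0 \<le> A"
proof (rule LIMSEQ_le_const)
  show "(\<lambda>n. A + inverse (real (Suc n)) * K) \<longlonglongrightarrow> A"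
    using tendsto_add[OF tendsto_const tendsto_mult[OF LIMSEQ_inverse_real_of_nat tendsto_const], of A K] by simp
  show "\<exists>N. \<forall>n\<ge>N. 0 \<le> A + inverse (real (Suc n)) * K"
    by (intro exI[of _ 0] allI impI assms) (auto simp: field_simps)
qed

text \<open>The residual \<open>(x - y) / \<lambda>\<close> of the proximal point \<open>y\<close> of \<open>x\<close> is a subgradient at \<open>y\<close>; it is
  used instead of a subgradient at \<open>x\<close> because it depends continuously on \<open>x\<close>.\<close>

lemma approximate_subgradient:
  fixes h :: "'a::euclidean_space \<Rightarrow> real"
  assumes conv: "convex_on UNIV h" and lip: "\<And>x y. \<bar>h x - h y\<bar> \<le> L * norm (x - y)"
    and L: "L \<ge> 0" and l: "l > 0"
  obtains S where "continuous_on UNIV S" "\<And>x. norm (S x) \<le> 2 * L"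
    "\<And>x z. h x + S x \<bullet> (z - x) - 2 * L\<^sup>2 * l \<le> h z"
proof -
  have cont: "continuous_on UNIV h" using lip by (intro lipschitz_imp_continuous[of UNIV h L]) auto
  \<comment> \<open>The proximal point of \<open>x\<close>. Outside the ball of radius
    \<open>2 * l * L\<close> the quadratic penalty outweighs any Lipschitz decrease of
    \<open>h\<close>, so a minimiser over the compact ball is a global one, and the residual has
    norm at most \<open>2 * L\<close>.\<close>
  have "\<exists>y. norm (y - x) \<le> 2 * l * L \<and> (\<forall>z. h y + (norm (y - x))\<^sup>2 / (2 * l) \<le> h z + (norm (z - x))\<^sup>2 / (2 * l))" for x
  proof -
    obtain y where y: "y \<in> cball x (2 * l * L)"
      "\<And>z. z \<in> cball x (2 * l * L) \<Longrightarrow> h y + (norm (y - x))\<^sup>2 / (2 * l) \<le> h z + (norm (z - x))\<^sup>2 / (2 * l)"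
    proof -
      have "continuous_on (cball x (2 * l * L)) (\<lambda>z. h z + (norm (z - x))\<^sup>2 / (2 * l))"
        using l by (intro continuous_intros continuous_on_subset[OF cont]) auto
      moreover have "cball x (2 * l * L) \<noteq> {}" using L l by (auto simp: not_less)
      ultimately show ?thesis using continuous_attains_inf[OF compact_cball] that by blast
    qed
    have "h y + (norm (y - x))\<^sup>2 / (2 * l) \<le> h z + (norm (z - x))\<^sup>2 / (2 * l)" for z
    proof (cases "z \<in> cball x (2 * l * L)")
      case False
      define u where "u = norm (z - x)"
      have u: "2 * l * L \<le> u" using False by (simp add: u_def dist_norm norm_minus_commute)
      have "h y + (norm (y - x))\<^sup>2 / (2 * l) \<le> h x" using y(2)[of x] L l by simp
      also have "\<dots> \<le> h z + L * u" using lip[of x z] by (simp add: u_def norm_minus_commute)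
      also have "L * u \<le> u\<^sup>2 / (2 * l)"
        using mult_right_mono[OF u, of u] l by (simp add: u_def field_simps power2_eq_square)
      finally show ?thesis by (simp add: u_def)
    qed (use y in auto)
    then show ?thesis using y(1) by (auto simp: dist_norm norm_minus_commute)
  qed
  then obtain Y where Y: "\<And>x. norm (Y x - x) \<le> 2 * l * L"
    "\<And>x z. h (Y x) + (norm (Y x - x))\<^sup>2 / (2 * l) \<le> h z + (norm (z - x))\<^sup>2 / (2 * l)" by metis
  define S where "S x = (x - Y x) /\<^sub>R l" for x
  have xY: "x = Y x + l *\<^sub>R S x" for x using l by (simp add: S_def)
  have sub: "h (Y x) + S x \<bullet> (z - Y x) \<le> h z" for x z
  proof -
    \<comment> \<open>Minimality is tested along the segment towards \<open>z\<close>. The squared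
      distance contributes a linear term, which identifies the subgradient, and a remainder
      quadratic in \<open>t\<close>.\<close>
    have "0 \<le> (h z - h (Y x) - S x \<bullet> (z - Y x)) + t * ((norm (z - Y x))\<^sup>2 / (2 * l))" if t: "0 < t" "t \<le> 1" for t
    proof -
      have e: "(norm ((1 - t) *\<^sub>R Y x + t *\<^sub>R z - x))\<^sup>2 =
          (norm (Y x - x))\<^sup>2 - 2 * l * t * (S x \<bullet> (z - Y x)) + t\<^sup>2 * (norm (z - Y x))\<^sup>2"
      proof -
        have "(1 - t) *\<^sub>R Y x + t *\<^sub>R z - x = (Y x - x) + t *\<^sub>R (z - Y x)" by (simp add: algebra_simps)
        moreover have "Y x - x = - l *\<^sub>R S x" using xY[of x] by (metis add_diff_cancel_left' minus_diff_eq scaleR_minus_left)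
        ultimately show ?thesis
          by (simp only: power2_norm_eq_inner)
             (simp add: inner_add_left inner_add_right inner_commute power2_eq_square algebra_simps)
      qed
      have "h (Y x) + (norm (Y x - x))\<^sup>2 / (2 * l) \<le> h ((1 - t) *\<^sub>R Y x + t *\<^sub>R z) + (norm ((1 - t) *\<^sub>R Y x + t *\<^sub>R z - x))\<^sup>2 / (2 * l)"
        by (rule Y(2))
      also have "h ((1 - t) *\<^sub>R Y x + t *\<^sub>R z) \<le> (1 - t) * h (Y x) + t * h z"
        using t by (intro convex_onD[OF conv]) auto
      finally have "0 \<le> t * (h z - h (Y x)) + ((norm ((1 - t) *\<^sub>R Y x + t *\<^sub>R z - x))\<^sup>2 - (norm (Y x - x))\<^sup>2) / (2 * l)"
        by (simp add: algebra_simps diff_divide_distrib)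
      also have "\<dots> = t * ((h z - h (Y x) - S x \<bullet> (z - Y x)) + t * ((norm (z - Y x))\<^sup>2 / (2 * l)))"
        unfolding e using l by (simp add: field_simps power2_eq_square)
      finally show ?thesis using t by (simp add: zero_le_mult_iff)
    qed
    then have "0 \<le> h z - h (Y x) - S x \<bullet> (z - Y x)" by (rule nonneg_of_vanishing_slope)
    then show ?thesis by simp
  qed
  have nS: "norm (S x) \<le> 2 * L" for x
  proof -
    have "norm (S x) = norm (x - Y x) / l" using l by (simp add: S_def divide_inverse_commute)
    also have "\<dots> \<le> 2 * l * L / l" using Y(1)[of x] l by (intro divide_right_mono) (simp_all add: norm_minus_commute)
    finally show ?thesis using l by simp
  qed
  show thesis
  proof
    have "norm (S x - S x') \<le> (1 / l) * norm (x - x')" for x x'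
    proof -
      \<comment> \<open>Subgradients are monotone. Expanding the square of \<open>x - x'\<close>
        then bounds the difference of the residuals and yields the Lipschitz constant
        \<open>1 / l\<close> of \<open>S\<close>.\<close>
      have "0 \<le> (S x - S x') \<bullet> (Y x - Y x')"
        using sub[of x "Y x'"] sub[of x' "Y x"] by (simp add: inner_diff_left inner_diff_right)
      moreover have "x - x' = (Y x - Y x') + l *\<^sub>R (S x - S x')"
        using xY[of x] xY[of x'] by (metis add_diff_add scaleR_diff_right)
      then have "(norm (x - x'))\<^sup>2 = (norm (Y x - Y x'))\<^sup>2 + 2 * l * ((S x - S x') \<bullet> (Y x - Y x')) + l\<^sup>2 * (norm (S x - S x'))\<^sup>2"
        by (simp only: power2_norm_eq_inner inner_add_left inner_add_right inner_scaleR_left inner_scaleR_right inner_commute)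
           (simp add: inner_commute power2_eq_square algebra_simps)
      ultimately have "(l * norm (S x - S x'))\<^sup>2 \<le> (norm (x - x'))\<^sup>2"
        using l by (simp add: power_mult_distrib)
      then have "l * norm (S x - S x') \<le> norm (x - x')" by (rule power2_le_imp_le) simp
      then show ?thesis using l by (simp add: field_simps)
    qed
    then show "continuous_on UNIV S" by (intro lipschitz_imp_continuous[of UNIV S "1 / l"]) auto
    show "norm (S x) \<le> 2 * L" for x by (rule nS)
    show "h x + S x \<bullet> (z - x) - 2 * L\<^sup>2 * l \<le> h z" for x z
    proof -
      have "h x - h (Y x) \<le> L * norm (x - Y x)" using lip[of x "Y x"] by simp
      also have "\<dots> \<le> L * (2 * l * L)" using Y(1)[of x] by (intro mult_left_mono L) (simp add: norm_minus_commute)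
      finally have 1: "h x - h (Y x) \<le> 2 * L\<^sup>2 * l" by (simp add: power2_eq_square mult_ac)
      have "S x \<bullet> (x - Y x) = (norm (x - Y x))\<^sup>2 / l"
        by (simp add: S_def power2_norm_eq_inner divide_inverse mult.commute)
      then have "S x \<bullet> (x - Y x) \<ge> 0" using l by simp
      then show ?thesis using sub[of x z] 1 by (simp add: inner_diff_right)
    qed
  qed
qed

text \<open>A rotation of the plane is a composition of three shears, and each shear preserves Lebesgue
  measure by translation invariance.\<close>

lemma nn_integral_lborel_rotation:
  fixes f :: "'a::euclidean_space \<times> 'a \<Rightarrow> ennreal"
  assumes [measurable]: "f \<in> borel_measurable borel" and t: "0 < t" "t < pi"
  shows "(\<integral>\<^sup>+x. \<integral>\<^sup>+y. f (cos t *\<^sub>R x + sin t *\<^sub>R y, cos t *\<^sub>R y - sin t *\<^sub>R x) \<partial>lborel \<partial>lborel) =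
    (\<integral>\<^sup>+x. \<integral>\<^sup>+y. f (x, y) \<partial>lborel \<partial>lborel)"
proof -
  have shear1: "(\<integral>\<^sup>+x. \<integral>\<^sup>+y. g (x + a *\<^sub>R y, y) \<partial>lborel \<partial>lborel) = (\<integral>\<^sup>+x. \<integral>\<^sup>+y. g (x, y) \<partial>lborel \<partial>lborel)"
    if [measurable]: "g \<in> borel_measurable borel" for g :: "'a \<times> 'a \<Rightarrow> ennreal" and a
  proof -
    have [measurable]: "g \<in> borel_measurable (borel \<Otimes>\<^sub>M borel)" using that by (simp add: borel_prod)
    have "(\<integral>\<^sup>+x. \<integral>\<^sup>+y. g (x + a *\<^sub>R y, y) \<partial>lborel \<partial>lborel) = (\<integral>\<^sup>+y. \<integral>\<^sup>+x. g (x + a *\<^sub>R y, y) \<partial>lborel \<partial>lborel)"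
      by (rule lborel_pair.Fubini') measurable
    also have "\<dots> = (\<integral>\<^sup>+y. \<integral>\<^sup>+x. g (x, y) \<partial>lborel \<partial>lborel)"
    proof (rule nn_integral_cong)
      fix y :: 'a
      show "(\<integral>\<^sup>+x. g (x + a *\<^sub>R y, y) \<partial>lborel) = (\<integral>\<^sup>+x. g (x, y) \<partial>lborel)"
        using nn_integral_lborel_translate[of "\<lambda>x. g (x, y)" "a *\<^sub>R y"] by (simp add: add.commute)
    qed
    also have "\<dots> = (\<integral>\<^sup>+x. \<integral>\<^sup>+y. g (x, y) \<partial>lborel \<partial>lborel)"
      by (rule lborel_pair.Fubini'[symmetric]) measurable
    finally show ?thesis .
  qed
  have shear2: "(\<integral>\<^sup>+x. \<integral>\<^sup>+y. g (x, y - b *\<^sub>R x) \<partial>lborel \<partial>lborel) = (\<integral>\<^sup>+x. \<integral>\<^sup>+y. g (x, y) \<partial>lborel \<partial>lborel)"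
    if [measurable]: "g \<in> borel_measurable borel" for g :: "'a \<times> 'a \<Rightarrow> ennreal" and b
  proof (rule nn_integral_cong)
    fix x :: 'a
    show "(\<integral>\<^sup>+y. g (x, y - b *\<^sub>R x) \<partial>lborel) = (\<integral>\<^sup>+y. g (x, y) \<partial>lborel)"
      using nn_integral_lborel_translate[of "\<lambda>y. g (x, y)" "- b *\<^sub>R x"] by simp
  qed
  define s where "s = sin t"
  \<comment> \<open>This is the tangent of half the angle, finite because \<open>sin t\<close> is
    positive on the open interval from 0 to pi. The rotation is the shear by \<open>a\<close>, the
    shear by \<open>- sin t\<close> in the other coordinate, and the shear by \<open>a\<close>
    again.\<close>
  define a where "a = (1 - cos t) / s"
  have s: "s > 0" unfolding s_def using t by (rule sin_gt_zero)
  have sa: "s * a = 1 - cos t" using s by (simp add: a_def)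
  have ac: "a * (1 + cos t) = s"
  proof -
    have "(1 - cos t) * (1 + cos t) = s\<^sup>2" using sin_squared_eq[of t] by (simp add: s_def algebra_simps power2_eq_square)
    then show ?thesis using s by (simp add: a_def field_simps power2_eq_square)
  qed
  have sc: "sin t = s" by (simp add: s_def)
  have c1: "cos t = 1 - s * a" using sa by simp
  have rot: "(cos t *\<^sub>R x + sin t *\<^sub>R y, cos t *\<^sub>R y - sin t *\<^sub>R x) =
     ((x + a *\<^sub>R y) + a *\<^sub>R (y - s *\<^sub>R (x + a *\<^sub>R y)), y - s *\<^sub>R (x + a *\<^sub>R y))" for x y :: 'a
  proof -
    have "s *\<^sub>R y = (a + a * cos t) *\<^sub>R y" using ac by (simp add: algebra_simps)
    then show ?thesis
      unfolding sc c1 by (simp add: algebra_simps) (metis mult_2_right scaleR_left_distrib)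
  qed
  have [measurable]: "f \<in> borel_measurable (borel \<Otimes>\<^sub>M borel)" using assms by (simp add: borel_prod)
  have m1: "(\<lambda>(x, y). f (x + a *\<^sub>R y, y)) \<in> borel_measurable borel"
    and m2: "(\<lambda>(x, y). f (x + a *\<^sub>R (y - s *\<^sub>R x), y - s *\<^sub>R x)) \<in> borel_measurable borel"
    unfolding borel_prod[symmetric] by measurable
  have "(\<integral>\<^sup>+x. \<integral>\<^sup>+y. f (x, y) \<partial>lborel \<partial>lborel) = (\<integral>\<^sup>+x. \<integral>\<^sup>+y. f (x + a *\<^sub>R y, y) \<partial>lborel \<partial>lborel)"
    by (rule shear1[symmetric]) simp
  also have "\<dots> = (\<integral>\<^sup>+x. \<integral>\<^sup>+y. f (x + a *\<^sub>R (y - s *\<^sub>R x), y - s *\<^sub>R x) \<partial>lborel \<partial>lborel)"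
    using shear2[OF m1, of s] by simp
  also have "\<dots> = (\<integral>\<^sup>+x. \<integral>\<^sup>+y. f ((x + a *\<^sub>R y) + a *\<^sub>R (y - s *\<^sub>R (x + a *\<^sub>R y)), y - s *\<^sub>R (x + a *\<^sub>R y)) \<partial>lborel \<partial>lborel)"
    using shear1[OF m2, of a] by simp
  finally show ?thesis by (simp add: rot)
qed

lemma nn_integral_gauss_gauss:
  fixes f :: "'a::euclidean_space \<times> 'a \<Rightarrow> ennreal"
  assumes [measurable]: "f \<in> borel_measurable borel"
  shows "(\<integral>\<^sup>+x. \<integral>\<^sup>+y. f (x, y) \<partial>gauss \<partial>gauss) =
    ennreal ((1 / sqrt (2 * pi)) ^ DIM('a)) * (ennreal ((1 / sqrt (2 * pi)) ^ DIM('a)) *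
     (\<integral>\<^sup>+x. \<integral>\<^sup>+y. f (x, y) * ennreal (exp (- ((norm x)\<^sup>2 + (norm y)\<^sup>2) / 2)) \<partial>lborel \<partial>lborel))"
proof -
  define C where "C = ennreal ((1 / sqrt (2 * pi)) ^ DIM('a))"
  define E where "E x = ennreal (exp (- (norm x)\<^sup>2 / 2))" for x :: 'a
  have E_m [measurable]: "E \<in> borel_measurable borel" unfolding E_def by measurable
  have f_m [measurable]: "f \<in> borel_measurable (borel \<Otimes>\<^sub>M borel)" by (simp add: borel_prod)
  have EE: "E y * E x = ennreal (exp (- ((norm x)\<^sup>2 + (norm y)\<^sup>2) / 2))" for x y :: 'a
  proof -
    have "- ((norm x)\<^sup>2 + (norm y)\<^sup>2) / 2 = - (norm y)\<^sup>2 / 2 + - (norm x)\<^sup>2 / 2" by (simp add: field_simps)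
    then show ?thesis by (simp only: E_def exp_add ennreal_mult' exp_ge_zero)
  qed
  have "(\<integral>\<^sup>+x. \<integral>\<^sup>+y. f (x, y) \<partial>gauss \<partial>gauss) = (\<integral>\<^sup>+x. C * (\<integral>\<^sup>+y. f (x, y) * E y \<partial>lborel) \<partial>gauss)"
    by (intro nn_integral_cong) (simp add: nn_integral_gauss C_def E_def)
  also have "\<dots> = C * (\<integral>\<^sup>+x. C * (\<integral>\<^sup>+y. f (x, y) * E y \<partial>lborel) * E x \<partial>lborel)"
    by (subst nn_integral_gauss) (simp_all add: C_def E_def)
  also have "(\<integral>\<^sup>+x. C * (\<integral>\<^sup>+y. f (x, y) * E y \<partial>lborel) * E x \<partial>lborel) = C * (\<integral>\<^sup>+x. (\<integral>\<^sup>+y. f (x, y) * E y \<partial>lborel) * E x \<partial>lborel)"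
    by (simp add: nn_integral_cmult mult.assoc)
  also have "(\<integral>\<^sup>+x. (\<integral>\<^sup>+y. f (x, y) * E y \<partial>lborel) * E x \<partial>lborel) = (\<integral>\<^sup>+x. \<integral>\<^sup>+y. f (x, y) * (E y * E x) \<partial>lborel \<partial>lborel)"
    by (intro nn_integral_cong) (simp add: nn_integral_multc[symmetric] mult.assoc)
  finally show ?thesis by (simp only: C_def EE)
qed

text \<open>The joint density depends only on the squared norm of the pair, which a rotation
  preserves. The angle stays below pi because that is the range of the shear decomposition.\<close>

lemma nn_integral_gauss_rotation:
  fixes f :: "'a::euclidean_space \<times> 'a \<Rightarrow> ennreal"
  assumes [measurable]: "f \<in> borel_measurable borel" and t: "0 \<le> t" "t < pi"
  shows "(\<integral>\<^sup>+x. \<integral>\<^sup>+y. f (cos t *\<^sub>R x + sin t *\<^sub>R y, cos t *\<^sub>R y - sin t *\<^sub>R x) \<partial>gauss \<partial>gauss) =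
    (\<integral>\<^sup>+x. \<integral>\<^sup>+y. f (x, y) \<partial>gauss \<partial>gauss)"
proof (cases "t = 0")
  case False
  then have t': "0 < t" using t by simp
  define r where "r = (\<lambda>p :: 'a \<times> 'a. (cos t *\<^sub>R fst p + sin t *\<^sub>R snd p, cos t *\<^sub>R snd p - sin t *\<^sub>R fst p))"
  have "continuous_on UNIV r" unfolding r_def by (intro continuous_intros)
  then have r_m [measurable]: "r \<in> borel_measurable borel" by (rule borel_measurable_continuous_onI)
  have n: "(norm x)\<^sup>2 + (norm y)\<^sup>2 = (norm (cos t *\<^sub>R x + sin t *\<^sub>R y))\<^sup>2 + (norm (cos t *\<^sub>R y - sin t *\<^sub>R x))\<^sup>2" for x y :: 'a
  proof -
    have "(norm (c *\<^sub>R x + s *\<^sub>R y))\<^sup>2 + (norm (c *\<^sub>R y - s *\<^sub>R x))\<^sup>2 = (c\<^sup>2 + s\<^sup>2) * (x \<bullet> x) + (c\<^sup>2 + s\<^sup>2) * (y \<bullet> y)" for c s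
      unfolding power2_norm_eq_inner unfolding inner_add_left inner_add_right inner_diff_left inner_diff_right
        inner_scaleR_left inner_scaleR_right power2_eq_square by (simp add: inner_commute[of y x] algebra_simps)
    from this[of "cos t" "sin t"]
    show ?thesis by (simp add: power2_norm_eq_inner)
  qed
  let ?g = "\<lambda>(x :: 'a, y :: 'a). f (x, y) * ennreal (exp (- ((norm x)\<^sup>2 + (norm y)\<^sup>2) / 2))"
  have g_m: "?g \<in> borel_measurable borel"
    unfolding borel_prod[symmetric] by measurable
  have fr: "(\<lambda>p. f (r p)) \<in> borel_measurable borel" by measurable
  have "(\<integral>\<^sup>+x. \<integral>\<^sup>+y. f (r (x, y)) * ennreal (exp (- ((norm x)\<^sup>2 + (norm y)\<^sup>2) / 2)) \<partial>lborel \<partial>lborel) =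
      (\<integral>\<^sup>+x. \<integral>\<^sup>+y. f (x, y) * ennreal (exp (- ((norm x)\<^sup>2 + (norm y)\<^sup>2) / 2)) \<partial>lborel \<partial>lborel)"
    using nn_integral_lborel_rotation[OF g_m t' t(2)] by (simp only: case_prod_conv n[symmetric] r_def fst_conv snd_conv)
  then have "(\<integral>\<^sup>+x. \<integral>\<^sup>+y. f (r (x, y)) \<partial>gauss \<partial>gauss) = (\<integral>\<^sup>+x. \<integral>\<^sup>+y. f (x, y) \<partial>gauss \<partial>gauss)"
    by (simp only: nn_integral_gauss_gauss[OF fr] nn_integral_gauss_gauss[OF assms(1)])
  then show ?thesis by (simp only: r_def fst_conv snd_conv)
qed simp

section \<open>Concentration by a discretised rotation\<close>

lemma sum_power4_le:
  fixes a :: "nat \<Rightarrow> real"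
  shows "(\<Sum>j<m. a j) ^ 4 \<le> real m ^ 3 * (\<Sum>j<m. a j ^ 4)"
proof -
  have "((\<Sum>j<m. a j)\<^sup>2)\<^sup>2 \<le> (real m * (\<Sum>j<m. (a j)\<^sup>2))\<^sup>2"
    using sum_squared_le_sum_of_squares[of a "{..<m}"] by (intro power_mono) (auto simp: mult.commute)
  also have "\<dots> = (real m)\<^sup>2 * (\<Sum>j<m. (a j)\<^sup>2)\<^sup>2" by (simp add: power_mult_distrib)
  also have "\<dots> \<le> (real m)\<^sup>2 * (real m * (\<Sum>j<m. ((a j)\<^sup>2)\<^sup>2))"
    using sum_squared_le_sum_of_squares[of "\<lambda>j. (a j)\<^sup>2" "{..<m}"] by (intro mult_left_mono) (auto simp: mult.commute)
  finally show ?thesis by (simp add: eval_nat_numeral mult_ac)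
qed

lemma power4_sum3_le: "((a :: real) + b + c) ^ 4 \<le> 27 * (a ^ 4 + b ^ 4 + c ^ 4)"
  using sum_power4_le[of "\<lambda>i::nat. if i = 0 then a else if i = 1 then b else c" 3]
  by (simp add: eval_nat_numeral)

text \<open>Rotating the pair \<open>(x, y)\<close> through half a turn moves the first component
  from \<open>x\<close> to \<open>- x\<close>. The turn is cut into \<open>m\<close> small rotations
  instead of being differentiated, since \<open>h\<close> need not be smooth. A subgradient at the
  start of a step bounds the decrease over that step from above but not from below, so only the
  positive part of \<open>h x - h (- x)\<close> is reached. By rotation invariance all the bounds on
  the steps have the same law.\<close>

lemma gauss_convex_concentration_one_sided:
  fixes h :: "'a::euclidean_space \<Rightarrow> real"
  assumes conv: "convex_on UNIV h" and lip: "\<And>x y. \<bar>h x - h y\<bar> \<le> L * norm (x - y)" and L: "L > 0"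
  shows "(\<integral>\<^sup>+x. ennreal (max 0 (h x - h (- x)) ^ 4) \<partial>gauss) \<le> ennreal (22 * 10 ^ 6 * L ^ 4)"
proof -
  define E4 where "E4 = (\<integral>x. norm (x :: 'a) ^ 4 \<partial>gauss)"
  have E4: "E4 \<ge> 0" by (simp add: E4_def integral_nonneg)
  \<comment> \<open>So many steps that the second-order term, whose fourth moment involves that of
    the norm and hence the dimension, contributes at most 1 in the final estimate.\<close>
  obtain m :: nat where m: "real m \<ge> pi ^ 8 * E4 + 1" using real_arch_simple by blast
  have "pi ^ 8 * E4 \<ge> 0" using E4 by simp
  then have m1: "real m \<ge> 1" using m by linarith
  then have m0: "m > 0" by simp
  define \<eta> where "\<eta> = pi / real m"
  have \<eta>: "\<eta> > 0" "\<eta> * real m = pi" using m1 by (auto simp: \<eta>_def)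
  \<comment> \<open>Makes the error of the approximate subgradient \<open>L / m\<close> per step,
    that is \<open>L\<close> over the whole path.\<close>
  define l where "l = 1 / (2 * L * real m)"
  have l: "l > 0" "2 * L\<^sup>2 * l = L / real m" using L m1 by (auto simp: l_def power2_eq_square)
  obtain S where S: "continuous_on UNIV S" "\<And>x. norm (S x) \<le> 2 * L"
    "\<And>x z. h x + S x \<bullet> (z - x) - L / real m \<le> h z"
    using approximate_subgradient[OF conv lip less_imp_le[OF L] l(1)] unfolding l(2) by blast
  have S_m [measurable]: "S \<in> borel_measurable borel" using S(1) by (rule borel_measurable_continuous_onI)
  have h_cont: "continuous_on UNIV h" using lip by (intro lipschitz_imp_continuous[of UNIV h L]) auto
  have h_m [measurable]: "h \<in> borel_measurable borel" using h_cont by (rule borel_measurable_continuous_onI)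
  define \<alpha> where "\<alpha> x y = (1 - cos \<eta>) * (S x \<bullet> x) - sin \<eta> * (S x \<bullet> y) + L / real m" for x y
  define G where "G j x y = cos (real j * \<eta>) *\<^sub>R x + sin (real j * \<eta>) *\<^sub>R y" for j :: nat and x y :: 'a
  define G' where "G' j x y = cos (real j * \<eta>) *\<^sub>R y - sin (real j * \<eta>) *\<^sub>R x" for j :: nat and x y :: 'a
  have step: "h (G j x y) - h (G (Suc j) x y) \<le> \<alpha> (G j x y) (G' j x y)" for j x y
  proof -
    have "G (Suc j) x y = cos \<eta> *\<^sub>R G j x y + sin \<eta> *\<^sub>R G' j x y"
      by (simp add: G_def G'_def algebra_simps cos_add sin_add)
    then have "S (G j x y) \<bullet> (G (Suc j) x y - G j x y) =
        - (1 - cos \<eta>) * (S (G j x y) \<bullet> G j x y) + sin \<eta> * (S (G j x y) \<bullet> G' j x y)"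
      by (simp add: inner_add_right inner_diff_right algebra_simps)
    then show ?thesis using S(3)[of "G j x y" "G (Suc j) x y"] by (simp add: \<alpha>_def algebra_simps)
  qed
  have G0: "G 0 x y = x" for x y by (simp add: G_def)
  have Gm: "G m x y = - x" for x y using \<eta> by (simp add: G_def mult.commute)
  have tel: "h x - h (- x) \<le> (\<Sum>j<m. \<alpha> (G j x y) (G' j x y))" for x y
  proof -
    have "h x - h (- x) = (\<Sum>j<m. h (G j x y) - h (G (Suc j) x y))"
      using sum_lessThan_telescope'[of "\<lambda>j. h (G j x y)" m] by (simp add: G0 Gm)
    also have "\<dots> \<le> (\<Sum>j<m. \<alpha> (G j x y) (G' j x y))" by (intro sum_mono step)
    finally show ?thesis .
  qed
  have pw: "max 0 (h x - h (- x)) ^ 4 \<le> real m ^ 3 * (\<Sum>j<m. \<alpha> (G j x y) (G' j x y) ^ 4)" for x y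
  proof -
    have "max 0 (h x - h (- x)) ^ 4 \<le> \<bar>\<Sum>j<m. \<alpha> (G j x y) (G' j x y)\<bar> ^ 4"
      using tel[of x y] by (intro power_mono) auto
    also have "\<dots> = (\<Sum>j<m. \<alpha> (G j x y) (G' j x y)) ^ 4" by (simp add: power_even_abs)
    also have "\<dots> \<le> real m ^ 3 * (\<Sum>j<m. \<alpha> (G j x y) (G' j x y) ^ 4)" by (rule sum_power4_le)
    finally show ?thesis .
  qed
  have \<alpha>_m [measurable]: "(\<lambda>(x, y). ennreal (\<alpha> x y ^ 4)) \<in> borel_measurable (borel \<Otimes>\<^sub>M borel)"
    unfolding \<alpha>_def by measurable
  have inv: "(\<integral>\<^sup>+x. \<integral>\<^sup>+y. ennreal (\<alpha> (G j x y) (G' j x y) ^ 4) \<partial>gauss \<partial>gauss) =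
      (\<integral>\<^sup>+x. \<integral>\<^sup>+y. ennreal (\<alpha> x y ^ 4) \<partial>gauss \<partial>gauss)" if "j < m" for j
  proof -
    have "real j * \<eta> < real m * \<eta>" using that \<eta> by simp
    then have "real j * \<eta> < pi" using \<eta> by (simp add: mult.commute)
    then show ?thesis
      using nn_integral_gauss_rotation[of "\<lambda>(x, y). ennreal (\<alpha> x y ^ 4)" "real j * \<eta>"] \<eta> \<alpha>_m
      by (simp add: G_def G'_def borel_prod)
  qed
  \<comment> \<open>The dominant term is the one with \<open>sin \<eta>\<close>: for fixed
    \<open>x\<close> the inner product \<open>S x \<bullet> y\<close> is Gaussian with variance at
    most \<open>4 * L^2\<close> in any dimension. The fourth moment is of order
    \<open>1 / m^4\<close>, and the factor \<open>m^3\<close> of the power mean together with the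
    \<open>m\<close> summands compensates this exactly.\<close>
  have \<alpha>4: "(\<integral>\<^sup>+x. \<integral>\<^sup>+y. ennreal (\<alpha> x y ^ 4) \<partial>gauss \<partial>gauss) \<le> ennreal (22 * 10 ^ 6 * L ^ 4 / real m ^ 4)"
  proof -
    have in1: "(\<integral>\<^sup>+y. ennreal (\<alpha> x y ^ 4) \<partial>gauss) \<le>
        ennreal (27 * (\<eta> ^ 8 * L ^ 4 * norm x ^ 4 + \<eta> ^ 4 * (88 * L\<^sup>2)\<^sup>2 + (L / real m) ^ 4))" for x
    proof -
      have int: "integrable gauss (\<lambda>y. (S x \<bullet> y) ^ 4)" using gauss_inner_moment(1)[of 2 "S x"] by simp
      have mom: "(\<integral>y. (S x \<bullet> y) ^ 4 \<partial>gauss) \<le> (88 * L\<^sup>2)\<^sup>2"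
      proof -
        have "(\<integral>y. (S x \<bullet> y) ^ 4 \<partial>gauss) \<le> (11 * 2 * (norm (S x))\<^sup>2)\<^sup>2"
          using gauss_inner_moment(2)[of 2 "S x"] by simp
        also have "\<dots> \<le> (11 * 2 * (2 * L)\<^sup>2)\<^sup>2"
          using S(2)[of x] by (intro power_mono mult_left_mono) auto
        finally show ?thesis by (simp add: power_mult_distrib)
      qed
      have p4: "\<alpha> x y ^ 4 \<le> 27 * (\<eta> ^ 8 * L ^ 4 * norm x ^ 4 + \<eta> ^ 4 * (S x \<bullet> y) ^ 4 + (L / real m) ^ 4)" for y
      proof -
        have "\<alpha> x y ^ 4 \<le> 27 * (((1 - cos \<eta>) * (S x \<bullet> x)) ^ 4 + (- sin \<eta> * (S x \<bullet> y)) ^ 4 + (L / real m) ^ 4)"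
          using power4_sum3_le[of "(1 - cos \<eta>) * (S x \<bullet> x)" "- sin \<eta> * (S x \<bullet> y)" "L / real m"] by (simp add: \<alpha>_def)
        also have "((1 - cos \<eta>) * (S x \<bullet> x)) ^ 4 \<le> (\<eta>\<^sup>2 * L * norm x) ^ 4"
        proof -
          have "\<bar>(1 - cos \<eta>) * (S x \<bullet> x)\<bar> \<le> (\<eta>\<^sup>2 / 2) * ((2 * L) * norm x)"
            unfolding abs_mult
          proof (intro mult_mono)
            show "\<bar>1 - cos \<eta>\<bar> \<le> \<eta>\<^sup>2 / 2"
            proof -
              have "1 - cos \<eta> = 2 * (sin (\<eta> / 2))\<^sup>2" using cos_double_sin[of "\<eta> / 2"] by simp
              moreover have "(sin (\<eta> / 2))\<^sup>2 \<le> (\<eta> / 2)\<^sup>2"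
                using abs_sin_x_le_abs_x[of "\<eta> / 2"] by (simp only: abs_le_square_iff)
              ultimately show ?thesis by (simp add: power_divide)
            qed
            show "\<bar>S x \<bullet> x\<bar> \<le> 2 * L * norm x"
              using Cauchy_Schwarz_ineq2[of "S x" x] mult_right_mono[OF S(2)[of x], of "norm x"] by simp
          qed auto
          then have "\<bar>(1 - cos \<eta>) * (S x \<bullet> x)\<bar> ^ 4 \<le> (\<eta>\<^sup>2 * L * norm x) ^ 4"
            by (intro power_mono) auto
          then show ?thesis by (simp add: power_even_abs)
        qed
        also have "(- sin \<eta> * (S x \<bullet> y)) ^ 4 \<le> \<eta> ^ 4 * (S x \<bullet> y) ^ 4"
        proof -
          have "\<bar>sin \<eta>\<bar> ^ 4 \<le> \<bar>\<eta>\<bar> ^ 4" by (intro power_mono abs_sin_x_le_abs_x) auto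
          then have "sin \<eta> ^ 4 \<le> \<eta> ^ 4" by (simp add: power_even_abs)
          then show ?thesis by (simp add: power_mult_distrib mult_right_mono)
        qed
        finally show ?thesis by (simp add: power_mult_distrib flip: power_mult)
      qed
      have "(\<integral>\<^sup>+y. ennreal (\<alpha> x y ^ 4) \<partial>gauss) \<le>
          (\<integral>\<^sup>+y. ennreal (27 * (\<eta> ^ 8 * L ^ 4 * norm x ^ 4 + \<eta> ^ 4 * (S x \<bullet> y) ^ 4 + (L / real m) ^ 4)) \<partial>gauss)"
        by (intro nn_integral_mono ennreal_leI p4)
      also have "\<dots> = ennreal (\<integral>y. 27 * (\<eta> ^ 8 * L ^ 4 * norm x ^ 4 + \<eta> ^ 4 * (S x \<bullet> y) ^ 4 + (L / real m) ^ 4) \<partial>gauss)"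
        using int L m1 by (intro nn_integral_eq_integral) (auto intro!: AE_I2 add_nonneg_nonneg)
      also have "(\<integral>y. 27 * (\<eta> ^ 8 * L ^ 4 * norm x ^ 4 + \<eta> ^ 4 * (S x \<bullet> y) ^ 4 + (L / real m) ^ 4) \<partial>gauss) =
          27 * (\<eta> ^ 8 * L ^ 4 * norm x ^ 4 + \<eta> ^ 4 * (\<integral>y. (S x \<bullet> y) ^ 4 \<partial>gauss) + (L / real m) ^ 4)"
        using int by (simp add: gauss.prob_space)
      also have "ennreal \<dots> \<le> ennreal (27 * (\<eta> ^ 8 * L ^ 4 * norm x ^ 4 + \<eta> ^ 4 * (88 * L\<^sup>2)\<^sup>2 + (L / real m) ^ 4))"
        using mom by (intro ennreal_leI mult_left_mono add_mono) auto
      finally show ?thesis .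
    qed
    have int4: "integrable gauss (\<lambda>x :: 'a. norm x ^ 4)" using integrable_gauss_norm_power[of 2] by simp
    have "(\<integral>\<^sup>+x. \<integral>\<^sup>+y. ennreal (\<alpha> x y ^ 4) \<partial>gauss \<partial>gauss) \<le>
        (\<integral>\<^sup>+x. ennreal (27 * (\<eta> ^ 8 * L ^ 4 * norm (x :: 'a) ^ 4 + \<eta> ^ 4 * (88 * L\<^sup>2)\<^sup>2 + (L / real m) ^ 4)) \<partial>gauss)"
      by (intro nn_integral_mono in1)
    also have "\<dots> = ennreal (\<integral>x. 27 * (\<eta> ^ 8 * L ^ 4 * norm (x :: 'a) ^ 4 + \<eta> ^ 4 * (88 * L\<^sup>2)\<^sup>2 + (L / real m) ^ 4) \<partial>gauss)"
      using int4 L by (intro nn_integral_eq_integral) (auto intro!: AE_I2 add_nonneg_nonneg)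
    also have "(\<integral>x. 27 * (\<eta> ^ 8 * L ^ 4 * norm (x :: 'a) ^ 4 + \<eta> ^ 4 * (88 * L\<^sup>2)\<^sup>2 + (L / real m) ^ 4) \<partial>gauss)
       = 27 * (\<eta> ^ 8 * L ^ 4 * E4 + \<eta> ^ 4 * (88 * L\<^sup>2)\<^sup>2 + (L / real m) ^ 4)"
      using int4 by (simp add: gauss.prob_space E4_def)
    also have "\<dots> = L ^ 4 / real m ^ 4 * (27 * (pi ^ 8 * E4 / real m ^ 4 + 7744 * pi ^ 4 + 1))"
      using m1 by (simp add: \<eta>_def field_simps power_divide power_mult_distrib flip: power_add power_mult)
    also have "\<dots> \<le> L ^ 4 / real m ^ 4 * (27 * (1 + 7744 * 100 + 1))"
    proof (intro mult_left_mono add_mono)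
      have "pi ^ 8 * E4 \<le> real m ^ 1" using m by simp
      also have "\<dots> \<le> real m ^ 4" using m1 by (intro power_increasing) auto
      finally show "pi ^ 8 * E4 / real m ^ 4 \<le> 1" using m1 by simp
      have "pi \<le> 3.15" using pi_approx by simp
      then have "pi ^ 4 \<le> 3.15 ^ 4" by (intro power_mono) auto
      then show "pi ^ 4 \<le> 100" by (simp add: power_divide)
    qed auto
    also have "\<dots> \<le> L ^ 4 / real m ^ 4 * (22 * 10 ^ 6)" by (intro mult_left_mono) auto
    finally show ?thesis by (simp add: ennreal_leI mult_ac)
  qed
  have "(\<integral>\<^sup>+x. ennreal (max 0 (h x - h (- x)) ^ 4) \<partial>gauss) =
      (\<integral>\<^sup>+x. \<integral>\<^sup>+(y :: 'a). ennreal (max 0 (h x - h (- x)) ^ 4) \<partial>gauss \<partial>gauss)"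
    using gauss.emeasure_space_1[where ?'a='a] by simp
  also have "\<dots> \<le> (\<integral>\<^sup>+x. \<integral>\<^sup>+y. (\<Sum>j<m. ennreal (real m ^ 3) * ennreal (\<alpha> (G j x y) (G' j x y) ^ 4)) \<partial>gauss \<partial>gauss)"
  proof (intro nn_integral_mono)
    fix x y :: 'a
    show "ennreal (max 0 (h x - h (- x)) ^ 4) \<le> (\<Sum>j<m. ennreal (real m ^ 3) * ennreal (\<alpha> (G j x y) (G' j x y) ^ 4))"
      using ennreal_leI[OF pw[of x y]] by (simp add: sum_distrib_left ennreal_mult'[symmetric] sum_nonneg)
  qed
  also have "\<dots> = (\<Sum>j<m. ennreal (real m ^ 3) * (\<integral>\<^sup>+x. \<integral>\<^sup>+y. ennreal (\<alpha> (G j x y) (G' j x y) ^ 4) \<partial>gauss \<partial>gauss))"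
  proof -
    have s1: "(\<lambda>y. ennreal (\<alpha> (G j x y) (G' j x y) ^ 4)) \<in> borel_measurable gauss" for j x
      unfolding \<alpha>_def G_def G'_def by measurable
    have s2: "(\<lambda>x. \<integral>\<^sup>+y. ennreal (\<alpha> (G j x y) (G' j x y) ^ 4) \<partial>gauss) \<in> borel_measurable gauss" for j
      unfolding \<alpha>_def G_def G'_def by measurable
    show ?thesis using s1 s2 by (simp add: nn_integral_sum nn_integral_cmult)
  qed
  also have "\<dots> = (\<Sum>j<m. ennreal (real m ^ 3) * (\<integral>\<^sup>+x. \<integral>\<^sup>+y. ennreal (\<alpha> x y ^ 4) \<partial>gauss \<partial>gauss))"
    by (simp add: inv)
  also have "\<dots> \<le> (\<Sum>j<m. ennreal (real m ^ 3) * ennreal (22 * 10 ^ 6 * L ^ 4 / real m ^ 4))"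
    by (intro sum_mono mult_left_mono \<alpha>4) auto
  also have "\<dots> = ennreal (22 * 10 ^ 6 * L ^ 4)"
    using m0 L by (simp add: ennreal_of_nat_eq_real_of_nat ennreal_mult'[symmetric] field_simps eval_nat_numeral)
  finally show ?thesis .
qed

text \<open>The positive and the negative part of the difference are covered by the one-sided bound
  for \<open>h\<close> and for its reflection.\<close>

lemma gauss_convex_concentration:
  fixes h :: "'a::euclidean_space \<Rightarrow> real"
  assumes conv: "convex_on UNIV h" and lip: "\<And>x y. \<bar>h x - h y\<bar> \<le> L * norm (x - y)" and L: "L > 0"
  shows "(\<integral>\<^sup>+x. ennreal ((h x - h (- x)) ^ 4) \<partial>gauss) \<le> ennreal (44 * 10 ^ 6 * L ^ 4)"
proof -
  have h_m [measurable]: "h \<in> borel_measurable borel"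
    using lip by (intro borel_measurable_continuous_onI lipschitz_imp_continuous[of UNIV h L]) auto
  have conv': "convex_on UNIV (\<lambda>x. h (- x))"
    using convex_on_affine_compose[OF conv, of 0 "-1"] by simp
  have lip': "\<bar>h (- x) - h (- y)\<bar> \<le> L * norm (x - y)" for x y
    using lip[of "- x" "- y"] by (simp add: norm_minus_commute)
  have "(\<integral>\<^sup>+x. ennreal ((h x - h (- x)) ^ 4) \<partial>gauss) =
      (\<integral>\<^sup>+x. ennreal (max 0 (h x - h (- x)) ^ 4) + ennreal (max 0 (h (- x) - h (- (- x))) ^ 4) \<partial>gauss)"
  proof (intro nn_integral_cong)
    fix x :: 'a
    have "u ^ 4 = max 0 u ^ 4 + max 0 (- u) ^ 4" for u :: real
      by (cases "u \<ge> 0") auto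
    from this[of "h x - h (- x)"]
    show "ennreal ((h x - h (- x)) ^ 4) = ennreal (max 0 (h x - h (- x)) ^ 4) + ennreal (max 0 (h (- x) - h (- (- x))) ^ 4)"
      by (simp flip: ennreal_plus)
  qed
  also have "\<dots> = (\<integral>\<^sup>+x. ennreal (max 0 (h x - h (- x)) ^ 4) \<partial>gauss) + (\<integral>\<^sup>+x. ennreal (max 0 (h (- x) - h (- (- x))) ^ 4) \<partial>gauss)"
    by (rule nn_integral_add) measurable
  also have "\<dots> \<le> ennreal (22 * 10 ^ 6 * L ^ 4) + ennreal (22 * 10 ^ 6 * L ^ 4)"
    by (intro add_mono gauss_convex_concentration_one_sided[OF conv lip L]
        gauss_convex_concentration_one_sided[OF conv' lip' L])
  also have "\<dots> = ennreal (44 * 10 ^ 6 * L ^ 4)" using L by (simp flip: ennreal_plus)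
  finally show ?thesis .
qed

text \<open>For a Gaussian \<open>x\<close> the direction \<open>sgn x\<close> is compared with
  \<open>x / sqrt d\<close>, to which the Gaussian bound applies. The error comes from the deviation
  of the norm from \<open>sqrt d\<close>, and its fourth moment has the same order
  \<open>L^4 / d^2\<close> as the main term.\<close>

lemma uniform_sphere_convex_concentration:
  fixes h :: "real ^ 'n \<Rightarrow> real"
  assumes conv: "convex_on UNIV h" and lip: "\<And>x y. \<bar>h x - h y\<bar> \<le> L * norm (x - y)" and L: "L \<ge> 0"
  shows "(\<integral>e. (h e - h (- e)) ^ 4 \<partial>uniform_sphere) \<le> (150 * L) ^ 4 / (real CARD('n))\<^sup>2"
proof (cases "L = 0")
  case True
  then have "h x = h y" for x y using lip[of x y] by simp
  then have "h e - h (- e) = 0" for e by simp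
  then show ?thesis by simp
next
  case False
  then have L: "L > 0" using L by simp
  define d where "d = real CARD('n)"
  define b where "b = 1 / sqrt d"
  have d: "d \<ge> 1" by (simp add: d_def Suc_leI)
  have b: "b > 0" "b\<^sup>2 = 1 / d" using d by (auto simp: b_def power_divide)
  have h_cont: "continuous_on UNIV h" using lip by (intro lipschitz_imp_continuous[of UNIV h L]) auto
  have h_m [measurable]: "h \<in> borel_measurable borel" using h_cont by (rule borel_measurable_continuous_onI)
  define H where "H x = h (b *\<^sub>R x)" for x
  have H_conv: "convex_on UNIV H"
    using convex_on_affine_compose[OF conv, of 0 b] by (simp add: H_def[abs_def])
  have H_lip: "\<bar>H x - H y\<bar> \<le> (L * b) * norm (x - y)" for x y
    using lip[of "b *\<^sub>R x" "b *\<^sub>R y"] b by (simp add: H_def flip: scaleR_diff_right)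
  let ?k = "\<lambda>e. (h e - h (- e)) ^ 4"
  have k_int: "integrable uniform_sphere ?k"
    by (intro integrable_uniform_sphere_continuous continuous_intros h_cont
        continuous_on_compose2[OF h_cont]) auto
  have nn: "(\<integral>\<^sup>+e. ennreal (?k e) \<partial>uniform_sphere) = ennreal (\<integral>e. ?k e \<partial>uniform_sphere)"
    by (rule nn_integral_eq_integral[OF k_int]) simp
  have pw: "?k (sgn x) \<le> 8 * (H x - H (- x)) ^ 4 + 128 * L ^ 4 * b ^ 8 * ((norm x)\<^sup>2 - d) ^ 4" for x :: "real ^ 'n"
  proof (cases "x = 0")
    case False
    have "\<bar>(h (sgn x) - h (- sgn x)) - (H x - H (- x))\<bar> \<le> \<bar>h (sgn x) - h (b *\<^sub>R x)\<bar> + \<bar>h (- sgn x) - h (- (b *\<^sub>R x))\<bar>"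
      by (simp add: H_def)
    also have "\<dots> \<le> L * norm (sgn x - b *\<^sub>R x) + L * norm (sgn x - b *\<^sub>R x)"
      using lip[of "sgn x" "b *\<^sub>R x"] lip[of "- sgn x" "- (b *\<^sub>R x)"] by (simp add: norm_minus_commute)
    also have "norm (sgn x - b *\<^sub>R x) = \<bar>1 - b * norm x\<bar>"
    proof -
      have "sgn x - b *\<^sub>R x = (1 - b * norm x) *\<^sub>R sgn x" using False by (simp add: sgn_div_norm algebra_simps)
      then show ?thesis using False by (simp add: norm_sgn)
    qed
    \<comment> \<open>Passing to the square of the norm costs nothing, since
      \<open>1 + u \<ge> 1\<close>, and it is the squared norm whose fluctuation has been
      bounded.\<close>
    also have "\<bar>1 - b * norm x\<bar> \<le> \<bar>1 - (b * norm x)\<^sup>2\<bar>"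
    proof -
      define u where "u = b * norm x"
      have u: "u \<ge> 0" using b by (simp add: u_def)
      have "\<bar>1 - u\<bar> * 1 \<le> \<bar>1 - u\<bar> * \<bar>1 + u\<bar>" using u by (intro mult_left_mono) auto
      also have "\<dots> = \<bar>1 - u\<^sup>2\<bar>" by (simp add: abs_mult[symmetric] algebra_simps power2_eq_square)
      finally show ?thesis by (simp add: u_def)
    qed
    also have "1 - (b * norm x)\<^sup>2 = b\<^sup>2 * (d - (norm x)\<^sup>2)" using b d by (simp add: power_mult_distrib algebra_simps)
    finally have le: "\<bar>(h (sgn x) - h (- sgn x)) - (H x - H (- x))\<bar> \<le> 2 * L * b\<^sup>2 * \<bar>d - (norm x)\<^sup>2\<bar>"
      using L by (simp add: abs_mult mult_ac)
    define u where "u = H x - H (- x)"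
    define v where "v = (h (sgn x) - h (- sgn x)) - (H x - H (- x))"
    have "?k (sgn x) = (u + v) ^ 4" by (simp add: u_def v_def)
    also have "\<dots> \<le> 8 * (u ^ 4 + v ^ 4)"
      using sum_power4_le[of "\<lambda>i::nat. if i = 0 then u else v" 2] by (simp add: eval_nat_numeral)
    also have "v ^ 4 \<le> (2 * L * b\<^sup>2 * \<bar>d - (norm x)\<^sup>2\<bar>) ^ 4"
      using power_mono[OF le, of 4] by (simp add: v_def power_even_abs)
    also have "\<dots> = 16 * L ^ 4 * b ^ 8 * ((norm x)\<^sup>2 - d) ^ 4"
    proof -
      have "(d - (norm x)\<^sup>2) ^ 4 = ((norm x)\<^sup>2 - d) ^ 4"
        using power_even_abs[of 4 "d - (norm x)\<^sup>2"] power_even_abs[of 4 "(norm x)\<^sup>2 - d"] by (simp add: abs_minus_commute)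
      then show ?thesis by (simp add: power_mult_distrib power_even_abs flip: power_mult)
    qed
    finally show ?thesis by (simp add: u_def)
  qed (use L b in \<open>simp add: H_def\<close>)
  have dev_int: "integrable gauss (\<lambda>x :: real ^ 'n. ((norm x)\<^sup>2 - d) ^ 4)"
    and dev: "(\<integral>x. ((norm (x :: real ^ 'n))\<^sup>2 - d) ^ 4 \<partial>gauss) \<le> 20000 * d\<^sup>2"
    using gauss_norm_square_deviation[where ?'a="real ^ 'n"] by (simp_all add: d_def)
  have "ennreal (\<integral>e. ?k e \<partial>uniform_sphere) = (\<integral>\<^sup>+x. ennreal (?k (sgn x)) \<partial>gauss)"
    unfolding nn[symmetric] by (rule nn_integral_uniform_sphere_gauss) (auto simp: nn)
  also have "\<dots> \<le> (\<integral>\<^sup>+x. ennreal 8 * ennreal ((H x - H (- x)) ^ 4) + ennreal (128 * L ^ 4 * b ^ 8) * ennreal (((norm x)\<^sup>2 - d) ^ 4) \<partial>(gauss :: (real ^ 'n) measure))"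
  proof (intro nn_integral_mono)
    fix x :: "real ^ 'n"
    show "ennreal (?k (sgn x)) \<le> ennreal 8 * ennreal ((H x - H (- x)) ^ 4) + ennreal (128 * L ^ 4 * b ^ 8) * ennreal (((norm x)\<^sup>2 - d) ^ 4)"
      using ennreal_leI[OF pw[of x]] L b
      by (simp add: ennreal_mult'[symmetric] ennreal_plus[symmetric] del: ennreal_plus ennreal_numeral)
  qed
  also have "\<dots> = ennreal 8 * (\<integral>\<^sup>+x. ennreal ((H x - H (- x)) ^ 4) \<partial>gauss) + ennreal (128 * L ^ 4 * b ^ 8) * (\<integral>\<^sup>+x. ennreal (((norm (x :: real ^ 'n))\<^sup>2 - d) ^ 4) \<partial>gauss)"
    unfolding H_def by (subst nn_integral_add) (auto simp: nn_integral_cmult)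
  also have "\<dots> \<le> ennreal 8 * ennreal (44 * 10 ^ 6 * (L * b) ^ 4) + ennreal (128 * L ^ 4 * b ^ 8) * ennreal (20000 * d\<^sup>2)"
  proof (intro add_mono mult_left_mono)
    show "(\<integral>\<^sup>+x. ennreal ((H x - H (- x)) ^ 4) \<partial>gauss) \<le> ennreal (44 * 10 ^ 6 * (L * b) ^ 4)"
      using L b by (intro gauss_convex_concentration[OF H_conv H_lip]) auto
    show "(\<integral>\<^sup>+x. ennreal (((norm (x :: real ^ 'n))\<^sup>2 - d) ^ 4) \<partial>gauss) \<le> ennreal (20000 * d\<^sup>2)"
      using dev by (subst nn_integral_eq_integral[OF dev_int]) (auto intro: ennreal_leI)
  qed auto
  also have "\<dots> = ennreal (8 * (44 * 10 ^ 6 * (L * b) ^ 4) + (128 * L ^ 4 * b ^ 8) * (20000 * d\<^sup>2))"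
    using L b by (simp add: ennreal_mult'[symmetric] ennreal_plus[symmetric] del: ennreal_plus ennreal_numeral)
  also have "8 * (44 * 10 ^ 6 * (L * b) ^ 4) + (128 * L ^ 4 * b ^ 8) * (20000 * d\<^sup>2) = 354560000 * L ^ 4 / d\<^sup>2"
  proof -
    have b4: "b ^ 4 = 1 / d\<^sup>2" using b(2) power_mult[of b 2 2] by (simp add: power_divide)
    have b8: "b ^ 8 = 1 / d\<^sup>2 * (1 / d\<^sup>2)" using b4 power_add[of b 4 4] by simp
    show ?thesis unfolding power_mult_distrib b4 b8 using d by (simp add: field_simps)
  qed
  finally have "(\<integral>e. ?k e \<partial>uniform_sphere) \<le> 354560000 * L ^ 4 / d\<^sup>2"
    using L d by (subst (asm) ennreal_le_iff) auto
  also have "\<dots> \<le> (150 * L) ^ 4 / d\<^sup>2"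
    using L by (intro divide_right_mono) (auto simp: power_mult_distrib)
  finally show ?thesis by (simp add: d_def)
qed

section \<open>The gradient of the smoothed function\<close>

lemma integral_sgn_cball:
  fixes K :: "real ^ 'n \<Rightarrow> real"
  assumes [measurable]: "K \<in> borel_measurable borel" and B: "\<And>x. \<bar>K x\<bar> \<le> B" and r: "r > 0"
  shows "integrable lborel (\<lambda>x. K (sgn x) * indicator (cball 0 r) x)"
    and "(\<integral>x. K (sgn x) * indicator (cball 0 r) x \<partial>lborel) =
      (\<integral>e. K e \<partial>uniform_sphere) * measure lborel (cball (0 :: real ^ 'n) r)"
proof -
  have ind: "integrable lborel (indicator (cball (0 :: real ^ 'n) r) :: _ \<Rightarrow> real)"
    using emeasure_lborel_cball_finite[of "0 :: real ^ 'n" r] by (simp add: integrable_indicator_iff)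
  have int: "integrable lborel (\<lambda>x. J (sgn x) * indicator (cball 0 r) x)"
    if [measurable]: "J \<in> borel_measurable borel" and C: "\<And>x. \<bar>J x\<bar> \<le> C" for J :: "real ^ 'n \<Rightarrow> real" and C
    by (rule Bochner_Integration.integrable_bound[OF integrable_mult_right[OF ind, of C]])
       (use C in \<open>auto simp: indicator_def intro: order_trans[OF C abs_ge_self]\<close>)
  have U: "integrable uniform_sphere J"
    if [measurable]: "J \<in> borel_measurable borel" and C: "\<And>x. \<bar>J x\<bar> \<le> C" for J :: "real ^ 'n \<Rightarrow> real" and C
    by (rule uniform_sphere.integrable_const_bound[of _ C]) (use C in \<open>auto intro!: borel_measurable_uniform_sphere\<close>)
  have pos: "(\<integral>x. J (sgn x) * indicator (cball 0 r) x \<partial>lborel) =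
      (\<integral>e. J e \<partial>uniform_sphere) * measure lborel (cball (0 :: real ^ 'n) r)"
    if m [measurable]: "J \<in> borel_measurable borel" and C: "\<And>x. \<bar>J x\<bar> \<le> C" and nn: "\<And>x. J x \<ge> 0"
    for J :: "real ^ 'n \<Rightarrow> real" and C
  proof -
    have "ennreal (\<integral>x. J (sgn x) * indicator (cball 0 r) x \<partial>lborel) =
        (\<integral>\<^sup>+x. ennreal (J (sgn x) * indicator (cball 0 r) x) \<partial>lborel)"
      by (rule nn_integral_eq_integral[symmetric, OF int[OF m C]]) (simp add: nn)
    also have "\<dots> = (\<integral>\<^sup>+x. ennreal (J (sgn x)) * indicator (cball 0 r) x \<partial>lborel)"
      by (intro nn_integral_cong) (simp add: indicator_def)
    also have "\<dots> = (\<integral>\<^sup>+e. ennreal (J e) \<partial>uniform_sphere) * emeasure lborel (cball (0 :: real ^ 'n) r)"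
      by (rule nn_integral_sgn_cball[OF _ r]) simp
    also have "(\<integral>\<^sup>+e. ennreal (J e) \<partial>uniform_sphere) = ennreal (\<integral>e. J e \<partial>uniform_sphere)"
      by (rule nn_integral_eq_integral[OF U[OF m C]]) (simp add: nn)
    also have "emeasure lborel (cball (0 :: real ^ 'n) r) = ennreal (measure lborel (cball (0 :: real ^ 'n) r))"
      using emeasure_lborel_cball_finite[of "0 :: real ^ 'n" r] by (simp add: emeasure_eq_ennreal_measure less_top)
    finally have e: "ennreal (\<integral>x. J (sgn x) * indicator (cball 0 r) x \<partial>lborel) =
        ennreal ((\<integral>e. J e \<partial>uniform_sphere) * measure lborel (cball (0 :: real ^ 'n) r))"
      by (simp only: ennreal_mult''[OF measure_nonneg])
    have i1: "0 \<le> (\<integral>x. J (sgn x) * indicator (cball 0 r) x \<partial>lborel)"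
      by (rule Bochner_Integration.integral_nonneg) (simp add: nn)
    have i2: "0 \<le> (\<integral>e. J e \<partial>uniform_sphere)"
      by (rule Bochner_Integration.integral_nonneg) (rule nn)
    show ?thesis using e by (simp only: ennreal_inj[OF i1 mult_nonneg_nonneg[OF i2 measure_nonneg]])
  qed
  show "integrable lborel (\<lambda>x. K (sgn x) * indicator (cball 0 r) x)" by (rule int[OF _ B]) simp
  have B0: "B \<ge> 0" using B[of 0] by simp
  \<comment> \<open>Adding \<open>B\<close> makes the integrand nonnegative, so that the nonnegative
    case applies; the constant is subtracted afterwards.\<close>
  have "(\<integral>x. (K (sgn x) + B) * indicator (cball 0 r) x \<partial>lborel) =
      (\<integral>e. K e + B \<partial>uniform_sphere) * measure lborel (cball (0 :: real ^ 'n) r)"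
  proof (rule pos[of _ "2 * B"])
    show "\<bar>K x + B\<bar> \<le> 2 * B" "0 \<le> K x + B" for x using B[of x] by auto
  qed simp
  also have "(\<integral>e. K e + B \<partial>uniform_sphere) = (\<integral>e. K e \<partial>uniform_sphere) + B"
    using U[OF assms(1) B] uniform_sphere.prob_space[where ?'n='n]
    by (subst Bochner_Integration.integral_add) simp_all
  also have "(\<integral>x. (K (sgn x) + B) * indicator (cball 0 r) x \<partial>lborel) =
      (\<integral>x. K (sgn x) * indicator (cball 0 r) x \<partial>lborel) + B * measure lborel (cball (0 :: real ^ 'n) r)"
    using int[OF assms(1) B] ind by (simp add: distrib_right)
  finally show "(\<integral>x. K (sgn x) * indicator (cball 0 r) x \<partial>lborel) =
      (\<integral>e. K e \<partial>uniform_sphere) * measure lborel (cball (0 :: real ^ 'n) r)"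
    by (simp add: distrib_right)
qed

lemma AE_lborel_norm_neq: "AE b in lborel. norm (b :: 'a::euclidean_space) \<noteq> r"
proof -
  have "sphere (0 :: 'a) r \<in> null_sets lborel"
    using negligible_sphere[of "0 :: 'a" r] by (simp add: negligible_iff_null_sets null_sets_completion_iff)
  then show ?thesis
    by (rule AE_I') auto
qed

text \<open>A radial ramp from 1 on the unit ball to 0 outside radius \<open>1 + \<eta>\<close>.
  Being Lipschitz, it has uniformly bounded difference quotients, which the indicator of the ball
  does not.\<close>

definition cutoff :: "real \<Rightarrow> real \<Rightarrow> real" where
  "cutoff \<eta> \<rho> = max 0 (min 1 ((1 + \<eta> - \<rho>) / \<eta>))"

lemma cutoff_bounds: "0 \<le> cutoff \<eta> \<rho>" "cutoff \<eta> \<rho> \<le> 1"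
  by (auto simp: cutoff_def)

lemma cutoff_lipschitz: "\<eta> > 0 \<Longrightarrow> \<bar>cutoff \<eta> \<rho> - cutoff \<eta> \<rho>'\<bar> \<le> \<bar>\<rho> - \<rho>'\<bar> / \<eta>"
proof -
  assume "\<eta> > 0"
  have clip: "\<bar>max 0 (min 1 a) - max 0 (min 1 b)\<bar> \<le> \<bar>a - b\<bar>" for a b :: real by (auto simp: max_def min_def)
  have "\<bar>cutoff \<eta> \<rho> - cutoff \<eta> \<rho>'\<bar> \<le> \<bar>(1 + \<eta> - \<rho>) / \<eta> - (1 + \<eta> - \<rho>') / \<eta>\<bar>"
    unfolding cutoff_def by (rule clip)
  also have "\<dots> = \<bar>\<rho> - \<rho>'\<bar> / \<eta>" using \<open>\<eta> > 0\<close> by (simp add: diff_divide_distrib[symmetric] abs_divide abs_minus_commute)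
  finally show ?thesis .
qed

lemma cutoff_inner: "\<eta> > 0 \<Longrightarrow> \<rho> \<le> 1 \<Longrightarrow> cutoff \<eta> \<rho> = 1"
  and cutoff_outer: "\<eta> > 0 \<Longrightarrow> \<rho> \<ge> 1 + \<eta> \<Longrightarrow> cutoff \<eta> \<rho> = 0"
  and cutoff_shell: "\<eta> > 0 \<Longrightarrow> 1 \<le> \<rho> \<Longrightarrow> \<rho> \<le> 1 + \<eta> \<Longrightarrow> cutoff \<eta> \<rho> = (1 + \<eta> - \<rho>) / \<eta>"
  by (auto simp: cutoff_def field_simps max_def min_def)

lemma norm_quotient_tendsto:
  fixes b w :: "'a::real_inner"
  assumes "b \<noteq> 0"
  shows "((\<lambda>t. (norm (b + t *\<^sub>R w) - norm b) / t) \<longlongrightarrow> sgn b \<bullet> w) (at 0)"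
proof -
  have "((\<lambda>t :: real. norm (b + t *\<^sub>R w)) has_derivative (\<lambda>t. (t *\<^sub>R w) \<bullet> sgn b)) (at 0)"
  proof -
    have f: "((\<lambda>t :: real. b + t *\<^sub>R w) has_derivative (\<lambda>t. t *\<^sub>R w)) (at 0)"
      by (auto intro!: derivative_eq_intros)
    have g: "(norm has_derivative (\<lambda>h. h \<bullet> sgn b)) (at (b + 0 *\<^sub>R w))"
      using GDERIV_norm[OF assms] by (simp add: gderiv_def)
    show ?thesis by (rule has_derivative_compose[OF f g])
  qed
  then have "((\<lambda>t :: real. norm (b + t *\<^sub>R w)) has_field_derivative (sgn b \<bullet> w)) (at 0)"
    by (simp add: has_field_derivative_def inner_commute mult_commute_abs)
  then show ?thesis by (simp add: DERIV_def)
qed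

lemma filterlim_inverse_Suc_at_0: "filterlim (\<lambda>n. inverse (real (Suc n))) (at 0) sequentially"
  by (rule filterlim_atI[OF LIMSEQ_inverse_real_of_nat]) simp

text \<open>As the cutoff tends to the indicator of the ball, the limit below becomes the divergence theorem on
  the ball: the shell integrals tend to an integral over the sphere.\<close>

lemma cutoff_difference_tendsto:
  fixes H :: "real ^ 'n \<Rightarrow> real"
  assumes H: "continuous_on UNIV H" and \<eta>: "0 < \<eta>" "\<eta> \<le> 1"
  shows "(\<lambda>n. \<integral>b. H b * ((cutoff \<eta> (norm b) - cutoff \<eta> (norm (b + inverse (real (Suc n)) *\<^sub>R w))) / inverse (real (Suc n))) \<partial>lborel)
    \<longlonglongrightarrow> (\<integral>b. H b * (1 / \<eta> * (sgn b \<bullet> w) * (indicator (cball 0 (1 + \<eta>)) b - indicator (cball 0 1) b)) \<partial>lborel)"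
proof (rule integral_dominated_convergence)
  have [measurable]: "H \<in> borel_measurable borel" using H by (rule borel_measurable_continuous_onI)
  have [measurable]: "cutoff \<eta> \<in> borel_measurable borel" unfolding cutoff_def by measurable
  let ?S = "cball (0 :: real ^ 'n) (2 + norm w)"
  \<comment> \<open>The increments and \<eta> are at most 1, so both cutoffs vanish outside
    \<open>?S\<close>; inside it the Lipschitz constant \<open>1 / \<eta>\<close> of the ramp bounds
    the quotient.\<close>
  let ?W = "\<lambda>b. indicator ?S b *\<^sub>R (\<bar>H b\<bar> * (norm w / \<eta>))"
  show "integrable lborel ?W"
    by (intro borel_integrable_compact compact_cball continuous_intros continuous_on_subset[OF H]) auto
  show "(\<lambda>b. H b * ((cutoff \<eta> (norm b) - cutoff \<eta> (norm (b + inverse (real (Suc n)) *\<^sub>R w))) / inverse (real (Suc n))))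
      \<in> borel_measurable lborel" for n by measurable
  show "(\<lambda>b. H b * (1 / \<eta> * (sgn b \<bullet> w) * (indicator (cball 0 (1 + \<eta>)) b - indicator (cball 0 1) b))) \<in> borel_measurable lborel"
    by measurable
  show "AE b in lborel. norm (H b * ((cutoff \<eta> (norm b) - cutoff \<eta> (norm (b + inverse (real (Suc n)) *\<^sub>R w))) / inverse (real (Suc n)))) \<le> ?W b" for n
  proof (rule AE_I2)
    fix b :: "real ^ 'n"
    define t where "t = inverse (real (Suc n))"
    have t: "0 < t" "t \<le> 1" by (auto simp: t_def field_simps)
    have nb: "\<bar>norm b - norm (b + t *\<^sub>R w)\<bar> \<le> t * norm w"
      using norm_triangle_ineq3[of b "b + t *\<^sub>R w"] t by simp
    have tw: "t * norm w \<le> norm w" using t by (simp add: mult_left_le_one_le)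
    show "norm (H b * ((cutoff \<eta> (norm b) - cutoff \<eta> (norm (b + t *\<^sub>R w))) / t)) \<le> ?W b"
    proof (cases "b \<in> ?S")
      case True
      have "\<bar>cutoff \<eta> (norm b) - cutoff \<eta> (norm (b + t *\<^sub>R w))\<bar> \<le> t * norm w / \<eta>"
        using cutoff_lipschitz[OF \<eta>(1), of "norm b" "norm (b + t *\<^sub>R w)"] divide_right_mono[OF nb, of \<eta>] \<eta> by simp
      then have "\<bar>(cutoff \<eta> (norm b) - cutoff \<eta> (norm (b + t *\<^sub>R w))) / t\<bar> \<le> norm w / \<eta>"
        using t \<eta> by (simp add: abs_divide field_simps)
      then have "\<bar>H b\<bar> * \<bar>(cutoff \<eta> (norm b) - cutoff \<eta> (norm (b + t *\<^sub>R w))) / t\<bar> \<le> \<bar>H b\<bar> * (norm w / \<eta>)"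
        by (rule mult_left_mono) simp
      then show ?thesis using True by (simp add: abs_mult)
    next
      case False
      then have "norm b > 2 + norm w" by simp
      then have "norm b \<ge> 1 + \<eta>" "norm (b + t *\<^sub>R w) \<ge> 1 + \<eta>" using nb tw \<eta> norm_ge_zero[of w] by linarith+
      then show ?thesis using \<eta> False by (simp add: cutoff_outer)
    qed
  qed
  have tn: "(\<lambda>n. inverse (real (Suc n))) \<longlonglongrightarrow> 0" by (rule LIMSEQ_inverse_real_of_nat)
  \<comment> \<open>The kinks of the ramp lie on two spheres, which are null sets; elsewhere the
    ramp is smooth or locally constant.\<close>
  have "AE b in lborel. norm (b :: real ^ 'n) \<noteq> 1 \<and> norm b \<noteq> 1 + \<eta>"
    using AE_lborel_norm_neq[of 1] AE_lborel_norm_neq[of "1 + \<eta>"] by eventually_elim auto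
  then show "AE b in lborel. (\<lambda>n. H b * ((cutoff \<eta> (norm b) - cutoff \<eta> (norm (b + inverse (real (Suc n)) *\<^sub>R w))) / inverse (real (Suc n))))
     \<longlonglongrightarrow> H b * (1 / \<eta> * (sgn b \<bullet> w) * (indicator (cball 0 (1 + \<eta>)) b - indicator (cball 0 1) b))"
  proof eventually_elim
    case (elim b)
    let ?N = "\<lambda>n. norm (b + inverse (real (Suc n)) *\<^sub>R w)"
    have lim: "?N \<longlonglongrightarrow> norm b"
    proof -
      have "?N \<longlonglongrightarrow> norm (b + 0 *\<^sub>R w)" by (intro tendsto_intros tn)
      then show ?thesis by simp
    qed
    consider "norm b < 1" | "1 < norm b" "norm b < 1 + \<eta>" | "norm b > 1 + \<eta>" using elim by linarith
    then show ?case
    proof cases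
      case 1
      then have "eventually (\<lambda>n. ?N n < 1) sequentially" using lim by (rule order_tendstoD(2)[rotated])
      then have ev: "eventually (\<lambda>n. H b * ((cutoff \<eta> (norm b) - cutoff \<eta> (?N n)) / inverse (real (Suc n))) = 0) sequentially"
        by eventually_elim (use 1 \<eta> in \<open>simp add: cutoff_inner\<close>)
      have "H b * (1 / \<eta> * (sgn b \<bullet> w) * (indicator (cball 0 (1 + \<eta>)) b - indicator (cball 0 1) b)) = 0"
        using 1 \<eta> by simp
      then show ?thesis using tendsto_eventually[OF ev] by (simp only:)
    next
      case 3
      then have "eventually (\<lambda>n. ?N n > 1 + \<eta>) sequentially" using lim by (rule order_tendstoD(1)[rotated])
      then have ev: "eventually (\<lambda>n. H b * ((cutoff \<eta> (norm b) - cutoff \<eta> (?N n)) / inverse (real (Suc n))) = 0) sequentially"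
        by eventually_elim (use 3 \<eta> in \<open>simp add: cutoff_outer\<close>)
      have "H b * (1 / \<eta> * (sgn b \<bullet> w) * (indicator (cball 0 (1 + \<eta>)) b - indicator (cball 0 1) b)) = 0"
        using 3 \<eta> by simp
      then show ?thesis using tendsto_eventually[OF ev] by (simp only:)
    next
      case 2
      have "eventually (\<lambda>n. ?N n < 1 + \<eta>) sequentially" "eventually (\<lambda>n. ?N n > 1) sequentially"
        using lim 2 by (auto intro: order_tendstoD)
      then have ev: "eventually (\<lambda>n. H b * ((cutoff \<eta> (norm b) - cutoff \<eta> (?N n)) / inverse (real (Suc n))) =
          H b * (1 / \<eta> * ((?N n - norm b) / inverse (real (Suc n))))) sequentially"
      proof eventually_elim
        case (elim n)
        have "cutoff \<eta> (norm b) - cutoff \<eta> (?N n) = (?N n - norm b) / \<eta>"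
          using elim 2 \<eta> by (simp add: cutoff_shell diff_divide_distrib[symmetric])
        then show ?case by simp
      qed
      have b0: "b \<noteq> 0" using 2 by auto
      have "(\<lambda>n. (?N n - norm b) / inverse (real (Suc n))) \<longlonglongrightarrow> sgn b \<bullet> w"
        by (rule filterlim_compose[OF norm_quotient_tendsto[OF b0] filterlim_inverse_Suc_at_0])
      then have "(\<lambda>n. H b * (1 / \<eta> * ((?N n - norm b) / inverse (real (Suc n))))) \<longlonglongrightarrow> H b * (1 / \<eta> * (sgn b \<bullet> w))"
        by (intro tendsto_intros)
      then have "(\<lambda>n. H b * ((cutoff \<eta> (norm b) - cutoff \<eta> (?N n)) / inverse (real (Suc n)))) \<longlonglongrightarrow> H b * (1 / \<eta> * (sgn b \<bullet> w))"
        using tendsto_cong[OF ev] by simp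
      moreover have "H b * (1 / \<eta> * (sgn b \<bullet> w) * (indicator (cball 0 (1 + \<eta>)) b - indicator (cball 0 1) b)) = H b * (1 / \<eta> * (sgn b \<bullet> w))"
        using 2 by simp
      ultimately show ?thesis by (simp only:)
    qed
  qed
qed

lemma integral_lborel_translate:
  fixes f :: "'a::euclidean_space \<Rightarrow> real"
  assumes [measurable]: "f \<in> borel_measurable borel"
  shows "(\<integral>x. f x \<partial>lborel) = (\<integral>x. f (a + x) \<partial>lborel)"
  by (subst lborel_affine[of 1 a]) (simp_all add: integral_distr density_1)

text \<open>Joins the divergence theorem to convexity through difference quotients. The weighted
  average \<open>J\<close> of translates is convex along a line, so the drop
  \<open>J 0 - J 1\<close> is at most every difference quotient at 0, and these converge to an
  integral over the shell. The loss \<open>2 * L\<close> arises when averages over the balls around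
  0 and \<open>- w\<close> are replaced by values at the centres.\<close>

lemma uniform_sphere_gradient_inequality_unit:
  fixes H :: "real ^ 'n \<Rightarrow> real"
  assumes conv: "convex_on UNIV H" and lip: "\<And>x y. \<bar>H x - H y\<bar> \<le> L * norm (x - y)"
  shows "H 0 - H (- w) - 2 * L \<le> real CARD('n) * (\<integral>e. H e * (e \<bullet> w) \<partial>uniform_sphere)"
proof -
  define d where "d = CARD('n)"
  have H: "continuous_on UNIV H" using lip by (intro lipschitz_imp_continuous[of UNIV H L]) auto
  have [measurable]: "H \<in> borel_measurable borel" using H by (rule borel_measurable_continuous_onI)
  define L' where "L' = max L 0"
  have L': "L' \<ge> 0" "\<And>x y. \<bar>H x - H y\<bar> \<le> L' * norm (x - y)"
    using lip by (auto simp: L'_def intro!: order_trans[OF lip] mult_right_mono)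
  define K where "K e = H (sgn e) * (sgn e \<bullet> w)" for e
  define EK where "EK = (\<integral>e. H e * (e \<bullet> w) \<partial>uniform_sphere)"
  define V where "V = measure lborel (cball (0 :: real ^ 'n) 1)"
  have V: "V > 0" by (simp add: V_def content_cball)
  have [measurable]: "K \<in> borel_measurable borel" unfolding K_def by measurable
  have sgn_sgn: "sgn (sgn x) = sgn x" for x :: "real ^ 'n" by (cases "x = 0") (auto simp: sgn_div_norm)
  have n_sgn: "norm (sgn x) \<le> 1" for x :: "real ^ 'n" by (simp add: norm_sgn)
  have KB: "\<bar>K e\<bar> \<le> (\<bar>H 0\<bar> + L') * norm w" for e
    unfolding K_def abs_mult
  proof (rule mult_mono)
    have "\<bar>H (sgn e) - H 0\<bar> \<le> L' * 1" using L'(2)[of "sgn e" 0] mult_left_mono[OF n_sgn[of e] L'(1)] by simp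
    then show "\<bar>H (sgn e)\<bar> \<le> \<bar>H 0\<bar> + L'" by simp
    show "\<bar>sgn e \<bullet> w\<bar> \<le> norm w"
      using Cauchy_Schwarz_ineq2[of "sgn e" w] mult_right_mono[OF n_sgn[of e], of "norm w"] by simp
  qed (use L' in auto)
  have EK: "(\<integral>e. K e \<partial>uniform_sphere) = EK"
    unfolding EK_def by (rule Bochner_Integration.integral_cong) (auto simp: K_def sgn_div_norm)
  \<comment> \<open>All estimates are made at a fixed ramp width \<eta>. The errors are controlled
    by the shell volume and by \<eta>, and the width tends to 0 only at the end.\<close>
  have key: "H 0 - H (- w) - 2 * L' - L' * norm w * ((1 + \<eta>) ^ d - 1) \<le> ((1 + \<eta>) ^ d - 1) / \<eta> * (EK + L' * \<eta> * norm w)"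
    if \<eta>: "0 < \<eta>" "\<eta> \<le> 1" for \<eta>
  proof -
    define ct where "ct b = cutoff \<eta> (norm b)" for b :: "real ^ 'n"
    have [measurable]: "ct \<in> borel_measurable borel" unfolding ct_def cutoff_def by measurable
    let ?B = "cball (0 :: real ^ 'n) 1" and ?B' = "cball (0 :: real ^ 'n) (1 + \<eta>)"
    define sh where "sh b = (indicator ?B' b - indicator ?B b :: real)" for b
    have [measurable]: "sh \<in> borel_measurable borel" unfolding sh_def by measurable
    have sh01: "0 \<le> sh b" for b using \<eta> by (auto simp: sh_def indicator_def)
    have ind: "integrable lborel (indicator (cball (0 :: real ^ 'n) r) :: _ \<Rightarrow> real)" for r
      using emeasure_lborel_cball_finite[of "0 :: real ^ 'n" r] by (simp add: integrable_indicator_iff)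
    have sh_int: "integrable lborel sh" unfolding sh_def by (intro Bochner_Integration.integrable_diff ind)
    have measB: "measure lborel ?B' = V * (1 + \<eta>) ^ d"
      using \<eta> by (simp add: V_def content_cball d_def)
    have sh_val: "(\<integral>b. sh b \<partial>lborel) = V * ((1 + \<eta>) ^ d - 1)"
      unfolding sh_def using ind by (simp add: measB V_def[symmetric] algebra_simps)
    have ct_le: "ct b \<le> indicator ?B' b" "indicator ?B b \<le> ct b" for b
      using \<eta> cutoff_bounds[of \<eta> "norm b"] by (auto simp: ct_def indicator_def cutoff_inner cutoff_outer)
    have Hchi_int: "integrable lborel (\<lambda>b. J b * ct (b + a))" if J: "continuous_on UNIV J" for a and J :: "real ^ 'n \<Rightarrow> real"
    proof (rule Bochner_Integration.integrable_bound)
      have "J \<in> borel_measurable borel" using J by (rule borel_measurable_continuous_onI)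
      then show "(\<lambda>b. J b * ct (b + a)) \<in> borel_measurable lborel" by measurable
      show "integrable lborel (\<lambda>b. indicator (cball (- a) (1 + \<eta>)) b *\<^sub>R \<bar>J b\<bar>)"
        by (intro borel_integrable_compact compact_cball continuous_intros continuous_on_subset[OF J]) auto
      show "AE b in lborel. norm (J b * ct (b + a)) \<le> norm (indicator (cball (- a) (1 + \<eta>)) b *\<^sub>R \<bar>J b\<bar>)"
      proof (rule AE_I2)
        fix b
        have "ct (b + a) \<le> indicator (cball (- a) (1 + \<eta>)) b"
          using ct_le(1)[of "b + a"] by (simp add: indicator_def dist_norm norm_minus_commute add.commute)
        moreover have "0 \<le> ct (b + a)" by (simp add: ct_def cutoff_bounds)
        ultimately have "\<bar>J b\<bar> * ct (b + a) \<le> \<bar>J b\<bar> * indicator (cball (- a) (1 + \<eta>)) b" by (intro mult_left_mono) auto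
        then show "norm (J b * ct (b + a)) \<le> norm (indicator (cball (- a) (1 + \<eta>)) b *\<^sub>R \<bar>J b\<bar>)"
          using \<open>0 \<le> ct (b + a)\<close> by (simp add: abs_mult mult.commute)
      qed
    qed
    have Hw: "continuous_on UNIV (\<lambda>b. H (b - t *\<^sub>R w))" for t
      by (intro continuous_on_compose2[OF H] continuous_intros) auto
    define J where "J t = (\<integral>b. H (b - t *\<^sub>R w) * ct b \<partial>lborel)" for t :: real
    have int0: "integrable lborel (\<lambda>b. H (b - t *\<^sub>R w) * ct b)" for t using Hchi_int[OF Hw, of t 0] by simp
    \<comment> \<open>Translation moves the displacement from \<open>H\<close>, which need not be
      smooth, to the cutoff.\<close>
    have J_shift: "J t = (\<integral>b. H b * ct (b + t *\<^sub>R w) \<partial>lborel)" for t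
      unfolding J_def by (subst integral_lborel_translate[of _ "t *\<^sub>R w"]) (simp_all add: add.commute)
    have conv_J: "t * (J 0 - J 1) \<le> J 0 - J t" if t: "0 < t" "t \<le> 1" for t
    proof -
      have "J t \<le> (\<integral>b. (1 - t) * (H (b - 0 *\<^sub>R w) * ct b) + t * (H (b - 1 *\<^sub>R w) * ct b) \<partial>lborel)"
        unfolding J_def
      proof (rule integral_mono)
        fix b
        have "b - t *\<^sub>R w = (1 - t) *\<^sub>R b + t *\<^sub>R (b - w)" by (simp add: algebra_simps)
        then have "H (b - t *\<^sub>R w) \<le> (1 - t) * H b + t * H (b - w)"
          using convex_onD[OF conv, of t b "b - w"] t by simp
        then have "H (b - t *\<^sub>R w) * ct b \<le> ((1 - t) * H b + t * H (b - w)) * ct b"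
          by (rule mult_right_mono) (simp add: ct_def cutoff_bounds)
        then show "H (b - t *\<^sub>R w) * ct b \<le> (1 - t) * (H (b - 0 *\<^sub>R w) * ct b) + t * (H (b - 1 *\<^sub>R w) * ct b)"
          by (simp add: algebra_simps)
      qed (use int0[of t] int0[of 0] int0[of 1] in auto)
      also have "\<dots> = (1 - t) * J 0 + t * J 1"
        unfolding J_def using int0[of 0] int0[of 1] by simp
      finally show ?thesis by (simp add: algebra_simps)
    qed
    define G where "G = (\<integral>b. H b * (1 / \<eta> * (sgn b \<bullet> w) * sh b) \<partial>lborel)"
    have "J 0 - J 1 \<le> G"
    proof (rule LIMSEQ_le_const)
      show "(\<lambda>n. \<integral>b. H b * ((ct b - ct (b + inverse (real (Suc n)) *\<^sub>R w)) / inverse (real (Suc n))) \<partial>lborel) \<longlonglongrightarrow> G"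
        unfolding ct_def G_def sh_def by (rule cutoff_difference_tendsto[OF H \<eta>])
      have quotient: "J 0 - J 1 \<le> (\<integral>b. H b * ((ct b - ct (b + t *\<^sub>R w)) / t) \<partial>lborel)" if t: "0 < t" "t \<le> 1" for t
      proof -
        have "(\<integral>b. H b * ((ct b - ct (b + t *\<^sub>R w)) / t) \<partial>lborel) = (\<integral>b. (H b * ct (b + 0) - H b * ct (b + t *\<^sub>R w)) / t \<partial>lborel)"
          by (rule Bochner_Integration.integral_cong) (simp_all add: algebra_simps)
        also have "\<dots> = (J 0 - J t) / t"
          using Hchi_int[OF H, of 0] Hchi_int[OF H, of "t *\<^sub>R w"] by (simp add: J_shift)
        finally show ?thesis using conv_J[OF t] t by (simp add: field_simps)
      qed
      show "\<exists>N. \<forall>n\<ge>N. J 0 - J 1 \<le> (\<integral>b. H b * ((ct b - ct (b + inverse (real (Suc n)) *\<^sub>R w)) / inverse (real (Suc n))) \<partial>lborel)"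
        by (intro exI[of _ 0] allI impI quotient) (auto simp: field_simps)
    qed
    \<comment> \<open>On the shell \<open>H b\<close> is replaced by its value at the radial
      projection, at distance at most \<eta>; polar coordinates then turn the shell integral into
      one over the sphere.\<close>
    also have "G \<le> 1 / \<eta> * (V * ((1 + \<eta>) ^ d - 1) * (EK + L' * \<eta> * norm w))"
    proof -
      have Ksh: "integrable lborel (\<lambda>b. K (sgn b) * sh b)"
        "(\<integral>b. K (sgn b) * sh b \<partial>lborel) = EK * (V * ((1 + \<eta>) ^ d - 1))"
      proof -
        have m: "K \<in> borel_measurable borel" by measurable
        have r: "1 + \<eta> > 0" using \<eta> by simp
        have eq: "K (sgn b) * sh b = K (sgn b) * indicator ?B' b - K (sgn b) * indicator ?B b" for b
          by (simp add: sh_def algebra_simps)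
        note i = integral_sgn_cball[OF m KB r] integral_sgn_cball[OF m KB zero_less_one]
        show "integrable lborel (\<lambda>b. K (sgn b) * sh b)" unfolding eq by (intro Bochner_Integration.integrable_diff i)
        have "(\<integral>b. K (sgn b) * sh b \<partial>lborel) = EK * measure lborel ?B' - EK * V"
          unfolding eq by (subst Bochner_Integration.integral_diff[OF i(1) i(3)]) (simp only: i(2,4) EK V_def)
        then show "(\<integral>b. K (sgn b) * sh b \<partial>lborel) = EK * (V * ((1 + \<eta>) ^ d - 1))" by (simp add: measB algebra_simps)
      qed
      have "G \<le> (\<integral>b. 1 / \<eta> * (K (sgn b) * sh b + L' * \<eta> * norm w * sh b) \<partial>lborel)"
        unfolding G_def
      proof (rule integral_mono)
        have "integrable lborel (\<lambda>b. indicator ?B' b *\<^sub>R (\<bar>H b\<bar> * (norm w / \<eta>)))"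
          by (intro borel_integrable_compact compact_cball continuous_intros continuous_on_subset[OF H]) auto
        then show "integrable lborel (\<lambda>b. H b * (1 / \<eta> * (sgn b \<bullet> w) * sh b))"
        proof (rule Bochner_Integration.integrable_bound)
          show "AE b in lborel. norm (H b * (1 / \<eta> * (sgn b \<bullet> w) * sh b)) \<le> norm (indicator ?B' b *\<^sub>R (\<bar>H b\<bar> * (norm w / \<eta>)))"
          proof (rule AE_I2)
            fix b
            have 1: "\<bar>sgn b \<bullet> w\<bar> \<le> norm w"
              using Cauchy_Schwarz_ineq2[of "sgn b" w] mult_right_mono[OF n_sgn[of b], of "norm w"] by simp
            have "\<bar>H b\<bar> * (\<bar>sgn b \<bullet> w\<bar> / \<eta> * sh b) \<le> \<bar>H b\<bar> * (norm w / \<eta> * indicator ?B' b)"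
              using \<eta> sh01[of b] by (intro mult_left_mono mult_mono divide_right_mono 1) (auto simp: sh_def)
            then show "norm (H b * (1 / \<eta> * (sgn b \<bullet> w) * sh b)) \<le> norm (indicator ?B' b *\<^sub>R (\<bar>H b\<bar> * (norm w / \<eta>)))"
              using \<eta> sh01[of b] by (simp add: abs_mult abs_divide mult_ac)
          qed
        qed measurable
        show "integrable lborel (\<lambda>b. 1 / \<eta> * (K (sgn b) * sh b + L' * \<eta> * norm w * sh b))"
          using Ksh(1) sh_int by auto
        fix b
        show "H b * (1 / \<eta> * (sgn b \<bullet> w) * sh b) \<le> 1 / \<eta> * (K (sgn b) * sh b + L' * \<eta> * norm w * sh b)"
        proof (cases "1 < norm b \<and> norm b \<le> 1 + \<eta>")
          case True
          then have sh1: "sh b = 1" by (simp add: sh_def)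
          have b0: "b \<noteq> 0" using True by auto
          have "b - sgn b = (norm b - 1) *\<^sub>R sgn b" using b0 by (simp add: sgn_div_norm algebra_simps)
          then have "norm (b - sgn b) = norm b - 1" using True b0 by (simp add: norm_sgn)
          then have "\<bar>H b - H (sgn b)\<bar> \<le> L' * \<eta>" using L'(2)[of b "sgn b"] True mult_left_mono[OF _ L'(1), of "norm b - 1" \<eta>] by simp
          moreover have "\<bar>sgn b \<bullet> w\<bar> \<le> norm w"
            using Cauchy_Schwarz_ineq2[of "sgn b" w] mult_right_mono[OF n_sgn[of b], of "norm w"] by simp
          ultimately have "\<bar>(H b - H (sgn b)) * (sgn b \<bullet> w)\<bar> \<le> L' * \<eta> * norm w"
            unfolding abs_mult by (intro mult_mono) auto
          then have "H b * (sgn b \<bullet> w) \<le> K (sgn b) + L' * \<eta> * norm w" by (simp add: K_def sgn_sgn algebra_simps)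
          then have "1 / \<eta> * (H b * (sgn b \<bullet> w)) \<le> 1 / \<eta> * (K (sgn b) + L' * \<eta> * norm w)" using \<eta> by (intro mult_left_mono) auto
          then show ?thesis by (simp add: sh1 mult_ac)
        next
          case False
          then have "sh b = 0" using \<eta> by (auto simp: sh_def indicator_def)
          then show ?thesis by simp
        qed
      qed
      also have "\<dots> = 1 / \<eta> * (EK * (V * ((1 + \<eta>) ^ d - 1)) + L' * \<eta> * norm w * (V * ((1 + \<eta>) ^ d - 1)))"
        using Ksh sh_int by (simp add: sh_val)
      finally show ?thesis by (simp add: algebra_simps)
    qed
    finally have upper: "J 0 - J 1 \<le> 1 / \<eta> * (V * ((1 + \<eta>) ^ d - 1) * (EK + L' * \<eta> * norm w))" .
    have "V * (H 0 - H (- w) - 2 * L') - L' * norm w * (V * ((1 + \<eta>) ^ d - 1)) =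
        (\<integral>b. (H 0 - H (- w) - 2 * L') * indicator ?B b - L' * norm w * sh b \<partial>lborel)"
      using ind[of 1] sh_int by (simp add: sh_val V_def)
    \<comment> \<open>Inside the unit ball both values of \<open>H\<close> are within
      \<open>L'\<close> of those at the centres. On the shell only the crude bound
      \<open>L' * norm w\<close> for a displacement by \<open>w\<close> is available.\<close>
    also have "\<dots> \<le> (\<integral>b. H (b - 0 *\<^sub>R w) * ct b - H (b - 1 *\<^sub>R w) * ct b \<partial>lborel)"
    proof (rule integral_mono)
      show "integrable lborel (\<lambda>b. (H 0 - H (- w) - 2 * L') * indicator ?B b - L' * norm w * sh b)"
        using ind[of 1] sh_int by auto
      show "integrable lborel (\<lambda>b. H (b - 0 *\<^sub>R w) * ct b - H (b - 1 *\<^sub>R w) * ct b)"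
        by (intro Bochner_Integration.integrable_diff int0)
      fix b
      have g: "- (L' * norm w) \<le> H b - H (b - w)" using L'(2)[of b "b - w"] by simp
      show "(H 0 - H (- w) - 2 * L') * indicator ?B b - L' * norm w * sh b \<le> H (b - 0 *\<^sub>R w) * ct b - H (b - 1 *\<^sub>R w) * ct b"
      proof (cases "b \<in> ?B")
        case True
        then have c: "ct b = 1" "sh b = 0" "indicator ?B b = (1 :: real)" using \<eta> by (auto simp: ct_def sh_def cutoff_inner indicator_def)
        have nb: "norm b \<le> 1" using True by simp
        have "H 0 - H b \<le> L'" using L'(2)[of 0 b] mult_left_mono[OF nb L'(1)] by simp
        moreover have "H (b - w) - H (- w) \<le> L'" using L'(2)[of "b - w" "- w"] mult_left_mono[OF nb L'(1)] by simp
        ultimately show ?thesis using c by simp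
      next
        case False
        have "ct b \<le> sh b" using ct_le(1)[of b] False by (simp add: sh_def)
        have "- (L' * norm w) * sh b \<le> - (L' * norm w) * ct b"
          using \<open>ct b \<le> sh b\<close> L'(1) by (intro mult_left_mono_neg) auto
        also have "\<dots> \<le> (H b - H (b - w)) * ct b"
          by (rule mult_right_mono[OF g]) (simp add: ct_def cutoff_bounds)
        finally show ?thesis using False by (simp add: algebra_simps)
      qed
    qed
    also have "\<dots> = J 0 - J 1" unfolding J_def by (rule Bochner_Integration.integral_diff[OF int0 int0])
    also note upper
    finally have "V * (H 0 - H (- w) - 2 * L' - L' * norm w * ((1 + \<eta>) ^ d - 1)) \<le> V * (((1 + \<eta>) ^ d - 1) / \<eta> * (EK + L' * \<eta> * norm w))"
    proof -
      have "V * c - a * (V * \<delta>) = V * (c - a * \<delta>)" "1 / \<eta> * (V * \<delta> * E) = V * (\<delta> / \<eta> * E)" for c a \<delta> E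
        by (simp_all add: algebra_simps)
      moreover assume "V * (H 0 - H (- w) - 2 * L') - L' * norm w * (V * ((1 + \<eta>) ^ d - 1)) \<le>
        1 / \<eta> * (V * ((1 + \<eta>) ^ d - 1) * (EK + L' * \<eta> * norm w))"
      ultimately show ?thesis by (simp only:)
    qed
    then show ?thesis using V by (simp only: mult_le_cancel_left_pos)
  qed
  let ?t = "\<lambda>n. inverse (real (Suc n))"
  have t0: "?t \<longlonglongrightarrow> 0" by (rule LIMSEQ_inverse_real_of_nat)
  \<comment> \<open>Relative to the volume of the ball, the shell volume divided by its width tends
    to \<open>d\<close>; this is the origin of the dimension factor in the estimator.\<close>
  have der: "((\<lambda>x :: real. (1 + x) ^ d) has_field_derivative real d) (at 0)"
    by (auto intro!: derivative_eq_intros)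
  then have q: "(\<lambda>n. ((1 + ?t n) ^ d - 1) / ?t n) \<longlonglongrightarrow> real d"
    using filterlim_compose[OF _ filterlim_inverse_Suc_at_0] by (simp add: DERIV_def)
  have p: "(\<lambda>n. (1 + ?t n) ^ d - 1) \<longlonglongrightarrow> 0"
  proof -
    have "(\<lambda>n. (1 + ?t n) ^ d - 1) \<longlonglongrightarrow> (1 + 0) ^ d - 1" by (intro tendsto_intros t0)
    then show ?thesis by simp
  qed
  have "H 0 - H (- w) - 2 * L' - L' * norm w * 0 \<le> real d * (EK + L' * 0 * norm w)"
  proof (rule LIMSEQ_le)
    show "(\<lambda>n. H 0 - H (- w) - 2 * L' - L' * norm w * ((1 + ?t n) ^ d - 1)) \<longlonglongrightarrow> H 0 - H (- w) - 2 * L' - L' * norm w * 0"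
      by (intro tendsto_intros p)
    show "(\<lambda>n. ((1 + ?t n) ^ d - 1) / ?t n * (EK + L' * ?t n * norm w)) \<longlonglongrightarrow> real d * (EK + L' * 0 * norm w)"
      by (intro tendsto_intros q t0)
    show "\<exists>N. \<forall>n\<ge>N. H 0 - H (- w) - 2 * L' - L' * norm w * ((1 + ?t n) ^ d - 1) \<le> ((1 + ?t n) ^ d - 1) / ?t n * (EK + L' * ?t n * norm w)"
      by (intro exI[of _ 0] allI impI key) (auto simp: field_simps)
  qed
  moreover have "L \<ge> 0" using lip[of "axis undefined 1" 0] by (simp add: norm_axis_1)
  ultimately show ?thesis by (simp add: EK_def d_def L'_def)
qed

lemma uniform_sphere_gradient_inequality:
  fixes h :: "real ^ 'n \<Rightarrow> real"
  assumes conv: "convex_on UNIV h" and lip: "\<And>x y. \<bar>h x - h y\<bar> \<le> L * norm (x - y)" and \<tau>: "\<tau> > 0"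
  shows "h x - h u - 2 * L * \<tau> \<le> real CARD('n) / \<tau> * (\<integral>e. h (x + \<tau> *\<^sub>R e) * (e \<bullet> (x - u)) \<partial>uniform_sphere)"
proof -
  define H where "H b = h (x + \<tau> *\<^sub>R b)" for b
  have "H 0 - H (- ((x - u) /\<^sub>R \<tau>)) - 2 * (L * \<tau>) \<le> real CARD('n) * (\<integral>e. H e * (e \<bullet> ((x - u) /\<^sub>R \<tau>)) \<partial>uniform_sphere)"
  proof (rule uniform_sphere_gradient_inequality_unit)
    show "convex_on UNIV H" unfolding H_def by (rule convex_on_affine_compose[OF conv])
    show "\<bar>H a - H b\<bar> \<le> L * \<tau> * norm (a - b)" for a b
      using lip[of "x + \<tau> *\<^sub>R a" "x + \<tau> *\<^sub>R b"] \<tau> by (simp add: H_def flip: scaleR_diff_right)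
  qed
  moreover have "(\<lambda>e. H e * (e \<bullet> ((x - u) /\<^sub>R \<tau>))) = (\<lambda>e. inverse \<tau> * (h (x + \<tau> *\<^sub>R e) * (e \<bullet> (x - u))))"
    by (simp only: H_def inner_scaleR_right mult.left_commute)
  ultimately show ?thesis using \<tau> by (simp add: H_def divide_inverse mult_ac)
qed

section \<open>Mirror steps\<close>

lemma gradient_eq:
  assumes "GDERIV f x :> g" shows "gradient f x = g"
proof -
  have "g' = g" if "GDERIV f x :> g'" for g'
  proof -
    have "(\<lambda>h. h \<bullet> g') = (\<lambda>h. h \<bullet> g)"
      using assms that unfolding gderiv_def by (rule has_derivative_unique[rotated])
    then have "h \<bullet> g' = h \<bullet> g" for h by meson
    then show ?thesis by (metis inner_commute vector_eq_ldot)
  qed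
  then show ?thesis unfolding gradient_def using assms by (blast intro: the_equality)
qed

lemma GDERIV_gradient:
  fixes f :: "real ^ 'n \<Rightarrow> real"
  assumes "f differentiable (at x)"
  shows "GDERIV f x :> gradient f x"
proof -
  obtain f' where f': "(f has_derivative f') (at x)" using assms by (auto simp: differentiable_def)
  then have lin: "linear f'" by (rule has_derivative_linear)
  define g where "g = (\<Sum>b\<in>Basis. f' b *\<^sub>R b)"
  have "f' h = h \<bullet> g" for h
  proof -
    have "f' h = f' (\<Sum>b\<in>Basis. (h \<bullet> b) *\<^sub>R b)" by (simp add: euclidean_representation)
    also have "\<dots> = (\<Sum>b\<in>Basis. (h \<bullet> b) * f' b)" using lin by (simp add: linear_sum linear_cmul)
    also have "\<dots> = h \<bullet> g" by (simp add: g_def inner_sum_right mult.commute)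
    finally show ?thesis .
  qed
  then have "f' = (\<lambda>h. h \<bullet> g)" by auto
  then have "GDERIV f x :> g" using f' by (simp add: gderiv_def)
  then show ?thesis using gradient_eq by metis
qed

lemma GDERIV_directional:
  assumes "GDERIV f x :> g"
  shows "((\<lambda>t. (f (x + t *\<^sub>R v) - f x) / t) \<longlongrightarrow> g \<bullet> v) (at 0)"
proof -
  have f: "((\<lambda>t :: real. x + t *\<^sub>R v) has_derivative (\<lambda>t. t *\<^sub>R v)) (at 0)"
    by (auto intro!: derivative_eq_intros)
  have g: "(f has_derivative (\<lambda>h. h \<bullet> g)) (at (x + 0 *\<^sub>R v))"
    using assms by (simp add: gderiv_def)
  have "((\<lambda>t. f (x + t *\<^sub>R v)) has_derivative (\<lambda>t. (t *\<^sub>R v) \<bullet> g)) (at 0)"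
    by (rule has_derivative_compose[OF f g])
  then have "((\<lambda>t. f (x + t *\<^sub>R v)) has_field_derivative (g \<bullet> v)) (at 0)"
    by (simp add: has_field_derivative_def inner_commute mult_commute_abs)
  then show ?thesis by (simp add: DERIV_def)
qed

lemma continuous_on_lp_norm: "1 \<le> p \<Longrightarrow> continuous_on S (lp_norm p)"
  unfolding lp_norm_def by (intro continuous_intros continuous_on_powr') (auto simp: sum_nonneg)

text \<open>The exponent \<open>s\<close> is conjugate to \<open>1 + \<kappa>\<close>, so Young's
  inequality can trade the power \<open>1 + \<kappa>\<close> of a gradient against the power
  \<open>s\<close> in uniform convexity.\<close>

locale prox_setup =
  fixes p \<kappa> s :: real and \<psi> :: "real ^ 'n \<Rightarrow> real" and X :: "(real ^ 'n) set"
  assumes p: "1 \<le> p" "p \<le> 2" and \<kappa>: "0 < \<kappa>" "\<kappa> \<le> 1" and s: "s = (1 + \<kappa>) / \<kappa>"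
    and uc: "uniformly_convex_lp p 1 s \<psi>" and X: "compact X" "convex X" "X \<noteq> {}"
begin

abbreviation D where "D \<equiv> bregman \<psi>"

lemma s2: "s \<ge> 2" using \<kappa> by (simp add: s field_simps)

lemma conjugate_exponents: "1 / (1 + \<kappa>) + 1 / s = 1"
  using \<kappa> by (simp add: s field_simps)

lemma GDERIV_prox: "GDERIV \<psi> x :> gradient \<psi> x"
  using uc by (intro GDERIV_gradient) (simp add: uniformly_convex_lp_def)

lemma continuous_prox: "continuous_on S \<psi>"
  using uc unfolding uniformly_convex_lp_def
  by (auto intro!: continuous_at_imp_continuous_on differentiable_imp_continuous_within)

lemma bregman_ge: "lp_norm p (x - y) powr s / s \<le> D y x"
  using uc by (simp add: uniformly_convex_lp_def bregman_def)

lemma bregman_nonneg: "0 \<le> D y x"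
  using order_trans[OF _ bregman_ge[of x y]] s2 by simp

lemma bregman_self [simp]: "D x x = 0"
  by (simp add: bregman_def)

lemma bregman_ge_norm: "norm (x - y) powr s / s \<le> D y x"
proof -
  have "norm (x - y) powr s \<le> lp_norm p (x - y) powr s"
    using p s2 norm_le_lp_norm[of p "x - y"] by (intro powr_mono2) auto
  then show ?thesis using bregman_ge[of x y] s2 by (meson divide_right_mono order_trans zero_le_numeral)
qed

lemma gradient_monotone: "2 * (norm (x - y) powr s / s) \<le> (gradient \<psi> x - gradient \<psi> y) \<bullet> (x - y)"
proof -
  have "D y x + D x y = (gradient \<psi> x - gradient \<psi> y) \<bullet> (x - y)"
    by (simp add: bregman_def inner_diff_left inner_diff_right algebra_simps)
  moreover have "norm (x - y) powr s / s \<le> D y x" "norm (x - y) powr s / s \<le> D x y"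
    using bregman_ge_norm[of x y] bregman_ge_norm[of y x] by (simp_all add: norm_minus_commute)
  ultimately show ?thesis by linarith
qed

text \<open>Applied both to the maximiser in the conjugate and to the proximal step: monotonicity of
  order \<open>s\<close> makes each of them a Hoelder continuous function of the dual point, with
  exponent \<open>1 / (s - 1)\<close>.\<close>

lemma holder_of_variational_bound:
  fixes x y w w' :: "real ^ 'n"
  assumes "2 * (norm (x - y) powr s / s) \<le> (w - w') \<bullet> (x - y)"
  shows "norm (x - y) \<le> (s * norm (w - w')) powr (1 / (s - 1))"
proof (cases "x = y")
  case False
  define n where "n = norm (x - y)"
  have n: "n > 0" using False by (simp add: n_def)
  have "0 \<le> n powr s / s" using s2 by simp
  then have "n powr s / s \<le> 2 * (n powr s / s)" by linarith
  also have "\<dots> \<le> norm (w - w') * n"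
    using assms norm_cauchy_schwarz[of "w - w'" "x - y"] by (simp add: n_def)
  finally have "n powr s \<le> s * norm (w - w') * n" using s2 by (simp add: field_simps)
  also have "n powr s = n powr (s - 1) * n" using n by (simp add: powr_diff)
  finally have "n powr (s - 1) \<le> s * norm (w - w')" using n by simp
  then have "(n powr (s - 1)) powr (1 / (s - 1)) \<le> (s * norm (w - w')) powr (1 / (s - 1))"
    using s2 by (intro powr_mono2) auto
  then show ?thesis using n s2 by (simp add: powr_powr n_def)
qed simp

lemma holder_imp_continuous:
  fixes Y :: "real ^ 'n \<Rightarrow> real ^ 'n"
  assumes "\<And>w w'. norm (Y w - Y w') \<le> (s * norm (w - w')) powr (1 / (s - 1))"
  shows "continuous_on UNIV Y"
proof (intro continuous_at_imp_continuous_on ballI)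
  fix w :: "real ^ 'n"
  have "((\<lambda>w'. (s * norm (w' - w)) powr (1 / (s - 1))) \<longlongrightarrow> (s * norm (w - w)) powr (1 / (s - 1))) (at w)"
    using s2 by (intro tendsto_powr' tendsto_intros) auto
  then have "((\<lambda>w'. (s * norm (w' - w)) powr (1 / (s - 1))) \<longlongrightarrow> 0) (at w)" by simp
  then have "((\<lambda>w'. Y w' - Y w) \<longlongrightarrow> 0) (at w)"
    by (rule Lim_null_comparison[rotated]) (simp add: assms)
  then show "isCont Y w" unfolding isCont_def by (simp add: LIM_zero_iff)
qed

lemma conjugate_maximizer_exists: "\<exists>y. gradient \<psi> y = w \<and> (\<forall>x. x \<bullet> w - \<psi> x \<le> y \<bullet> w - \<psi> y)"
proof -
  define g where "g = gradient \<psi> 0 - w"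
  \<comment> \<open>Beyond this radius the growth of order \<open>s\<close> in the expansion of
    \<psi> at 0 dominates the linear term with coefficient \<open>g\<close>, so the extremum over
    the ball is a global one.\<close>
  define \<rho> where "\<rho> = (s * norm g) powr (1 / (s - 1)) + 1"
  have \<rho>: "\<rho> \<ge> 1" by (simp add: \<rho>_def)
  have far: "\<psi> 0 \<le> \<psi> x - x \<bullet> w" if "norm x \<ge> \<rho>" for x
  proof -
    define n where "n = norm x"
    have n: "n \<ge> \<rho>" "n > 0" using that \<rho> by (auto simp: n_def)
    have "((s * norm g) powr (1 / (s - 1))) powr (s - 1) \<le> n powr (s - 1)"
      using n s2 by (intro powr_mono2) (auto simp: \<rho>_def)
    then have "s * norm g \<le> n powr (s - 1)" using s2 by (simp add: powr_powr)
    then have "s * norm g * n \<le> n powr (s - 1) * n" using n by (intro mult_right_mono) auto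
    also have "\<dots> = n powr s" using n by (simp add: powr_diff)
    finally have "norm g * n \<le> n powr s / s" using s2 by (simp add: field_simps)
    also have "\<dots> \<le> D x 0" using bregman_ge_norm[of 0 x] by (simp add: n_def)
    also have "\<dots> = \<psi> x - \<psi> 0 - x \<bullet> w - g \<bullet> x" by (simp add: bregman_def g_def inner_diff_left inner_commute[of w x])
    finally show ?thesis using Cauchy_Schwarz_ineq2[of g x] by (simp add: n_def)
  qed
  have "continuous_on (cball 0 \<rho>) (\<lambda>x. \<psi> x - x \<bullet> w)" by (intro continuous_intros continuous_prox)
  moreover have "cball (0 :: real ^ 'n) \<rho> \<noteq> {}" using \<rho> by simp
  ultimately obtain y where y: "y \<in> cball 0 \<rho>" "\<And>x. x \<in> cball 0 \<rho> \<Longrightarrow> \<psi> y - y \<bullet> w \<le> \<psi> x - x \<bullet> w"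
    using continuous_attains_inf[OF compact_cball] by blast
  have min: "\<psi> y - y \<bullet> w \<le> \<psi> x - x \<bullet> w" for x
  proof (cases "x \<in> cball 0 \<rho>")
    case False
    then show ?thesis using y(2)[of 0] far[of x] \<rho> by simp
  qed (rule y)
  have "gradient \<psi> y = w"
  proof -
    have "GDERIV (\<lambda>x. \<psi> x - x \<bullet> w) y :> gradient \<psi> y - w"
      unfolding gderiv_def inner_diff_right
      by (intro has_derivative_diff GDERIV_prox[unfolded gderiv_def]) (auto intro!: derivative_eq_intros)
    then have "((\<lambda>x. \<psi> x - x \<bullet> w) has_derivative (\<lambda>h. h \<bullet> (gradient \<psi> y - w))) (at y)" by (simp add: gderiv_def)
    then have "(\<lambda>h. h \<bullet> (gradient \<psi> y - w)) = (\<lambda>h. 0)"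
      by (rule differential_zero_maxmin[rotated 2, of _ _ y UNIV]) (auto intro: min)
    then have "(gradient \<psi> y - w) \<bullet> (gradient \<psi> y - w) = 0" by meson
    then show ?thesis by simp
  qed
  then show ?thesis using min by (intro exI[of _ y]) (auto simp: algebra_simps)
qed

text \<open>The maximiser \<open>Y w\<close> is the gradient of the conjugate at \<open>w\<close>:
  the linearisation error at \<open>v\<close> is nonnegative and at most
  \<open>(v - w) \<bullet> (Y v - Y w)\<close>, so continuity of \<open>Y\<close> suffices. The
  critical-point equation of \<open>Y w\<close> is then the claim.\<close>

lemma gradient_conjugate: "gradient \<psi> (gradient (fenchel_conjugate \<psi>) w) = w"
proof -
  obtain Y where Y: "\<And>w. gradient \<psi> (Y w) = w" "\<And>w x. x \<bullet> w - \<psi> x \<le> Y w \<bullet> w - \<psi> (Y w)"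
    using conjugate_maximizer_exists by metis
  have conj: "fenchel_conjugate \<psi> w = Y w \<bullet> w - \<psi> (Y w)" for w
    unfolding fenchel_conjugate_def by (rule cSup_eq_maximum) (auto intro: Y)
  have "norm (Y w - Y w') \<le> (s * norm (w - w')) powr (1 / (s - 1))" for w w' :: "real ^ 'n"
    using gradient_monotone[of "Y w" "Y w'"] by (intro holder_of_variational_bound) (simp add: Y)
  then have Y_cont: "continuous_on UNIV Y" by (rule holder_imp_continuous)
  have "GDERIV (fenchel_conjugate \<psi>) w :> Y w"
    unfolding gderiv_def has_derivative_iff_norm
  proof
    show "bounded_linear (\<lambda>h. h \<bullet> Y w)" by (rule bounded_linear_inner_left)
    show "((\<lambda>v. norm (fenchel_conjugate \<psi> v - fenchel_conjugate \<psi> w - (v - w) \<bullet> Y w) / norm (v - w)) \<longlongrightarrow> 0) (at w)"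
    proof (rule tendsto_sandwich[of "\<lambda>_. 0" _ _ "\<lambda>v. norm (Y v - Y w)"])
      show "\<forall>\<^sub>F v in at w. norm (fenchel_conjugate \<psi> v - fenchel_conjugate \<psi> w - (v - w) \<bullet> Y w) / norm (v - w) \<le> norm (Y v - Y w)"
      proof (rule always_eventually, rule allI)
        fix v
        have "fenchel_conjugate \<psi> v - fenchel_conjugate \<psi> w - (v - w) \<bullet> Y w \<ge> 0"
          using Y(2)[of "Y w" v] by (simp add: conj inner_diff_left inner_diff_right inner_commute[of _ "Y w"])
        moreover have "fenchel_conjugate \<psi> v - fenchel_conjugate \<psi> w - (v - w) \<bullet> Y w \<le> (v - w) \<bullet> (Y v - Y w)"
          using Y(2)[of "Y v" w] by (simp add: conj inner_diff_left inner_diff_right inner_commute[of _ "Y w"] inner_commute[of _ "Y v"])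
        moreover have "(v - w) \<bullet> (Y v - Y w) \<le> norm (v - w) * norm (Y v - Y w)" by (rule norm_cauchy_schwarz)
        ultimately have "norm (fenchel_conjugate \<psi> v - fenchel_conjugate \<psi> w - (v - w) \<bullet> Y w) \<le> norm (v - w) * norm (Y v - Y w)" by simp
        then show "norm (fenchel_conjugate \<psi> v - fenchel_conjugate \<psi> w - (v - w) \<bullet> Y w) / norm (v - w) \<le> norm (Y v - Y w)"
          by (cases "v = w") (auto simp: field_simps)
      qed
      have "isCont Y w" using Y_cont by (simp add: continuous_on_eq_continuous_at)
      then show "((\<lambda>v. norm (Y v - Y w)) \<longlongrightarrow> 0) (at w)"
        by (simp add: isCont_def LIM_zero tendsto_norm_zero)
    qed auto
  qed
  then show ?thesis by (simp add: gradient_eq Y)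
qed

text \<open>The argument is the dual point reached by the gradient step, because both the
  variational inequality and the continuity estimate are expressed in it.\<close>

definition prox_step :: "real ^ 'n \<Rightarrow> real ^ 'n" where
  "prox_step w = arg_min_on (\<lambda>x. D x (gradient (fenchel_conjugate \<psi>) w)) X"

lemma prox_step:
  shows "prox_step w \<in> X" and "u \<in> X \<Longrightarrow> 0 \<le> (gradient \<psi> (prox_step w) - w) \<bullet> (u - prox_step w)"
proof -
  define y where "y = gradient (fenchel_conjugate \<psi>) w"
  have gy: "gradient \<psi> y = w" by (simp add: y_def gradient_conjugate)
  have "continuous_on X (\<lambda>x. D x y)" unfolding bregman_def by (intro continuous_intros continuous_prox)
  then obtain z where z: "z \<in> X" "\<And>x. x \<in> X \<Longrightarrow> D z y \<le> D x y" using continuous_attains_inf[OF X(1,3)] by blast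
  then have "is_arg_min (\<lambda>x. D x y) (\<lambda>x. x \<in> X) z" by (simp add: is_arg_min_linorder)
  \<comment> \<open>\<open>arg_min_on\<close> is a choice operator; it is the existence of
    \<open>z\<close> that makes its value a minimiser.\<close>
  then have "is_arg_min (\<lambda>x. D x y) (\<lambda>x. x \<in> X) (prox_step w)"
    unfolding prox_step_def arg_min_on_def arg_min_def y_def[symmetric] by (rule someI)
  then have *: "prox_step w \<in> X" "\<And>x. x \<in> X \<Longrightarrow> D (prox_step w) y \<le> D x y" by (auto simp: is_arg_min_linorder)
  show "prox_step w \<in> X" by (rule *)
  assume u: "u \<in> X"
  define x where "x = prox_step w"
  have "((\<lambda>t. (\<psi> (x + t *\<^sub>R (u - x)) - \<psi> x) / t) \<longlongrightarrow> gradient \<psi> x \<bullet> (u - x)) (at 0)"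
    by (rule GDERIV_directional[OF GDERIV_prox])
  then have lim: "((\<lambda>t. (\<psi> (x + t *\<^sub>R (u - x)) - \<psi> x) / t) \<longlongrightarrow> gradient \<psi> x \<bullet> (u - x)) (at_right 0)"
    by (rule filterlim_mono) (auto simp: at_le)
  \<comment> \<open>First-order optimality: the segment from \<open>x\<close> to \<open>u\<close>
    stays in the convex set, and the one-sided derivative of the divergence along it is
    nonnegative.\<close>
  have "w \<bullet> (u - x) \<le> gradient \<psi> x \<bullet> (u - x)"
  proof (rule tendsto_lowerbound[OF lim])
    have "\<forall>\<^sub>F t in at_right 0. t \<in> {0<..<1 :: real}" by (rule eventually_at_right_real) simp
    then show "\<forall>\<^sub>F t in at_right 0. w \<bullet> (u - x) \<le> (\<psi> (x + t *\<^sub>R (u - x)) - \<psi> x) / t"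
    proof eventually_elim
      case (elim t)
      have "x + t *\<^sub>R (u - x) = (1 - t) *\<^sub>R x + t *\<^sub>R u" by (simp add: algebra_simps)
      then have "x + t *\<^sub>R (u - x) \<in> X" using elim u *(1) X(2) by (simp add: x_def convexD_alt)
      then have "D x y \<le> D (x + t *\<^sub>R (u - x)) y" unfolding x_def by (rule *)
      then have "t * (w \<bullet> (u - x)) \<le> \<psi> (x + t *\<^sub>R (u - x)) - \<psi> x"
        by (simp add: bregman_def gy inner_add_right inner_diff_right algebra_simps)
      then show ?case using elim by (simp add: field_simps)
    qed
  qed simp
  then show "0 \<le> (gradient \<psi> (prox_step w) - w) \<bullet> (u - prox_step w)" by (simp add: x_def inner_diff_left)
qed

text \<open>Needed for measurability of the iterates. The estimate follows by adding the variational
  inequalities of the two steps, each tested at the other one.\<close>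

lemma continuous_prox_step: "continuous_on UNIV prox_step"
proof (rule holder_imp_continuous)
  fix w w'
  have "2 * (norm (prox_step w - prox_step w') powr s / s) \<le> (gradient \<psi> (prox_step w) - gradient \<psi> (prox_step w')) \<bullet> (prox_step w - prox_step w')"
    by (rule gradient_monotone)
  also have "\<dots> \<le> (w - w') \<bullet> (prox_step w - prox_step w')"
    using prox_step(2)[OF prox_step(1)[of w'], of w] prox_step(2)[OF prox_step(1)[of w], of w']
    by (simp add: inner_diff_left inner_diff_right)
  finally show "norm (prox_step w - prox_step w') \<le> (s * norm (w - w')) powr (1 / (s - 1))"
    by (rule holder_of_variational_bound)
qed

text \<open>The variational inequality and the three-point identity leave
  \<open>\<nu> * (g \<bullet> (x - x'))\<close> minus the divergence of the step. Uniform convexity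
  bounds that divergence from below by a power \<open>s\<close> of the step length, which absorbs
  the corresponding term of Young's inequality.\<close>

lemma mirror_step_bound:
  fixes x :: "real ^ 'n"
  assumes u: "u \<in> X" and \<nu>: "\<nu> \<ge> 0" and G: "G \<ge> 0" "\<And>v. \<bar>g \<bullet> v\<bar> \<le> G * lp_norm p v"
  defines "x' \<equiv> prox_step (gradient \<psi> x - \<nu> *\<^sub>R g)"
  shows "\<nu> * (g \<bullet> (x - u)) \<le> D u x - D u x' + (\<nu> * G) powr (1 + \<kappa>)"
proof -
  define n where "n = lp_norm p (x - x')"
  have "0 \<le> (gradient \<psi> x' - (gradient \<psi> x - \<nu> *\<^sub>R g)) \<bullet> (u - x')"
    unfolding x'_def by (rule prox_step(2)[OF u])
  then have "\<nu> * (g \<bullet> (x - u)) \<le> D u x - D u x' + (\<nu> * (g \<bullet> (x - x')) - D x' x)"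
    by (simp add: bregman_def inner_diff_left inner_diff_right algebra_simps)
  moreover have "\<nu> * (g \<bullet> (x - x')) \<le> \<nu> * (G * n)"
    using G(2)[of "x - x'"] \<nu> by (intro mult_left_mono) (auto simp: n_def)
  moreover have "n powr s / s \<le> D x' x" unfolding n_def by (rule bregman_ge)
  moreover have "\<nu> * (G * n) \<le> (\<nu> * G) powr (1 + \<kappa>) / (1 + \<kappa>) + n powr s / s"
    using Youngs_inequality[of "1 + \<kappa>" s "\<nu> * G" n] \<kappa> s2 conjugate_exponents \<nu> G by (simp add: n_def mult.assoc)
  moreover have "(\<nu> * G) powr (1 + \<kappa>) / (1 + \<kappa>) \<le> (\<nu> * G) powr (1 + \<kappa>)"
    using \<kappa> by (simp add: divide_le_eq distrib_left)
  ultimately show ?thesis by linarith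
qed

text \<open>Convexity along the unit vector in the direction of the gradient bounds the norm of the
  gradient by the oscillation of \<psi> on a ball larger by 1.\<close>

lemma gradient_bounded: obtains B where "\<And>x. x \<in> X \<Longrightarrow> norm (gradient \<psi> x) \<le> B"
proof -
  have "bounded X" using X(1) by (rule compact_imp_bounded)
  then obtain a where a: "\<And>x. x \<in> X \<Longrightarrow> norm x \<le> a" by (auto simp: bounded_iff)
  have "bounded (\<psi> ` cball 0 (a + 1))"
    by (intro compact_imp_bounded compact_continuous_image continuous_prox compact_cball)
  then obtain M where M: "\<forall>x\<in>cball 0 (a + 1). \<bar>\<psi> x\<bar> \<le> M" by (auto simp: bounded_iff)
  have "norm (gradient \<psi> x) \<le> 2 * M" if x: "x \<in> X" for x
  proof -
    let ?v = "sgn (gradient \<psi> x)"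
    have "norm (x + ?v) \<le> a + 1"
      using norm_triangle_ineq[of x ?v] a[OF x] by (simp add: norm_sgn split: if_splits)
    then have "\<bar>\<psi> (x + ?v)\<bar> \<le> M" "\<bar>\<psi> x\<bar> \<le> M" using M a[OF x] by auto
    moreover have "gradient \<psi> x \<bullet> ?v = norm (gradient \<psi> x)"
      by (cases "gradient \<psi> x = 0") (auto simp: sgn_div_norm power2_norm_eq_inner[symmetric] power2_eq_square)
    moreover have "0 \<le> D (x + ?v) x" by (rule bregman_nonneg)
    ultimately show ?thesis by (simp add: bregman_def)
  qed
  then show thesis by (rule that)
qed

lemma bregman_bounded: obtains B where "\<And>x y. x \<in> X \<Longrightarrow> y \<in> X \<Longrightarrow> D x y \<le> B"
proof -
  obtain G where G: "\<And>x. x \<in> X \<Longrightarrow> norm (gradient \<psi> x) \<le> G" using gradient_bounded by blast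
  obtain a where a: "\<And>x. x \<in> X \<Longrightarrow> norm x \<le> a"
    using compact_imp_bounded[OF X(1)] by (auto simp: bounded_iff)
  have "bounded (\<psi> ` X)" by (intro compact_imp_bounded compact_continuous_image continuous_prox X)
  then obtain M where M: "\<And>x. x \<in> X \<Longrightarrow> \<bar>\<psi> x\<bar> \<le> M" by (auto simp: bounded_iff)
  have "D x y \<le> 2 * M + G * (2 * a)" if "x \<in> X" "y \<in> X" for x y
  proof -
    have G0: "G \<ge> 0" using G[OF that(1)] norm_ge_zero order_trans by blast
    have "\<bar>gradient \<psi> y \<bullet> (x - y)\<bar> \<le> norm (gradient \<psi> y) * norm (x - y)" by (rule Cauchy_Schwarz_ineq2)
    also have "\<dots> \<le> G * (2 * a)"
      using norm_triangle_ineq4[of x y] a[OF that(1)] a[OF that(2)] by (intro mult_mono G that) (use G0 in auto)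
    finally show ?thesis using M[OF that(1)] M[OF that(2)] by (simp add: bregman_def)
  qed
  then show thesis by (rule that)
qed

text \<open>Each component is a pointwise limit of difference quotients of the continuous function
  \<psi>.\<close>

lemma borel_measurable_gradient_prox [measurable]: "gradient \<psi> \<in> borel_measurable borel"
proof -
  have [measurable]: "\<psi> \<in> borel_measurable borel" by (rule borel_measurable_continuous_onI[OF continuous_prox])
  have comp: "(\<lambda>x. gradient \<psi> x \<bullet> b) \<in> borel_measurable borel" for b
  proof (rule borel_measurable_LIMSEQ_real)
    show "(\<lambda>n. (\<psi> (x + inverse (real (Suc n)) *\<^sub>R b) - \<psi> x) / inverse (real (Suc n))) \<longlonglongrightarrow> gradient \<psi> x \<bullet> b" for x
      by (rule filterlim_compose[OF GDERIV_directional[OF GDERIV_prox] filterlim_inverse_Suc_at_0])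
  qed measurable
  have "(\<lambda>x. \<Sum>b\<in>Basis. (gradient \<psi> x \<bullet> b) *\<^sub>R b) \<in> borel_measurable borel"
    using comp by measurable
  then show ?thesis by (simp add: euclidean_representation)
qed

lemma borel_measurable_prox_step [measurable]: "prox_step \<in> borel_measurable borel"
  by (rule borel_measurable_continuous_onI[OF continuous_prox_step])

section \<open>Radius, diameter and distortion of the prox-function\<close>

lemma bregman_le_radius:
  assumes "x \<in> X" "y \<in> X"
  shows "(s * D x y) powr (1 / s) \<le> prox_radius \<kappa> \<psi> X"
proof -
  obtain B where B: "\<And>x y. x \<in> X \<Longrightarrow> y \<in> X \<Longrightarrow> D x y \<le> B" using bregman_bounded by blast
  have e: "\<kappa> / (1 + \<kappa>) = 1 / s" using \<kappa> by (simp add: s)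
  have "bdd_above ((\<lambda>(x, y). (s * D x y) powr (1 / s)) ` (X \<times> X))"
    using B s2 bregman_nonneg by (intro bdd_aboveI[of _ "(s * B) powr (1 / s)"]) (auto intro!: powr_mono2)
  then show ?thesis
    unfolding prox_radius_def e s[symmetric] using assms
    using cSUP_upper[of "(x, y)" "X \<times> X" "\<lambda>(x, y). (s * D x y) powr (1 / s)"] by simp
qed

lemma lp_norm_le_radius:
  assumes "x \<in> X" "y \<in> X" shows "lp_norm p (x - y) \<le> prox_radius \<kappa> \<psi> X"
proof -
  have "lp_norm p (x - y) powr s \<le> s * D y x" using bregman_ge[of x y] s2 by (simp add: field_simps)
  then have "(lp_norm p (x - y) powr s) powr (1 / s) \<le> (s * D y x) powr (1 / s)"
    using s2 by (intro powr_mono2) auto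
  then show ?thesis using bregman_le_radius[OF assms(2,1)] s2 by (simp add: powr_powr)
qed

lemma lp_diameter_attained:
  "\<exists>x\<in>X. \<exists>y\<in>X. lp_diameter p X = lp_norm p (x - y)"
  and lp_norm_le_diameter: "u \<in> X \<Longrightarrow> v \<in> X \<Longrightarrow> lp_norm p (u - v) \<le> lp_diameter p X"
proof -
  have "continuous_on (X \<times> X) (\<lambda>z. lp_norm p (fst z - snd z))"
    by (rule continuous_on_compose2[OF continuous_on_lp_norm[OF p(1), of UNIV]]) (auto intro!: continuous_intros)
  moreover have "compact (X \<times> X)" "X \<times> X \<noteq> {}" using X by (auto intro: compact_Times)
  ultimately have "\<exists>z\<in>X \<times> X. \<forall>z'\<in>X \<times> X. lp_norm p (fst z' - snd z') \<le> lp_norm p (fst z - snd z)"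
    by (intro continuous_attains_sup)
  then obtain z where z: "z \<in> X \<times> X" "\<And>z'. z' \<in> X \<times> X \<Longrightarrow> lp_norm p (fst z' - snd z') \<le> lp_norm p (fst z - snd z)"
    by metis
  have eq: "lp_diameter p X = lp_norm p (fst z - snd z)"
    unfolding lp_diameter_def
  proof (rule cSup_eq_maximum)
    show "lp_norm p (fst z - snd z) \<in> (\<lambda>(x, y). lp_norm p (x - y)) ` (X \<times> X)"
      using z(1) by (intro image_eqI[of _ _ z]) (simp_all add: case_prod_beta)
    show "y \<le> lp_norm p (fst z - snd z)" if "y \<in> (\<lambda>(x, y). lp_norm p (x - y)) ` (X \<times> X)" for y
      using that z(2) by (auto simp: case_prod_beta)
  qed
  then show "\<exists>x\<in>X. \<exists>y\<in>X. lp_diameter p X = lp_norm p (x - y)" using z(1) by (auto simp: mem_Times_iff)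
  show "lp_norm p (u - v) \<le> lp_diameter p X" if "u \<in> X" "v \<in> X"
    using z(2)[of "(u, v)"] that eq by simp
qed

lemma far_point_exists:
  assumes "a \<in> X" obtains x where "x \<in> X" "lp_diameter p X \<le> 2 * lp_norm p (x - a)"
proof -
  obtain x y where xy: "x \<in> X" "y \<in> X" "lp_diameter p X = lp_norm p (x - y)" using lp_diameter_attained by blast
  have "lp_norm p ((x - a) + (a - y)) \<le> 2 * max (lp_norm p (x - a)) (lp_norm p (a - y))"
    using p(1) by (rule lp_norm_add_le_max)
  then have "lp_diameter p X \<le> 2 * lp_norm p (x - a) \<or> lp_diameter p X \<le> 2 * lp_norm p (y - a)"
    using xy by (auto simp: max_def lp_norm_minus_commute[of p a y] split: if_splits)
  then show thesis using xy that by blast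
qed

lemma lp_diameter_le_radius: "lp_diameter p X \<le> prox_radius \<kappa> \<psi> X"
  using lp_diameter_attained lp_norm_le_radius by fastforce

lemma lp_diameter_pos: assumes "prox_radius \<kappa> \<psi> X > 0" shows "lp_diameter p X > 0"
proof (rule ccontr)
  assume "\<not> lp_diameter p X > 0"
  then have eq: "x = y" if "x \<in> X" "y \<in> X" for x y
  proof -
    have "lp_norm p (x - y) = 0"
      using lp_norm_le_diameter[OF that] lp_norm_nonneg[of p "x - y"] \<open>\<not> lp_diameter p X > 0\<close> by linarith
    then show ?thesis using p lp_norm_eq_0_iff[of p "x - y"] by simp
  qed
  have e: "\<kappa> / (1 + \<kappa>) = 1 / s" using \<kappa> by (simp add: s)
  have zero: "(s * D x y) powr (1 / s) = 0" if "x \<in> X" "y \<in> X" for x y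
    using eq[OF that] by simp
  have "prox_radius \<kappa> \<psi> X = (SUP z\<in>X \<times> X. 0)"
    unfolding prox_radius_def e s[symmetric] by (rule SUP_cong) (auto simp: zero)
  then have "prox_radius \<kappa> \<psi> X = 0" using X(3) by simp
  then show False using assms by simp
qed

text \<open>A real supremum bounds its members only if the family is bounded. The numerator is at
  most the radius, and the floor in the denominator is positive because a positive radius forces a
  positive diameter. Without the floor the quotient could blow up near \<open>a\<close>, where
  uniform convexity yields no upper bound on the divergence.\<close>

lemma prox_distortion_ge:
  fixes a x :: "real ^ 'n" and N :: nat
  assumes R0: "prox_radius \<kappa> \<psi> X > 0"
  defines "\<Lambda> \<equiv> prox_distortion \<kappa> p \<psi> X a N"
  shows "1 \<le> \<Lambda>" "prox_radius \<kappa> \<psi> X \<le> \<Lambda> * lp_diameter p X"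
    "a \<in> X \<Longrightarrow> x \<in> X \<Longrightarrow> (s * D a x) powr (1 / s) \<le> \<Lambda> * max (lp_norm p (x - a)) (lp_diameter p X / 2 ^ N)"
proof -
  have e: "\<kappa> / (1 + \<kappa>) = 1 / s" using \<kappa> by (simp add: s)
  have diam: "lp_diameter p X > 0" using lp_diameter_pos[OF R0] .
  have \<Lambda>: "\<Lambda> = max (prox_radius \<kappa> \<psi> X / lp_diameter p X)
     (SUP x\<in>X. (s * D a x) powr (1 / s) / max (lp_norm p (x - a)) (lp_diameter p X / 2 ^ N))"
    unfolding \<Lambda>_def prox_distortion_def e s[symmetric] by (rule refl)
  have 1: "prox_radius \<kappa> \<psi> X / lp_diameter p X \<le> \<Lambda>" by (simp add: \<Lambda>)
  then show "prox_radius \<kappa> \<psi> X \<le> \<Lambda> * lp_diameter p X" using diam by (simp add: field_simps)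
  have "1 \<le> prox_radius \<kappa> \<psi> X / lp_diameter p X" using lp_diameter_le_radius diam by simp
  then show "1 \<le> \<Lambda>" using 1 by simp
  assume a: "a \<in> X" and x: "x \<in> X"
  define m where "m x = max (lp_norm p (x - a)) (lp_diameter p X / 2 ^ N)" for x
  have m: "m x \<ge> lp_diameter p X / 2 ^ N" for x by (auto simp: m_def)
  have diam_N: "lp_diameter p X / 2 ^ N > 0" using diam by simp
  have "bdd_above ((\<lambda>x. (s * D a x) powr (1 / s) / m x) ` X)"
  proof (rule bdd_aboveI2)
    fix x assume x: "x \<in> X"
    show "(s * D a x) powr (1 / s) / m x \<le> prox_radius \<kappa> \<psi> X / (lp_diameter p X / 2 ^ N)"
      using bregman_le_radius[OF a x] m[of x] R0 diam_N by (intro frac_le) auto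
  qed
  then have "(s * D a x) powr (1 / s) / m x \<le> \<Lambda>"
    unfolding \<Lambda> m_def[symmetric] using x by (intro max.coboundedI2 cSUP_upper)
  moreover have "m x > 0" using m[of x] diam_N by linarith
  ultimately show "(s * D a x) powr (1 / s) \<le> \<Lambda> * max (lp_norm p (x - a)) (lp_diameter p X / 2 ^ N)"
    by (simp add: m_def[symmetric] field_simps)
qed

end

section \<open>The gradient estimator\<close>

text \<open>The second moment of the product is split by the arithmetic-geometric mean inequality,
  with weights that balance the two fourth moments; Jensen with exponent \<open>\<alpha> / 2\<close>
  then lowers the order. The weights divide by \<open>A\<close>, so \<open>A = 0\<close> is treated
  first.\<close>

lemma (in prob_space) expectation_mult_powr_le:
  fixes k N :: "'a \<Rightarrow> real"
  assumes m [measurable]: "k \<in> borel_measurable M" "N \<in> borel_measurable M"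
    and k: "integrable M (\<lambda>x. k x ^ 4)" "expectation (\<lambda>x. k x ^ 4) \<le> A ^ 4" "A \<ge> 0"
    and N: "integrable M (\<lambda>x. N x ^ 4)" "expectation (\<lambda>x. N x ^ 4) \<le> C ^ 4" "C > 0"
    and \<alpha>: "0 < \<alpha>" "\<alpha> \<le> 2"
  shows "(\<integral>\<^sup>+x. ennreal (\<bar>k x * N x\<bar> powr \<alpha>) \<partial>M) \<le> ennreal ((A * C) powr \<alpha>)"
proof (cases "A = 0")
  case True
  have "AE x in M. k x ^ 4 = 0"
  proof (subst integral_nonneg_eq_0_iff_AE[OF k(1), symmetric])
    have "0 \<le> expectation (\<lambda>x. k x ^ 4)" by (rule Bochner_Integration.integral_nonneg) simp
    moreover have "expectation (\<lambda>x. k x ^ 4) \<le> 0" using k(2) True by simp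
    ultimately show "expectation (\<lambda>x. k x ^ 4) = 0" by (rule antisym[rotated])
  qed simp
  then have "(\<integral>\<^sup>+x. ennreal (\<bar>k x * N x\<bar> powr \<alpha>) \<partial>M) = (\<integral>\<^sup>+x. 0 \<partial>M)"
    by (intro nn_integral_cong_AE) (auto elim!: eventually_mono)
  then show ?thesis by simp
next
  case False
  then have A: "A > 0" using k by simp
  define Y where "Y x = (k x * N x)\<^sup>2" for x
  have le: "Y x \<le> (C\<^sup>2 / A\<^sup>2 * k x ^ 4 + A\<^sup>2 / C\<^sup>2 * N x ^ 4) / 2" for x
  proof -
    have "0 \<le> (C / A * (k x)\<^sup>2 - A / C * (N x)\<^sup>2)\<^sup>2" by simp
    also have "\<dots> = C\<^sup>2 / A\<^sup>2 * k x ^ 4 + A\<^sup>2 / C\<^sup>2 * N x ^ 4 - 2 * Y x"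
      using A N(3) by (simp add: Y_def power2_diff power_mult_distrib power_divide flip: power_mult)
    finally show ?thesis by simp
  qed
  have bint: "integrable M (\<lambda>x. (C\<^sup>2 / A\<^sup>2 * k x ^ 4 + A\<^sup>2 / C\<^sup>2 * N x ^ 4) / 2)" using k N by auto
  have [measurable]: "Y \<in> borel_measurable M" unfolding Y_def by measurable
  have Y_int: "integrable M Y"
    by (rule Bochner_Integration.integrable_bound[OF bint]) (use le in \<open>auto simp: Y_def intro!: AE_I2 order_trans[OF _ abs_ge_self]\<close>)
  have "expectation Y \<le> expectation (\<lambda>x. (C\<^sup>2 / A\<^sup>2 * k x ^ 4 + A\<^sup>2 / C\<^sup>2 * N x ^ 4) / 2)"
    by (intro integral_mono Y_int bint le)
  also have "\<dots> = (C\<^sup>2 / A\<^sup>2 * expectation (\<lambda>x. k x ^ 4) + A\<^sup>2 / C\<^sup>2 * expectation (\<lambda>x. N x ^ 4)) / 2"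
    using k N by simp
  also have "\<dots> \<le> (C\<^sup>2 / A\<^sup>2 * A ^ 4 + A\<^sup>2 / C\<^sup>2 * C ^ 4) / 2"
    using k N by (intro divide_right_mono add_mono mult_left_mono) auto
  also have "\<dots> = (A * C)\<^sup>2" using A N(3) by (simp add: field_simps eval_nat_numeral)
  finally have EY: "expectation Y \<le> (A * C)\<^sup>2" .
  have sq: "u\<^sup>2 powr (\<alpha> / 2) = \<bar>u\<bar> powr \<alpha>" for u :: real
  proof -
    have "u\<^sup>2 = \<bar>u\<bar> powr 2" by simp
    then show ?thesis by (simp only: powr_powr) simp
  qed
  note ex = expectation_powr_le[OF Y_int, of "\<alpha> / 2"]
  have Y0: "Y x \<ge> 0" for x by (simp add: Y_def)
  have "(\<integral>\<^sup>+x. ennreal (\<bar>k x * N x\<bar> powr \<alpha>) \<partial>M) = (\<integral>\<^sup>+x. ennreal (Y x powr (\<alpha> / 2)) \<partial>M)"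
    by (simp add: Y_def sq)
  also have "\<dots> = ennreal (expectation (\<lambda>x. Y x powr (\<alpha> / 2)))"
    using ex(1) Y0 \<alpha> by (intro nn_integral_eq_integral) auto
  also have "\<dots> \<le> ennreal (expectation Y powr (\<alpha> / 2))"
    using ex(2) Y0 \<alpha> by (intro ennreal_leI) auto
  also have "\<dots> \<le> ennreal (((A * C)\<^sup>2) powr (\<alpha> / 2))"
    using EY \<alpha> by (intro ennreal_leI powr_mono2) (auto intro!: Bochner_Integration.integral_nonneg Y0)
  also have "\<dots> = ennreal ((A * C) powr \<alpha>)" using A N(3) by (simp add: sq)
  finally show ?thesis .
qed

text \<open>Jensen from the second moment, whose constant 22 is rounded up to the square 25.\<close>

lemma uniform_sphere_abs_inner:
  fixes w :: "real ^ 'n"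
  shows "(\<integral>e. \<bar>w \<bullet> e\<bar> \<partial>uniform_sphere) \<le> 5 * norm w / sqrt (real CARD('n))"
proof -
  define d where "d = real CARD('n)"
  have d: "d > 0" by (simp add: d_def)
  have int: "integrable uniform_sphere (\<lambda>e. (w \<bullet> e)\<^sup>2)"
    by (intro integrable_uniform_sphere_continuous continuous_intros)
  have eq: "((w \<bullet> e)\<^sup>2) powr (1 / 2) = \<bar>w \<bullet> e\<bar>" for e by (simp add: powr_half_sqrt)
  have "(\<integral>e. \<bar>w \<bullet> e\<bar> \<partial>uniform_sphere) \<le> (\<integral>e. (w \<bullet> e)\<^sup>2 \<partial>uniform_sphere) powr (1 / 2)"
    using uniform_sphere.expectation_powr_le(2)[OF int, of "1 / 2"] by (simp only: eq) simp
  also have "\<dots> \<le> (22 * (norm w)\<^sup>2 / d) powr (1 / 2)"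
    using uniform_sphere_inner_moment[of 1 w] by (intro powr_mono2) (auto simp: d_def intro!: Bochner_Integration.integral_nonneg)
  also have "\<dots> \<le> ((5 * norm w)\<^sup>2 / d) powr (1 / 2)"
    using d by (intro powr_mono2 divide_right_mono) (auto simp: power_mult_distrib)
  also have "\<dots> = sqrt ((5 * norm w)\<^sup>2) / sqrt d" using d by (subst powr_half_sqrt) (auto simp: real_sqrt_divide)
  also have "sqrt ((5 * norm w)\<^sup>2) = 5 * norm w" by (subst real_sqrt_abs) simp
  finally show ?thesis by (simp add: d_def)
qed

lemma thicken_properties:
  fixes X :: "(real ^ 'n) set"
  assumes "compact X" "convex X" "\<tau> > 0"
  shows "compact (thicken X \<tau>)" "convex (thicken X \<tau>)"
    "\<And>x e. x \<in> X \<Longrightarrow> norm e \<le> 1 \<Longrightarrow> x + \<tau> *\<^sub>R e \<in> thicken X \<tau>" "X \<subseteq> thicken X \<tau>"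
proof -
  have eq: "thicken X \<tau> = (\<lambda>z. fst z + \<tau> *\<^sub>R snd z) ` (X \<times> cball 0 1)"
    by (auto simp: thicken_def image_iff) force+
  show "compact (thicken X \<tau>)"
    unfolding eq using assms by (intro compact_continuous_image compact_Times) (auto intro!: continuous_intros)
  have "convex (X \<times> cball (0 :: real ^ 'n) 1)" using assms by (intro convex_Times) auto
  moreover have "linear (\<lambda>z :: (real ^ 'n) \<times> (real ^ 'n). fst z + \<tau> *\<^sub>R snd z)"
    by (intro linearI) (auto simp: algebra_simps)
  ultimately show "convex (thicken X \<tau>)" unfolding eq by (rule convex_linear_image[rotated])
  show 1: "x + \<tau> *\<^sub>R e \<in> thicken X \<tau>" if "x \<in> X" "norm e \<le> 1" for x e
    using that by (auto simp: thicken_def)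
  show "X \<subseteq> thicken X \<tau>" using 1[of _ 0] by auto
qed

section \<open>One restart: the objective, its extensions and measurability\<close>

locale zo_step = prox_setup p \<kappa> s \<psi> X + data: prob_space Dm
  for p \<kappa> s :: real and \<psi> :: "real ^ 'n \<Rightarrow> real" and X :: "(real ^ 'n) set" and Dm :: "'s measure" +
  fixes q :: ennreal and f :: "real ^ 'n \<Rightarrow> 's \<Rightarrow> real" and F :: "real ^ 'n \<Rightarrow> real" and M2fun :: "'s \<Rightarrow> real"
    and M2 \<tau> \<Delta> :: real and \<delta> :: "real ^ 'n \<Rightarrow> real"
  assumes card2: "CARD('n) \<ge> 2" and q: "1 / ennreal p + 1 / q = 1"
    and \<tau>: "\<tau> > 0" and \<Delta>: "\<Delta> \<ge> 0" and M2: "M2 > 0"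
    and F: "\<And>x. F x = (\<integral>\<zeta>. f x \<zeta> \<partial>Dm)"
    and f_int: "\<And>x. x \<in> thicken X \<tau> \<Longrightarrow> integrable Dm (f x)"
    and f_convex: "\<And>\<zeta>. \<zeta> \<in> space Dm \<Longrightarrow> convex_on (thicken X \<tau>) (\<lambda>x. f x \<zeta>)"
    and f_lipschitz: "\<And>\<zeta> x1 x2. \<zeta> \<in> space Dm \<Longrightarrow> x1 \<in> thicken X \<tau> \<Longrightarrow> x2 \<in> thicken X \<tau> \<Longrightarrow>
      \<bar>f x1 \<zeta> - f x2 \<zeta>\<bar> \<le> M2fun \<zeta> * norm (x1 - x2)"
    and M2_moment: "integrable Dm (\<lambda>\<zeta>. M2fun \<zeta> powr (1 + \<kappa>))"
      "(\<integral>\<zeta>. M2fun \<zeta> powr (1 + \<kappa>) \<partial>Dm) \<le> M2 powr (1 + \<kappa>)"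
    and \<delta>_measurable: "\<delta> \<in> borel_measurable (restrict_space borel (thicken X \<tau>))"
    and \<delta>_bound: "\<And>x. x \<in> thicken X \<tau> \<Longrightarrow> \<bar>\<delta> x\<bar> \<le> \<Delta>"
begin

lemmas C_compact = thicken_properties(1)[OF X(1,2) \<tau>]
lemmas C_mem = thicken_properties(3)[OF X(1,2) \<tau>]
lemmas C_sub = thicken_properties(4)[OF X(1,2) \<tau>]

lemma C_nonempty: "thicken X \<tau> \<noteq> {}" using C_sub X(3) by auto

lemma C_mem2: "x \<in> X \<Longrightarrow> norm e \<le> 1 \<Longrightarrow> x - \<tau> *\<^sub>R e \<in> thicken X \<tau>"
  using C_mem[of x "- e"] by simp

text \<open>The Lipschitz inequality at two distinct points fixes the sign. The thickened set
  supplies a second point even if \<open>X\<close> is a singleton.\<close>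

lemma M2fun_nonneg: assumes "\<zeta> \<in> space Dm" shows "M2fun \<zeta> \<ge> 0"
proof -
  obtain x where x: "x \<in> X" using X(3) by blast
  define e :: "real ^ 'n" where "e = axis undefined 1"
  have e: "norm e = 1" by (simp add: e_def norm_axis_1)
  have "0 \<le> \<bar>f (x + \<tau> *\<^sub>R e) \<zeta> - f x \<zeta>\<bar>" by simp
  also have "\<dots> \<le> M2fun \<zeta> * norm (x + \<tau> *\<^sub>R e - x)"
    using x e C_sub by (intro f_lipschitz assms C_mem) auto
  finally show ?thesis using e \<tau> by (simp add: zero_le_mult_iff)
qed

text \<open>The moment hypothesis makes a power of the function measurable; on nonnegative values
  the function is recovered as a root of that power.\<close>

lemma M2fun_measurable [measurable]: "M2fun \<in> borel_measurable Dm"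
proof -
  have "(\<lambda>\<zeta>. (M2fun \<zeta> powr (1 + \<kappa>)) powr (1 / (1 + \<kappa>))) \<in> borel_measurable Dm"
    using borel_measurable_integrable[OF M2_moment(1)] by measurable
  then show ?thesis
    using M2fun_nonneg \<kappa> by (subst measurable_cong[where g="\<lambda>\<zeta>. (M2fun \<zeta> powr (1 + \<kappa>)) powr (1 / (1 + \<kappa>))"])
      (auto simp: powr_powr)
qed

lemma M2fun_int: "integrable Dm M2fun" and M2fun_mean: "(\<integral>\<zeta>. M2fun \<zeta> \<partial>Dm) \<le> M2"
proof -
  have eq: "(M2fun \<zeta> powr (1 + \<kappa>)) powr (1 / (1 + \<kappa>)) = M2fun \<zeta>" if "\<zeta> \<in> space Dm" for \<zeta>
    using M2fun_nonneg[OF that] \<kappa> by (simp add: powr_powr)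
  note ex = data.expectation_powr_le[OF M2_moment(1), of "1 / (1 + \<kappa>)"]
  have int: "integrable Dm (\<lambda>\<zeta>. (M2fun \<zeta> powr (1 + \<kappa>)) powr (1 / (1 + \<kappa>)))" using ex(1) \<kappa> by simp
  show "integrable Dm M2fun" using int by (subst Bochner_Integration.integrable_cong[OF refl, of _ _ "\<lambda>\<zeta>. (M2fun \<zeta> powr (1 + \<kappa>)) powr (1 / (1 + \<kappa>))"]) (auto simp: eq)
  have "(\<integral>\<zeta>. M2fun \<zeta> \<partial>Dm) = (\<integral>\<zeta>. (M2fun \<zeta> powr (1 + \<kappa>)) powr (1 / (1 + \<kappa>)) \<partial>Dm)"
    by (rule Bochner_Integration.integral_cong) (auto simp: eq)
  also have "\<dots> \<le> (\<integral>\<zeta>. M2fun \<zeta> powr (1 + \<kappa>) \<partial>Dm) powr (1 / (1 + \<kappa>))" using ex(2) \<kappa> by simp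
  also have "\<dots> \<le> (M2 powr (1 + \<kappa>)) powr (1 / (1 + \<kappa>))"
    using \<kappa> by (intro powr_mono2 M2_moment) (auto intro!: Bochner_Integration.integral_nonneg)
  also have "\<dots> = M2" using M2 \<kappa> by (simp add: powr_powr)
  finally show "(\<integral>\<zeta>. M2fun \<zeta> \<partial>Dm) \<le> M2" .
qed

lemma F_lipschitz:
  assumes "x \<in> thicken X \<tau>" "y \<in> thicken X \<tau>" shows "\<bar>F x - F y\<bar> \<le> M2 * norm (x - y)"
proof -
  have "F x - F y = (\<integral>\<zeta>. f x \<zeta> - f y \<zeta> \<partial>Dm)" unfolding F using assms f_int by simp
  also have "\<bar>\<dots>\<bar> \<le> (\<integral>\<zeta>. \<bar>f x \<zeta> - f y \<zeta>\<bar> \<partial>Dm)" by (rule integral_abs_bound)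
  also have "\<dots> \<le> (\<integral>\<zeta>. M2fun \<zeta> * norm (x - y) \<partial>Dm)"
    using assms f_int M2fun_int f_lipschitz by (intro integral_mono) auto
  also have "\<dots> \<le> M2 * norm (x - y)" using M2fun_mean M2fun_int by (simp add: mult_right_mono)
  finally show ?thesis .
qed

lemma F_convex: "convex_on X F"
proof (rule convex_onI)
  fix t x y assume t: "0 < t" "t < (1 :: real)" and xy: "x \<in> X" "y \<in> X"
  have mem: "(1 - t) *\<^sub>R x + t *\<^sub>R y \<in> thicken X \<tau>" using t xy X(2) C_sub convexD_alt[of X x y t] by auto
  have fxy: "integrable Dm (f x)" "integrable Dm (f y)" using xy C_sub by (auto intro: f_int)
  have "F ((1 - t) *\<^sub>R x + t *\<^sub>R y) \<le> (\<integral>\<zeta>. (1 - t) * f x \<zeta> + t * f y \<zeta> \<partial>Dm)"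
    unfolding F
  proof (rule integral_mono)
    show "integrable Dm (\<lambda>\<zeta>. (1 - t) * f x \<zeta> + t * f y \<zeta>)" using fxy by auto
    show "f ((1 - t) *\<^sub>R x + t *\<^sub>R y) \<zeta> \<le> (1 - t) * f x \<zeta> + t * f y \<zeta>" if "\<zeta> \<in> space Dm" for \<zeta>
      using t xy C_sub by (intro convex_onD[OF f_convex[OF that]]) auto
  qed (rule f_int[OF mem])
  also have "\<dots> = (1 - t) * F x + t * F y" unfolding F using fxy by simp
  finally show "F ((1 - t) *\<^sub>R x + t *\<^sub>R y) \<le> (1 - t) * F x + t * F y" .
qed (rule X)

lemma slice_extension:
  assumes "\<zeta> \<in> space Dm"
  obtains h where "convex_on UNIV h" "\<And>x y. \<bar>h x - h y\<bar> \<le> M2fun \<zeta> * norm (x - y)"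
    "\<And>x. x \<in> thicken X \<tau> \<Longrightarrow> h x = f x \<zeta>"
  using lipschitz_convex_extension[OF C_compact C_nonempty f_convex[OF assms] M2fun_nonneg[OF assms] f_lipschitz[OF assms]]
  by blast

text \<open>The extension is an infimal convolution over a countable dense set, which makes it measurable.\<close>

lemma joint_extension:
  obtains fe where "(\<lambda>(x, \<zeta>). fe x \<zeta>) \<in> borel_measurable (borel \<Otimes>\<^sub>M Dm)"
    "\<And>x \<zeta>. x \<in> thicken X \<tau> \<Longrightarrow> \<zeta> \<in> space Dm \<Longrightarrow> fe x \<zeta> = f x \<zeta>"
proof -
  obtain Q where Q: "countable Q" "Q \<subseteq> thicken X \<tau>" "Q \<noteq> {}"
    "\<And>x \<eta>. x \<in> thicken X \<tau> \<Longrightarrow> \<eta> > 0 \<Longrightarrow> \<exists>c\<in>Q. norm (x - c) < \<eta>"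
  proof -
    obtain Q where Q: "countable Q" "Q \<subseteq> thicken X \<tau>" "thicken X \<tau> \<subseteq> closure Q" by (rule separable)
    then have "Q \<noteq> {}" using C_nonempty by auto
    moreover have "\<exists>c\<in>Q. norm (x - c) < \<eta>" if "x \<in> thicken X \<tau>" "\<eta> > 0" for x \<eta>
    proof -
      have "x \<in> closure Q" using that Q by auto
      then show ?thesis using that(2) by (auto simp: closure_approachable dist_norm norm_minus_commute)
    qed
    ultimately show thesis using Q that by blast
  qed
  define fe where "fe x \<zeta> = (INF c\<in>Q. f c \<zeta> + M2fun \<zeta> * norm (x - c))" for x \<zeta>
  have "(\<lambda>z. INF c\<in>Q. f c (snd z) + M2fun (snd z) * norm (fst z - c)) \<in> borel_measurable (borel \<Otimes>\<^sub>M Dm)"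
  proof (rule borel_measurable_cINF_real[OF Q(1)])
    fix c assume "c \<in> Q"
    then have [measurable]: "f c \<in> borel_measurable Dm" using Q(2) f_int by blast
    show "(\<lambda>z. f c (snd z) + M2fun (snd z) * norm (fst z - c)) \<in> borel_measurable (borel \<Otimes>\<^sub>M Dm)" by measurable
  qed
  then have meas: "(\<lambda>(x, \<zeta>). fe x \<zeta>) \<in> borel_measurable (borel \<Otimes>\<^sub>M Dm)" by (simp add: fe_def case_prod_beta')
  have "fe x \<zeta> = f x \<zeta>" if x: "x \<in> thicken X \<tau>" and z: "\<zeta> \<in> space Dm" for x \<zeta>
  proof (rule antisym)
    have lb: "f x \<zeta> \<le> f c \<zeta> + M2fun \<zeta> * norm (x - c)" if "c \<in> Q" for c
      using f_lipschitz[OF z x, of c] that Q(2) by auto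
    then show "f x \<zeta> \<le> fe x \<zeta>" unfolding fe_def by (intro cINF_greatest Q)
    show "fe x \<zeta> \<le> f x \<zeta>"
    proof (rule field_le_epsilon)
      fix \<eta> :: real assume \<eta>: "\<eta> > 0"
      have M0: "M2fun \<zeta> \<ge> 0" by (rule M2fun_nonneg[OF z])
      \<comment> \<open>The factor 2 covers the penalty and the change of \<open>f\<close> between
        \<open>x\<close> and \<open>c\<close>; the added 1 avoids division by zero when the
        Lipschitz constant vanishes.\<close>
      define e where "e = \<eta> / (2 * M2fun \<zeta> + 1)"
      have e: "e > 0" using \<eta> M0 by (simp add: e_def)
      obtain c where c: "c \<in> Q" "norm (x - c) < e" using Q(4)[OF x e] by blast
      have "fe x \<zeta> \<le> f c \<zeta> + M2fun \<zeta> * norm (x - c)"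
        unfolding fe_def by (rule cINF_lower[OF bdd_belowI2[of Q "f x \<zeta>"] c(1)]) (rule lb)
      also have "f c \<zeta> \<le> f x \<zeta> + M2fun \<zeta> * norm (x - c)"
        using f_lipschitz[OF z x, of c] c(1) Q(2) by auto
      also have "f x \<zeta> + M2fun \<zeta> * norm (x - c) + M2fun \<zeta> * norm (x - c) \<le> f x \<zeta> + (2 * M2fun \<zeta> + 1) * e"
        using mult_left_mono[OF less_imp_le[OF c(2)] M0] e by (simp add: algebra_simps)
      also have "\<dots> = f x \<zeta> + \<eta>" using M0 by (simp add: e_def)
      finally show "fe x \<zeta> \<le> f x \<zeta> + \<eta>" by simp
    qed
  qed
  then show thesis using meas that by blast
qed

abbreviation Z :: "((real ^ 'n) \<times> 's) measure" where "Z \<equiv> uniform_sphere \<Otimes>\<^sub>M Dm"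

lemma pair_sigma_finite_Z: "pair_sigma_finite (uniform_sphere :: (real ^ 'n) measure) Dm"
  by (simp add: pair_sigma_finite_def uniform_sphere.sigma_finite_measure_axioms data.sigma_finite_measure_axioms)

lemma prob_space_Z: "prob_space (Z :: ((real ^ 'n) \<times> 's) measure)"
proof -
  interpret pair_prob_space "uniform_sphere :: (real ^ 'n) measure" Dm
    by (simp add: pair_prob_space_def pair_sigma_finite_Z uniform_sphere.prob_space_axioms data.prob_space_axioms)
  show ?thesis by (rule prob_space_axioms)
qed

lemma space_Z: "z \<in> space Z \<longleftrightarrow> norm (fst z) = 1 \<and> snd z \<in> space Dm"
  by (cases z) (simp add: space_pair_measure)

lemma zo_gradient_measurable:
  "(\<lambda>(x, z). zo_gradient f \<delta> \<tau> x z) \<in> borel_measurable (restrict_space borel X \<Otimes>\<^sub>M Z)"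
proof -
  obtain fe where fe [measurable]: "(\<lambda>(x, \<zeta>). fe x \<zeta>) \<in> borel_measurable (borel \<Otimes>\<^sub>M Dm)"
    and fe_eq: "\<And>x \<zeta>. x \<in> thicken X \<tau> \<Longrightarrow> \<zeta> \<in> space Dm \<Longrightarrow> fe x \<zeta> = f x \<zeta>"
    using joint_extension by blast
  \<comment> \<open>The noise is measurable only on the thickened set and is extended by zero.
    Directions in the sample space have norm exactly 1, so all queries stay in that set and the
    extensions leave the estimator unchanged.\<close>
  define de where "de x = indicator (thicken X \<tau>) x * \<delta> x" for x
  have de [measurable]: "de \<in> borel_measurable borel"
    using \<delta>_measurable compact_imp_closed[OF C_compact]
    by (subst (asm) borel_measurable_restrict_space_iff) (auto simp: de_def[abs_def])
  have id_X [measurable]: "(\<lambda>x. x) \<in> restrict_space borel X \<rightarrow>\<^sub>M borel" by (rule measurable_restrict_space1) simp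
  have id_U [measurable]: "(\<lambda>x. x) \<in> (uniform_sphere :: (real ^ 'n) measure) \<rightarrow>\<^sub>M borel"
    by (rule borel_measurable_uniform_sphere) simp
  have [measurable]: "(\<lambda>w. fst w) \<in> restrict_space borel X \<Otimes>\<^sub>M Z \<rightarrow>\<^sub>M (borel :: (real ^ 'n) measure)"
    by (rule measurable_compose[OF measurable_fst id_X])
  have [measurable]: "(\<lambda>w. fst (snd w)) \<in> restrict_space borel X \<Otimes>\<^sub>M Z \<rightarrow>\<^sub>M (borel :: (real ^ 'n) measure)"
    by (rule measurable_compose[OF measurable_compose[OF measurable_snd measurable_fst] id_U])
  have [measurable]: "(\<lambda>w. snd (snd w)) \<in> restrict_space borel X \<Otimes>\<^sub>M Z \<rightarrow>\<^sub>M Dm"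
    by (rule measurable_compose[OF measurable_snd measurable_snd])
  have fe' [measurable]: "(\<lambda>w. fe (g w) (h w)) \<in> borel_measurable N"
    if "g \<in> N \<rightarrow>\<^sub>M borel" "h \<in> N \<rightarrow>\<^sub>M Dm" for g h and N :: "'b measure"
    using measurable_compose[OF measurable_Pair[OF that] fe] by simp
  have "(\<lambda>w. (real CARD('n) / (2 * \<tau>) * ((fe (fst w + \<tau> *\<^sub>R fst (snd w)) (snd (snd w)) + de (fst w + \<tau> *\<^sub>R fst (snd w))) -
      (fe (fst w - \<tau> *\<^sub>R fst (snd w)) (snd (snd w)) + de (fst w - \<tau> *\<^sub>R fst (snd w))))) *\<^sub>R fst (snd w))
    \<in> borel_measurable (restrict_space borel X \<Otimes>\<^sub>M Z)"
    by measurable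
  then show ?thesis
  proof (subst measurable_cong)
    fix w assume "w \<in> space (restrict_space borel X \<Otimes>\<^sub>M Z)"
    then have w: "fst w \<in> X" "norm (fst (snd w)) = 1" "snd (snd w) \<in> space Dm"
      by (auto simp: space_pair_measure space_restrict_space)
    have "fst w + \<tau> *\<^sub>R fst (snd w) \<in> thicken X \<tau>" "fst w - \<tau> *\<^sub>R fst (snd w) \<in> thicken X \<tau>"
      using w by (auto intro!: C_mem C_mem2)
    then show "(case w of (x, z) \<Rightarrow> zo_gradient f \<delta> \<tau> x z) =
      (real CARD('n) / (2 * \<tau>) * ((fe (fst w + \<tau> *\<^sub>R fst (snd w)) (snd (snd w)) + de (fst w + \<tau> *\<^sub>R fst (snd w))) -
      (fe (fst w - \<tau> *\<^sub>R fst (snd w)) (snd (snd w)) + de (fst w - \<tau> *\<^sub>R fst (snd w))))) *\<^sub>R fst (snd w)"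
      using w by (simp add: zo_gradient_def noisy_oracle_def case_prod_beta' fe_eq de_def)
  qed
qed

lemma zo_gradient_measurable_slice:
  assumes "x \<in> X" shows "zo_gradient f \<delta> \<tau> x \<in> borel_measurable Z"
  using measurable_compose[OF measurable_Pair1' zo_gradient_measurable, of x] assms by (simp add: space_restrict_space)

end

section \<open>Moment and bias of the estimator, and one expected step\<close>

context zo_step
begin

lemma sigma_powr:
  "sigma_const \<kappa> (real CARD('n)) q M2 \<Delta> \<tau> powr (1 + \<kappa>) =
    2 powr \<kappa> * (sqrt (real CARD('n)) / 2 powr (1 / 4) * a_const (real CARD('n)) q * M2) powr (1 + \<kappa>) +
    2 powr \<kappa> * (real CARD('n) * a_const (real CARD('n)) q * \<Delta> / \<tau>) powr (1 + \<kappa>)"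
  using \<kappa> by (simp add: sigma_const_def powr_powr)

definition scale :: "real ^ 'n \<Rightarrow> (real ^ 'n) \<times> 's \<Rightarrow> real" where
  "scale x z = real CARD('n) / (2 * \<tau>) *
    (noisy_oracle f \<delta> (x + \<tau> *\<^sub>R fst z) (snd z) - noisy_oracle f \<delta> (x - \<tau> *\<^sub>R fst z) (snd z))"

lemma zo_gradient_scale: "zo_gradient f \<delta> \<tau> x z = scale x z *\<^sub>R fst z"
  by (simp add: zo_gradient_def scale_def case_prod_beta)

text \<open>The direction is a unit vector, so the scalar factor is the inner product of the
  estimator with it.\<close>

lemma scale_measurable:
  assumes "x \<in> X" shows "scale x \<in> borel_measurable Z"
proof -
  have [measurable]: "(\<lambda>z. fst z) \<in> Z \<rightarrow>\<^sub>M borel"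
    by (rule measurable_compose[OF measurable_fst borel_measurable_uniform_sphere[of "\<lambda>x. x"]]) simp
  have [measurable]: "zo_gradient f \<delta> \<tau> x \<in> borel_measurable Z" by (rule zo_gradient_measurable_slice[OF assms])
  have "(\<lambda>z. zo_gradient f \<delta> \<tau> x z \<bullet> fst z) \<in> borel_measurable Z" by measurable
  then show ?thesis
  proof (subst measurable_cong)
    fix z assume "z \<in> space Z"
    then have "fst z \<bullet> fst z = 1" by (simp add: space_Z power2_norm_eq_inner[symmetric])
    then show "scale x z = zo_gradient f \<delta> \<tau> x z \<bullet> fst z" by (simp add: zo_gradient_scale)
  qed
qed

lemma scale_decomposition:
  assumes x: "x \<in> X" and z: "norm e = 1" "\<zeta> \<in> space Dm"
  obtains \<eta> where "\<bar>\<eta>\<bar> \<le> real CARD('n) * \<Delta> / \<tau>"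
    "scale x (e, \<zeta>) = real CARD('n) / (2 * \<tau>) * (f (x + \<tau> *\<^sub>R e) \<zeta> - f (x - \<tau> *\<^sub>R e) \<zeta>) + \<eta>"
proof
  let ?\<eta> = "real CARD('n) / (2 * \<tau>) * (\<delta> (x + \<tau> *\<^sub>R e) - \<delta> (x - \<tau> *\<^sub>R e))"
  show "scale x (e, \<zeta>) = real CARD('n) / (2 * \<tau>) * (f (x + \<tau> *\<^sub>R e) \<zeta> - f (x - \<tau> *\<^sub>R e) \<zeta>) + ?\<eta>"
    by (simp add: scale_def noisy_oracle_def algebra_simps)
  have "\<bar>\<delta> (x + \<tau> *\<^sub>R e)\<bar> \<le> \<Delta>" "\<bar>\<delta> (x - \<tau> *\<^sub>R e)\<bar> \<le> \<Delta>" using x z by (auto intro!: \<delta>_bound C_mem C_mem2)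
  then have "\<bar>\<delta> (x + \<tau> *\<^sub>R e) - \<delta> (x - \<tau> *\<^sub>R e)\<bar> \<le> 2 * \<Delta>" by linarith
  then have "real CARD('n) / (2 * \<tau>) * \<bar>\<delta> (x + \<tau> *\<^sub>R e) - \<delta> (x - \<tau> *\<^sub>R e)\<bar> \<le> real CARD('n) / (2 * \<tau>) * (2 * \<Delta>)"
    using \<tau> by (intro mult_left_mono) auto
  then show "\<bar>?\<eta>\<bar> \<le> real CARD('n) * \<Delta> / \<tau>" using \<tau> by (simp add: abs_mult)
qed

text \<open>\<open>G\<close> bounds the dual norm of the estimator by its scalar factor times the
  surrogate norm of the direction. For a fixed data sample the two-point difference is odd in the
  direction, so concentration on the sphere reduces the dimension factor to \<open>sqrt d\<close>.
  The noise is only bounded in absolute value and keeps the full dimension. These are the two terms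
  of \<open>sigma_const\<close>.\<close>

lemma estimator_moment:
  obtains G where "\<And>x. x \<in> X \<Longrightarrow> G x \<in> borel_measurable Z" "\<And>x z. G x z \<ge> 0"
    "\<And>x z v. \<bar>zo_gradient f \<delta> \<tau> x z \<bullet> v\<bar> \<le> G x z * lp_norm p v"
    "\<And>x. x \<in> X \<Longrightarrow> (\<integral>\<^sup>+z. ennreal (G x z powr (1 + \<kappa>)) \<partial>Z) \<le> ennreal ((720 * sigma_const \<kappa> (real CARD('n)) q M2 \<Delta> \<tau>) powr (1 + \<kappa>))"
proof -
  define d where "d = real CARD('n)"
  define a where "a = a_const d q"
  obtain Nn :: "real ^ 'n \<Rightarrow> real" where Nn: "continuous_on UNIV Nn" "\<And>e. Nn e \<ge> 0"
    "\<And>e x. \<bar>e \<bullet> x\<bar> \<le> Nn e * lp_norm p x" "(\<integral>e. Nn e ^ 4 \<partial>uniform_sphere) \<le> (8 * a) ^ 4" "a > 0"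
    using uniform_sphere_dual_norm[OF card2 p q] unfolding a_def d_def by blast
  have d: "d > 0" by (simp add: d_def)
  have Nn_m [measurable]: "Nn \<in> borel_measurable uniform_sphere"
    by (intro borel_measurable_uniform_sphere borel_measurable_continuous_onI Nn)
  have N4: "integrable uniform_sphere (\<lambda>e. Nn e ^ 4)"
    by (intro integrable_uniform_sphere_continuous continuous_intros Nn)
  define G where "G x z = \<bar>scale x z\<bar> * Nn (fst z)" for x z
  interpret P: pair_sigma_finite "uniform_sphere :: (real ^ 'n) measure" Dm by (rule pair_sigma_finite_Z)
  show thesis
  proof
    show G_m: "G x \<in> borel_measurable Z" if "x \<in> X" for x
      using scale_measurable[OF that] unfolding G_def by measurable
    show "G x z \<ge> 0" for x z by (simp add: G_def Nn)
    show "\<bar>zo_gradient f \<delta> \<tau> x z \<bullet> v\<bar> \<le> G x z * lp_norm p v" for x z v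
      using mult_left_mono[OF Nn(3)[of "fst z" v], of "\<bar>scale x z\<bar>"]
      by (simp add: zo_gradient_scale G_def abs_mult mult.assoc)
    fix x assume x: "x \<in> X"
    \<comment> \<open>600 is \<open>150 * 8 / 2\<close>: the deviation constant, the dual-norm
      constant, and the 2 in the denominator of the estimator.\<close>
    define c0 where "c0 = (600 * sqrt d * a) powr (1 + \<kappa>)"
    define c1 where "c1 = (8 * (d * a * \<Delta> / \<tau>)) powr (1 + \<kappa>)"
    have inner: "(\<integral>\<^sup>+e. ennreal (G x (e, \<zeta>) powr (1 + \<kappa>)) \<partial>uniform_sphere) \<le>
        ennreal (2 powr \<kappa> * (c0 * M2fun \<zeta> powr (1 + \<kappa>) + c1))" if z: "\<zeta> \<in> space Dm" for \<zeta>
    proof -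
      obtain h where h: "convex_on UNIV h" "\<And>x y. \<bar>h x - h y\<bar> \<le> M2fun \<zeta> * norm (x - y)"
        "\<And>x. x \<in> thicken X \<tau> \<Longrightarrow> h x = f x \<zeta>" using slice_extension[OF z] by blast
      define H where "H b = h (x + \<tau> *\<^sub>R b)" for b
      define k where "k e = H e - H (- e)" for e
      have M0: "M2fun \<zeta> \<ge> 0" by (rule M2fun_nonneg[OF z])
      have H: "convex_on UNIV H" "\<And>a b. \<bar>H a - H b\<bar> \<le> (\<tau> * M2fun \<zeta>) * norm (a - b)"
        unfolding H_def using h(2)[of "x + \<tau> *\<^sub>R _" "x + \<tau> *\<^sub>R _"] \<tau>
        by (auto intro: convex_on_affine_compose h simp: mult_ac simp flip: scaleR_diff_right)
      have H_cont: "continuous_on UNIV H" using H(2) by (intro lipschitz_imp_continuous[of UNIV H]) auto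
      have k_cont: "continuous_on UNIV k"
        unfolding k_def by (intro continuous_intros H_cont continuous_on_compose2[OF H_cont]) auto
      have [measurable]: "k \<in> borel_measurable uniform_sphere"
        by (intro borel_measurable_uniform_sphere borel_measurable_continuous_onI k_cont)
      have k4: "integrable uniform_sphere (\<lambda>e. k e ^ 4)"
        by (intro integrable_uniform_sphere_continuous continuous_intros k_cont)
      define A where "A = 150 * (\<tau> * M2fun \<zeta>) / sqrt d"
      have A0: "A \<ge> 0" using \<tau> M0 d by (simp add: A_def)
      have "(\<integral>e. k e ^ 4 \<partial>uniform_sphere) \<le> (150 * (\<tau> * M2fun \<zeta>)) ^ 4 / d\<^sup>2"
        unfolding k_def d_def by (rule uniform_sphere_convex_concentration[OF H]) (use \<tau> M0 in simp)
      also have "\<dots> = A ^ 4"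
      proof -
        have "sqrt d ^ 4 = d\<^sup>2" using d power_mult[of "sqrt d" 2 2] by simp
        then show ?thesis by (simp add: A_def power_divide)
      qed
      finally have k4_le: "(\<integral>e. k e ^ 4 \<partial>uniform_sphere) \<le> A ^ 4" .
      have kN: "(\<integral>\<^sup>+e. ennreal (\<bar>k e * Nn e\<bar> powr (1 + \<kappa>)) \<partial>uniform_sphere) \<le> ennreal ((A * (8 * a)) powr (1 + \<kappa>))"
        using Nn k4 k4_le A0 N4 \<kappa> by (intro uniform_sphere.expectation_mult_powr_le) auto
      have oneN: "(\<integral>\<^sup>+e. ennreal (\<bar>1 * Nn e\<bar> powr (1 + \<kappa>)) \<partial>uniform_sphere) \<le> ennreal ((1 * (8 * a)) powr (1 + \<kappa>))"
        using Nn N4 \<kappa> uniform_sphere.prob_space[where ?'n='n]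
        by (intro uniform_sphere.expectation_mult_powr_le) auto
      have pw: "G x (e, \<zeta>) powr (1 + \<kappa>) \<le> 2 powr \<kappa> * ((d / (2 * \<tau>)) powr (1 + \<kappa>) * \<bar>k e * Nn e\<bar> powr (1 + \<kappa>) + (d * \<Delta> / \<tau>) powr (1 + \<kappa>) * \<bar>1 * Nn e\<bar> powr (1 + \<kappa>))"
        if e: "norm e = 1" for e
      proof -
        obtain \<eta> where \<eta>: "\<bar>\<eta>\<bar> \<le> d * \<Delta> / \<tau>"
          "scale x (e, \<zeta>) = d / (2 * \<tau>) * (f (x + \<tau> *\<^sub>R e) \<zeta> - f (x - \<tau> *\<^sub>R e) \<zeta>) + \<eta>"
          using scale_decomposition[OF x e z] unfolding d_def by blast
        have "f (x + \<tau> *\<^sub>R e) \<zeta> - f (x - \<tau> *\<^sub>R e) \<zeta> = k e"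
          using h(3)[OF C_mem[OF x, of e]] h(3)[OF C_mem[OF x, of "- e"]] e by (simp add: k_def H_def)
        then have sc: "scale x (e, \<zeta>) = d / (2 * \<tau>) * k e + \<eta>" using \<eta>(2) by simp
        have "\<bar>scale x (e, \<zeta>)\<bar> \<le> d / (2 * \<tau>) * \<bar>k e\<bar> + d * \<Delta> / \<tau>"
          unfolding sc using \<eta>(1) \<tau> d abs_triangle_ineq[of "d / (2 * \<tau>) * k e" \<eta>] by (simp add: abs_mult)
        then have "G x (e, \<zeta>) \<le> (d / (2 * \<tau>) * \<bar>k e\<bar> + d * \<Delta> / \<tau>) * Nn e"
          unfolding G_def by (simp add: mult_right_mono Nn)
        also have "\<dots> = d / (2 * \<tau>) * \<bar>k e * Nn e\<bar> + d * \<Delta> / \<tau> * \<bar>1 * Nn e\<bar>"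
          using Nn(2)[of e] by (simp add: abs_mult algebra_simps)
        finally have "G x (e, \<zeta>) powr (1 + \<kappa>) \<le> (d / (2 * \<tau>) * \<bar>k e * Nn e\<bar> + d * \<Delta> / \<tau> * \<bar>1 * Nn e\<bar>) powr (1 + \<kappa>)"
          using \<kappa> by (intro powr_mono2) (auto simp: G_def Nn)
        also have "\<dots> \<le> 2 powr (1 + \<kappa> - 1) * ((d / (2 * \<tau>) * \<bar>k e * Nn e\<bar>) powr (1 + \<kappa>) + (d * \<Delta> / \<tau> * \<bar>1 * Nn e\<bar>) powr (1 + \<kappa>))"
          using \<kappa> d \<tau> \<Delta> by (intro powr_add_le) auto
        finally show ?thesis by (simp only: powr_mult add_diff_cancel_left')
      qed
      have "(\<integral>\<^sup>+e. ennreal (G x (e, \<zeta>) powr (1 + \<kappa>)) \<partial>uniform_sphere) \<le>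
          (\<integral>\<^sup>+e. ennreal (2 powr \<kappa> * (d / (2 * \<tau>)) powr (1 + \<kappa>)) * ennreal (\<bar>k e * Nn e\<bar> powr (1 + \<kappa>)) + ennreal (2 powr \<kappa> * (d * \<Delta> / \<tau>) powr (1 + \<kappa>)) * ennreal (\<bar>1 * Nn e\<bar> powr (1 + \<kappa>)) \<partial>uniform_sphere)"
      proof (intro nn_integral_mono)
        fix e :: "real ^ 'n" assume "e \<in> space uniform_sphere"
        then have e: "norm e = 1" by simp
        show "ennreal (G x (e, \<zeta>) powr (1 + \<kappa>)) \<le> ennreal (2 powr \<kappa> * (d / (2 * \<tau>)) powr (1 + \<kappa>)) * ennreal (\<bar>k e * Nn e\<bar> powr (1 + \<kappa>)) + ennreal (2 powr \<kappa> * (d * \<Delta> / \<tau>) powr (1 + \<kappa>)) * ennreal (\<bar>1 * Nn e\<bar> powr (1 + \<kappa>))"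
          using ennreal_leI[OF pw[OF e]]
          by (simp add: ennreal_mult'[symmetric] ennreal_plus[symmetric] algebra_simps del: ennreal_plus)
      qed
      also have "\<dots> = ennreal (2 powr \<kappa> * (d / (2 * \<tau>)) powr (1 + \<kappa>)) * (\<integral>\<^sup>+e. ennreal (\<bar>k e * Nn e\<bar> powr (1 + \<kappa>)) \<partial>uniform_sphere) + ennreal (2 powr \<kappa> * (d * \<Delta> / \<tau>) powr (1 + \<kappa>)) * (\<integral>\<^sup>+e. ennreal (\<bar>1 * Nn e\<bar> powr (1 + \<kappa>)) \<partial>uniform_sphere)"
        by (subst nn_integral_add) (auto simp: nn_integral_cmult)
      also have "\<dots> \<le> ennreal (2 powr \<kappa> * (d / (2 * \<tau>)) powr (1 + \<kappa>)) * ennreal ((A * (8 * a)) powr (1 + \<kappa>)) + ennreal (2 powr \<kappa> * (d * \<Delta> / \<tau>) powr (1 + \<kappa>)) * ennreal ((1 * (8 * a)) powr (1 + \<kappa>))"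
        by (intro add_mono mult_left_mono kN oneN) auto
      also have "\<dots> = ennreal (2 powr \<kappa> * ((d / (2 * \<tau>) * (A * (8 * a))) powr (1 + \<kappa>) + (d * \<Delta> / \<tau> * (8 * a)) powr (1 + \<kappa>)))"
      proof -
        have eq: "2 powr \<kappa> * (d / (2 * \<tau>)) powr (1 + \<kappa>) * (A * (8 * a)) powr (1 + \<kappa>) + 2 powr \<kappa> * (d * \<Delta> / \<tau>) powr (1 + \<kappa>) * (1 * (8 * a)) powr (1 + \<kappa>) =
            2 powr \<kappa> * ((d / (2 * \<tau>) * (A * (8 * a))) powr (1 + \<kappa>) + (d * \<Delta> / \<tau> * (8 * a)) powr (1 + \<kappa>))"
          by (simp only: powr_mult distrib_left mult.assoc mult_1_left)
        have ee: "ennreal b1 * ennreal b2 + ennreal b3 * ennreal b4 = ennreal (b1 * b2 + b3 * b4)"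
          if "b1 \<ge> 0" "b2 \<ge> 0" "b3 \<ge> 0" "b4 \<ge> 0" for b1 b2 b3 b4
          using that by (simp add: ennreal_mult')
        show ?thesis by (subst ee, simp, simp, simp, simp, subst eq, rule refl)
      qed
      also have "d / (2 * \<tau>) * (A * (8 * a)) = 600 * sqrt d * a * M2fun \<zeta>"
      proof -
        have "d = sqrt d * sqrt d" using d by simp
        then have "d / sqrt d = sqrt d" using d by (metis less_irrefl nonzero_mult_div_cancel_right real_sqrt_eq_zero_cancel_iff)
        moreover have "d / (2 * \<tau>) * (A * (8 * a)) = 600 * (d / sqrt d) * a * M2fun \<zeta>"
          using \<tau> by (simp add: A_def)
        ultimately show ?thesis by simp
      qed
      also have "(600 * sqrt d * a * M2fun \<zeta>) powr (1 + \<kappa>) = c0 * M2fun \<zeta> powr (1 + \<kappa>)"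
        using d Nn(5) M0 by (simp add: c0_def powr_mult)
      also have "(d * \<Delta> / \<tau> * (8 * a)) powr (1 + \<kappa>) = c1" by (simp add: c1_def mult_ac)
      finally show ?thesis .
    qed
    have cn: "c0 \<ge> 0" "c1 \<ge> 0" by (simp_all add: c0_def c1_def)
    have "(\<integral>\<^sup>+z. ennreal (G x z powr (1 + \<kappa>)) \<partial>Z) = (\<integral>\<^sup>+\<zeta>. \<integral>\<^sup>+e. ennreal (G x (e, \<zeta>) powr (1 + \<kappa>)) \<partial>uniform_sphere \<partial>Dm)"
      by (rule P.nn_integral_snd[symmetric]) (use G_m[OF x] in measurable)
    also have "\<dots> \<le> (\<integral>\<^sup>+\<zeta>. ennreal (2 powr \<kappa> * (c0 * M2fun \<zeta> powr (1 + \<kappa>) + c1)) \<partial>Dm)"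
      by (intro nn_integral_mono inner)
    also have "\<dots> = ennreal (\<integral>\<zeta>. 2 powr \<kappa> * (c0 * M2fun \<zeta> powr (1 + \<kappa>) + c1) \<partial>Dm)"
      using M2_moment(1) cn by (intro nn_integral_eq_integral) auto
    also have "(\<integral>\<zeta>. 2 powr \<kappa> * (c0 * M2fun \<zeta> powr (1 + \<kappa>) + c1) \<partial>Dm) = 2 powr \<kappa> * (c0 * (\<integral>\<zeta>. M2fun \<zeta> powr (1 + \<kappa>) \<partial>Dm) + c1)"
      using M2_moment(1) by (simp add: data.prob_space)
    also have "\<dots> \<le> 2 powr \<kappa> * (c0 * M2 powr (1 + \<kappa>) + c1)"
      using M2_moment(2) cn by (intro mult_left_mono add_right_mono) auto
    also have "c0 * M2 powr (1 + \<kappa>) \<le> (720 * (sqrt d / 2 powr (1 / 4) * a * M2)) powr (1 + \<kappa>)"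
    proof -
      \<comment> \<open>\<open>sigma_const\<close> divides by the fourth root of 2, which is at most
        1.2; hence 720 in place of 600.\<close>
      have "(2 :: real) powr (1 / 4) \<le> (1.2 ^ 4) powr (1 / 4)" by (intro powr_mono2) (auto simp: power_divide)
      also have "(1.2 ^ 4 :: real) powr (1 / 4) = 1.2"
      proof -
        have "(1.2 ^ 4 :: real) = 1.2 powr 4" by simp
        then show ?thesis by (simp only: powr_powr) simp
      qed
      finally have q: "(2 :: real) powr (1 / 4) \<le> 1.2" .
      have "c0 * M2 powr (1 + \<kappa>) = (600 * (sqrt d * a * M2)) powr (1 + \<kappa>)"
        using d Nn(5) M2 by (simp add: c0_def powr_mult)
      also have "\<dots> \<le> (720 / 2 powr (1 / 4) * (sqrt d * a * M2)) powr (1 + \<kappa>)"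
      proof (intro powr_mono2 mult_right_mono)
        show "600 \<le> 720 / (2 :: real) powr (1 / 4)" using q by (simp add: field_simps)
      qed (use d Nn(5) M2 \<kappa> in auto)
      finally show ?thesis by (simp add: mult_ac)
    qed
    also have "c1 \<le> (720 * (d * a * \<Delta> / \<tau>)) powr (1 + \<kappa>)"
      unfolding c1_def using d Nn(5) \<Delta> \<tau> \<kappa> by (intro powr_mono2 mult_right_mono) auto
    also have "2 powr \<kappa> * ((720 * (sqrt d / 2 powr (1 / 4) * a * M2)) powr (1 + \<kappa>) + (720 * (d * a * \<Delta> / \<tau>)) powr (1 + \<kappa>)) = (720 * sigma_const \<kappa> (real CARD('n)) q M2 \<Delta> \<tau>) powr (1 + \<kappa>)"
    proof -
      have S: "sigma_const \<kappa> (real CARD('n)) q M2 \<Delta> \<tau> powr (1 + \<kappa>) =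
          2 powr \<kappa> * (sqrt d / 2 powr (1 / 4) * a * M2) powr (1 + \<kappa>) + 2 powr \<kappa> * (d * a * \<Delta> / \<tau>) powr (1 + \<kappa>)"
        unfolding a_def d_def by (rule sigma_powr)
      have p720: "(720 * y) powr (1 + \<kappa>) = 720 powr (1 + \<kappa>) * y powr (1 + \<kappa>)" for y
        by (rule powr_mult)
      show ?thesis by (simp only: p720 S distrib_left mult.left_commute)
    qed
    finally show "(\<integral>\<^sup>+z. ennreal (G x z powr (1 + \<kappa>)) \<partial>Z) \<le> ennreal ((720 * sigma_const \<kappa> (real CARD('n)) q M2 \<Delta> \<tau>) powr (1 + \<kappa>))"
      by (simp add: ennreal_leI)
  qed
qed

text \<open>A nonnegative number is at most 1 plus its power of order \<open>1 + \<kappa>\<close>,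
  so the moment bound dominates the inner product.\<close>

lemma estimator_integrable:
  assumes x: "x \<in> X" shows "integrable Z (\<lambda>z. zo_gradient f \<delta> \<tau> x z \<bullet> v)"
proof -
  obtain G where G: "\<And>x. x \<in> X \<Longrightarrow> G x \<in> borel_measurable Z" "\<And>x z. G x z \<ge> 0"
    "\<And>x z v. \<bar>zo_gradient f \<delta> \<tau> x z \<bullet> v\<bar> \<le> G x z * lp_norm p v"
    "\<And>x. x \<in> X \<Longrightarrow> (\<integral>\<^sup>+z. ennreal (G x z powr (1 + \<kappa>)) \<partial>Z) \<le> ennreal ((720 * sigma_const \<kappa> (real CARD('n)) q M2 \<Delta> \<tau>) powr (1 + \<kappa>))"
    using estimator_moment by blast
  interpret PZ: prob_space Z by (rule prob_space_Z)
  have Gp: "integrable Z (\<lambda>z. G x z powr (1 + \<kappa>))"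
    using G(1)[OF x] G(4)[OF x] by (intro integrableI_nonneg) (auto intro: le_less_trans)
  have [measurable]: "zo_gradient f \<delta> \<tau> x \<in> borel_measurable Z" by (rule zo_gradient_measurable_slice[OF x])
  have bnd: "integrable Z (\<lambda>z. (1 + G x z powr (1 + \<kappa>)) * lp_norm p v)" using Gp by auto
  show ?thesis
  proof (rule Bochner_Integration.integrable_bound[OF bnd])
    show "AE z in Z. norm (zo_gradient f \<delta> \<tau> x z \<bullet> v) \<le> norm ((1 + G x z powr (1 + \<kappa>)) * lp_norm p v)"
    proof (rule AE_I2)
      fix z
      have "G x z \<le> 1 + G x z powr (1 + \<kappa>)"
      proof (cases "G x z \<le> 1")
        case True then show ?thesis by (simp add: add_increasing2)
      next
        case False
        then have "G x z powr 1 \<le> G x z powr (1 + \<kappa>)" using \<kappa> by (intro powr_mono) auto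
        then show ?thesis using False by simp
      qed
      then have "G x z * lp_norm p v \<le> (1 + G x z powr (1 + \<kappa>)) * lp_norm p v" by (intro mult_right_mono) auto
      then show "norm (zo_gradient f \<delta> \<tau> x z \<bullet> v) \<le> norm ((1 + G x z powr (1 + \<kappa>)) * lp_norm p v)"
        using G(3)[of x z v] by (simp add: abs_mult add_nonneg_nonneg)
    qed
  qed measurable
qed

text \<open>Without noise the two-point estimator is the average of two one-point estimators, one
  forward and one backward, and the gradient inequality holds for each. The noise enters through the
  mean of \<open>\<bar>w \<bullet> e\<bar>\<close>, which is of order
  \<open>norm w / sqrt d\<close>; bounding the inner product by \<open>norm w\<close> would lose
  that factor.\<close>

lemma estimator_bias:
  assumes x: "x \<in> X" and u: "u \<in> X"
  shows "F x - F u - 2 * M2 * \<tau> - 5 * sqrt (real CARD('n)) * \<Delta> / \<tau> * norm (x - u) \<le>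
    (\<integral>z. zo_gradient f \<delta> \<tau> x z \<bullet> (x - u) \<partial>Z)"
proof -
  define d where "d = real CARD('n)"
  define w where "w = x - u"
  define c where "c = 5 * sqrt d * \<Delta> / \<tau> * norm w"
  have d: "d > 0" by (simp add: d_def)
  interpret P: pair_sigma_finite "uniform_sphere :: (real ^ 'n) measure" Dm by (rule pair_sigma_finite_Z)
  have int: "integrable Z (\<lambda>(e, \<zeta>). zo_gradient f \<delta> \<tau> x (e, \<zeta>) \<bullet> w)"
    using estimator_integrable[OF x, of w] by (simp add: case_prod_beta')
  have inner: "f x \<zeta> - f u \<zeta> - 2 * M2fun \<zeta> * \<tau> - c \<le> (\<integral>e. zo_gradient f \<delta> \<tau> x (e, \<zeta>) \<bullet> w \<partial>uniform_sphere)"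
    if z: "\<zeta> \<in> space Dm" for \<zeta>
  proof -
    obtain h where h: "convex_on UNIV h" "\<And>x y. \<bar>h x - h y\<bar> \<le> M2fun \<zeta> * norm (x - y)"
      "\<And>x. x \<in> thicken X \<tau> \<Longrightarrow> h x = f x \<zeta>" using slice_extension[OF z] by blast
    have M0: "M2fun \<zeta> \<ge> 0" by (rule M2fun_nonneg[OF z])
    have h_cont: "continuous_on UNIV h" using h(2) by (intro lipschitz_imp_continuous[of UNIV h]) auto
    define hp hm where "hp e = h (x + \<tau> *\<^sub>R e) * (e \<bullet> w)" and "hm e = h (x - \<tau> *\<^sub>R e) * (e \<bullet> w)" for e
    have hp_int: "integrable uniform_sphere hp" and hm_int: "integrable uniform_sphere hm"
      unfolding hp_def hm_def
      by (intro integrable_uniform_sphere_continuous continuous_intros continuous_on_compose2[OF h_cont]; auto)+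
    have ab_int: "integrable uniform_sphere (\<lambda>e. \<bar>w \<bullet> e\<bar>)"
      by (intro integrable_uniform_sphere_continuous continuous_intros)
    have xu: "h x = f x \<zeta>" "h u = f u \<zeta>" using h(3) x u C_sub by auto
    have p1: "f x \<zeta> - f u \<zeta> - 2 * M2fun \<zeta> * \<tau> \<le> d / \<tau> * (\<integral>e. hp e \<partial>uniform_sphere)"
      using uniform_sphere_gradient_inequality[OF h(1,2) \<tau>, of x u] by (simp add: xu hp_def d_def w_def)
    have m1: "f x \<zeta> - f u \<zeta> - 2 * M2fun \<zeta> * \<tau> \<le> d / \<tau> * (- (\<integral>e. hm e \<partial>uniform_sphere))"
    proof -
      \<comment> \<open>Point reflection at \<open>x\<close> turns the backward query into a forward
        one and sends \<open>u\<close> to \<open>2 *\<^sub>R x - u\<close>, so the same inequality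
        applies to it.\<close>
      define h' where "h' y = h (2 *\<^sub>R x + (- 1) *\<^sub>R y)" for y
      have h': "convex_on UNIV h'" unfolding h'_def by (rule convex_on_affine_compose[OF h(1)])
      have h'l: "\<bar>h' a - h' b\<bar> \<le> M2fun \<zeta> * norm (a - b)" for a b
        using h(2)[of "2 *\<^sub>R x + (- 1) *\<^sub>R a" "2 *\<^sub>R x + (- 1) *\<^sub>R b"] by (simp add: h'_def norm_minus_commute)
      have e1: "h' x = h x" "h' (2 *\<^sub>R x - u) = h u" "h' (x + \<tau> *\<^sub>R e) = h (x - \<tau> *\<^sub>R e)" for e
        by (simp_all add: h'_def algebra_simps scaleR_2)
      have e2: "x - (2 *\<^sub>R x - u) = - w" by (simp add: w_def algebra_simps scaleR_2)
      have "h' x - h' (2 *\<^sub>R x - u) - 2 * M2fun \<zeta> * \<tau> \<le>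
          d / \<tau> * (\<integral>e. h' (x + \<tau> *\<^sub>R e) * (e \<bullet> (x - (2 *\<^sub>R x - u))) \<partial>uniform_sphere)"
        unfolding d_def by (rule uniform_sphere_gradient_inequality[OF h' h'l \<tau>])
      then show ?thesis unfolding e1 e2 by (simp add: xu hm_def)
    qed
    have lb_int: "integrable uniform_sphere (\<lambda>e. d / (2 * \<tau>) * (hp e - hm e) - d * \<Delta> / \<tau> * \<bar>w \<bullet> e\<bar>)"
      using hp_int hm_int ab_int by auto
    have pw: "d / (2 * \<tau>) * (hp e - hm e) - d * \<Delta> / \<tau> * \<bar>w \<bullet> e\<bar> \<le> zo_gradient f \<delta> \<tau> x (e, \<zeta>) \<bullet> w \<and>
        zo_gradient f \<delta> \<tau> x (e, \<zeta>) \<bullet> w \<le> d / (2 * \<tau>) * (hp e - hm e) + d * \<Delta> / \<tau> * \<bar>w \<bullet> e\<bar>"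
      if e: "norm e = 1" for e
    proof -
      obtain \<eta> where \<eta>: "\<bar>\<eta>\<bar> \<le> d * \<Delta> / \<tau>"
        "scale x (e, \<zeta>) = d / (2 * \<tau>) * (f (x + \<tau> *\<^sub>R e) \<zeta> - f (x - \<tau> *\<^sub>R e) \<zeta>) + \<eta>"
        using scale_decomposition[OF x e z] unfolding d_def by blast
      have ff: "f (x + \<tau> *\<^sub>R e) \<zeta> = h (x + \<tau> *\<^sub>R e)" "f (x - \<tau> *\<^sub>R e) \<zeta> = h (x - \<tau> *\<^sub>R e)"
        using h(3)[OF C_mem[OF x, of e]] h(3)[OF C_mem2[OF x, of e]] e by auto
      have "zo_gradient f \<delta> \<tau> x (e, \<zeta>) \<bullet> w = d / (2 * \<tau>) * (hp e - hm e) + \<eta> * (e \<bullet> w)"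
        by (simp add: zo_gradient_scale \<eta>(2) ff hp_def hm_def algebra_simps)
      moreover have "\<bar>\<eta> * (e \<bullet> w)\<bar> \<le> d * \<Delta> / \<tau> * \<bar>w \<bullet> e\<bar>"
        unfolding abs_mult inner_commute[of e w] by (rule mult_right_mono[OF \<eta>(1)]) simp
      ultimately show ?thesis by linarith
    qed
    have sl: "(\<lambda>e. zo_gradient f \<delta> \<tau> x (e, \<zeta>) \<bullet> w) \<in> borel_measurable uniform_sphere"
      using measurable_compose[OF measurable_Pair2'[OF z] zo_gradient_measurable_slice[OF x]] by measurable
    have g_int: "integrable uniform_sphere (\<lambda>e. zo_gradient f \<delta> \<tau> x (e, \<zeta>) \<bullet> w)"
    proof (rule Bochner_Integration.integrable_bound)
      show "integrable uniform_sphere (\<lambda>e. \<bar>d / (2 * \<tau>) * (hp e - hm e)\<bar> + d * \<Delta> / \<tau> * \<bar>w \<bullet> e\<bar>)"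
        using hp_int hm_int ab_int by auto
      show "AE e in uniform_sphere. norm (zo_gradient f \<delta> \<tau> x (e, \<zeta>) \<bullet> w) \<le> norm (\<bar>d / (2 * \<tau>) * (hp e - hm e)\<bar> + d * \<Delta> / \<tau> * \<bar>w \<bullet> e\<bar>)"
      proof (rule AE_I2)
        fix e :: "real ^ 'n" assume "e \<in> space uniform_sphere"
        then have "norm e = 1" by simp
        from pw[OF this] show "norm (zo_gradient f \<delta> \<tau> x (e, \<zeta>) \<bullet> w) \<le> norm (\<bar>d / (2 * \<tau>) * (hp e - hm e)\<bar> + d * \<Delta> / \<tau> * \<bar>w \<bullet> e\<bar>)"
          unfolding real_norm_def by linarith
      qed
    qed (rule sl)
    have "f x \<zeta> - f u \<zeta> - 2 * M2fun \<zeta> * \<tau> - c \<le>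
        d / (2 * \<tau>) * ((\<integral>e. hp e \<partial>uniform_sphere) - (\<integral>e. hm e \<partial>uniform_sphere)) - d * \<Delta> / \<tau> * (\<integral>e. \<bar>w \<bullet> e\<bar> \<partial>uniform_sphere)"
    proof -
      have "d * \<Delta> / \<tau> * (\<integral>e. \<bar>w \<bullet> e\<bar> \<partial>uniform_sphere) \<le> d * \<Delta> / \<tau> * (5 * norm w / sqrt d)"
        using uniform_sphere_abs_inner[of w] d \<Delta> \<tau> by (intro mult_left_mono) (auto simp: d_def)
      also have "\<dots> = c"
      proof -
        have "d / sqrt d = sqrt d" using d by (simp add: real_div_sqrt)
        moreover have "d * \<Delta> / \<tau> * (5 * norm w / sqrt d) = 5 * (d / sqrt d) * \<Delta> / \<tau> * norm w" by (simp add: mult_ac)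
        ultimately show ?thesis by (simp add: c_def)
      qed
      finally have 1: "d * \<Delta> / \<tau> * (\<integral>e. \<bar>w \<bullet> e\<bar> \<partial>uniform_sphere) \<le> c" .
      have "d / (2 * \<tau>) * (A - B) = (d / \<tau> * A + d / \<tau> * (- B)) / 2" for A B
        using \<tau> by (simp add: field_simps)
      moreover have "b - c' \<le> (P + Q) / 2 - n" if "b \<le> P" "b \<le> Q" "n \<le> c'" for b P Q n c' :: real
        using that by (simp add: field_simps)
      ultimately show ?thesis using p1 m1 1 by (simp only:)
    qed
    also have "\<dots> = (\<integral>e. d / (2 * \<tau>) * (hp e - hm e) - d * \<Delta> / \<tau> * \<bar>w \<bullet> e\<bar> \<partial>uniform_sphere)"
      using hp_int hm_int ab_int by simp
    also have "\<dots> \<le> (\<integral>e. zo_gradient f \<delta> \<tau> x (e, \<zeta>) \<bullet> w \<partial>uniform_sphere)"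
      using pw by (intro integral_mono lb_int g_int) simp
    finally show ?thesis .
  qed
  have fxu: "integrable Dm (f x)" "integrable Dm (f u)" using x u C_sub by (auto intro: f_int)
  have "F x - F u - 2 * M2 * \<tau> - c \<le> F x - F u - 2 * (\<integral>\<zeta>. M2fun \<zeta> \<partial>Dm) * \<tau> - c"
    using M2fun_mean \<tau> by simp
  also have "\<dots> = (\<integral>\<zeta>. f x \<zeta> - f u \<zeta> - 2 * M2fun \<zeta> * \<tau> - c \<partial>Dm)"
    unfolding F using fxu M2fun_int by (simp add: data.prob_space)
  also have "\<dots> \<le> (\<integral>\<zeta>. \<integral>e. zo_gradient f \<delta> \<tau> x (e, \<zeta>) \<bullet> w \<partial>uniform_sphere \<partial>Dm)"
    using fxu M2fun_int inner P.integrable_snd[OF int] by (intro integral_mono) auto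
  also have "\<dots> = (\<integral>z. zo_gradient f \<delta> \<tau> x z \<bullet> w \<partial>Z)"
    using P.integral_snd[OF int] by (simp add: case_prod_beta')
  finally show ?thesis by (simp add: c_def d_def w_def)
qed

definition update :: "real \<Rightarrow> real ^ 'n \<Rightarrow> (real ^ 'n) \<times> 's \<Rightarrow> real ^ 'n" where
  "update \<nu> x z = prox_step (gradient \<psi> x - \<nu> *\<^sub>R zo_gradient f \<delta> \<tau> x z)"

lemma update_in: "update \<nu> x z \<in> X"
  unfolding update_def by (rule prox_step)

lemma update_measurable:
  "(\<lambda>(x, z). update \<nu> x z) \<in> restrict_space borel X \<Otimes>\<^sub>M Z \<rightarrow>\<^sub>M restrict_space borel X"
proof (rule measurable_restrict_space2)
  have [measurable]: "(\<lambda>w. zo_gradient f \<delta> \<tau> (fst w) (snd w)) \<in> borel_measurable (restrict_space borel X \<Otimes>\<^sub>M Z)"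
    using zo_gradient_measurable by (simp add: case_prod_beta')
  have [measurable]: "fst \<in> restrict_space borel X \<Otimes>\<^sub>M Z \<rightarrow>\<^sub>M (borel :: (real ^ 'n) measure)"
    by (rule measurable_compose[OF measurable_fst measurable_restrict_space1[of "\<lambda>x. x", simplified]]) simp
  show "(\<lambda>(x, z). update \<nu> x z) \<in> borel_measurable (restrict_space borel X \<Otimes>\<^sub>M Z)"
    unfolding update_def case_prod_beta' by measurable
qed (auto simp: update_in)

lemma bregman_measurable: "D u \<in> borel_measurable borel"
proof -
  have [measurable]: "\<psi> \<in> borel_measurable borel" by (rule borel_measurable_continuous_onI[OF continuous_prox])
  show ?thesis unfolding bregman_def by measurable
qed

text \<open>One step from a fixed current point. Both summands on the left are nonnegative and the
  integral is an extended one, so that the inequality can be integrated over the random iterate by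
  Tonelli.\<close>

lemma expected_step:
  assumes x: "x \<in> X" and u: "u \<in> X" and \<nu>: "\<nu> \<ge> 0" and min: "F u \<le> F x"
  shows "(\<integral>\<^sup>+z. ennreal (D u (update \<nu> x z)) \<partial>Z) + ennreal (\<nu> * (F x - F u)) \<le>
    ennreal (D u x + 2 * \<nu> * M2 * \<tau> + \<nu> * (5 * sqrt (real CARD('n)) * \<Delta> / \<tau> * norm (x - u)) + (\<nu> * (720 * sigma_const \<kappa> (real CARD('n)) q M2 \<Delta> \<tau>)) powr (1 + \<kappa>))"
    (is "_ + _ \<le> ennreal ?R")
proof -
  obtain G where G: "\<And>x. x \<in> X \<Longrightarrow> G x \<in> borel_measurable Z" "\<And>x z. G x z \<ge> 0"
    "\<And>x z v. \<bar>zo_gradient f \<delta> \<tau> x z \<bullet> v\<bar> \<le> G x z * lp_norm p v"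
    "\<And>x. x \<in> X \<Longrightarrow> (\<integral>\<^sup>+z. ennreal (G x z powr (1 + \<kappa>)) \<partial>Z) \<le> ennreal ((720 * sigma_const \<kappa> (real CARD('n)) q M2 \<Delta> \<tau>) powr (1 + \<kappa>))"
    using estimator_moment by blast
  interpret PZ: prob_space Z by (rule prob_space_Z)
  have Gp: "integrable Z (\<lambda>z. G x z powr (1 + \<kappa>))"
    using G(1)[OF x] G(4)[OF x] by (intro integrableI_nonneg) (auto intro: le_less_trans)
  have EG: "(\<integral>z. G x z powr (1 + \<kappa>) \<partial>Z) \<le> (720 * sigma_const \<kappa> (real CARD('n)) q M2 \<Delta> \<tau>) powr (1 + \<kappa>)"
    using G(4)[OF x] by (subst (asm) nn_integral_eq_integral[OF Gp]) auto
  let ?g = "\<lambda>z. zo_gradient f \<delta> \<tau> x z \<bullet> (x - u)"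
  have g_int: "integrable Z ?g" by (rule estimator_integrable[OF x])
  have pw: "D u (update \<nu> x z) \<le> D u x - \<nu> * ?g z + \<nu> powr (1 + \<kappa>) * G x z powr (1 + \<kappa>)" for z
    using mirror_step_bound[where x=x, OF u \<nu> G(2)[of x z] G(3)[of x z]] unfolding update_def powr_mult by linarith
  have [measurable]: "D u \<in> borel_measurable borel" by (rule bregman_measurable)
  have "update \<nu> x \<in> Z \<rightarrow>\<^sub>M restrict_space borel X"
    using measurable_compose[OF measurable_Pair1'[of x "restrict_space borel X" Z] update_measurable[of \<nu>]] x by (simp add: space_restrict_space)
  then have [measurable]: "update \<nu> x \<in> borel_measurable Z" using measurable_restrict_space2_iff by blast
  have D_int: "integrable Z (\<lambda>z. D u (update \<nu> x z))"
  proof -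
    obtain B where B: "\<And>x y. x \<in> X \<Longrightarrow> y \<in> X \<Longrightarrow> D x y \<le> B" using bregman_bounded by blast
    show ?thesis
      by (rule PZ.integrable_const_bound[of _ B]) (auto simp: bregman_nonneg intro!: AE_I2 B u update_in)
  qed
  have "(\<integral>z. D u (update \<nu> x z) \<partial>Z) \<le> (\<integral>z. D u x - \<nu> * ?g z + \<nu> powr (1 + \<kappa>) * G x z powr (1 + \<kappa>) \<partial>Z)"
    using D_int g_int Gp by (intro integral_mono pw) auto
  also have "\<dots> = D u x - \<nu> * (\<integral>z. ?g z \<partial>Z) + \<nu> powr (1 + \<kappa>) * (\<integral>z. G x z powr (1 + \<kappa>) \<partial>Z)"
    using g_int Gp by (simp add: PZ.prob_space)
  also have "\<dots> \<le> D u x - \<nu> * (F x - F u - 2 * M2 * \<tau> - 5 * sqrt (real CARD('n)) * \<Delta> / \<tau> * norm (x - u)) + \<nu> powr (1 + \<kappa>) * (720 * sigma_const \<kappa> (real CARD('n)) q M2 \<Delta> \<tau>) powr (1 + \<kappa>)"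
    using \<nu> EG estimator_bias[OF x u] by (intro add_mono diff_left_mono mult_left_mono) auto
  also have "\<dots> = ?R - \<nu> * (F x - F u)" by (simp add: powr_mult algebra_simps)
  finally have fin: "(\<integral>z. D u (update \<nu> x z) \<partial>Z) \<le> ?R - \<nu> * (F x - F u)" .
  have nn: "0 \<le> (\<integral>z. D u (update \<nu> x z) \<partial>Z)" by (simp add: bregman_nonneg)
  have "(\<integral>\<^sup>+z. ennreal (D u (update \<nu> x z)) \<partial>Z) = ennreal (\<integral>z. D u (update \<nu> x z) \<partial>Z)"
    by (rule nn_integral_eq_integral[OF D_int]) (simp add: bregman_nonneg)
  moreover have "\<nu> * (F x - F u) \<ge> 0" using \<nu> min by simp
  ultimately show ?thesis using fin nn
    by (simp add: ennreal_plus[symmetric] ennreal_leI del: ennreal_plus)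
qed

end

section \<open>Independence of the samples from the past\<close>

text \<open>The information contained in the initial point and the samples with index in
  \<open>J\<close>. Encoded as a measure space over the same set, it makes dependence on the past an
  ordinary measurability statement; only its measurable sets matter.\<close>

definition history :: "'w measure \<Rightarrow> ('w \<Rightarrow> 'a) \<Rightarrow> 'a measure \<Rightarrow> ('i \<Rightarrow> 'w \<Rightarrow> 'z) \<Rightarrow> 'z measure \<Rightarrow> 'i set \<Rightarrow> 'w measure" where
  "history M x0 A zz N J = vimage_algebra (space M) (\<lambda>\<omega>. (x0 \<omega>, \<lambda>i\<in>J. zz i \<omega>)) (A \<Otimes>\<^sub>M (\<Pi>\<^sub>M i\<in>J. N))"

lemma space_history [simp]: "space (history M x0 A zz N J) = space M"
  by (simp add: history_def)

context prob_space
begin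

text \<open>Unlike \<open>indep_var\<close>, this does not require the two variables to have the same range type.\<close>

definition indep_pair :: "'b measure \<Rightarrow> ('a \<Rightarrow> 'b) \<Rightarrow> 'c measure \<Rightarrow> ('a \<Rightarrow> 'c) \<Rightarrow> bool" where
  "indep_pair S X T Y \<longleftrightarrow> X \<in> M \<rightarrow>\<^sub>M S \<and> Y \<in> M \<rightarrow>\<^sub>M T \<and>
    (\<forall>A\<in>sets S. \<forall>B\<in>sets T. prob (X -` A \<inter> Y -` B \<inter> space M) = prob (X -` A \<inter> space M) * prob (Y -` B \<inter> space M))"

lemma indep_pair_compose:
  assumes "indep_pair S X T Y" "f \<in> S \<rightarrow>\<^sub>M S'" "g \<in> T \<rightarrow>\<^sub>M T'"
  shows "indep_pair S' (\<lambda>\<omega>. f (X \<omega>)) T' (\<lambda>\<omega>. g (Y \<omega>))"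
  unfolding indep_pair_def
proof (intro conjI ballI)
  have X: "X \<in> M \<rightarrow>\<^sub>M S" and Y: "Y \<in> M \<rightarrow>\<^sub>M T" using assms(1) by (auto simp: indep_pair_def)
  show "(\<lambda>\<omega>. f (X \<omega>)) \<in> M \<rightarrow>\<^sub>M S'" by (rule measurable_compose[OF X assms(2)])
  show "(\<lambda>\<omega>. g (Y \<omega>)) \<in> M \<rightarrow>\<^sub>M T'" by (rule measurable_compose[OF Y assms(3)])
  fix A B assume A: "A \<in> sets S'" and B: "B \<in> sets T'"
  have "(\<lambda>\<omega>. f (X \<omega>)) -` A \<inter> space M = X -` (f -` A \<inter> space S) \<inter> space M"
    "(\<lambda>\<omega>. g (Y \<omega>)) -` B \<inter> space M = Y -` (g -` B \<inter> space T) \<inter> space M"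
    using measurable_space[OF X] measurable_space[OF Y] by auto
  moreover from this have "(\<lambda>\<omega>. f (X \<omega>)) -` A \<inter> (\<lambda>\<omega>. g (Y \<omega>)) -` B \<inter> space M =
      X -` (f -` A \<inter> space S) \<inter> Y -` (g -` B \<inter> space T) \<inter> space M" by blast
  moreover have "prob (X -` (f -` A \<inter> space S) \<inter> Y -` (g -` B \<inter> space T) \<inter> space M) =
      prob (X -` (f -` A \<inter> space S) \<inter> space M) * prob (Y -` (g -` B \<inter> space T) \<inter> space M)"
    using assms(1) measurable_sets[OF assms(2) A] measurable_sets[OF assms(3) B] unfolding indep_pair_def by blast
  ultimately show "prob ((\<lambda>\<omega>. f (X \<omega>)) -` A \<inter> (\<lambda>\<omega>. g (Y \<omega>)) -` B \<inter> space M) =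
      prob ((\<lambda>\<omega>. f (X \<omega>)) -` A \<inter> space M) * prob ((\<lambda>\<omega>. g (Y \<omega>)) -` B \<inter> space M)"
    by (simp only:)
qed

text \<open>Independence as the product form of the joint law, the form in which Tonelli becomes
  applicable.\<close>

lemma indep_pair_distr:
  "indep_pair S X T Y \<longleftrightarrow> X \<in> M \<rightarrow>\<^sub>M S \<and> Y \<in> M \<rightarrow>\<^sub>M T \<and>
    distr M S X \<Otimes>\<^sub>M distr M T Y = distr M (S \<Otimes>\<^sub>M T) (\<lambda>\<omega>. (X \<omega>, Y \<omega>))"
proof (cases "X \<in> M \<rightarrow>\<^sub>M S \<and> Y \<in> M \<rightarrow>\<^sub>M T")
  case True
  then have X [measurable]: "X \<in> M \<rightarrow>\<^sub>M S" and Y [measurable]: "Y \<in> M \<rightarrow>\<^sub>M T" by auto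
  interpret PX: prob_space "distr M S X" by (rule prob_space_distr) measurable
  interpret PY: prob_space "distr M T Y" by (rule prob_space_distr) measurable
  have joint: "emeasure (distr M (S \<Otimes>\<^sub>M T) (\<lambda>\<omega>. (X \<omega>, Y \<omega>))) (A \<times> B) = prob (X -` A \<inter> Y -` B \<inter> space M)"
    if [measurable]: "A \<in> sets S" "B \<in> sets T" for A B
  proof -
    have "(\<lambda>\<omega>. (X \<omega>, Y \<omega>)) -` (A \<times> B) = X -` A \<inter> Y -` B" by auto
    then show ?thesis by (simp add: emeasure_distr emeasure_eq_measure)
  qed
  have prod: "emeasure (distr M S X) A * emeasure (distr M T Y) B = ennreal (prob (X -` A \<inter> space M) * prob (Y -` B \<inter> space M))"
    if [measurable]: "A \<in> sets S" "B \<in> sets T" for A B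
    by (simp add: emeasure_distr emeasure_eq_measure ennreal_mult')
  show ?thesis
  proof
    assume "indep_pair S X T Y"
    then have "distr M S X \<Otimes>\<^sub>M distr M T Y = distr M (S \<Otimes>\<^sub>M T) (\<lambda>\<omega>. (X \<omega>, Y \<omega>))"
      by (intro pair_measure_eqI)
         (auto simp: PX.sigma_finite_measure_axioms PY.sigma_finite_measure_axioms joint prod indep_pair_def)
    then show "X \<in> M \<rightarrow>\<^sub>M S \<and> Y \<in> M \<rightarrow>\<^sub>M T \<and> distr M S X \<Otimes>\<^sub>M distr M T Y = distr M (S \<Otimes>\<^sub>M T) (\<lambda>\<omega>. (X \<omega>, Y \<omega>))"
      using True by blast
  next
    assume "X \<in> M \<rightarrow>\<^sub>M S \<and> Y \<in> M \<rightarrow>\<^sub>M T \<and> distr M S X \<Otimes>\<^sub>M distr M T Y = distr M (S \<Otimes>\<^sub>M T) (\<lambda>\<omega>. (X \<omega>, Y \<omega>))"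
    then have d: "distr M (S \<Otimes>\<^sub>M T) (\<lambda>\<omega>. (X \<omega>, Y \<omega>)) = distr M S X \<Otimes>\<^sub>M distr M T Y" by simp
    have "prob (X -` A \<inter> Y -` B \<inter> space M) = prob (X -` A \<inter> space M) * prob (Y -` B \<inter> space M)"
      if AB: "A \<in> sets S" "B \<in> sets T" for A B
    proof -
      have "ennreal (prob (X -` A \<inter> Y -` B \<inter> space M)) = ennreal (prob (X -` A \<inter> space M) * prob (Y -` B \<inter> space M))"
        unfolding joint[OF AB, symmetric] prod[OF AB, symmetric] d
        using AB by (intro PY.emeasure_pair_measure_Times) auto
      then show ?thesis by simp
    qed
    then show "indep_pair S X T Y" using True by (simp add: indep_pair_def)
  qed
qed (auto simp: indep_pair_def)

context
  fixes x0 :: "'a \<Rightarrow> 'b" and A :: "'b measure" and zz :: "'i \<Rightarrow> 'a \<Rightarrow> 'z" and N :: "'z measure" and I :: "'i set"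
  assumes x0: "x0 \<in> M \<rightarrow>\<^sub>M A"
    and zz: "indep_vars (\<lambda>_. N) zz I"
    and x0_indep: "indep_set (sets (vimage_algebra (space M) x0 A))
      (sets (vimage_algebra (space M) (\<lambda>\<omega>. \<lambda>i\<in>I. zz i \<omega>) (\<Pi>\<^sub>M i\<in>I. N)))"
begin

lemma sample_measurable: "i \<in> I \<Longrightarrow> zz i \<in> M \<rightarrow>\<^sub>M N"
  using zz by (simp add: indep_vars_def)

lemma samples_measurable: "J \<subseteq> I \<Longrightarrow> (\<lambda>\<omega>. \<lambda>i\<in>J. zz i \<omega>) \<in> M \<rightarrow>\<^sub>M (\<Pi>\<^sub>M i\<in>J. N)"
  by (intro measurable_restrict sample_measurable) auto

lemma history_map_space: "J \<subseteq> I \<Longrightarrow> (\<lambda>\<omega>. (x0 \<omega>, \<lambda>i\<in>J. zz i \<omega>)) \<in> space M \<rightarrow> space (A \<Otimes>\<^sub>M (\<Pi>\<^sub>M i\<in>J. N))"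
  using measurable_space[OF measurable_Pair[OF x0 samples_measurable]] by auto

lemma history_map_measurable:
  "J \<subseteq> I \<Longrightarrow> (\<lambda>\<omega>. (x0 \<omega>, \<lambda>i\<in>J. zz i \<omega>)) \<in> history M x0 A zz N J \<rightarrow>\<^sub>M (A \<Otimes>\<^sub>M (\<Pi>\<^sub>M i\<in>J. N))"
  unfolding history_def by (rule measurable_vimage_algebra1) (rule history_map_space)

lemma history_initial: "J \<subseteq> I \<Longrightarrow> x0 \<in> history M x0 A zz N J \<rightarrow>\<^sub>M A"
  using measurable_compose[OF history_map_measurable measurable_fst] by simp

lemma history_sample:
  assumes "J \<subseteq> I" "i \<in> J" shows "zz i \<in> history M x0 A zz N J \<rightarrow>\<^sub>M N"
proof -
  have "(\<lambda>\<omega>. snd (x0 \<omega>, \<lambda>i\<in>J. zz i \<omega>) i) \<in> history M x0 A zz N J \<rightarrow>\<^sub>M N"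
    by (rule measurable_compose[OF measurable_compose[OF history_map_measurable[OF assms(1)] measurable_snd]
        measurable_component_singleton[OF assms(2)]])
  then show ?thesis using assms by simp
qed

lemma history_identity:
  assumes "J \<subseteq> I" shows "(\<lambda>\<omega>. \<omega>) \<in> M \<rightarrow>\<^sub>M history M x0 A zz N J"
  unfolding history_def
  by (rule measurable_vimage_algebra2) (auto intro!: measurable_Pair x0 samples_measurable assms)

lemma history_mono_identity:
  assumes "J \<subseteq> J'" "J' \<subseteq> I" shows "(\<lambda>\<omega>. \<omega>) \<in> history M x0 A zz N J' \<rightarrow>\<^sub>M history M x0 A zz N J"
  unfolding history_def[of M x0 A zz N J]
  by (rule measurable_vimage_algebra2)
     (use assms in \<open>auto intro!: measurable_Pair history_initial measurable_restrict history_sample\<close>)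

lemma history_mono:
  assumes "J \<subseteq> J'" "J' \<subseteq> I" "Y \<in> history M x0 A zz N J \<rightarrow>\<^sub>M S" shows "Y \<in> history M x0 A zz N J' \<rightarrow>\<^sub>M S"
  using measurable_compose[OF history_mono_identity[OF assms(1,2)] assms(3)] by simp

lemma history_measurable:
  assumes "J \<subseteq> I" "Y \<in> history M x0 A zz N J \<rightarrow>\<^sub>M S" shows "Y \<in> M \<rightarrow>\<^sub>M S"
  using measurable_compose[OF history_identity[OF assms(1)] assms(2)] by simp

lemma indep_initial_samples: "indep_pair A x0 (\<Pi>\<^sub>M i\<in>I. N) (\<lambda>\<omega>. \<lambda>i\<in>I. zz i \<omega>)"
  unfolding indep_pair_def
proof (intro conjI ballI)
  fix B C assume B: "B \<in> sets A" and C: "C \<in> sets (\<Pi>\<^sub>M i\<in>I. N)"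
  have "prob ((x0 -` B \<inter> space M) \<inter> ((\<lambda>\<omega>. \<lambda>i\<in>I. zz i \<omega>) -` C \<inter> space M)) =
      prob (x0 -` B \<inter> space M) * prob ((\<lambda>\<omega>. \<lambda>i\<in>I. zz i \<omega>) -` C \<inter> space M)"
    by (rule indep_setD[OF x0_indep in_vimage_algebra[OF B] in_vimage_algebra[OF C]])
  moreover have "x0 -` B \<inter> (\<lambda>\<omega>. \<lambda>i\<in>I. zz i \<omega>) -` C \<inter> space M = (x0 -` B \<inter> space M) \<inter> ((\<lambda>\<omega>. \<lambda>i\<in>I. zz i \<omega>) -` C \<inter> space M)"
    by blast
  ultimately show "prob (x0 -` B \<inter> (\<lambda>\<omega>. \<lambda>i\<in>I. zz i \<omega>) -` C \<inter> space M) =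
      prob (x0 -` B \<inter> space M) * prob ((\<lambda>\<omega>. \<lambda>i\<in>I. zz i \<omega>) -` C \<inter> space M)" by (simp only:)
qed (use x0 samples_measurable[OF order_refl] in auto)

text \<open>Two independences are combined: that of the initial point from all samples jointly, and
  that of the samples in \<open>J\<close> from sample \<open>j\<close>. The law of the triple is
  split into initial point and samples, then the samples are split; regrouping gives the product
  form on rectangles.\<close>

lemma indep_history_sample:
  assumes J: "J \<subseteq> I" and j: "j \<in> I" "j \<notin> J"
  shows "indep_pair (A \<Otimes>\<^sub>M (\<Pi>\<^sub>M i\<in>J. N)) (\<lambda>\<omega>. (x0 \<omega>, \<lambda>i\<in>J. zz i \<omega>)) N (zz j)"
proof -
  let ?zJ = "\<lambda>\<omega>. \<lambda>i\<in>J. zz i \<omega>" and ?PJ = "\<Pi>\<^sub>M i\<in>J. N"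
  have [measurable]: "x0 \<in> M \<rightarrow>\<^sub>M A" "?zJ \<in> M \<rightarrow>\<^sub>M ?PJ" "zz j \<in> M \<rightarrow>\<^sub>M N"
    using x0 samples_measurable[OF J] sample_measurable[OF j(1)] by auto
  have restr: "(\<lambda>f. (restrict f J, f j)) \<in> (\<Pi>\<^sub>M i\<in>I. N) \<rightarrow>\<^sub>M (?PJ \<Otimes>\<^sub>M N)"
    using J j by (intro measurable_Pair measurable_restrict_subset measurable_component_singleton)
  have restrJ: "(\<lambda>f. restrict f J) \<in> (\<Pi>\<^sub>M i\<in>I. N) \<rightarrow>\<^sub>M ?PJ"
    using J by (rule measurable_restrict_subset)
  have IJ: "I \<inter> J = J" using J by blast
  have d1: "distr M A x0 \<Otimes>\<^sub>M distr M (?PJ \<Otimes>\<^sub>M N) (\<lambda>\<omega>. (?zJ \<omega>, zz j \<omega>)) =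
      distr M (A \<Otimes>\<^sub>M (?PJ \<Otimes>\<^sub>M N)) (\<lambda>\<omega>. (x0 \<omega>, (?zJ \<omega>, zz j \<omega>)))"
    using indep_pair_compose[OF indep_initial_samples measurable_ident restr] j by (simp add: indep_pair_distr IJ)
  have d2: "distr M A x0 \<Otimes>\<^sub>M distr M ?PJ ?zJ = distr M (A \<Otimes>\<^sub>M ?PJ) (\<lambda>\<omega>. (x0 \<omega>, ?zJ \<omega>))"
    using indep_pair_compose[OF indep_initial_samples measurable_ident restrJ] by (simp add: indep_pair_distr IJ)
  \<comment> \<open>Independence of disjoint blocks speaks of restricted families, so sample
    \<open>j\<close> appears first as a block with one index and is then projected.\<close>
  have "indep_pair ?PJ ?zJ (\<Pi>\<^sub>M i\<in>{j}. N) (\<lambda>\<omega>. \<lambda>i\<in>{j}. zz i \<omega>)"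
  proof -
    have iv: "indep_var ?PJ ?zJ (\<Pi>\<^sub>M i\<in>{j}. N) (\<lambda>\<omega>. \<lambda>i\<in>{j}. zz i \<omega>)"
      using J j by (intro indep_var_restrict[OF zz]) auto
    have vim: "(\<lambda>\<omega>. (?zJ \<omega>, \<lambda>i\<in>{j}. zz i \<omega>)) -` (B \<times> C) = ?zJ -` B \<inter> (\<lambda>\<omega>. \<lambda>i\<in>{j}. zz i \<omega>) -` C" for B C
      by auto
    have "{j} \<subseteq> I" using j by simp
    then show ?thesis
      unfolding indep_pair_def
      using samples_measurable[OF J] samples_measurable[of "{j}"] indep_varD[OF iv, unfolded vim] by blast
  qed
  from indep_pair_compose[OF this measurable_ident measurable_component_singleton[of j "{j}"]]
  have d3: "distr M ?PJ ?zJ \<Otimes>\<^sub>M distr M N (zz j) = distr M (?PJ \<Otimes>\<^sub>M N) (\<lambda>\<omega>. (?zJ \<omega>, zz j \<omega>))"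
    by (simp add: indep_pair_distr)
  interpret P0: prob_space "distr M A x0" by (rule prob_space_distr) measurable
  interpret P1: prob_space "distr M ?PJ ?zJ" by (rule prob_space_distr) measurable
  interpret P2: prob_space "distr M N (zz j)" by (rule prob_space_distr) measurable
  interpret P01: prob_space "distr M (A \<Otimes>\<^sub>M ?PJ) (\<lambda>\<omega>. (x0 \<omega>, ?zJ \<omega>))" by (rule prob_space_distr) measurable
  interpret P12: prob_space "distr M (?PJ \<Otimes>\<^sub>M N) (\<lambda>\<omega>. (?zJ \<omega>, zz j \<omega>))" by (rule prob_space_distr) measurable
  show ?thesis
    unfolding indep_pair_distr
  proof (intro conjI pair_measure_eqI)
    fix B C assume B: "B \<in> sets (distr M (A \<Otimes>\<^sub>M ?PJ) (\<lambda>\<omega>. (x0 \<omega>, ?zJ \<omega>)))" and C: "C \<in> sets (distr M N (zz j))"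
    have [measurable]: "B \<in> sets (A \<Otimes>\<^sub>M ?PJ)" "C \<in> sets N" using B C by auto
    let ?h = "\<lambda>w. indicator B (fst w, fst (snd w)) * indicator C (snd (snd w)) :: ennreal"
    have "emeasure (distr M ((A \<Otimes>\<^sub>M ?PJ) \<Otimes>\<^sub>M N) (\<lambda>\<omega>. ((x0 \<omega>, ?zJ \<omega>), zz j \<omega>))) (B \<times> C) =
        (\<integral>\<^sup>+\<omega>. ?h (x0 \<omega>, (?zJ \<omega>, zz j \<omega>)) \<partial>M)"
      by (subst nn_integral_indicator[symmetric], simp, subst nn_integral_distr)
         (auto intro!: nn_integral_cong simp: indicator_def)
    also have "\<dots> = (\<integral>\<^sup>+w. ?h w \<partial>distr M (A \<Otimes>\<^sub>M (?PJ \<Otimes>\<^sub>M N)) (\<lambda>\<omega>. (x0 \<omega>, (?zJ \<omega>, zz j \<omega>))))"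
      by (subst nn_integral_distr) auto
    also have "\<dots> = (\<integral>\<^sup>+a. \<integral>\<^sup>+v. ?h (a, v) \<partial>distr M (?PJ \<Otimes>\<^sub>M N) (\<lambda>\<omega>. (?zJ \<omega>, zz j \<omega>)) \<partial>distr M A x0)"
      unfolding d1[symmetric] by (subst P12.nn_integral_fst[symmetric]) auto
    also have "\<dots> = (\<integral>\<^sup>+a. \<integral>\<^sup>+b. \<integral>\<^sup>+c. ?h (a, (b, c)) \<partial>distr M N (zz j) \<partial>distr M ?PJ ?zJ \<partial>distr M A x0)"
      unfolding d3[symmetric] by (intro nn_integral_cong, subst P2.nn_integral_fst[symmetric]) auto
    also have "\<dots> = (\<integral>\<^sup>+a. \<integral>\<^sup>+b. indicator B (a, b) * emeasure (distr M N (zz j)) C \<partial>distr M ?PJ ?zJ \<partial>distr M A x0)"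
      by (intro nn_integral_cong) (simp add: nn_integral_cmult)
    also have "\<dots> = (\<integral>\<^sup>+w. indicator B w * emeasure (distr M N (zz j)) C \<partial>(distr M A x0 \<Otimes>\<^sub>M distr M ?PJ ?zJ))"
      by (subst P1.nn_integral_fst[symmetric]) auto
    also have "\<dots> = emeasure (distr M (A \<Otimes>\<^sub>M ?PJ) (\<lambda>\<omega>. (x0 \<omega>, ?zJ \<omega>))) B * emeasure (distr M N (zz j)) C"
      unfolding d2 by (subst nn_integral_multc) auto
    finally show "emeasure (distr M (A \<Otimes>\<^sub>M ?PJ) (\<lambda>\<omega>. (x0 \<omega>, ?zJ \<omega>))) B * emeasure (distr M N (zz j)) C =
        emeasure (distr M ((A \<Otimes>\<^sub>M ?PJ) \<Otimes>\<^sub>M N) (\<lambda>\<omega>. ((x0 \<omega>, ?zJ \<omega>), zz j \<omega>))) (B \<times> C)" ..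
  qed (auto simp: P01.sigma_finite_measure_axioms P2.sigma_finite_measure_axioms)
qed

text \<open>Freezing: a variable determined by the past is held fixed while the fresh sample is
  averaged. Every event of \<open>Y\<close> is a preimage under the map that generates the history,
  so \<open>Y\<close> inherits independence from that map.\<close>

lemma nn_integral_history_sample:
  assumes J: "J \<subseteq> I" and j: "j \<in> I" "j \<notin> J" and Y: "Y \<in> history M x0 A zz N J \<rightarrow>\<^sub>M S"
    and h [measurable]: "h \<in> borel_measurable (S \<Otimes>\<^sub>M N)"
  shows "(\<integral>\<^sup>+\<omega>. h (Y \<omega>, zz j \<omega>) \<partial>M) = (\<integral>\<^sup>+\<omega>. \<integral>\<^sup>+z. h (Y \<omega>, z) \<partial>distr M N (zz j) \<partial>M)"
proof -
  let ?W = "\<lambda>\<omega>. (x0 \<omega>, \<lambda>i\<in>J. zz i \<omega>)" and ?S = "A \<Otimes>\<^sub>M (\<Pi>\<^sub>M i\<in>J. N)"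
  have Y_m [measurable]: "Y \<in> M \<rightarrow>\<^sub>M S" using history_measurable[OF J Y] .
  have z_m [measurable]: "zz j \<in> M \<rightarrow>\<^sub>M N" using sample_measurable[OF j(1)] .
  have "indep_pair S Y N (zz j)"
    unfolding indep_pair_def
  proof (intro conjI ballI Y_m z_m)
    fix B C assume B: "B \<in> sets S" and C: "C \<in> sets N"
    have "Y -` B \<inter> space M \<in> sets (history M x0 A zz N J)" using measurable_sets[OF Y B] by simp
    then obtain E where E: "E \<in> sets ?S" "Y -` B \<inter> space M = ?W -` E \<inter> space M"
      unfolding history_def sets_vimage_algebra2[OF history_map_space[OF J]] by blast
    have "Y -` B \<inter> zz j -` C \<inter> space M = ?W -` E \<inter> zz j -` C \<inter> space M" using E(2) by blast
    then show "prob (Y -` B \<inter> zz j -` C \<inter> space M) = prob (Y -` B \<inter> space M) * prob (zz j -` C \<inter> space M)"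
      using indep_history_sample[OF J j] E C by (simp add: indep_pair_def)
  qed
  then have d: "distr M S Y \<Otimes>\<^sub>M distr M N (zz j) = distr M (S \<Otimes>\<^sub>M N) (\<lambda>\<omega>. (Y \<omega>, zz j \<omega>))"
    by (simp add: indep_pair_distr)
  interpret P: prob_space "distr M N (zz j)" by (rule prob_space_distr) measurable
  have "(\<integral>\<^sup>+\<omega>. h (Y \<omega>, zz j \<omega>) \<partial>M) = (\<integral>\<^sup>+w. h w \<partial>distr M (S \<Otimes>\<^sub>M N) (\<lambda>\<omega>. (Y \<omega>, zz j \<omega>)))"
    by (subst nn_integral_distr) auto
  also have "\<dots> = (\<integral>\<^sup>+y. \<integral>\<^sup>+z. h (y, z) \<partial>distr M N (zz j) \<partial>distr M S Y)"
    unfolding d[symmetric] by (subst P.nn_integral_fst[symmetric]) auto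
  also have "\<dots> = (\<integral>\<^sup>+\<omega>. \<integral>\<^sup>+z. h (Y \<omega>, z) \<partial>distr M N (zz j) \<partial>M)"
    by (subst nn_integral_distr) auto
  finally show ?thesis .
qed

end

end

section \<open>One run of mirror descent\<close>

context zo_step
begin

lemma F_measurable: "F \<in> borel_measurable (restrict_space borel X)"
proof (rule borel_measurable_continuous_on_restrict)
  show "continuous_on X F" using F_lipschitz C_sub by (intro lipschitz_imp_continuous[of X F M2]) auto
qed

lemma F_bounded: obtains B where "\<And>x. x \<in> X \<Longrightarrow> \<bar>F x\<bar> \<le> B"
proof -
  have "continuous_on X F" using F_lipschitz C_sub by (intro lipschitz_imp_continuous[of X F M2]) auto
  then have "bounded (F ` X)" using X by (intro compact_imp_bounded compact_continuous_image)
  then show thesis using that by (auto simp: bounded_iff)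
qed

lemma bounded_on_X_integrable:
  assumes "prob_space M" and Y: "Y \<in> M \<rightarrow>\<^sub>M restrict_space borel X"
    and g: "g \<in> borel_measurable (restrict_space borel X)" "\<And>x. x \<in> X \<Longrightarrow> \<bar>g x\<bar> \<le> (B :: real)"
  shows "integrable M (\<lambda>\<omega>. g (Y \<omega>))"
proof -
  interpret M: prob_space M by fact
  have "Y \<omega> \<in> X" if "\<omega> \<in> space M" for \<omega> using measurable_space[OF Y that] by (simp add: space_restrict_space)
  then show ?thesis
    by (intro M.integrable_const_bound[of _ B]) (use g measurable_compose[OF Y g(1)] in auto)
qed

lemma F_integrable:
  assumes "prob_space M" "Y \<in> M \<rightarrow>\<^sub>M restrict_space borel X" shows "integrable M (\<lambda>\<omega>. F (Y \<omega>))"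
proof -
  obtain B where "\<And>x. x \<in> X \<Longrightarrow> \<bar>F x\<bar> \<le> B" using F_bounded by blast
  then show ?thesis using bounded_on_X_integrable[OF assms F_measurable] by blast
qed

lemma bregman_integrable:
  assumes "prob_space M" "Y \<in> M \<rightarrow>\<^sub>M restrict_space borel X" "u \<in> X" shows "integrable M (\<lambda>\<omega>. D u (Y \<omega>))"
proof -
  obtain B where B: "\<And>x y. x \<in> X \<Longrightarrow> y \<in> X \<Longrightarrow> D x y \<le> B" using bregman_bounded by blast
  show ?thesis
    by (rule bounded_on_X_integrable[OF assms(1,2), of _ B])
       (auto intro!: measurable_restrict_space1 bregman_measurable B assms simp: bregman_nonneg)
qed

text \<open>The noise term of a step is proportional to the distance to \<open>u\<close>. A bound by
  the diameter would not shrink with \<open>R\<close> in later restarts, so the distance is bounded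
  by the divergence and \<open>R powr s\<close>. This turns the telescoping sum into a recursion
  with factor \<open>1 + 1 / T\<close>, whose product over the run is at most
  \<open>exp 1 \<le> 3\<close>.\<close>

lemma run_bound:
  fixes x :: "nat \<Rightarrow> 'w \<Rightarrow> real ^ 'n" and z :: "nat \<Rightarrow> 'w \<Rightarrow> (real ^ 'n) \<times> 's"
  assumes M: "prob_space M" and x_m: "\<And>t. t \<le> T \<Longrightarrow> x t \<in> M \<rightarrow>\<^sub>M restrict_space borel X"
    and step: "\<And>t \<omega>. t < T \<Longrightarrow> \<omega> \<in> space M \<Longrightarrow> x (Suc t) \<omega> = update \<nu> (x t \<omega>) (z t \<omega>)"
    and fub: "\<And>t h. t < T \<Longrightarrow> h \<in> borel_measurable (restrict_space borel X \<Otimes>\<^sub>M Z) \<Longrightarrow>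
      (\<integral>\<^sup>+\<omega>. h (x t \<omega>, z t \<omega>) \<partial>M) = (\<integral>\<^sup>+\<omega>. \<integral>\<^sup>+y. h (x t \<omega>, y) \<partial>Z \<partial>M)"
    and u: "u \<in> X" "\<And>y. y \<in> X \<Longrightarrow> F u \<le> F y" and \<nu>: "\<nu> \<ge> 0" and R: "R > 0" and T: "T \<ge> 1"
    and A1: "\<nu> * M2 * \<tau> \<le> R powr s / real T"
    and A2: "(\<nu> * (720 * sigma_const \<kappa> (real CARD('n)) q M2 \<Delta> \<tau>)) powr (1 + \<kappa>) \<le> 518400 * R powr s / real T"
    and A3: "\<nu> * (5 * sqrt (real CARD('n)) * \<Delta> / \<tau>) \<le> R powr (s - 1) / (s * real T)"
  shows "\<nu> * (\<Sum>t<T. (\<integral>\<omega>. F (x t \<omega>) \<partial>M) - F u) \<le> 3 * ((\<integral>\<omega>. D u (x 0 \<omega>) \<partial>M) + 518403 * R powr s)"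
proof -
  interpret M: prob_space M by fact
  \<comment> \<open>518400 comes from the moment of the estimator, 2 from smoothing and 1 from the
    noise.\<close>
  define b where "b = 518403 * R powr s"
  define Dt where "Dt t = (\<integral>\<omega>. D u (x t \<omega>) \<partial>M)" for t
  define gt where "gt t = (\<integral>\<omega>. F (x t \<omega>) \<partial>M) - F u" for t
  have xX: "x t \<omega> \<in> X" if "t \<le> T" "\<omega> \<in> space M" for t \<omega>
    using measurable_space[OF x_m[OF that(1)] that(2)] by (simp add: space_restrict_space)
  have D_int: "integrable M (\<lambda>\<omega>. D u (x t \<omega>))" if "t \<le> T" for t by (rule bregman_integrable[OF M x_m[OF that] u(1)])
  have F_int: "integrable M (\<lambda>\<omega>. F (x t \<omega>))" if "t \<le> T" for t by (rule F_integrable[OF M x_m[OF that]])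
  have Dt0: "Dt t \<ge> 0" for t by (simp add: Dt_def bregman_nonneg)
  have gt0: "gt t \<ge> 0" if "t \<le> T" for t
  proof -
    have "(\<integral>\<omega>. F u \<partial>M) \<le> (\<integral>\<omega>. F (x t \<omega>) \<partial>M)"
      using F_int[OF that] u(2) xX[OF that] by (intro integral_mono) auto
    then show ?thesis by (simp add: gt_def M.prob_space)
  qed
  have s0: "s > 0" using s2 by simp
  have rec: "Dt (Suc t) + \<nu> * gt t \<le> (1 + 1 / real T) * Dt t + b / real T" if t: "t < T" for t
  proof -
    have tT: "t \<le> T" "Suc t \<le> T" using t by auto
    have noise: "\<nu> * (5 * sqrt (real CARD('n)) * \<Delta> / \<tau> * norm (y - u)) \<le> (D u y + R powr s) / real T" if y: "y \<in> X" for y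
    proof -
      define n where "n = norm (y - u)"
      have nD: "n powr s \<le> s * D u y" using bregman_ge_norm[of y u] s0 by (simp add: n_def field_simps)
      \<comment> \<open>The larger of \<open>n\<close> and \<open>R\<close> dominates the mixed
        product.\<close>
      have "R powr (s - 1) * n \<le> n powr s + R powr s"
      proof (cases "n \<le> R")
        case True
        then have "R powr (s - 1) * n \<le> R powr (s - 1) * R" by (intro mult_left_mono) auto
        also have "\<dots> = R powr s" using R by (simp add: powr_diff)
        finally show ?thesis using powr_ge_zero[of n s] by linarith
      next
        case False
        then have n: "n > 0" "n \<ge> R" using R by auto
        have "R powr (s - 1) * n \<le> n powr (s - 1) * n"
          using n R s2 by (intro mult_right_mono powr_mono2) auto
        also have "\<dots> = n powr s" using n by (simp add: powr_diff)
        finally show ?thesis using powr_ge_zero[of R s] by linarith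
      qed
      also have "\<dots> \<le> s * (D u y + R powr s)"
      proof -
        have "1 * R powr s \<le> s * R powr s" using s2 by (intro mult_right_mono) auto
        then show ?thesis using nD by (simp add: distrib_left)
      qed
      finally have le: "R powr (s - 1) * n \<le> s * (D u y + R powr s)" .
      have "\<nu> * (5 * sqrt (real CARD('n)) * \<Delta> / \<tau> * n) = (\<nu> * (5 * sqrt (real CARD('n)) * \<Delta> / \<tau>)) * n" by simp
      also have "\<dots> \<le> R powr (s - 1) / (s * real T) * n" by (intro mult_right_mono A3) (simp add: n_def)
      also have "\<dots> = (R powr (s - 1) * n) / (s * real T)" by simp
      also have "\<dots> \<le> (s * (D u y + R powr s)) / (s * real T)" using s0 T by (intro divide_right_mono le) auto
      also have "\<dots> = (D u y + R powr s) / real T" using s0 by simp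
      finally show ?thesis by (simp add: n_def)
    qed
    let ?rhs = "\<lambda>y. (1 + 1 / real T) * D u y + b / real T"
    have pw: "(\<integral>\<^sup>+v. ennreal (D u (update \<nu> y v)) \<partial>Z) + ennreal (\<nu> * (F y - F u)) \<le> ennreal (?rhs y)" if y: "y \<in> X" for y
    proof -
      have "D u y + 2 * \<nu> * M2 * \<tau> + \<nu> * (5 * sqrt (real CARD('n)) * \<Delta> / \<tau> * norm (y - u)) + (\<nu> * (720 * sigma_const \<kappa> (real CARD('n)) q M2 \<Delta> \<tau>)) powr (1 + \<kappa>)
          \<le> D u y + 2 * (R powr s / real T) + (D u y + R powr s) / real T + 518400 * R powr s / real T"
        using A1 A2 noise[OF y] by simp
      also have "\<dots> = ?rhs y" by (simp add: b_def add_divide_distrib algebra_simps)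
      finally show ?thesis using expected_step[OF y u(1) \<nu> u(2)[OF y]] by (meson ennreal_leI order_trans)
    qed
    have [measurable]: "D u \<in> borel_measurable borel" by (rule bregman_measurable)
    have up: "(\<lambda>w. update \<nu> (fst w) (snd w)) \<in> borel_measurable (restrict_space borel X \<Otimes>\<^sub>M Z)"
      using update_measurable[of \<nu>] measurable_restrict_space2_iff by (auto simp: case_prod_beta')
    have h: "(\<lambda>w. ennreal (D u (update \<nu> (fst w) (snd w)))) \<in> borel_measurable (restrict_space borel X \<Otimes>\<^sub>M Z)"
      using up by measurable
    have "ennreal (Dt (Suc t)) + ennreal (\<nu> * gt t) =
        (\<integral>\<^sup>+\<omega>. ennreal (D u (x (Suc t) \<omega>)) \<partial>M) + (\<integral>\<^sup>+\<omega>. ennreal (\<nu> * (F (x t \<omega>) - F u)) \<partial>M)"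
    proof -
      have "(\<integral>\<^sup>+\<omega>. ennreal (D u (x (Suc t) \<omega>)) \<partial>M) = ennreal (Dt (Suc t))"
        unfolding Dt_def by (rule nn_integral_eq_integral[OF D_int[OF tT(2)]]) (simp add: bregman_nonneg)
      moreover have "(\<integral>\<^sup>+\<omega>. ennreal (\<nu> * (F (x t \<omega>) - F u)) \<partial>M) = ennreal (\<integral>\<omega>. \<nu> * (F (x t \<omega>) - F u) \<partial>M)"
        using F_int[OF tT(1)] \<nu> u(2) xX[OF tT(1)] by (intro nn_integral_eq_integral) (auto intro!: AE_I2)
      moreover have "(\<integral>\<omega>. \<nu> * (F (x t \<omega>) - F u) \<partial>M) = \<nu> * gt t"
        using F_int[OF tT(1)] by (simp add: gt_def M.prob_space)
      ultimately show ?thesis by (simp only:)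
    qed
    also have "(\<integral>\<^sup>+\<omega>. ennreal (D u (x (Suc t) \<omega>)) \<partial>M) = (\<integral>\<^sup>+\<omega>. ennreal (D u (update \<nu> (x t \<omega>) (z t \<omega>))) \<partial>M)"
      by (intro nn_integral_cong) (simp add: step[OF t])
    also have "\<dots> = (\<integral>\<^sup>+\<omega>. \<integral>\<^sup>+y. ennreal (D u (update \<nu> (x t \<omega>) y)) \<partial>Z \<partial>M)"
      using fub[OF t h] by simp
    also have "\<dots> + (\<integral>\<^sup>+\<omega>. ennreal (\<nu> * (F (x t \<omega>) - F u)) \<partial>M) =
        (\<integral>\<^sup>+\<omega>. (\<integral>\<^sup>+y. ennreal (D u (update \<nu> (x t \<omega>) y)) \<partial>Z) + ennreal (\<nu> * (F (x t \<omega>) - F u)) \<partial>M)"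
    proof (rule nn_integral_add[symmetric])
      interpret PZ: prob_space Z by (rule prob_space_Z)
      have "(\<lambda>y. \<integral>\<^sup>+v. ennreal (D u (update \<nu> y v)) \<partial>Z) \<in> borel_measurable (restrict_space borel X)"
        using PZ.borel_measurable_nn_integral_fst[OF h] by simp
      then show "(\<lambda>\<omega>. \<integral>\<^sup>+y. ennreal (D u (update \<nu> (x t \<omega>) y)) \<partial>Z) \<in> borel_measurable M"
        by (rule measurable_compose[OF x_m[OF tT(1)]])
      show "(\<lambda>\<omega>. ennreal (\<nu> * (F (x t \<omega>) - F u))) \<in> borel_measurable M"
        using borel_measurable_integrable[OF F_int[OF tT(1)]] by measurable
    qed
    also have "\<dots> \<le> (\<integral>\<^sup>+\<omega>. ennreal (?rhs (x t \<omega>)) \<partial>M)"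
      by (intro nn_integral_mono pw xX[OF tT(1)])
    also have "\<dots> = ennreal (\<integral>\<omega>. ?rhs (x t \<omega>) \<partial>M)"
      using D_int[OF tT(1)] by (intro nn_integral_eq_integral) (auto intro!: AE_I2 add_nonneg_nonneg mult_nonneg_nonneg simp: bregman_nonneg b_def)
    also have "(\<integral>\<omega>. ?rhs (x t \<omega>) \<partial>M) = (1 + 1 / real T) * Dt t + b / real T"
      using D_int[OF tT(1)] by (simp add: Dt_def M.prob_space)
    finally have "ennreal (Dt (Suc t) + \<nu> * gt t) \<le> ennreal ((1 + 1 / real T) * Dt t + b / real T)"
      using Dt0[of "Suc t"] gt0[OF tT(1)] \<nu> by simp
    then show ?thesis
      by (subst (asm) ennreal_le_iff) (auto intro!: add_nonneg_nonneg mult_nonneg_nonneg Dt0 simp: b_def)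
  qed
  have b0: "b \<ge> 0" by (simp add: b_def)
  \<comment> \<open>A discrete Gronwall argument. The accumulated gaps are carried inside the
    induction, which works because they are nonnegative and the factor is at least 1.\<close>
  have "Dt t + \<nu> * (\<Sum>i<t. gt i) \<le> (1 + 1 / real T) ^ t * (Dt 0 + real t * (b / real T))" if "t \<le> T" for t
    using that
  proof (induction t)
    case (Suc t)
    let ?c = "1 + 1 / real T"
    have S0: "(\<Sum>i<t. gt i) \<ge> 0" using Suc.prems by (intro sum_nonneg gt0) auto
    have c1: "?c \<ge> 1" by simp
    have "Dt (Suc t) + \<nu> * (\<Sum>i<Suc t. gt i) \<le> ?c * Dt t + b / real T + \<nu> * (\<Sum>i<t. gt i)"
      using rec[of t] Suc.prems by (simp add: distrib_left)
    also have "\<dots> \<le> ?c * (Dt t + \<nu> * (\<Sum>i<t. gt i)) + b / real T"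
      using mult_right_mono[OF c1, of "\<nu> * (\<Sum>i<t. gt i)"] \<nu> S0 by (simp add: distrib_left)
    also have "\<dots> \<le> ?c * (?c ^ t * (Dt 0 + real t * (b / real T))) + ?c ^ Suc t * (b / real T)"
    proof (intro add_mono mult_left_mono)
      show "Dt t + \<nu> * (\<Sum>i<t. gt i) \<le> ?c ^ t * (Dt 0 + real t * (b / real T))" using Suc by simp
      have "1 * (b / real T) \<le> ?c ^ Suc t * (b / real T)" using b0 c1 by (intro mult_right_mono one_le_power) auto
      then show "b / real T \<le> ?c ^ Suc t * (b / real T)" by simp
    qed auto
    also have "\<dots> = ?c ^ Suc t * (Dt 0 + real (Suc t) * (b / real T))"
    proof -
      have "c * (c ^ t * (e + real t * v)) + c ^ Suc t * v = c ^ Suc t * (e + real (Suc t) * v)" for c e v :: real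
        by (simp add: algebra_simps)
      then show ?thesis by (simp only:)
    qed
    finally show ?case .
  qed simp
  from this[of T] have fin: "Dt T + \<nu> * (\<Sum>i<T. gt i) \<le> (1 + 1 / real T) ^ T * (Dt 0 + b)" using T by simp
  have "(1 + 1 / real T) ^ T \<le> exp (1 / real T) ^ T"
    by (intro power_mono exp_ge_add_one_self) auto
  also have "\<dots> = exp 1" using T by (simp add: exp_of_nat_mult[symmetric])
  also have "\<dots> \<le> 3" by (rule exp_le)
  finally have "(1 + 1 / real T) ^ T * (Dt 0 + b) \<le> 3 * (Dt 0 + b)"
    using Dt0[of 0] b0 by (intro mult_right_mono) auto
  then show ?thesis using fin Dt0[of T] by (simp add: Dt_def gt_def b_def)
qed

lemma average_in:
  assumes "\<And>t. t < T \<Longrightarrow> y t \<in> X" "T \<ge> 1"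
  shows "(1 / real T) *\<^sub>R (\<Sum>t<T. y t) \<in> X"
proof -
  have "(\<Sum>t<T. (1 / real T) *\<^sub>R y t) \<in> X"
    using assms X by (intro convex_sum) auto
  then show ?thesis by (simp add: scaleR_sum_right)
qed

lemma F_average:
  assumes "\<And>t. t < T \<Longrightarrow> y t \<in> X" "T \<ge> 1"
  shows "F ((1 / real T) *\<^sub>R (\<Sum>t<T. y t)) \<le> (1 / real T) * (\<Sum>t<T. F (y t))"
proof -
  have "F (\<Sum>t<T. (1 / real T) *\<^sub>R y t) \<le> (\<Sum>t<T. (1 / real T) * F (y t))"
    using assms by (intro convex_on_sum[OF _ _ F_convex]) (auto simp: lessThan_empty_iff)
  then show ?thesis by (simp add: scaleR_sum_right sum_distrib_left)
qed

end

section \<open>One restart\<close>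

text \<open>The arithmetic of one restart, isolated from probability. With \<open>W\<close> for the
  root of the number of steps and \<open>Q\<close> for the bracket in its prescription,
  \<open>W\<close> lies between two multiples of \<open>Q\<close>. The lower one makes the run long
  enough to halve the radius; the upper one keeps \<tau>, which has \<open>W\<close> in its
  denominator, large enough for the noise.\<close>

lemma restart_parameters:
  fixes \<kappa> s r \<Lambda> \<mu> M2 R \<sigma> \<tau> \<nu> \<Delta> Tn hT HT uD d :: real
  assumes \<kappa>: "0 < \<kappa>" "\<kappa> \<le> 1" and s: "s = (1 + \<kappa>) / \<kappa>" and r: "s \<le> r" and \<Lambda>: "1 \<le> \<Lambda>"
    and pos: "\<mu> > 0" "M2 > 0" "R > 0" "\<sigma> > 0" "Tn > 0" "d > 0"
    and hT: "(10 ^ 8 * s * (2 * \<Lambda>) powr s) powr s \<le> hT" "hT \<le> HT"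
    and T: "hT * (\<sigma> * 2 powr (1 + r) / (\<mu> * R powr (r - 1))) powr s \<le> Tn"
      "Tn \<le> HT * (\<sigma> * 2 powr (1 + r) / (\<mu> * R powr (r - 1))) powr s"
    and \<tau>: "\<tau> = \<sigma> * R / (M2 * Tn powr (1 / s))"
    and \<nu>: "\<nu> = R powr (1 / \<kappa>) / \<sigma> * Tn powr (- 1 / (1 + \<kappa>))"
    and \<Delta>: "\<Delta> \<le> uD * (\<mu>\<^sup>2 * R powr (2 * r - 1) / (M2 * sqrt d))"
    and uD: "0 \<le> uD" "uD \<le> 1 / (10 ^ 3 * s * 8 powr r * HT * \<Lambda> powr r)"
  shows "\<nu> > 0" "\<nu> * M2 * \<tau> = R powr s / Tn" "(\<nu> * (720 * \<sigma>)) powr (1 + \<kappa>) \<le> 518400 * R powr s / Tn"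
    "\<nu> * (5 * sqrt d * \<Delta> / \<tau>) \<le> R powr (s - 1) / (s * Tn)"
    "3 * ((2 * \<Lambda> * R) powr s / s + 518403 * R powr s) \<le> \<nu> * Tn * (\<mu> / 2 * (R / 2) powr r)"
    "\<mu> * R powr (r - 1) \<le> 2 * M2 * \<Lambda> powr (r - 1) \<Longrightarrow> sqrt d * \<Delta> / \<tau> \<le> M2"
proof -
  have s2: "s \<ge> 2" using \<kappa> by (simp add: s field_simps)
  have s1: "1 / \<kappa> = s - 1" using \<kappa> by (simp add: s field_simps)
  have e1: "- 1 / (1 + \<kappa>) = 1 / s - 1" using \<kappa> by (simp add: s field_simps)
  have se: "(s - 1) * (1 + \<kappa>) = s" using \<kappa> by (simp add: s field_simps)
  define W where "W = Tn powr (1 / s)"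
  define P where "P = \<mu> * R powr (r - 1)"
  define q where "q = 2 powr (1 + r) / P"
  define Q where "Q = \<sigma> * 2 powr (1 + r) / (\<mu> * R powr (r - 1))"
  define b where "b = 10 ^ 8 * s * (2 * \<Lambda>) powr s"
  define K where "K = HT powr (1 / s)"
  have W: "W > 0" using pos by (simp add: W_def)
  have P: "P > 0" using pos by (simp add: P_def)
  have q: "q > 0" using P by (simp add: q_def)
  have Pq: "P * q = 2 powr (1 + r)" using P by (simp add: q_def)
  have Q: "Q = \<sigma> * q" by (simp add: Q_def q_def P_def)
  have Qp: "Q > 0" using q pos by (simp add: Q)
  have L4: "(2 * \<Lambda>) powr s \<ge> 4"
  proof -
    have "(4 :: real) = 2 powr 2" by simp
    also have "\<dots> \<le> 2 powr s" using s2 by (intro powr_mono) auto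
    also have "\<dots> \<le> (2 * \<Lambda>) powr s" using \<Lambda> s2 by (intro powr_mono2) auto
    finally show ?thesis .
  qed
  have b1: "b \<ge> 1"
  proof -
    have "1 * 1 \<le> (10 ^ 8 * s) * (2 * \<Lambda>) powr s" using s2 L4 by (intro mult_mono) auto
    then show ?thesis by (simp add: b_def)
  qed
  have HT1: "HT \<ge> 1"
    using hT ge_one_powr_ge_zero[of b s] b1 s2 unfolding b_def[symmetric] by linarith
  have root: "(x powr s) powr (1 / s) = x" if "x > 0" for x using that s2 by (simp add: powr_powr)
  have W_ge: "b * Q \<le> W"
  proof -
    have "(b * Q) powr s = b powr s * Q powr s" by (rule powr_mult)
    also have "\<dots> \<le> hT * Q powr s" using hT by (intro mult_right_mono) (auto simp: b_def)
    also have "\<dots> \<le> Tn" using T(1) by (simp add: Q_def)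
    finally have "((b * Q) powr s) powr (1 / s) \<le> W" unfolding W_def using s2 by (intro powr_mono2) auto
    then show ?thesis using root[of "b * Q"] b1 Qp by simp
  qed
  have W_le: "W \<le> K * Q"
  proof -
    have "W \<le> (HT * Q powr s) powr (1 / s)"
      unfolding W_def using T(2) pos s2 by (intro powr_mono2) (auto simp: Q_def)
    also have "\<dots> = K * Q" using root[OF Qp] by (simp add: powr_mult K_def)
    finally show ?thesis .
  qed
  have K1: "K \<ge> 1" unfolding K_def using HT1 s2 by (intro ge_one_powr_ge_zero) auto
  \<comment> \<open>In the noise condition the upper bound on \<open>W\<close> enters twice, through
    \<nu> and through \<tau>. Since \<open>2 / s \<le> 1\<close>, the single factor
    \<open>HT\<close> in \<open>max_noise_factor\<close> pays for both.\<close>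
  have KK: "K * K \<le> HT"
  proof -
    have "K * K = HT powr (2 / s)" by (simp add: K_def powr_add[symmetric] field_simps)
    also have "\<dots> \<le> HT powr 1" using HT1 s2 by (intro powr_mono) auto
    finally show ?thesis using HT1 by simp
  qed
  have KH: "K \<le> HT" using mult_left_mono[OF K1, of K] K1 KK by linarith
  have \<nu>': "\<nu> = R powr (s - 1) * W / (\<sigma> * Tn)"
  proof -
    have "Tn powr (1 / s - 1) = W / Tn" using pos by (simp add: W_def powr_diff)
    then show ?thesis unfolding \<nu> s1 e1 by simp
  qed
  have \<tau>': "\<tau> = \<sigma> * R / (M2 * W)" by (simp add: \<tau> W_def)
  have \<tau>p: "\<tau> > 0" using pos W by (simp add: \<tau>')
  show \<nu>p: "\<nu> > 0" using pos W by (simp add: \<nu>')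
  have RR: "R powr (s - 1) * R = R powr s" using pos by (simp add: powr_diff)
  show "\<nu> * M2 * \<tau> = R powr s / Tn"
    using pos W RR by (simp add: \<nu>' \<tau>' field_simps)
  show "(\<nu> * (720 * \<sigma>)) powr (1 + \<kappa>) \<le> 518400 * R powr s / Tn"
  proof -
    have "\<nu> * (720 * \<sigma>) = 720 * (R powr (s - 1) * Tn powr (- 1 / (1 + \<kappa>)))"
      using pos by (simp add: \<nu> s1)
    then have "(\<nu> * (720 * \<sigma>)) powr (1 + \<kappa>) = 720 powr (1 + \<kappa>) * (R powr ((s - 1) * (1 + \<kappa>)) * Tn powr (- 1 / (1 + \<kappa>) * (1 + \<kappa>)))"
      by (simp only: powr_mult powr_powr)
    also have "- 1 / (1 + \<kappa>) * (1 + \<kappa>) = - 1" using \<kappa> by simp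
    also have "Tn powr (- 1) = 1 / Tn" using pos by (simp add: powr_minus_divide)
    also have "720 powr (1 + \<kappa>) * (R powr ((s - 1) * (1 + \<kappa>)) * (1 / Tn)) \<le> 720 powr 2 * (R powr s * (1 / Tn))"
      unfolding se using \<kappa> pos by (intro mult_right_mono powr_mono) auto
    finally show ?thesis by simp
  qed
  have uH: "uD * HT * (10 ^ 3 * s * 8 powr r * \<Lambda> powr r) \<le> 1"
  proof -
    have "10 ^ 3 * s * 8 powr r * HT * \<Lambda> powr r > 0" using s2 HT1 \<Lambda> by (intro mult_pos_pos) auto
    then show ?thesis using uD(2) by (simp add: pos_le_divide_eq mult_ac)
  qed
  \<comment> \<open>The noise relative to the smoothing radius; \<sigma> cancels between \<tau> and
    the bound on \<open>W\<close>, so the right side contains no circular quantity.\<close>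
  have noise: "sqrt d * \<Delta> / \<tau> \<le> uD * K * (P * 2 powr (1 + r))"
  proof -
    have "sqrt d * \<Delta> / \<tau> = (sqrt d * M2 * \<Delta>) * (W / (\<sigma> * R))" using pos W by (simp add: \<tau>' field_simps)
    also have "\<dots> \<le> (uD * (\<mu>\<^sup>2 * R powr (2 * r - 1))) * (K * q / R)"
    proof (rule mult_mono)
      have "sqrt d * M2 * \<Delta> \<le> sqrt d * M2 * (uD * (\<mu>\<^sup>2 * R powr (2 * r - 1) / (M2 * sqrt d)))"
        using pos by (intro mult_left_mono \<Delta>) auto
      also have "\<dots> = uD * (\<mu>\<^sup>2 * R powr (2 * r - 1))" using pos by simp
      finally show "sqrt d * M2 * \<Delta> \<le> uD * (\<mu>\<^sup>2 * R powr (2 * r - 1))" .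
      have "W / (\<sigma> * R) \<le> K * Q / (\<sigma> * R)" using pos by (intro divide_right_mono W_le) auto
      also have "\<dots> = K * q / R" using pos by (simp add: Q)
      finally show "W / (\<sigma> * R) \<le> K * q / R" .
    qed (use pos W uD in auto)
    also have "\<dots> = uD * K * (P * 2 powr (1 + r))"
    proof -
      have "R powr (2 * r - 1) = R powr (r - 1) * R powr (r - 1) * R"
        using pos by (simp add: powr_add[symmetric] powr_mult_base[symmetric] flip: powr_mult_base) (simp add: powr_diff power2_eq_square powr_add[symmetric])
      then have "\<mu>\<^sup>2 * R powr (2 * r - 1) = P * P * R" by (simp add: P_def power2_eq_square)
      then show ?thesis using pos by (simp add: Pq[symmetric])
    qed
    finally show ?thesis .
  qed
  show "\<nu> * (5 * sqrt d * \<Delta> / \<tau>) \<le> R powr (s - 1) / (s * Tn)"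
  proof -
    have "\<nu> * (5 * sqrt d * \<Delta> / \<tau>) = 5 * \<nu> * (sqrt d * \<Delta> / \<tau>)" by simp
    also have "\<dots> \<le> 5 * \<nu> * (uD * K * (P * 2 powr (1 + r)))" using \<nu>p by (intro mult_left_mono noise) auto
    also have "\<dots> = R powr (s - 1) / Tn * (5 * (uD * K * (P * 2 powr (1 + r))) * (W / \<sigma>))" by (simp add: \<nu>' mult_ac)
    also have "\<dots> \<le> R powr (s - 1) / Tn * (5 * (uD * K * (P * 2 powr (1 + r))) * (K * q))"
    proof (intro mult_left_mono)
      show "W / \<sigma> \<le> K * q" using W_le pos by (simp add: Q field_simps)
    qed (use pos uD K1 P in auto)
    also have "\<dots> = R powr (s - 1) / Tn * (5 * (uD * (K * K)) * (2 powr (1 + r) * 2 powr (1 + r)))"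
      by (simp add: Pq[symmetric])
    also have "\<dots> \<le> R powr (s - 1) / Tn * (5 * (uD * HT) * (2 powr (1 + r) * 2 powr (1 + r)))"
      using pos uD by (intro mult_left_mono mult_right_mono KK) auto
    also have "\<dots> \<le> R powr (s - 1) / Tn * (1 / s)"
    proof (rule mult_left_mono)
      have four: "2 powr (1 + r) * 2 powr (1 + r) = 4 * (4 :: real) powr r"
      proof -
        have "(4 :: real) powr r = (2 * 2) powr r" by simp
        also have "\<dots> = 2 powr r * 2 powr r" by (rule powr_mult)
        finally show ?thesis by (simp add: powr_add)
      qed
      have "(4 :: real) powr r \<le> 8 powr r" using r s2 by (intro powr_mono2) auto
      also have "\<dots> \<le> 8 powr r * \<Lambda> powr r"
      proof -
        have "1 \<le> \<Lambda> powr r" using \<Lambda> r s2 by (intro ge_one_powr_ge_zero) auto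
        from mult_left_mono[OF this, of "8 powr r"] show ?thesis by simp
      qed
      finally have e8: "(4 :: real) powr r \<le> 8 powr r * \<Lambda> powr r" .
      have "s * (5 * (uD * HT) * (2 powr (1 + r) * 2 powr (1 + r))) = 20 * ((uD * HT) * s * 4 powr r)"
        by (simp add: four)
      also have "\<dots> \<le> 20 * ((uD * HT) * s * (8 powr r * \<Lambda> powr r))"
        using uD HT1 s2 by (intro mult_left_mono e8) auto
      also have "\<dots> \<le> 10 ^ 3 * ((uD * HT) * s * (8 powr r * \<Lambda> powr r))"
        using uD HT1 s2 by (intro mult_right_mono) auto
      also have "\<dots> \<le> 1" using uH by (simp add: mult_ac)
      finally show "5 * (uD * HT) * (2 powr (1 + r) * 2 powr (1 + r)) \<le> 1 / s" using s2 by (simp add: field_simps)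
    qed (use pos in auto)
    finally show ?thesis using pos s2 by (simp add: mult_ac)
  qed
  \<comment> \<open>The left side is at most \<open>b * R powr s\<close>, and the right side equals
    \<open>W / Q * R powr s\<close>. The condition is therefore \<open>b * Q \<le> W\<close>, which
    is why \<open>min_steps_factor\<close> is the power \<open>s\<close> of
    \<open>b\<close>.\<close>
  show "3 * ((2 * \<Lambda> * R) powr s / s + 518403 * R powr s) \<le> \<nu> * Tn * (\<mu> / 2 * (R / 2) powr r)"
  proof -
    define L where "L = (2 * \<Lambda>) powr s"
    have "(2 * \<Lambda> * R) powr s = L * R powr s" by (simp add: L_def powr_mult)
    then have "3 * ((2 * \<Lambda> * R) powr s / s + 518403 * R powr s) = 3 * (L / s + 518403) * R powr s"
      by (simp add: algebra_simps)
    also have "\<dots> \<le> (10 ^ 8 * s * L) * R powr s"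
    proof (rule mult_right_mono)
      have L: "L \<ge> 4" using L4 by (simp add: L_def)
      have "L / s \<le> L / 1" using s2 L by (intro divide_left_mono) auto
      then have "3 * (L / s + 518403) \<le> 10 ^ 8 * (2 * L)" using L by simp
      also have "\<dots> \<le> 10 ^ 8 * (s * L)" using s2 L by (intro mult_left_mono mult_right_mono) auto
      finally show "3 * (L / s + 518403) \<le> 10 ^ 8 * s * L" by simp
    qed simp
    also have "\<dots> = b * R powr s" by (simp add: b_def L_def)
    also have "\<dots> = b * Q * (R powr s * P / (\<sigma> * 2 powr (1 + r)))"
      using pos P by (simp add: Q q_def)
    also have "\<dots> \<le> W * (R powr s * P / (\<sigma> * 2 powr (1 + r)))"
      using pos P by (intro mult_right_mono W_ge) auto
    also have "\<dots> = \<nu> * Tn * (\<mu> / 2 * (R / 2) powr r)"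
    proof -
      have "R powr s * P = R powr (s - 1) * (\<mu> * R powr r)"
      proof -
        have "R * R powr (r - 1) = R powr r" using pos by (simp add: powr_diff)
        moreover have "R powr s * P = R powr (s - 1) * (\<mu> * (R * R powr (r - 1)))"
          unfolding P_def RR[symmetric] by (simp only: mult_ac)
        ultimately show ?thesis by (simp only:)
      qed
      moreover have "(R / 2) powr r = R powr r / 2 powr r" using pos by (simp add: powr_divide)
      moreover have "\<nu> * Tn = R powr (s - 1) * W / \<sigma>" using pos by (simp add: \<nu>')
      moreover have "2 powr (1 + r) = 2 * (2 :: real) powr r" by (simp add: powr_add)
      ultimately show ?thesis by (simp only:) simp
    qed
    finally show ?thesis .
  qed
  \<comment> \<open>The noise bound scales like \<open>\<mu> * R powr (r - 1)\<close>. That this is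
    at most a multiple of \<open>M2\<close> does not follow from the parameters; it is a premise
    here, supplied by comparing growth with the Lipschitz bound.\<close>
  show "sqrt d * \<Delta> / \<tau> \<le> M2" if P_le: "\<mu> * R powr (r - 1) \<le> 2 * M2 * \<Lambda> powr (r - 1)"
  proof -
    have "sqrt d * \<Delta> / \<tau> \<le> uD * K * (P * 2 powr (1 + r))" by (rule noise)
    also have "\<dots> \<le> uD * HT * ((2 * M2 * \<Lambda> powr r) * (2 * 8 powr r))"
    proof (intro mult_mono)
      show "P \<le> 2 * M2 * \<Lambda> powr r"
      proof -
        have "\<Lambda> powr (r - 1) \<le> \<Lambda> powr r" using \<Lambda> by (intro powr_mono) auto
        then have "2 * M2 * \<Lambda> powr (r - 1) \<le> 2 * M2 * \<Lambda> powr r" using pos by (intro mult_left_mono) auto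
        then show ?thesis using P_le by (simp add: P_def)
      qed
      have "(2 :: real) powr r \<le> 8 powr r" using r s2 by (intro powr_mono2) auto
      then show "2 powr (1 + r) \<le> 2 * (8 :: real) powr r" by (simp add: powr_add)
    qed (use KH uD HT1 K1 P pos in auto)
    also have "\<dots> = 4 * M2 * (uD * HT * (8 powr r * \<Lambda> powr r))" by simp
    also have "\<dots> \<le> 4 * M2 * (1 / 10 ^ 3)"
    proof (rule mult_left_mono)
      have "uD * HT * (8 powr r * \<Lambda> powr r) * 1 \<le> uD * HT * (8 powr r * \<Lambda> powr r) * s"
        using s2 uD HT1 by (intro mult_left_mono mult_nonneg_nonneg) auto
      then show "uD * HT * (8 powr r * \<Lambda> powr r) \<le> 1 / 10 ^ 3" using uH by (simp add: mult_ac)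
    qed (use pos in auto)
    also have "\<dots> \<le> M2" using pos by simp
    finally show ?thesis .
  qed
qed

section \<open>Gap after one run and start of the next\<close>

context zo_step
begin

text \<open>Convexity passes from the iterates to their average. The free bounds \<open>D0\<close>
  and \<open>E\<close> keep the analysis of the run apart from the choice of parameters.\<close>

lemma run_gap:
  fixes x :: "nat \<Rightarrow> 'w \<Rightarrow> real ^ 'n" and z :: "nat \<Rightarrow> 'w \<Rightarrow> (real ^ 'n) \<times> 's"
  assumes M: "prob_space M" and x_m: "\<And>t. t \<le> T \<Longrightarrow> x t \<in> M \<rightarrow>\<^sub>M restrict_space borel X"
    and step: "\<And>t \<omega>. t < T \<Longrightarrow> \<omega> \<in> space M \<Longrightarrow> x (Suc t) \<omega> = update \<nu> (x t \<omega>) (z t \<omega>)"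
    and fub: "\<And>t h. t < T \<Longrightarrow> h \<in> borel_measurable (restrict_space borel X \<Otimes>\<^sub>M Z) \<Longrightarrow>
      (\<integral>\<^sup>+\<omega>. h (x t \<omega>, z t \<omega>) \<partial>M) = (\<integral>\<^sup>+\<omega>. \<integral>\<^sup>+y. h (x t \<omega>, y) \<partial>Z \<partial>M)"
    and u: "u \<in> X" "\<And>y. y \<in> X \<Longrightarrow> F u \<le> F y" and \<nu>: "\<nu> > 0" and R: "R > 0" and T: "T \<ge> 1"
    and A1: "\<nu> * M2 * \<tau> \<le> R powr s / real T"
    and A2: "(\<nu> * (720 * sigma_const \<kappa> (real CARD('n)) q M2 \<Delta> \<tau>)) powr (1 + \<kappa>) \<le> 518400 * R powr s / real T"
    and A3: "\<nu> * (5 * sqrt (real CARD('n)) * \<Delta> / \<tau>) \<le> R powr (s - 1) / (s * real T)"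
    and D0: "(\<integral>\<omega>. D u (x 0 \<omega>) \<partial>M) \<le> D0" and E: "3 * (D0 + 518403 * R powr s) \<le> \<nu> * real T * E"
  shows "(\<integral>\<omega>. F ((1 / real T) *\<^sub>R (\<Sum>t<T. x t \<omega>)) \<partial>M) - F u \<le> E"
proof -
  interpret M: prob_space M by fact
  have xX: "x t \<omega> \<in> X" if "t \<le> T" "\<omega> \<in> space M" for t \<omega>
    using measurable_space[OF x_m[OF that(1)] that(2)] by (simp add: space_restrict_space)
  have xb [measurable]: "x t \<in> borel_measurable M" if "t < T" for t
    using x_m[of t] that measurable_restrict_space2_iff by auto
  have avg: "(\<lambda>\<omega>. (1 / real T) *\<^sub>R (\<Sum>t<T. x t \<omega>)) \<in> M \<rightarrow>\<^sub>M restrict_space borel X"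
    by (rule measurable_restrict_space2) (use xX T in \<open>auto intro!: average_in\<close>)
  have F_int: "integrable M (\<lambda>\<omega>. F (x t \<omega>))" if "t < T" for t using that by (intro F_integrable[OF M x_m]) auto
  have "(\<integral>\<omega>. F ((1 / real T) *\<^sub>R (\<Sum>t<T. x t \<omega>)) \<partial>M) \<le> (\<integral>\<omega>. (1 / real T) * (\<Sum>t<T. F (x t \<omega>)) \<partial>M)"
  proof (rule integral_mono[OF F_integrable[OF M avg]])
    show "integrable M (\<lambda>\<omega>. (1 / real T) * (\<Sum>t<T. F (x t \<omega>)))"
      using F_int by (intro integrable_mult_right Bochner_Integration.integrable_sum) auto
    show "F ((1 / real T) *\<^sub>R (\<Sum>t<T. x t \<omega>)) \<le> (1 / real T) * (\<Sum>t<T. F (x t \<omega>))" if "\<omega> \<in> space M" for \<omega>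
      using xX that T by (intro F_average) auto
  qed
  also have "\<dots> = (1 / real T) * (\<Sum>t<T. (\<integral>\<omega>. F (x t \<omega>) \<partial>M))" using F_int by simp
  finally have "(\<integral>\<omega>. F ((1 / real T) *\<^sub>R (\<Sum>t<T. x t \<omega>)) \<partial>M) - F u \<le> (1 / real T) * (\<Sum>t<T. (\<integral>\<omega>. F (x t \<omega>) \<partial>M) - F u)"
    using T by (simp add: sum_subtractf right_diff_distrib)
  then have "\<nu> * real T * ((\<integral>\<omega>. F ((1 / real T) *\<^sub>R (\<Sum>t<T. x t \<omega>)) \<partial>M) - F u) \<le> \<nu> * real T * ((1 / real T) * (\<Sum>t<T. (\<integral>\<omega>. F (x t \<omega>) \<partial>M) - F u))"
    using \<nu> by (intro mult_left_mono) auto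
  also have "\<dots> = \<nu> * (\<Sum>t<T. (\<integral>\<omega>. F (x t \<omega>) \<partial>M) - F u)" using T by simp
  also have "\<dots> \<le> 3 * ((\<integral>\<omega>. D u (x 0 \<omega>) \<partial>M) + 518403 * R powr s)"
    by (rule run_bound[where x=x and z=z, OF M x_m step fub u less_imp_le[OF \<nu>] R T A1 A2 A3])
  also have "\<dots> \<le> 3 * (D0 + 518403 * R powr s)" by (intro mult_left_mono add_right_mono D0) simp
  also note E
  finally show ?thesis using \<nu> T by simp
qed

text \<open>Growth turns the gap into a moment of order \<open>r\<close> of the distance, Jensen
  lowers the order to \<open>s \<le> r\<close>, and the distortion returns to divergences. The floor
  in the distortion is harmless because the scale \<open>R\<close> of a restart never falls below
  the radius divided by \<open>2 ^ N\<close>.\<close>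

lemma next_start:
  assumes M: "prob_space M" and Y: "Y \<in> M \<rightarrow>\<^sub>M restrict_space borel X"
    and u: "u \<in> X" and growth: "\<And>x. x \<in> X \<Longrightarrow> \<mu> / 2 * lp_norm p (x - u) powr r \<le> F x - F u"
    and \<mu>: "\<mu> > 0" and r: "s \<le> r" and R: "R > 0" "prox_radius \<kappa> \<psi> X / 2 ^ N \<le> R"
    and gap: "(\<integral>\<omega>. F (Y \<omega>) \<partial>M) - F u \<le> \<mu> / 2 * R powr r" and R0: "prox_radius \<kappa> \<psi> X > 0"
  shows "(\<integral>\<omega>. D u (Y \<omega>) \<partial>M) \<le> (2 * prox_distortion \<kappa> p \<psi> X u N * R) powr s / s"
proof -
  interpret M: prob_space M by fact
  define \<Lambda> where "\<Lambda> = prox_distortion \<kappa> p \<psi> X u N"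
  have \<Lambda>: "\<Lambda> \<ge> 1" using prox_distortion_ge(1)[OF R0] by (simp add: \<Lambda>_def)
  define n where "n \<omega> = lp_norm p (Y \<omega> - u)" for \<omega>
  have YX: "Y \<omega> \<in> X" if "\<omega> \<in> space M" for \<omega> using measurable_space[OF Y that] by (simp add: space_restrict_space)
  have Yb [measurable]: "Y \<in> borel_measurable M" using Y measurable_restrict_space2_iff by blast
  have n_m [measurable]: "n \<in> borel_measurable M" unfolding n_def by measurable
  have F_int: "integrable M (\<lambda>\<omega>. F (Y \<omega>))" by (rule F_integrable[OF M Y])
  have r0: "r > 0" using r s2 by simp
  have nr_int: "integrable M (\<lambda>\<omega>. n \<omega> powr r)"
  proof (rule M.integrable_const_bound[of _ "lp_diameter p X powr r"])
    show "AE \<omega> in M. norm (n \<omega> powr r) \<le> lp_diameter p X powr r"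
      using lp_norm_le_diameter[OF YX u] r0 by (intro AE_I2) (auto simp: n_def intro!: powr_mono2)
  qed measurable
  have "\<mu> / 2 * (\<integral>\<omega>. n \<omega> powr r \<partial>M) = (\<integral>\<omega>. \<mu> / 2 * n \<omega> powr r \<partial>M)" by simp
  also have "\<dots> \<le> (\<integral>\<omega>. F (Y \<omega>) - F u \<partial>M)"
    using nr_int F_int growth[OF YX] by (intro integral_mono) (auto simp: n_def)
  also have "\<dots> \<le> \<mu> / 2 * R powr r" using gap F_int by (simp add: M.prob_space)
  finally have nr: "(\<integral>\<omega>. n \<omega> powr r \<partial>M) \<le> R powr r" using \<mu> by simp
  have ns: "integrable M (\<lambda>\<omega>. n \<omega> powr s)" "(\<integral>\<omega>. n \<omega> powr s \<partial>M) \<le> R powr s"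
  proof -
    have eq: "(n \<omega> powr r) powr (s / r) = n \<omega> powr s" for \<omega> using r0 by (simp add: powr_powr)
    have sr: "0 < s / r" "s / r \<le> 1" using r r0 s2 by auto
    note ex = M.expectation_powr_le[OF nr_int _ sr]
    show "integrable M (\<lambda>\<omega>. n \<omega> powr s)" using ex(1) by (simp add: eq)
    have "(\<integral>\<omega>. n \<omega> powr s \<partial>M) \<le> (\<integral>\<omega>. n \<omega> powr r \<partial>M) powr (s / r)" using ex(2) by (simp add: eq)
    also have "\<dots> \<le> (R powr r) powr (s / r)" using nr sr by (intro powr_mono2) auto
    also have "\<dots> = R powr s" using r0 by (simp add: powr_powr)
    finally show "(\<integral>\<omega>. n \<omega> powr s \<partial>M) \<le> R powr s" .
  qed
  have pw: "s * D u (Y \<omega>) \<le> \<Lambda> powr s * (n \<omega> powr s + R powr s)" if w: "\<omega> \<in> space M" for \<omega>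
  proof -
    have "lp_diameter p X / 2 ^ N \<le> prox_radius \<kappa> \<psi> X / 2 ^ N" by (intro divide_right_mono lp_diameter_le_radius) simp
    then have dR: "lp_diameter p X / 2 ^ N \<le> R" using R by linarith
    have "s * D u (Y \<omega>) = ((s * D u (Y \<omega>)) powr (1 / s)) powr s"
      using s2 bregman_nonneg[where y=u and x="Y \<omega>"] by (simp add: powr_powr)
    also have "\<dots> \<le> (\<Lambda> * max (n \<omega>) (lp_diameter p X / 2 ^ N)) powr s"
      using prox_distortion_ge(3)[OF R0 u YX[OF w], of N] s2 by (intro powr_mono2) (auto simp: \<Lambda>_def n_def)
    also have "\<dots> \<le> (\<Lambda> * max (n \<omega>) R) powr s"
    proof (intro powr_mono2 mult_left_mono)
      show "max (n \<omega>) (lp_diameter p X / 2 ^ N) \<le> max (n \<omega>) R" using dR by (auto simp: max_def)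
      show "0 \<le> \<Lambda> * max (n \<omega>) (lp_diameter p X / 2 ^ N)" using \<Lambda> by (simp add: n_def le_max_iff_disj)
    qed (use s2 \<Lambda> in auto)
    also have "\<dots> = \<Lambda> powr s * (max (n \<omega>) R) powr s" by (rule powr_mult)
    also have "\<dots> \<le> \<Lambda> powr s * (n \<omega> powr s + R powr s)"
      by (intro mult_left_mono) (auto simp: max_def)
    finally show ?thesis .
  qed
  have "s * (\<integral>\<omega>. D u (Y \<omega>) \<partial>M) = (\<integral>\<omega>. s * D u (Y \<omega>) \<partial>M)" by simp
  also have "\<dots> \<le> (\<integral>\<omega>. \<Lambda> powr s * (n \<omega> powr s + R powr s) \<partial>M)"
    using bregman_integrable[OF M Y u] ns(1) pw by (intro integral_mono) auto
  also have "\<dots> = \<Lambda> powr s * ((\<integral>\<omega>. n \<omega> powr s \<partial>M) + R powr s)" using ns(1) by (simp add: M.prob_space)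
  also have "\<dots> \<le> \<Lambda> powr s * (R powr s + R powr s)" by (intro mult_left_mono add_right_mono ns) simp
  also have "\<dots> = 2 powr 1 * (\<Lambda> powr s * R powr s)" by simp
  also have "\<dots> \<le> 2 powr s * (\<Lambda> powr s * R powr s)" using s2 by (intro mult_right_mono powr_mono) auto
  also have "\<dots> = (2 * \<Lambda> * R) powr s" by (simp add: powr_mult)
  finally show ?thesis using s2 by (simp add: \<Lambda>_def field_simps)
qed

end

section \<open>Parameters of the restart scheme\<close>

text \<open>Conversion to a natural number sends nonpositive values to 0, so
  \<open>1 \<le> N\<close> makes the logarithm positive and hence \<open>y > 1\<close>. The two
  bounds say that rounding up costs at most one restart.\<close>

lemma restart_count:
  assumes r: "r > 0" and N: "N = nat \<lceil>1 / r * log 2 y\<rceil>" "1 \<le> N" and y: "y \<ge> 0"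
  shows "y > 1" "y \<le> 2 powr (real N * r)" "2 powr (real N) \<le> 2 * y powr (1 / r)"
proof -
  have "\<lceil>1 / r * log 2 y\<rceil> \<ge> 1" using N by linarith
  then have l0: "1 / r * log 2 y > 0" by linarith
  then have l: "log 2 y > 0" using r by (simp add: zero_less_divide_iff)
  \<comment> \<open>The logarithm of 0 is 0 by convention, so positivity excludes this
    value.\<close>
  then have "y \<noteq> 0" by (auto simp: log_def)
  then have y0: "y > 0" using y by simp
  then show y1: "y > 1" using l by simp
  have N1: "real N \<ge> 1 / r * log 2 y" "real N \<le> 1 / r * log 2 y + 1" using N l0 by linarith+
  have "log 2 y \<le> real N * r" using N1(1) r by (simp add: field_simps)
  then show "y \<le> 2 powr (real N * r)" using y0 by (simp add: log_le_iff)
  have "2 powr (real N) \<le> 2 powr (log 2 y * (1 / r) + 1)" using N1(2) by (intro powr_mono) (auto simp: mult.commute)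
  also have "\<dots> = 2 * (2 powr (log 2 y)) powr (1 / r)" by (simp only: powr_add powr_powr) simp
  also have "2 powr (log 2 y) = y" using y0 by simp
  finally show "2 powr (real N) \<le> 2 * y powr (1 / r)" .
qed

lemma powr_of_power2: "((2 :: real) ^ k) powr b = 2 powr (real k * b)"
  by (simp add: powr_powr flip: powr_realpow)

lemma geometric_sum_le:
  fixes c :: real assumes "c \<ge> 2" shows "(\<Sum>k=1..N. c ^ k) \<le> 2 * c ^ N"
proof (induction N)
  case (Suc N)
  have "2 * c ^ N \<le> c * c ^ N" using assms by (intro mult_right_mono) auto
  then show ?case using Suc by simp
qed simp

text \<open>The bounds on the numbers of steps grow geometrically with ratio at least 2, so their
  sum is at most twice the last one and the number of restarts causes no logarithmic factor.\<close>

lemma total_steps_bound: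
  fixes Tn \<sigma> :: "nat \<Rightarrow> real"
  assumes s: "s \<ge> 2" and r: "s \<le> r" and pos: "\<mu> > 0" "R0 > 0" "\<epsilon> > 0" "A > 0" "HT > 0"
    and N: "2 powr (real N) \<le> 2 * (\<mu> * R0 powr r / (2 * \<epsilon>)) powr (1 / r)"
    and \<sigma>: "\<And>k. k \<in> {1..N} \<Longrightarrow> 0 \<le> \<sigma> k \<and> \<sigma> k \<le> 2 * A"
    and Tn: "\<And>k. k \<in> {1..N} \<Longrightarrow> Tn k \<le> HT * (\<sigma> k * 2 powr (1 + r) / (\<mu> * (R0 / 2 ^ k) powr (r - 1))) powr s"
  shows "(\<Sum>k=1..N. Tn k) \<le> (HT * 2 powr ((2 * r + 3) * s)) * (A / \<mu> powr (1 / r) * (1 / \<epsilon> powr ((r - 1) / r))) powr s"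
proof -
  define B where "B = 2 * A * 2 powr (1 + r) / (\<mu> * R0 powr (r - 1))"
  define c where "c = 2 powr ((r - 1) * s)"
  have B: "B > 0" using pos by (simp add: B_def)
  have r2: "r \<ge> 2" using s r by simp
  have c2: "c \<ge> 2"
  proof -
    have "1 * 1 \<le> (r - 1) * s" using s r2 by (intro mult_mono) auto
    then have "2 powr 1 \<le> c" unfolding c_def by (intro powr_mono) auto
    then show ?thesis by simp
  qed
  have ck: "c ^ k = (2 powr (real k * (r - 1))) powr s" for k
  proof -
    have "c ^ k = c powr (real k)" using c2 by (simp add: powr_realpow)
    then show ?thesis by (simp add: c_def powr_powr mult_ac)
  qed
  have summand: "Tn k \<le> HT * (B powr s * c ^ k)" if k: "k \<in> {1..N}" for k
  proof -
    have Rk: "(R0 / 2 ^ k) powr (r - 1) = R0 powr (r - 1) / 2 powr (real k * (r - 1))"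
      using pos by (simp add: powr_divide powr_of_power2)
    have "\<sigma> k * 2 powr (1 + r) / (\<mu> * (R0 / 2 ^ k) powr (r - 1)) \<le> 2 * A * 2 powr (1 + r) / (\<mu> * (R0 / 2 ^ k) powr (r - 1))"
      using \<sigma>[OF k] pos by (intro divide_right_mono mult_right_mono) auto
    also have "\<dots> = B * 2 powr (real k * (r - 1))" using pos by (simp add: Rk B_def)
    finally have "(\<sigma> k * 2 powr (1 + r) / (\<mu> * (R0 / 2 ^ k) powr (r - 1))) powr s \<le> (B * 2 powr (real k * (r - 1))) powr s"
      using \<sigma>[OF k] pos s by (intro powr_mono2) auto
    also have "\<dots> = B powr s * c ^ k" by (simp only: powr_mult ck)
    finally show ?thesis using Tn[OF k] pos by (meson mult_left_mono order_trans less_imp_le)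
  qed
  have "(\<Sum>k=1..N. Tn k) \<le> (\<Sum>k=1..N. HT * (B powr s * c ^ k))" by (intro sum_mono summand)
  also have "\<dots> = HT * (B powr s * (\<Sum>k=1..N. c ^ k))" by (simp add: sum_distrib_left)
  also have "\<dots> \<le> HT * (B powr s * (2 * c ^ N))"
    using pos by (intro mult_left_mono geometric_sum_le c2) auto
  also have "\<dots> \<le> HT * (B powr s * (2 powr s * c ^ N))"
  proof -
    have "2 powr 1 \<le> (2 :: real) powr s" using s by (intro powr_mono) auto
    then show ?thesis using pos c2 by (intro mult_left_mono mult_right_mono) auto
  qed
  also have "\<dots> = HT * (2 * B * 2 powr (real N * (r - 1))) powr s"
    by (simp only: powr_mult ck mult_ac)
  also have "\<dots> \<le> HT * (2 powr (2 * r + 3) * (A / \<mu> powr (1 / r) * (1 / \<epsilon> powr ((r - 1) / r)))) powr s"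
  proof (intro mult_left_mono powr_mono2)
    \<comment> \<open>Inserting the bound on \<open>2 powr N\<close> eliminates \<open>R0\<close>:
      the power \<open>R0 powr (r - 1)\<close> in the denominator of \<open>B\<close> meets the same
      power in \<open>y powr b\<close>.\<close>
    define b where "b = (r - 1) / r"
    have b: "0 \<le> b" "1 / r = 1 - b" using r2 by (auto simp: b_def field_simps)
    define y where "y = \<mu> * R0 powr r / (2 * \<epsilon>)"
    have y: "y > 0" using pos by (simp add: y_def)
    have "2 powr (real N * (r - 1)) = (2 powr real N) powr (r - 1)" by (simp add: powr_powr)
    also have "\<dots> \<le> (2 * y powr (1 / r)) powr (r - 1)" using N r2 by (intro powr_mono2) (auto simp: y_def)
    also have "\<dots> = 2 powr (r - 1) * y powr b" by (simp add: powr_mult powr_powr b_def)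
    also have "y powr b = \<mu> powr b * R0 powr (r - 1) / (2 * \<epsilon>) powr b"
    proof -
      have "(R0 powr r) powr b = R0 powr (r - 1)" using r2 by (simp add: powr_powr b_def)
      then show ?thesis using pos by (simp add: y_def powr_divide powr_mult)
    qed
    also have "\<dots> \<le> \<mu> powr b * R0 powr (r - 1) / \<epsilon> powr b"
      using pos b by (intro divide_left_mono powr_mono2) auto
    finally have growth: "2 powr (real N * (r - 1)) \<le> 2 powr (r - 1) * (\<mu> powr b * R0 powr (r - 1) / \<epsilon> powr b)"
      by simp
    have "2 * B * 2 powr (real N * (r - 1)) \<le> 2 * B * (2 powr (r - 1) * (\<mu> powr b * R0 powr (r - 1) / \<epsilon> powr b))"
      using B by (intro mult_left_mono growth) auto
    also have "\<dots> = 4 * (2 powr (1 + r) * 2 powr (r - 1)) * A * (\<mu> powr b / \<mu>) / \<epsilon> powr b"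
      using pos by (simp add: B_def)
    also have "4 * (2 powr (1 + r) * 2 powr (r - 1)) = 2 powr (2 * r + 2)"
    proof -
      have "2 * r + 2 = 2 + ((1 + r) + (r - 1))" by simp
      then show ?thesis by (simp only: powr_add) simp
    qed
    also have "\<mu> powr b / \<mu> = 1 / \<mu> powr (1 / r)"
      using pos by (simp add: b(2) powr_diff)
    also have "2 powr (2 * r + 2) * A * (1 / \<mu> powr (1 / r)) / \<epsilon> powr b \<le> 2 powr (2 * r + 3) * A * (1 / \<mu> powr (1 / r)) / \<epsilon> powr b"
      using pos by (intro divide_right_mono mult_right_mono powr_mono) auto
    finally show "2 * B * 2 powr (real N * (r - 1)) \<le> 2 powr (2 * r + 3) * (A / \<mu> powr (1 / r) * (1 / \<epsilon> powr ((r - 1) / r)))"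
      by (simp add: b_def)
  qed (use B pos s in auto)
  also have "\<dots> = (HT * 2 powr ((2 * r + 3) * s)) * (A / \<mu> powr (1 / r) * (1 / \<epsilon> powr ((r - 1) / r))) powr s"
    by (simp only: powr_mult powr_powr mult.assoc)
  finally show ?thesis .
qed

text \<open>If the noise rate is at most \<open>M2\<close>, both terms inside \<sigma> are at most
  \<open>2 powr \<kappa> * A powr (1 + \<kappa>)\<close>, and the sum of two such terms is exactly
  the power of \<open>2 * A\<close>.\<close>

lemma sigma_const_bounds:
  assumes \<kappa>: "0 < \<kappa>" and pos: "d > 0" "a_const d q > 0" "M2 > 0"
  shows "0 < sigma_const \<kappa> d q M2 \<Delta> \<tau>"
    and "0 \<le> \<Delta> / \<tau> \<Longrightarrow> sqrt d * \<Delta> / \<tau> \<le> M2 \<Longrightarrow> sigma_const \<kappa> d q M2 \<Delta> \<tau> \<le> 2 * (a_const d q * M2 * sqrt d)"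
proof -
  define a where "a = a_const d q"
  define A where "A = a * M2 * sqrt d"
  have a: "a > 0" using pos by (simp add: a_def)
  have A: "A > 0" using pos a by (simp add: A_def)
  have sc: "sigma_const \<kappa> d q M2 \<Delta> \<tau> =
      (2 powr \<kappa> * (A / 2 powr (1 / 4)) powr (1 + \<kappa>) + 2 powr \<kappa> * (d * a * \<Delta> / \<tau>) powr (1 + \<kappa>)) powr (1 / (1 + \<kappa>))"
    by (simp add: sigma_const_def A_def a_def mult_ac)
  have "2 powr \<kappa> * (A / 2 powr (1 / 4)) powr (1 + \<kappa>) + 2 powr \<kappa> * (d * a * \<Delta> / \<tau>) powr (1 + \<kappa>) > 0"
    using A by (intro add_pos_nonneg) auto
  then show "0 < sigma_const \<kappa> d q M2 \<Delta> \<tau>" unfolding sc by simp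
  assume h: "0 \<le> \<Delta> / \<tau>" "sqrt d * \<Delta> / \<tau> \<le> M2"
  have "d * a * \<Delta> / \<tau> = sqrt d * a * (sqrt d * \<Delta> / \<tau>)"
  proof -
    have "d = sqrt d * sqrt d" using pos by simp
    then show ?thesis by (metis (no_types, lifting) mult.assoc mult.left_commute times_divide_eq_right)
  qed
  also have "\<dots> \<le> sqrt d * a * M2" using h pos a by (intro mult_left_mono) auto
  finally have B: "d * a * \<Delta> / \<tau> \<le> A" by (simp add: A_def mult_ac)
  have B0: "0 \<le> d * a * \<Delta> / \<tau>" using mult_nonneg_nonneg[OF _ h(1), of "d * a"] pos a by simp
  have A4: "A / 2 powr (1 / 4) \<le> A" using A ge_one_powr_ge_zero[of 2 "1 / 4"] by (simp add: divide_le_eq mult_le_cancel_left1)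
  have "2 powr \<kappa> * (A / 2 powr (1 / 4)) powr (1 + \<kappa>) + 2 powr \<kappa> * (d * a * \<Delta> / \<tau>) powr (1 + \<kappa>) \<le>
      2 powr \<kappa> * A powr (1 + \<kappa>) + 2 powr \<kappa> * A powr (1 + \<kappa>)"
    using A A4 B B0 \<kappa> by (intro add_mono mult_left_mono powr_mono2) auto
  also have "\<dots> = (2 * A) powr (1 + \<kappa>)"
  proof -
    have "(2 * A) powr (1 + \<kappa>) = (2 powr 1 * 2 powr \<kappa>) * A powr (1 + \<kappa>)"
      by (simp only: powr_mult powr_add[of 2])
    then show ?thesis by simp
  qed
  finally have "sigma_const \<kappa> d q M2 \<Delta> \<tau> \<le> ((2 * A) powr (1 + \<kappa>)) powr (1 / (1 + \<kappa>))"
    unfolding sc using \<kappa> by (intro powr_mono2) (auto intro!: add_nonneg_nonneg)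
  also have "\<dots> = 2 * A" using A \<kappa> by (simp add: powr_powr)
  finally show "sigma_const \<kappa> d q M2 \<Delta> \<tau> \<le> 2 * (a_const d q * M2 * sqrt d)" by (simp add: A_def a_def)
qed

text \<open>\<open>S\<close> is \<mu> times the power \<open>r\<close> of the last radius. The
  choice of \<open>N\<close> confines it between \<open>2 powr (1 - r) * \<epsilon>\<close> and
  \<open>2 * \<epsilon>\<close>, and the prescribed order of the noise is
  \<open>\<mu> powr (1 / r) / m\<close> times the power \<open>2 - 1 / r\<close> of
  \<open>S\<close>.\<close>

lemma final_noise_order:
  assumes r: "r \<ge> 2" and pos: "\<mu> > 0" "R0 > 0" "\<epsilon> > 0" "m > 0" and l: "0 \<le> lD" "0 \<le> uD"
    and N: "\<mu> * R0 powr r / (2 * \<epsilon>) \<le> 2 powr (real N * r)"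
      "2 powr (real N) \<le> 2 * (\<mu> * R0 powr r / (2 * \<epsilon>)) powr (1 / r)"
    and \<Delta>: "of_order lD uD \<Delta> (\<mu>\<^sup>2 * R0 powr (2 * r - 1) / m * (1 / 2 powr (real N * (2 * r - 1))))"
  shows "of_order (lD / 2 powr (2 * r)) (4 * uD) \<Delta> (\<mu> powr (1 / r) / m * \<epsilon> powr (2 - 1 / r))"
proof -
  define b where "b = 2 - 1 / r"
  define S where "S = \<mu> * R0 powr r / 2 powr (real N * r)"
  have b: "1 \<le> b" "b \<le> 2" "r * b = 2 * r - 1" using r by (auto simp: b_def field_simps)
  have S: "S > 0" using pos by (simp add: S_def)
  have S_le: "S \<le> 2 * \<epsilon>"
    using N(1) pos by (simp add: S_def field_simps)
  have S_ge: "2 powr (1 - r) * \<epsilon> \<le> S"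
  proof -
    have "2 powr (real N * r) = (2 powr real N) powr r" by (simp add: powr_powr)
    also have "\<dots> \<le> (2 * (\<mu> * R0 powr r / (2 * \<epsilon>)) powr (1 / r)) powr r"
      using N(2) r by (intro powr_mono2) auto
    also have "\<dots> = 2 powr r * (\<mu> * R0 powr r / (2 * \<epsilon>))" using pos r by (simp add: powr_mult powr_powr)
    finally have "2 powr (real N * r) * (2 * \<epsilon>) \<le> 2 powr r * (\<mu> * R0 powr r)" using pos by (simp add: field_simps)
    then have "2 * \<epsilon> \<le> 2 powr r * S" by (simp add: S_def field_simps)
    then show ?thesis by (simp add: powr_diff field_simps)
  qed
  have v: "\<mu>\<^sup>2 * R0 powr (2 * r - 1) / m * (1 / 2 powr (real N * (2 * r - 1))) = \<mu> powr (1 / r) / m * S powr b"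
  proof -
    have "S powr b = \<mu> powr b * R0 powr (2 * r - 1) / 2 powr (real N * (2 * r - 1))"
      using pos b by (simp add: S_def powr_divide powr_mult powr_powr mult.assoc)
    moreover have "\<mu> powr (1 / r) * \<mu> powr b = \<mu>\<^sup>2" using pos by (simp add: powr_add[symmetric] b_def)
    ultimately show ?thesis by (simp add: mult.assoc[symmetric])
  qed
  have up: "S powr b \<le> 4 * \<epsilon> powr b"
  proof -
    have "S powr b \<le> (2 * \<epsilon>) powr b" using S S_le b by (intro powr_mono2) auto
    also have "\<dots> = 2 powr b * \<epsilon> powr b" by (rule powr_mult)
    also have "\<dots> \<le> 2 powr 2 * \<epsilon> powr b" using b by (intro mult_right_mono powr_mono) auto
    finally show ?thesis by simp
  qed
  have low: "\<epsilon> powr b / 2 powr (2 * r) \<le> S powr b"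
  proof -
    have "(r - 1) * b \<le> (r - 1) * 2" using r b by (intro mult_left_mono) auto
    then have "- (2 * r) \<le> (1 - r) * b" by (simp add: algebra_simps)
    then have "2 powr (- (2 * r)) * \<epsilon> powr b \<le> 2 powr ((1 - r) * b) * \<epsilon> powr b"
      by (intro mult_right_mono powr_mono) auto
    also have "\<dots> = (2 powr (1 - r) * \<epsilon>) powr b" by (simp add: powr_mult powr_powr)
    also have "\<dots> \<le> S powr b" using S_ge pos b by (intro powr_mono2) auto
    finally show ?thesis by (simp add: powr_minus_divide)
  qed
  define w where "w = \<mu> powr (1 / r) / m"
  have w: "w \<ge> 0" using pos by (simp add: w_def)
  have D: "lD * (w * S powr b) \<le> \<Delta>" "\<Delta> \<le> uD * (w * S powr b)"
    using \<Delta> unfolding v w_def[symmetric] of_order_def by auto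
  have "lD / 2 powr (2 * r) * (w * \<epsilon> powr b) = lD * (w * (\<epsilon> powr b / 2 powr (2 * r)))" by simp
  also have "\<dots> \<le> lD * (w * S powr b)" using l w by (intro mult_left_mono low) auto
  also note D(1)
  finally have 1: "lD / 2 powr (2 * r) * (w * \<epsilon> powr b) \<le> \<Delta>" .
  have "uD * (w * S powr b) \<le> uD * (w * (4 * \<epsilon> powr b))" using l w by (intro mult_left_mono up) auto
  then have 2: "\<Delta> \<le> 4 * uD * (w * \<epsilon> powr b)" using D(2) by simp
  show ?thesis using 1 2 by (simp add: of_order_def w_def b_def)
qed

section \<open>The restarted method\<close>

theorem theorem5p1:
  fixes X :: "(real ^ 'n) set"
    and D :: "'s measure"
    and f :: "real ^ 'n \<Rightarrow> 's \<Rightarrow> real"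
    and F :: "real ^ 'n \<Rightarrow> real"
    and xs :: "real ^ 'n"
    and d p \<kappa> r \<epsilon> \<mu> M2 R0 hT HT lD uD :: real
    and q :: ennreal
    and M2fun :: "'s \<Rightarrow> real"
    and \<psi> :: "real ^ 'n \<Rightarrow> real"
    and N :: nat
    and T :: "nat \<Rightarrow> nat"
    and R \<sigma> \<tau> \<nu> \<Delta> :: "nat \<Rightarrow> real"
    and \<delta> :: "nat \<Rightarrow> real ^ 'n \<Rightarrow> real"
    and M :: "'w measure"
    and e :: "nat \<Rightarrow> nat \<Rightarrow> 'w \<Rightarrow> real ^ 'n"
    and \<xi> :: "nat \<Rightarrow> nat \<Rightarrow> 'w \<Rightarrow> 's"
    and x0 x_final :: "'w \<Rightarrow> real ^ 'n"
    and I :: "(nat \<times> nat) set"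
  assumes d: "d = real CARD('n)" "CARD('n) \<ge> 2"
    and pq: "1 \<le> p" "p \<le> 2" "1 / ennreal p + 1 / q = 1"
    and X: "compact X" "convex X"
    and D: "prob_space D"
    and F: "\<And>x. F x = (\<integral>\<zeta>. f x \<zeta> \<partial>D)"
    and F_exists: "\<And>k x. k \<in> {1..N} \<Longrightarrow> x \<in> thicken X (\<tau> k) \<Longrightarrow> integrable D (f x)"
    and xs: "is_arg_min F (\<lambda>x. x \<in> X) xs"
    and f_convex: "\<And>k \<zeta>. k \<in> {1..N} \<Longrightarrow> \<zeta> \<in> space D \<Longrightarrow>
          convex_on (thicken X (\<tau> k)) (\<lambda>x. f x \<zeta>)"
    and \<kappa>: "0 < \<kappa>" "\<kappa> \<le> 1" and M2: "0 < M2"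
    and f_lipschitz: "\<And>k \<zeta> x1 x2. k \<in> {1..N} \<Longrightarrow> \<zeta> \<in> space D \<Longrightarrow>
          x1 \<in> thicken X (\<tau> k) \<Longrightarrow> x2 \<in> thicken X (\<tau> k) \<Longrightarrow>
          \<bar>f x1 \<zeta> - f x2 \<zeta>\<bar> \<le> M2fun \<zeta> * norm (x1 - x2)"
    and M2_moment: "integrable D (\<lambda>\<zeta>. M2fun \<zeta> powr (1 + \<kappa>))"
          "(\<integral>\<zeta>. M2fun \<zeta> powr (1 + \<kappa>) \<partial>D) \<le> M2 powr (1 + \<kappa>)"
    and \<epsilon>: "0 < \<epsilon>"
    and r: "(1 + \<kappa>) / \<kappa> \<le> r" and \<mu>: "0 < \<mu>"
    and growth: "\<And>x. x \<in> X \<Longrightarrow> \<mu> / 2 * lp_norm p (x - xs) powr r \<le> F x - F xs"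
    and prox: "uniformly_convex_lp p 1 ((1 + \<kappa>) / \<kappa>) \<psi>"
    and R0: "R0 = prox_radius \<kappa> \<psi> X"
    and R: "\<And>k. R k = R0 / 2 ^ k"
    and factors_T: "min_steps_factor \<kappa> (prox_distortion \<kappa> p \<psi> X xs N) \<le> hT" "hT \<le> HT"
    and factors_\<Delta>: "0 < lD" "lD \<le> uD"
          "uD \<le> max_noise_factor \<kappa> r (prox_distortion \<kappa> p \<psi> X xs N) HT"
    and N: "N = nat \<lceil>1 / r * log 2 (\<mu> * R0 powr r / (2 * \<epsilon>))\<rceil>" "1 \<le> N"
    and \<sigma>: "\<And>k. k \<in> {1..N} \<Longrightarrow> \<sigma> k = sigma_const \<kappa> d q M2 (\<Delta> k) (\<tau> k)"
    and T: "\<And>k. k \<in> {1..N} \<Longrightarrow>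
          of_order hT HT (real (T k))
            ((\<sigma> k * 2 powr (1 + r) / (\<mu> * R k powr (r - 1))) powr ((1 + \<kappa>) / \<kappa>))"
    and \<tau>: "\<And>k. k \<in> {1..N} \<Longrightarrow>
          \<tau> k = \<sigma> k * R k / (M2 * real (T k) powr (\<kappa> / (1 + \<kappa>)))"
    and \<nu>: "\<And>k. k \<in> {1..N} \<Longrightarrow>
          \<nu> k = R k powr (1 / \<kappa>) / \<sigma> k * real (T k) powr (- 1 / (1 + \<kappa>))"
    and \<Delta>: "\<And>k. k \<in> {1..N} \<Longrightarrow>
          of_order lD uD (\<Delta> k)
            (\<mu>\<^sup>2 * R0 powr (2 * r - 1) / (M2 * sqrt d) * (1 / 2 powr (real k * (2 * r - 1))))"
    and \<delta>_measurable: "\<And>k. k \<in> {1..N} \<Longrightarrow>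
          \<delta> k \<in> borel_measurable (restrict_space borel (thicken X (\<tau> k)))"
    and \<delta>_bound: "\<And>k x. k \<in> {1..N} \<Longrightarrow> x \<in> thicken X (\<tau> k) \<Longrightarrow> \<bar>\<delta> k x\<bar> \<le> \<Delta> k"
    and M: "prob_space M"
    and I: "I = {(k, t). k \<in> {1..N} \<and> t < T k}"
    and sample_distr: "\<And>k t. (k, t) \<in> I \<Longrightarrow>
          distr M (uniform_sphere \<Otimes>\<^sub>M D) (\<lambda>\<omega>. (e k t \<omega>, \<xi> k t \<omega>)) = uniform_sphere \<Otimes>\<^sub>M D"
    and sample_indep: "prob_space.indep_vars M (\<lambda>_. uniform_sphere \<Otimes>\<^sub>M D)
          (\<lambda>(k, t) \<omega>. (e k t \<omega>, \<xi> k t \<omega>)) I"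
    and x0_in: "\<And>\<omega>. \<omega> \<in> space M \<Longrightarrow> x0 \<omega> \<in> X"
    and x0_measurable: "x0 \<in> borel_measurable M"
    and x0_indep: "prob_space.indep_set M
          (sets (vimage_algebra (space M) x0 borel))
          (sets (vimage_algebra (space M) (\<lambda>\<omega>. \<lambda>(k, t)\<in>I. (e k t \<omega>, \<xi> k t \<omega>))
            (\<Pi>\<^sub>M i\<in>I. uniform_sphere \<Otimes>\<^sub>M D)))"
    and x_final: "\<And>\<omega>. x_final \<omega> =
          zo_restarts X \<psi> f \<delta> T \<nu> \<tau> (\<lambda>k t. (e k t \<omega>, \<xi> k t \<omega>)) (x0 \<omega>) N"
  shows "integrable M (\<lambda>\<omega>. F (x_final \<omega>)) \<and>
         (\<integral>\<omega>. F (x_final \<omega>) \<partial>M) - F xs \<le> \<epsilon> \<and>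
         real (\<Sum>k=1..N. T k) \<le>
           (HT * 2 powr ((2 * r + 3) * ((1 + \<kappa>) / \<kappa>))) *
           (a_const d q * M2 * sqrt d / \<mu> powr (1 / r) * (1 / \<epsilon> powr ((r - 1) / r)))
             powr ((1 + \<kappa>) / \<kappa>) \<and>
         of_order (lD / 2 powr (2 * r)) (4 * uD) (\<Delta> N)
           (\<mu> powr (1 / r) / (M2 * sqrt d) * \<epsilon> powr (2 - 1 / r))"
proof -
  define s where "s = (1 + \<kappa>) / \<kappa>"
  define \<Lambda> where "\<Lambda> = prox_distortion \<kappa> p \<psi> X xs N"
  have s2: "s \<ge> 2" using \<kappa> by (simp add: s_def field_simps)
  have e_s: "\<kappa> / (1 + \<kappa>) = 1 / s" using \<kappa> by (simp add: s_def)
  have xsX: "xs \<in> X" and xs_min: "\<And>y. y \<in> X \<Longrightarrow> F xs \<le> F y"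
    using xs by (auto simp: is_arg_min_linorder)
  interpret PS: prox_setup p \<kappa> s \<psi> X
    by unfold_locales (use pq \<kappa> prox X xsX in \<open>auto simp: s_def\<close>)
  have sr: "s \<le> r" and r2: "r \<ge> 2" using r s2 by (auto simp: s_def)
  have R0_ge: "R0 \<ge> 0" using PS.bregman_le_radius[OF xsX xsX] by (simp add: R0)
  define y where "y = \<mu> * R0 powr r / (2 * \<epsilon>)"
  have "y \<ge> 0" using \<mu> \<epsilon> by (simp add: y_def)
  note count = restart_count[of r N y, OF _ N(1)[folded y_def] N(2) this]
  have y1: "y > 1" and yN: "y \<le> 2 powr (real N * r)" and Ny: "2 powr (real N) \<le> 2 * y powr (1 / r)"
    using count r2 by auto
  \<comment> \<open>At least one restart excludes a degenerate feasible set: radius zero would give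
    \<open>y = 0\<close>.\<close>
  have R0p: "R0 > 0" using y1 R0_ge r2 by (cases "R0 = 0") (auto simp: y_def)
  have radius: "prox_radius \<kappa> \<psi> X > 0" using R0p by (simp add: R0)
  have \<Lambda>1: "\<Lambda> \<ge> 1" and R0_diam: "R0 \<le> \<Lambda> * lp_diameter p X"
    using PS.prox_distortion_ge(1,2)[OF radius, of xs N] by (simp_all add: \<Lambda>_def R0)
  have Rp: "R k > 0" for k using R0p by (simp add: R)
  obtain Nn :: "real ^ 'n \<Rightarrow> real" where "a_const (real CARD('n)) q > 0"
    using uniform_sphere_dual_norm[OF d(2) pq] by blast
  then have a: "a_const d q > 0" by (simp add: d)
  have dp: "d > 0" by (simp add: d)
  define A where "A = a_const d q * M2 * sqrt d"
  have A: "A > 0" using a M2 dp by (simp add: A_def)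
  have \<sigma>p: "\<sigma> k > 0" if "k \<in> {1..N}" for k
    using \<sigma>[OF that] sigma_const_bounds(1)[OF \<kappa>(1) dp a M2] by simp
  have hT: "(10 ^ 8 * s * (2 * \<Lambda>) powr s) powr s \<le> hT"
    using factors_T(1) by (simp add: min_steps_factor_def Let_def s_def \<Lambda>_def)
  have "0 < (10 ^ 8 * s * (2 * \<Lambda>) powr s) powr s" using s2 \<Lambda>1 by simp
  then have hTp: "hT > 0" and HTp: "HT > 0" using hT factors_T(2) by linarith+
  have uD: "0 \<le> uD" "uD \<le> 1 / (10 ^ 3 * s * 8 powr r * HT * \<Lambda> powr r)"
    using factors_\<Delta> by (auto simp: max_noise_factor_def s_def \<Lambda>_def)
  have T_bounds: "hT * (\<sigma> k * 2 powr (1 + r) / (\<mu> * R k powr (r - 1))) powr s \<le> real (T k)"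
    "real (T k) \<le> HT * (\<sigma> k * 2 powr (1 + r) / (\<mu> * R k powr (r - 1))) powr s" if "k \<in> {1..N}" for k
    using T[OF that] by (auto simp: of_order_def s_def)
  have Tp: "real (T k) > 0" if k: "k \<in> {1..N}" for k
  proof -
    have "0 < hT * (\<sigma> k * 2 powr (1 + r) / (\<mu> * R k powr (r - 1))) powr s"
      using hTp \<sigma>p[OF k] \<mu> Rp[of k] by simp
    then show ?thesis using T_bounds(1)[OF k] by linarith
  qed
  have \<tau>': "\<tau> k = \<sigma> k * R k / (M2 * real (T k) powr (1 / s))" if "k \<in> {1..N}" for k
    using \<tau>[OF that] by (simp only: e_s)
  have \<tau>p: "\<tau> k > 0" if k: "k \<in> {1..N}" for k
    using \<tau>'[OF k] \<sigma>p[OF k] Rp[of k] M2 Tp[OF k] by simp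
  have R_powr: "R k powr b = R0 powr b * (1 / 2 powr (real k * b))" for k b
    using R0p by (simp add: R powr_divide powr_of_power2)
  have \<Delta>_bounds: "lD * (\<mu>\<^sup>2 * R k powr (2 * r - 1) / (M2 * sqrt d)) \<le> \<Delta> k"
    "\<Delta> k \<le> uD * (\<mu>\<^sup>2 * R k powr (2 * r - 1) / (M2 * sqrt d))" if "k \<in> {1..N}" for k
    using \<Delta>[OF that] by (auto simp: of_order_def R_powr mult_ac)
  have \<Delta>p: "\<Delta> k \<ge> 0" if "k \<in> {1..N}" for k
  proof -
    have "0 \<le> lD * (\<mu>\<^sup>2 * R k powr (2 * r - 1) / (M2 * sqrt d))" using factors_\<Delta> M2 dp by simp
    then show ?thesis using \<Delta>_bounds(1)[OF that] by linarith
  qed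
  have step_locale: "zo_step p \<kappa> s \<psi> X D q f F M2fun M2 (\<tau> k) (\<Delta> k) (\<delta> k)" if k: "k \<in> {1..N}" for k
    by (intro zo_step.intro zo_step_axioms.intro PS.prox_setup_axioms D d pq \<tau>p[OF k] \<Delta>p[OF k] M2 F F_exists[OF k]
        f_convex[OF k] f_lipschitz[OF k] M2_moment \<delta>_measurable[OF k] \<delta>_bound[OF k])
  \<comment> \<open>Seven of the instantiated facts hold only for \<open>k\<close> in
    \<open>{1..N}\<close>, which explains the repeated argument \<open>k\<close> in later
    uses.\<close>
  note params = restart_parameters[OF \<kappa> s_def sr \<Lambda>1 \<mu> M2 Rp \<sigma>p Tp dp hT factors_T(2) T_bounds(1) T_bounds(2) \<tau>' \<nu> \<Delta>_bounds(2) uD]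
  have one_N: "1 \<in> {1..N}" using N(2) by simp

  text \<open>Compare the growth condition with the Lipschitz bound at a point far from \<open>xs\<close>.\<close>
  have growth_M2: "\<mu> * R k powr (r - 1) \<le> 2 * M2 * \<Lambda> powr (r - 1)" if k: "k \<in> {1..N}" for k
  proof -
    interpret S: zo_step p \<kappa> s \<psi> X D q f F M2fun M2 "\<tau> k" "\<Delta> k" "\<delta> k" by (rule step_locale[OF k])
    obtain x where x: "x \<in> X" "lp_diameter p X \<le> 2 * lp_norm p (x - xs)"
      using PS.far_point_exists[OF xsX] by blast
    define n where "n = lp_norm p (x - xs)"
    \<comment> \<open>One halving has already taken place, since \<open>k\<close> is at least 1; it
      pays for the far point being only at half the diameter.\<close>
    have "R k \<le> R0 / 2"
    proof -
      have "(2 :: real) ^ 1 \<le> 2 ^ k" using k by (intro power_increasing) auto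
      then show ?thesis unfolding R using R0p by (intro frac_le) auto
    qed
    also have "R0 / 2 \<le> \<Lambda> * n"
    proof -
      have "\<Lambda> * lp_diameter p X \<le> \<Lambda> * (2 * n)" using x(2) \<Lambda>1 by (intro mult_left_mono) (auto simp: n_def)
      then show ?thesis using R0_diam by simp
    qed
    finally have Rn: "R k \<le> \<Lambda> * n" .
    then have "0 < \<Lambda> * n" using Rp[of k] by linarith
    then have n: "n > 0" using \<Lambda>1 by (simp add: zero_less_mult_iff)
    have "\<mu> / 2 * n powr r \<le> F x - F xs" using growth[OF x(1)] by (simp add: n_def)
    also have "\<dots> \<le> M2 * norm (x - xs)" by (rule order_trans[OF abs_ge_self S.F_lipschitz]) (use S.C_sub x(1) xsX in auto)
    also have "\<dots> \<le> M2 * n" using norm_le_lp_norm[of p "x - xs"] pq M2 by (intro mult_left_mono) (auto simp: n_def)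
    finally have "\<mu> / 2 * n powr r \<le> M2 * n" .
    moreover have "n powr r = n powr (r - 1) * n" using n by (simp add: powr_diff)
    ultimately have n_le: "\<mu> * n powr (r - 1) \<le> 2 * M2" using n by (simp add: field_simps)
    have "\<mu> * R k powr (r - 1) \<le> \<mu> * (\<Lambda> * n) powr (r - 1)"
      using \<mu> Rn Rp[of k] r2 by (intro mult_left_mono powr_mono2) auto
    also have "\<dots> = \<Lambda> powr (r - 1) * (\<mu> * n powr (r - 1))" by (simp add: powr_mult)
    also have "\<dots> \<le> \<Lambda> powr (r - 1) * (2 * M2)" by (intro mult_left_mono n_le) simp
    finally show ?thesis by (simp add: mult_ac)
  qed
  \<comment> \<open>Here the circular definition of \<sigma> is resolved: the noise rate is at most
    \<open>M2\<close>, so \<sigma> is bounded by twice its value \<open>A\<close> in terms of the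
    Lipschitz constant, uniformly over the restarts.\<close>
  have \<sigma>_le: "0 \<le> \<sigma> k \<and> \<sigma> k \<le> 2 * A" if k: "k \<in> {1..N}" for k
  proof
    show "0 \<le> \<sigma> k" using \<sigma>p[OF k] by simp
    have "0 \<le> \<Delta> k / \<tau> k" using \<Delta>p[OF k] \<tau>p[OF k] by simp
    moreover have "sqrt d * \<Delta> k / \<tau> k \<le> M2"
      by (rule params(6)[OF k k k k k k k growth_M2[OF k]])
    ultimately show "\<sigma> k \<le> 2 * A"
      unfolding \<sigma>[OF k] A_def by (rule sigma_const_bounds(2)[OF \<kappa>(1) dp a M2])
  qed

  define zz where "zz = (\<lambda>(k, t) \<omega>. (e k t \<omega>, \<xi> k t \<omega>))"
  define Zm :: "((real ^ 'n) \<times> 's) measure" where "Zm = uniform_sphere \<Otimes>\<^sub>M D"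
  interpret M: prob_space M by (rule M)
  have zz_indep: "M.indep_vars (\<lambda>_. Zm) zz I" using sample_indep by (simp add: zz_def Zm_def)
  have zz_restrict: "(\<lambda>\<omega>. \<lambda>(k, t)\<in>I. (e k t \<omega>, \<xi> k t \<omega>)) = (\<lambda>\<omega>. \<lambda>i\<in>I. zz i \<omega>)"
    by (auto simp: fun_eq_iff restrict_def zz_def split: prod.split)
  have x0_ind: "M.indep_set (sets (vimage_algebra (space M) x0 borel))
      (sets (vimage_algebra (space M) (\<lambda>\<omega>. \<lambda>i\<in>I. zz i \<omega>) (\<Pi>\<^sub>M i\<in>I. Zm)))"
    using x0_indep unfolding zz_restrict Zm_def .
  note ctx = x0_measurable zz_indep x0_ind
  \<comment> \<open>The samples drawn before iteration \<open>t\<close> of restart \<open>k\<close>,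
    in lexicographic order. Sample \<open>(k, t)\<close> itself is excluded, so it is independent of
    the iterate to which it is applied.\<close>
  define J where "J k t = {i \<in> I. fst i < k \<or> fst i = k \<and> snd i < t}" for k t :: nat
  have J_I: "J k t \<subseteq> I" for k t by (auto simp: J_def)
  define hist where "hist k t = history M x0 borel zz Zm (J k t)" for k t
  have hist_mono: "Y \<in> hist k' t' \<rightarrow>\<^sub>M S" if "Y \<in> hist k t \<rightarrow>\<^sub>M S" "J k t \<subseteq> J k' t'" for Y k t k' t' and S :: "(real ^ 'n) measure"
    using M.history_mono[OF ctx that(2) J_I] that(1) by (simp add: hist_def)
  have hist_M: "Y \<in> M \<rightarrow>\<^sub>M S" if "Y \<in> hist k t \<rightarrow>\<^sub>M S" for Y k t and S :: "(real ^ 'n) measure"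
    using M.history_measurable[OF ctx J_I] that by (simp add: hist_def)
  have space_hist: "space (hist k t) = space M" for k t by (simp add: hist_def)
  define st where "st k \<omega> = zo_restarts X \<psi> f \<delta> T \<nu> \<tau> (\<lambda>k t. (e k t \<omega>, \<xi> k t \<omega>)) (x0 \<omega>) k" for k \<omega>
  \<comment> \<open>Restarts count from 1 while \<open>st 0\<close> is the initial point:
    \<open>it k\<close> is the run that begins at \<open>st k\<close>, hence it carries the
    parameters of restart \<open>Suc k\<close>.\<close>
  define it where "it k t \<omega> = rsmd_iterate X \<psi> f (\<delta> (Suc k)) (\<nu> (Suc k)) (\<tau> (Suc k)) (\<lambda>t. (e (Suc k) t \<omega>, \<xi> (Suc k) t \<omega>)) (st k \<omega>) t" for k t \<omega>
  have it_0: "it k 0 = st k" for k by (simp add: it_def fun_eq_iff)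
  have st_0: "st 0 = x0" by (simp add: st_def fun_eq_iff)
  have st_Suc: "st (Suc k) = (\<lambda>\<omega>. (1 / real (T (Suc k))) *\<^sub>R (\<Sum>t<T (Suc k). it k t \<omega>))" for k
    by (simp add: st_def it_def zo_rsmd_def fun_eq_iff)
  have it_Suc: "it k (Suc t) \<omega> = zo_step.update \<psi> X f (\<tau> (Suc k)) (\<delta> (Suc k)) (\<nu> (Suc k)) (it k t \<omega>) (zz (Suc k, t) \<omega>)"
    if k: "Suc k \<in> {1..N}" for k t \<omega>
  proof -
    interpret S: zo_step p \<kappa> s \<psi> X D q f F M2fun M2 "\<tau> (Suc k)" "\<Delta> (Suc k)" "\<delta> (Suc k)" by (rule step_locale[OF k])
    show ?thesis by (simp add: it_def S.update_def PS.prox_step_def zz_def Let_def)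
  qed
  have it_meas: "\<forall>t\<le>T (Suc k). it k t \<in> hist (Suc k) t \<rightarrow>\<^sub>M restrict_space borel X"
    if k: "Suc k \<in> {1..N}" and st: "st k \<in> hist (Suc k) 0 \<rightarrow>\<^sub>M restrict_space borel X" for k
  proof (intro allI)
    interpret S: zo_step p \<kappa> s \<psi> X D q f F M2fun M2 "\<tau> (Suc k)" "\<Delta> (Suc k)" "\<delta> (Suc k)" by (rule step_locale[OF k])
    fix t show "t \<le> T (Suc k) \<longrightarrow> it k t \<in> hist (Suc k) t \<rightarrow>\<^sub>M restrict_space borel X"
    proof (induction t)
      case 0 then show ?case using st by (simp add: it_0)
    next
      case (Suc t)
      show ?case
      proof
        assume t: "Suc t \<le> T (Suc k)"
        have "it k t \<in> hist (Suc k) t \<rightarrow>\<^sub>M restrict_space borel X" using Suc t by linarith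
        then have "it k t \<in> hist (Suc k) (Suc t) \<rightarrow>\<^sub>M restrict_space borel X"
          by (rule hist_mono) (auto simp: J_def)
        moreover have "zz (Suc k, t) \<in> hist (Suc k) (Suc t) \<rightarrow>\<^sub>M Zm"
          unfolding hist_def using k t by (intro M.history_sample[OF ctx J_I]) (auto simp: J_def I)
        ultimately have "(\<lambda>\<omega>. (it k t \<omega>, zz (Suc k, t) \<omega>)) \<in> hist (Suc k) (Suc t) \<rightarrow>\<^sub>M (restrict_space borel X \<Otimes>\<^sub>M Zm)"
          by (rule measurable_Pair)
        from measurable_compose[OF this[unfolded Zm_def] S.update_measurable]
        show "it k (Suc t) \<in> hist (Suc k) (Suc t) \<rightarrow>\<^sub>M restrict_space borel X"
          by (simp add: it_Suc[OF k, abs_def])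
      qed
    qed
  qed
  \<comment> \<open>The output of a restart is known once all its samples are drawn, which is time 0
    of the following restart.\<close>
  have st_meas: "k \<le> N \<longrightarrow> st k \<in> hist (Suc k) 0 \<rightarrow>\<^sub>M restrict_space borel X" for k
  proof (induction k)
    case 0
    have "x0 \<in> hist 1 0 \<rightarrow>\<^sub>M borel" unfolding hist_def by (rule M.history_initial[OF ctx J_I])
    then show ?case using x0_in by (auto simp: st_0 space_hist intro!: measurable_restrict_space2)
  next
    case (Suc k)
    show ?case
    proof
      assume kN: "Suc k \<le> N"
      then have k: "Suc k \<in> {1..N}" by simp
      interpret S: zo_step p \<kappa> s \<psi> X D q f F M2fun M2 "\<tau> (Suc k)" "\<Delta> (Suc k)" "\<delta> (Suc k)" by (rule step_locale[OF k])
      have it: "it k t \<in> hist (Suc (Suc k)) 0 \<rightarrow>\<^sub>M restrict_space borel X" if "t < T (Suc k)" for t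
      proof -
        have "it k t \<in> hist (Suc k) t \<rightarrow>\<^sub>M restrict_space borel X"
          using it_meas[OF k mp[OF Suc]] kN that by (meson Suc_leD less_imp_le_nat)
        then show ?thesis by (rule hist_mono) (auto simp: J_def)
      qed
      have [measurable]: "it k t \<in> borel_measurable (hist (Suc (Suc k)) 0)" if "t < T (Suc k)" for t
        using it[OF that] measurable_restrict_space2_iff by blast
      have in_X: "it k t \<omega> \<in> X" if "t < T (Suc k)" "\<omega> \<in> space M" for t \<omega>
        using measurable_space[OF it[OF that(1)]] that(2) by (simp add: space_hist space_restrict_space)
      show "st (Suc k) \<in> hist (Suc (Suc k)) 0 \<rightarrow>\<^sub>M restrict_space borel X"
        unfolding st_Suc
      proof (rule measurable_restrict_space2)
        show "(\<lambda>\<omega>. (1 / real (T (Suc k))) *\<^sub>R (\<Sum>t<T (Suc k). it k t \<omega>)) \<in> space (hist (Suc (Suc k)) 0) \<rightarrow> X"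
          using in_X Tp[OF k] by (auto simp: space_hist intro!: S.average_in)
      qed measurable
    qed
  qed
  have st_M: "st k \<in> M \<rightarrow>\<^sub>M restrict_space borel X" if "k \<le> N" for k
    using st_meas[of k] that hist_M by blast
  \<comment> \<open>Half the current radius is the next one, so this is the hypothesis under which
    \<open>next_start\<close> begins the following restart.\<close>
  have gap: "(\<integral>\<omega>. F (st (Suc k) \<omega>) \<partial>M) - F xs \<le> \<mu> / 2 * (R (Suc k) / 2) powr r"
    if k: "Suc k \<in> {1..N}" and D0: "(\<integral>\<omega>. bregman \<psi> xs (st k \<omega>) \<partial>M) \<le> (2 * \<Lambda> * R (Suc k)) powr s / s" for k
  proof -
    interpret S: zo_step p \<kappa> s \<psi> X D q f F M2fun M2 "\<tau> (Suc k)" "\<Delta> (Suc k)" "\<delta> (Suc k)" by (rule step_locale[OF k])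
    have im: "\<forall>t\<le>T (Suc k). it k t \<in> hist (Suc k) t \<rightarrow>\<^sub>M restrict_space borel X"
      using it_meas[OF k] st_meas[of k] k by simp
    note pk = params[OF k k k k k k k]
    show ?thesis
      unfolding st_Suc
    proof (rule S.run_gap[where x="it k" and z="\<lambda>t. zz (Suc k, t)" and \<nu>="\<nu> (Suc k)" and R="R (Suc k)", OF M])
      show "it k t \<in> M \<rightarrow>\<^sub>M restrict_space borel X" if "t \<le> T (Suc k)" for t using im that hist_M by blast
      show "it k (Suc t) \<omega> = S.update (\<nu> (Suc k)) (it k t \<omega>) (zz (Suc k, t) \<omega>)" for t \<omega> by (rule it_Suc[OF k])
      show "(\<integral>\<^sup>+\<omega>. h (it k t \<omega>, zz (Suc k, t) \<omega>) \<partial>M) = (\<integral>\<^sup>+\<omega>. \<integral>\<^sup>+y. h (it k t \<omega>, y) \<partial>(uniform_sphere \<Otimes>\<^sub>M D) \<partial>M)"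
        if t: "t < T (Suc k)" and h: "h \<in> borel_measurable (restrict_space borel X \<Otimes>\<^sub>M (uniform_sphere \<Otimes>\<^sub>M D))" for t h
      proof -
        have kt: "(Suc k, t) \<in> I" using k t by (simp add: I)
        have "distr M Zm (zz (Suc k, t)) = Zm" using sample_distr[OF kt] by (simp add: Zm_def zz_def)
        moreover have "it k t \<in> history M x0 borel zz Zm (J (Suc k) t) \<rightarrow>\<^sub>M restrict_space borel X"
          using im t by (simp add: hist_def)
        moreover have "(Suc k, t) \<notin> J (Suc k) t" by (simp add: J_def)
        ultimately show ?thesis
          using M.nn_integral_history_sample[OF ctx J_I kt, of "Suc k" t "it k t" "restrict_space borel X" h] h
          by (simp add: Zm_def)
      qed
      show "1 \<le> T (Suc k)" using Tp[OF k] by simp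
      show "(\<integral>\<omega>. bregman \<psi> xs (it k 0 \<omega>) \<partial>M) \<le> (2 * \<Lambda> * R (Suc k)) powr s / s" using D0 by (simp add: it_0)
      show "(\<nu> (Suc k) * (720 * sigma_const \<kappa> (real CARD('n)) q M2 (\<Delta> (Suc k)) (\<tau> (Suc k)))) powr (1 + \<kappa>) \<le> 518400 * R (Suc k) powr s / real (T (Suc k))"
        using pk(3) by (simp add: \<sigma>[OF k] d(1))
      show "\<nu> (Suc k) * (5 * sqrt (real CARD('n)) * \<Delta> (Suc k) / \<tau> (Suc k)) \<le> R (Suc k) powr (s - 1) / (s * real (T (Suc k)))"
        using pk(4) by (simp add: d(1))
      show "\<nu> (Suc k) * M2 * \<tau> (Suc k) \<le> R (Suc k) powr s / real (T (Suc k))" using pk(2) by simp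
    qed (use xsX xs_min Rp pk in auto)
  qed
  \<comment> \<open>The invariant carried through the restarts. The base case rests on the
    definition of the radius: \<open>R 1 = R0 / 2\<close> and \<open>\<Lambda> \<ge> 1\<close> give
    \<open>R0 \<le> 2 * \<Lambda> * R 1\<close>.\<close>
  have start: "Suc k \<le> N \<longrightarrow> (\<integral>\<omega>. bregman \<psi> xs (st k \<omega>) \<partial>M) \<le> (2 * \<Lambda> * R (Suc k)) powr s / s" for k
  proof (induction k)
    case 0
    interpret S: zo_step p \<kappa> s \<psi> X D q f F M2fun M2 "\<tau> 1" "\<Delta> 1" "\<delta> 1" by (rule step_locale[OF one_N])
    have "(\<integral>\<omega>. bregman \<psi> xs (st 0 \<omega>) \<partial>M) \<le> (\<integral>\<omega>. R0 powr s / s \<partial>M)"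
    proof (rule integral_mono)
      show "integrable M (\<lambda>\<omega>. bregman \<psi> xs (st 0 \<omega>))" by (rule S.bregman_integrable[OF M st_M xsX]) simp
      fix \<omega> assume "\<omega> \<in> space M"
      then have "st 0 \<omega> \<in> X" using x0_in by (simp add: st_0)
      then have "((s * bregman \<psi> xs (st 0 \<omega>)) powr (1 / s)) powr s \<le> R0 powr s"
        using PS.bregman_le_radius[OF xsX] s2 by (intro powr_mono2) (auto simp: R0)
      then have "s * bregman \<psi> xs (st 0 \<omega>) \<le> R0 powr s"
        using s2 PS.bregman_nonneg[of xs "st 0 \<omega>"] by (simp add: powr_powr)
      then show "bregman \<psi> xs (st 0 \<omega>) \<le> R0 powr s / s" using s2 by (simp add: field_simps)
    qed simp
    also have "\<dots> = R0 powr s / s" by (simp add: M.prob_space)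
    also have "\<dots> \<le> (2 * \<Lambda> * R (Suc 0)) powr s / s"
      using s2 R0p \<Lambda>1 by (intro divide_right_mono powr_mono2) (auto simp: R)
    finally show ?case by simp
  next
    case (Suc k)
    show ?case
    proof
      assume kN: "Suc (Suc k) \<le> N"
      then have k: "Suc k \<in> {1..N}" by simp
      interpret S: zo_step p \<kappa> s \<psi> X D q f F M2fun M2 "\<tau> (Suc k)" "\<Delta> (Suc k)" "\<delta> (Suc k)" by (rule step_locale[OF k])
      have half: "R (Suc k) / 2 = R (Suc (Suc k))" by (simp add: R)
      have "(\<integral>\<omega>. F (st (Suc k) \<omega>) \<partial>M) - F xs \<le> \<mu> / 2 * R (Suc (Suc k)) powr r"
        using gap[OF k] Suc kN half by simp
      moreover have "prox_radius \<kappa> \<psi> X / 2 ^ N \<le> R (Suc (Suc k))"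
      proof -
        have "(2 :: real) ^ Suc (Suc k) \<le> 2 ^ N" using kN by (intro power_increasing) auto
        then show ?thesis using R0p unfolding R R0[symmetric] by (intro divide_left_mono) auto
      qed
      ultimately show "(\<integral>\<omega>. bregman \<psi> xs (st (Suc k) \<omega>) \<partial>M) \<le> (2 * \<Lambda> * R (Suc (Suc k))) powr s / s"
        unfolding \<Lambda>_def using kN
        by (intro S.next_start[OF M st_M xsX growth \<mu> sr Rp _ _ radius]) auto
    qed
  qed
  obtain n where n: "N = Suc n" using N(2) by (cases N) auto
  have nN: "Suc n \<in> {1..N}" by (simp add: n)
  interpret S: zo_step p \<kappa> s \<psi> X D q f F M2fun M2 "\<tau> (Suc n)" "\<Delta> (Suc n)" "\<delta> (Suc n)" by (rule step_locale[OF nN])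
  have final: "x_final = st N" using x_final by (simp add: st_def fun_eq_iff)
  have goal1: "integrable M (\<lambda>\<omega>. F (x_final \<omega>))"
    unfolding final by (rule S.F_integrable[OF M st_M]) simp
  have goal2: "(\<integral>\<omega>. F (x_final \<omega>) \<partial>M) - F xs \<le> \<epsilon>"
  proof -
    \<comment> \<open>The number of restarts is calibrated to
      \<open>\<mu> / 2 * R N powr r \<le> \<epsilon>\<close>; in terms of \<open>y\<close> this
      reads \<open>y \<le> 2 powr (N * r)\<close>.\<close>
    have "(\<integral>\<omega>. F (x_final \<omega>) \<partial>M) - F xs \<le> \<mu> / 2 * (R N / 2) powr r"
      using gap[OF nN] start[of n] by (simp add: final n)
    also have "\<dots> \<le> \<mu> / 2 * R N powr r"
      using \<mu> Rp[of N] r2 by (intro mult_left_mono powr_mono2) auto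
    also have "\<dots> = \<epsilon> * (y / 2 powr (real N * r))" using \<epsilon> by (simp add: R_powr y_def)
    also have "\<dots> \<le> \<epsilon> * 1" using yN \<epsilon> by (intro mult_left_mono) auto
    finally show ?thesis by simp
  qed
  have goal3: "real (\<Sum>k=1..N. T k) \<le>
     (HT * 2 powr ((2 * r + 3) * ((1 + \<kappa>) / \<kappa>))) *
     (a_const d q * M2 * sqrt d / \<mu> powr (1 / r) * (1 / \<epsilon> powr ((r - 1) / r))) powr ((1 + \<kappa>) / \<kappa>)"
  proof -
    have "(\<Sum>k=1..N. real (T k)) \<le> (HT * 2 powr ((2 * r + 3) * s)) * (A / \<mu> powr (1 / r) * (1 / \<epsilon> powr ((r - 1) / r))) powr s"
      using Ny T_bounds(2) \<sigma>_le s2 sr \<mu> R0p \<epsilon> A HTp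
      by (intro total_steps_bound[where \<sigma>=\<sigma> and ?R0.0=R0]) (auto simp: y_def R)
    then show ?thesis by (simp add: A_def s_def)
  qed
  have goal4: "of_order (lD / 2 powr (2 * r)) (4 * uD) (\<Delta> N) (\<mu> powr (1 / r) / (M2 * sqrt d) * \<epsilon> powr (2 - 1 / r))"
    using factors_\<Delta> uD yN Ny \<Delta>[of N] N(2) M2 dp r2 \<mu> R0p \<epsilon>
    by (intro final_noise_order[where ?R0.0=R0 and N=N]) (auto simp: y_def)
  show ?thesis using goal1 goal2 goal3 goal4 by blast
qed

end
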